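(* Let $r,s>0$ with $r^2+s^2=1$. The torus $T_r = r\,\mathbb{S}^1\times s\,\mathbb{S}^1\subset\mathbb{S}^3$, parametrized by $f_r$, is a stable constrained Willmore surface if and only if $$r\in\Big[\tfrac12,\tfrac{\sqrt3}{2}\Big],\qquad\text{or equivalently}\qquad b\in\Big[\tfrac{1}{\sqrt3},\sqrt3\Big],$$ where $(a,b)=\Pi(f_r)=(0,s/r)$ are the Teichmüller coordinates of $T_r$.
   Context: $\mathbb{S}^3\subset\mathbb{C}^2$ is the unit sphere with its round metric $g_{\mathbb{S}^3}$. For $r,s>0$ with $r^2+s^2=1$ let $\Sigma_r=\mathbb{R}^2/(2\pi r\mathbb{Z}\times 2\pi s\mathbb{Z})$ and $f_r:\Sigma_r\to\mathbb{S}^3$, $f_r(u,v)=(r e^{iu/r}, s e^{iv/s})$. The map $f_r$ is an isometric embedding of flat $\Sigma_r$ with image $T_r$. Willmore functional: for an immersion $f:\Sigma_r\to\mathbb{S}^3$ with induced metric $g=f^*g_{\mathbb{S}^3}$ and mean curvature vector $\vec H$ in $\mathbb{S}^3$ (the trace of the second fundamental form), $\mathcal{W}(f)=\int_{\Sigma_r}(\frac14|\vec H|^2+1)\,d\mu_g$. Teichmüller coordinates: for $(a,b)\in\mathbb{H}=\mathbb{R}\times(0,\infty)$ let $g_{a,b}=du^2+2a\frac rs\,du\,dv+(a^2+b^2)\frac{r^2}{s^2}\,dv^2$ on $\Sigma_r$. For every Riemannian metric $g$ on $\Sigma_r$ there is a unique $(a,b)=:\pi(g)\in\mathbb{H}$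 such that $g=e^{2w}\varphi^*g_{a,b}$ for some function $w$ and some diffeomorphism $\varphi$ of $\Sigma_r$ isotopic to the identity. Put $\Pi(f)=\pi(f^*g_{\mathbb{S}^3})$ for an immersion $f$. Immersions are taken in a fixed, sufficiently high degree of smoothness; a variation of $f_r$ is a family of immersions $f(\cdot,t):\Sigma_r\to\mathbb{S}^3$, $t\in(-\delta,\delta)$, $f(\cdot,0)=f_r$, depending twice continuously differentiably on $t$. It is called admissible if $\Pi(f(\cdot,t))=\Pi(f_r)$ for all $t$. The immersion $f_r$ is a constrained Willmore surface if $\frac{d}{dt}\mathcal{W}(f(\cdot,t))|_{t=0}=0$ for all admissible variations, and it is a stable constrained Willmore surface if in addition $\frac{d^2}{dt^2}\mathcal{W}(f(\cdot,t))|_{t=0}\ge0$ for all admissible variations. *)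

theory Defs
  imports "HOL-Analysis.Analysis"
begin

text \<open>
  Objects on the torus \<open>\<Sigma> = \<real>\<^sup>2 / (2\<pi>r\<int> \<times> 2\<pi>s\<int>)\<close> are represented by their lifts to the universal
  cover \<open>real \<times> real\<close>. The ambient space \<open>\<complex>\<^sup>2\<close> is \<open>complex \<times> complex\<close>, whose library inner product
  is the real Euclidean one, so that the sphere carries the round metric.
\<close>

definition lattice :: "real \<Rightarrow> real \<Rightarrow> (real \<times> real) set" where
  "lattice r s = {(2 * pi * r * of_int m, 2 * pi * s * of_int n) | m n. True}"

definition periodic :: "real \<Rightarrow> real \<Rightarrow> (real \<times> real \<Rightarrow> 'b) \<Rightarrow> bool" where
  "periodic r s f \<longleftrightarrow> (\<forall>x. \<forall>l\<in>lattice r s. f (x + l) = f x)"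


section \<open>Degrees of smoothness\<close>

definition dd :: "'a::real_normed_vector \<Rightarrow> ('a \<Rightarrow> 'b::real_normed_vector) \<Rightarrow> 'a \<Rightarrow> 'b" where
  "dd X f x = frechet_derivative f (at x) X"

primrec Ck :: "nat \<Rightarrow> ('a::euclidean_space \<Rightarrow> 'b::real_normed_vector) \<Rightarrow> bool" where
  "Ck 0 f \<longleftrightarrow> continuous_on UNIV f"
| "Ck (Suc k) f \<longleftrightarrow> (\<forall>x. f differentiable at x) \<and> (\<forall>X. Ck k (dd X f))"

text \<open>
  All spatial derivatives of order at most \<open>k\<close> exist and are jointly continuous in \<open>(t, x)\<close>. For
  doubly periodic families this says exactly that \<open>t \<mapsto> F t\<close> is a continuous curve in the Banach
  space of \<open>C\<^sup>k\<close> maps on the (compact) torus.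
\<close>

primrec Ck_family ::
    "nat \<Rightarrow> real set \<Rightarrow> (real \<Rightarrow> 'a::euclidean_space \<Rightarrow> 'b::real_normed_vector) \<Rightarrow> bool" where
  "Ck_family 0 J F \<longleftrightarrow> continuous_on (J \<times> UNIV) (\<lambda>(t, x). F t x)"
| "Ck_family (Suc k) J F \<longleftrightarrow>
     continuous_on (J \<times> UNIV) (\<lambda>(t, x). F t x) \<and>
     (\<forall>t\<in>J. \<forall>x. F t differentiable at x) \<and>
     (\<forall>X. Ck_family k J (\<lambda>t. dd X (F t)))"

text \<open>
  Twice continuously differentiable dependence on \<open>t\<close>, i.e. \<open>t \<mapsto> F t\<close> is a \<open>C\<^sup>2\<close> curve in the space of
  \<open>C\<^sup>k\<close> maps: the pointwise derivatives \<open>F'\<close> and \<open>F''\<close> in \<open>t\<close> are again continuous curves of \<open>C\<^sup>k\<close>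
  maps, and by integration in \<open>t\<close> they are then derivatives in \<open>C\<^sup>k\<close> as well.
\<close>

definition C2_family ::
    "nat \<Rightarrow> real set \<Rightarrow> (real \<Rightarrow> 'a::euclidean_space \<Rightarrow> 'b::real_normed_vector) \<Rightarrow> bool" where
  "C2_family k J F \<longleftrightarrow> (\<exists>F' F''.
     Ck_family k J F \<and> Ck_family k J F' \<and> Ck_family k J F'' \<and>
     (\<forall>t\<in>J. \<forall>x. ((\<lambda>\<tau>. F \<tau> x) has_vector_derivative F' t x) (at t) \<and>
                 ((\<lambda>\<tau>. F' \<tau> x) has_vector_derivative F'' t x) (at t)))"


section \<open>Immersions and the Willmore functional\<close>

definition immersion ::
    "nat \<Rightarrow> real \<Rightarrow> real \<Rightarrow> (real \<times> real \<Rightarrow> complex \<times> complex) \<Rightarrow> bool" where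
  "immersion k r s f \<longleftrightarrow>
     periodic r s f \<and> Ck k f \<and> (\<forall>x. f x \<in> sphere 0 1) \<and> (\<forall>x. inj (frechet_derivative f (at x)))"

type_synonym metric = "real \<times> real \<Rightarrow> real \<times> real \<Rightarrow> real \<times> real \<Rightarrow> real"

definition induced_metric :: "(real \<times> real \<Rightarrow> complex \<times> complex) \<Rightarrow> metric" where
  "induced_metric f x X Y = dd X f x \<bullet> dd Y f x"

definition orth_part :: "'a::euclidean_space set \<Rightarrow> 'a \<Rightarrow> 'a" where
  "orth_part S w = (THE p. p \<in> S\<^sup>\<bottom> \<and> w - p \<in> span S)"

text \<open>
  The second fundamental form in the sphere. The covariant derivative of \<open>df(Y)\<close> in the sphere,
  for a constant field \<open>Y\<close>, is the Euclidean derivative up to a multiple of the position vector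
  \<open>f x\<close>; its component normal to the surface is therefore the component of the Euclidean derivative
  orthogonal to the tangent plane and to \<open>f x\<close>.
\<close>

definition second_ff ::
    "(real \<times> real \<Rightarrow> complex \<times> complex) \<Rightarrow> real \<times> real \<Rightarrow> real \<times> real \<Rightarrow> real \<times> real
       \<Rightarrow> complex \<times> complex" where
  "second_ff f x X Y = orth_part (insert (f x) (range (\<lambda>Z. dd Z f x))) (dd X (dd Y f) x)"

definition gram_det :: "metric \<Rightarrow> real \<times> real \<Rightarrow> real" where
  "gram_det g x = g x (1, 0) (1, 0) * g x (0, 1) (0, 1) - (g x (1, 0) (0, 1))\<^sup>2"

text \<open>The trace of the second fundamental form with respect to the induced metric, with the inverse
  of the \<open>2 \<times> 2\<close> Gram matrix written out.\<close>

definition mean_curvature ::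
    "(real \<times> real \<Rightarrow> complex \<times> complex) \<Rightarrow> real \<times> real \<Rightarrow> complex \<times> complex" where
  "mean_curvature f x =
     (let g = induced_metric f in
      (1 / gram_det g x) *\<^sub>R
        (g x (0, 1) (0, 1) *\<^sub>R second_ff f x (1, 0) (1, 0)
         - (2 * g x (1, 0) (0, 1)) *\<^sub>R second_ff f x (1, 0) (0, 1)
         + g x (1, 0) (1, 0) *\<^sub>R second_ff f x (0, 1) (0, 1)))"

definition willmore :: "real \<Rightarrow> real \<Rightarrow> (real \<times> real \<Rightarrow> complex \<times> complex) \<Rightarrow> real" where
  "willmore r s f =
     integral (cbox (0, 0) (2 * pi * r, 2 * pi * s))
       (\<lambda>x. ((norm (mean_curvature f x))\<^sup>2 / 4 + 1) * sqrt (gram_det (induced_metric f) x))"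


section \<open>Teichmueller coordinates\<close>

text \<open>
  Diffeomorphisms of the torus, given by a lift to the plane. The last clause says that the lift
  induces a well-defined bijection of the quotient. Only \<open>C\<^sup>1\<close> is demanded: a conformal
  \<open>C\<^sup>1\<close> diffeomorphism between smooth metrics is automatically smooth, while for metrics of finite
  integer degree of differentiability the expected gain of exactly one derivative may fail.
\<close>

definition torus_diffeo :: "real \<Rightarrow> real \<Rightarrow> (real \<times> real \<Rightarrow> real \<times> real) \<Rightarrow> bool" where
  "torus_diffeo r s \<phi> \<longleftrightarrow>
     bij \<phi> \<and> Ck 1 \<phi> \<and> Ck 1 (inv \<phi>) \<and>
     (\<forall>x y. \<phi> x - \<phi> y \<in> lattice r s \<longleftrightarrow> x - y \<in> lattice r s)"

text \<open>An isotopy of the torus starting at the identity has a unique lift starting at the identity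
  of the plane; \<open>H\<close> is that lift and \<open>\<phi>\<close> its end point.\<close>

definition isotopic_to_id :: "real \<Rightarrow> real \<Rightarrow> (real \<times> real \<Rightarrow> real \<times> real) \<Rightarrow> bool" where
  "isotopic_to_id r s \<phi> \<longleftrightarrow>
     (\<exists>H. Ck_family 1 {0..1} H \<and> (\<forall>\<tau>\<in>{0..1}. torus_diffeo r s (H \<tau>)) \<and> H 0 = id \<and> H 1 = \<phi>)"

definition model_metric :: "real \<Rightarrow> real \<Rightarrow> real \<times> real \<Rightarrow> metric" where
  "model_metric r s = (\<lambda>(a, b) x X Y.
     fst X * fst Y + a * (r / s) * (fst X * snd Y + snd X * fst Y)
       + (a\<^sup>2 + b\<^sup>2) * (r\<^sup>2 / s\<^sup>2) * (snd X * snd Y))"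

definition pullback :: "(real \<times> real \<Rightarrow> real \<times> real) \<Rightarrow> metric \<Rightarrow> metric" where
  "pullback \<phi> g x X Y = g (\<phi> x) (dd X \<phi> x) (dd Y \<phi> x)"

text \<open>The graph of the projection \<open>\<pi>\<close> from metrics to the upper half plane, and \<open>\<pi>\<close> itself.\<close>

definition has_teichmueller :: "real \<Rightarrow> real \<Rightarrow> metric \<Rightarrow> real \<times> real \<Rightarrow> bool" where
  "has_teichmueller r s g p \<longleftrightarrow>
     0 < snd p \<and>
     (\<exists>w \<phi>. periodic r s w \<and> torus_diffeo r s \<phi> \<and> isotopic_to_id r s \<phi> \<and>
        (\<forall>x X Y. g x X Y = exp (2 * w x) * pullback \<phi> (model_metric r s p) x X Y))"

definition teichmueller :: "real \<Rightarrow> real \<Rightarrow> metric \<Rightarrow> real \<times> real" where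
  "teichmueller r s g = (THE p. has_teichmueller r s g p)"

definition Teich :: "real \<Rightarrow> real \<Rightarrow> (real \<times> real \<Rightarrow> complex \<times> complex) \<Rightarrow> real \<times> real" where
  "Teich r s f = teichmueller r s (induced_metric f)"


section \<open>Stability\<close>

definition variation ::
    "nat \<Rightarrow> real \<Rightarrow> real \<Rightarrow> (real \<times> real \<Rightarrow> complex \<times> complex) \<Rightarrow> real
       \<Rightarrow> (real \<Rightarrow> real \<times> real \<Rightarrow> complex \<times> complex) \<Rightarrow> bool" where
  "variation k r s f \<delta> F \<longleftrightarrow>
     0 < \<delta> \<and> F 0 = f \<and> C2_family k {-\<delta><..<\<delta>} F \<and> (\<forall>t\<in>{-\<delta><..<\<delta>}. immersion k r s (F t))"

text \<open>The condition \<open>\<Pi>(F t) = \<Pi>(f)\<close> is expressed through the graph of \<open>\<pi>\<close>, so that it does not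
  involve a definite description that might fail to denote.\<close>

definition admissible ::
    "nat \<Rightarrow> real \<Rightarrow> real \<Rightarrow> (real \<times> real \<Rightarrow> complex \<times> complex) \<Rightarrow> real
       \<Rightarrow> (real \<Rightarrow> real \<times> real \<Rightarrow> complex \<times> complex) \<Rightarrow> bool" where
  "admissible k r s f \<delta> F \<longleftrightarrow>
     variation k r s f \<delta> F \<and>
     (\<forall>t\<in>{-\<delta><..<\<delta>}. has_teichmueller r s (induced_metric (F t)) (Teich r s f))"

definition constrained_willmore ::
    "nat \<Rightarrow> real \<Rightarrow> real \<Rightarrow> (real \<times> real \<Rightarrow> complex \<times> complex) \<Rightarrow> bool" where
  "constrained_willmore k r s f \<longleftrightarrow>
     (\<forall>\<delta> F. admissible k r s f \<delta> F \<longrightarrow>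
        ((\<lambda>t. willmore r s (F t)) has_real_derivative 0) (at 0))"

definition stable_constrained_willmore ::
    "nat \<Rightarrow> real \<Rightarrow> real \<Rightarrow> (real \<times> real \<Rightarrow> complex \<times> complex) \<Rightarrow> bool" where
  "stable_constrained_willmore k r s f \<longleftrightarrow>
     constrained_willmore k r s f \<and>
     (\<forall>\<delta> F. admissible k r s f \<delta> F \<longrightarrow> 0 \<le> (deriv ^^ 2) (\<lambda>t. willmore r s (F t)) 0)"

definition torus_param :: "real \<Rightarrow> real \<Rightarrow> real \<times> real \<Rightarrow> complex \<times> complex" where
  "torus_param r s = (\<lambda>(u, v). (of_real r * cis (u / r), of_real s * cis (v / s)))"

end

theory Submission
  imports Defs "HOL-Complex_Analysis.Complex_Analysis"
begin

text \<open>
  Stability for \<open>1/2 \<le> r \<le> s\<close>. Near the torus write \<open>F\<^sub>t = (cos \<omega> e\<^bsup>i\<Theta>\<^sub>1\<^esup>, sin \<omega> e\<^bsup>i\<Theta>\<^sub>2\<^esup>)\<close>. Two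
  inequalities replace the second variation calculus on Teichmueller space. First,
  \<open>\<bar>H\<bar>\<^sup>2 \<ge> 2 H\<cdot>N - \<bar>N\<^sup>\<bottom>\<bar>\<^sup>2\<close> for every field \<open>N\<close>, and \<open>\<integral> H\<cdot>N\<close> becomes first order in \<open>F\<^sub>t\<close> after
  an integration by parts. Second, a function \<open>U\<close> with \<open>U - u\<close> periodic has conformal energy at least
  the area of the flat torus when the metric has the Teichmueller coordinates of \<open>T\<^sub>r\<close>, since
  \<open>\<integral> dU \<and> d\<phi>\<^sub>2\<close> is a null Lagrangian. With the Lagrange multiplier \<open>\<lambda> \<le> 0\<close> both combine to
  \<open>W(F\<^sub>t) \<ge> W(F\<^sub>0) + t\<^sup>2 \<integral> I\<^sub>t\<close> for an explicit continuous \<open>I\<close> depending on test functions \<open>\<eta>, \<zeta>\<close>,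
  and the choice of \<open>\<eta>, \<zeta>\<close> cancels the Fourier modes with \<open>k\<^sup>2 + l\<^sup>2 < 4\<close> in \<open>\<integral> I\<^sub>0\<close>. The remaining
  modes contribute multiples of \<open>k\<^sup>2 + l\<^sup>2 - 1/r\<^sup>2 \<ge> 0\<close>.

  Instability for \<open>r < 1/2\<close>. Among tori of revolution the profiles \<open>k = \<epsilon> (1 + t\<^sup>2 + 2t cos 2\<theta>)\<close> keep
  the conformal class for a suitable \<open>\<epsilon>(t)\<close>, and their Willmore energy is an elementary integral
  whose second derivative at \<open>0\<close> has the sign of \<open>-(1 - 14\<epsilon>\<^sup>2 + \<epsilon>\<^sup>4)\<close>; this is negative exactly for \<open>r < 1/2\<close>.
  Exchanging the two factors of \<open>\<complex>\<^sup>2\<close> reduces everything to \<open>r \<le> s\<close>.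
\<close>

text \<open>The Teichmueller projection is given only through the existence of a uniformising
  diffeomorphism, so neither its derivative along a variation nor an admissible curve with
  prescribed velocity is at hand. In the stable case the constraint is therefore used only through
  one-sided integral inequalities; this is why the sign of the multiplier matters and why the
  argument is run for r \<le> s. In the unstable case an explicit family must keep the conformal
  class exactly, not just to second order. Apart from the constant mode, which the constraint
  removes, the Fourier modes with k^2 + l^2 < 4 are the eight infinitesimal Moebius transformations
  of the sphere that move the torus normally. Energy and conformal class are constant along them, so
  a sharp bound has to give exactly zero there, and \<eta>, \<zeta> serve to achieve this. The
  decision falls on wave number 2, where k^2 + l^2 = 4 is compared with 1/r^2; hence the threshold
  1/2 and the perturbation by cos 2\<theta>.\<close>

section \<open>Families of maps\<close>

lemma dd_eqI: "(f has_derivative D) (at x) \<Longrightarrow> dd X f x = D X"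
  unfolding dd_def by (metis frechet_derivative_at)

lemma has_derivative_dd: "f differentiable at x \<Longrightarrow> (f has_derivative (\<lambda>X. dd X f x)) (at x)"
  unfolding dd_def using frechet_derivative_works by auto

lemma dd_coords:
  fixes f :: "real \<times> real \<Rightarrow> 'b::real_normed_vector"
  assumes "f differentiable at x"
  shows "dd X f x = fst X *\<^sub>R dd (1, 0) f x + snd X *\<^sub>R dd (0, 1) f x"
proof -
  have lin: "linear (\<lambda>X. dd X f x)"
    using has_derivative_dd[OF assms] has_derivative_linear by blast
  have "X = fst X *\<^sub>R (1, 0) + snd X *\<^sub>R (0, 1)" by simp
  then have "dd X f x = dd (fst X *\<^sub>R (1, 0) + snd X *\<^sub>R (0, 1)) f x" by simp
  also have "\<dots> = fst X *\<^sub>R dd (1, 0) f x + snd X *\<^sub>R dd (0, 1) f x"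
    by (simp only: linear_add[OF lin] linear_scale[OF lin])
  finally show ?thesis .
qed

lemma Ck_family_cong: "(\<And>t. t \<in> J \<Longrightarrow> F t = G t) \<Longrightarrow> Ck_family k J F \<longleftrightarrow> Ck_family k J G"
proof (induction k arbitrary: F G)
  case 0
  have "continuous_on (J \<times> UNIV) (\<lambda>(t, x). F t x) = continuous_on (J \<times> UNIV) (\<lambda>(t, x). G t x)"
    by (rule continuous_on_cong) (use 0 in auto)
  then show ?case by simp
next
  case (Suc k)
  have 1: "continuous_on (J \<times> UNIV) (\<lambda>(t, x). F t x) = continuous_on (J \<times> UNIV) (\<lambda>(t, x). G t x)"
    by (rule continuous_on_cong) (use Suc in auto)
  have 2: "Ck_family k J (\<lambda>t. dd X (F t)) = Ck_family k J (\<lambda>t. dd X (G t))" for X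
    by (rule Suc.IH) (simp add: Suc.prems)
  show ?case using 1 2 Suc.prems by simp
qed

lemma Ck_family_continuous: "Ck_family k J F \<Longrightarrow> continuous_on (J \<times> UNIV) (\<lambda>(t, x). F t x)"
  by (cases k) auto

lemma Ck_family_Suc_imp: "Ck_family (Suc k) J F \<Longrightarrow> Ck_family k J F"
proof (induction k arbitrary: F)
  case 0 then show ?case by simp
next
  case (Suc k)
  have "Ck_family k J (\<lambda>t. dd X (F t))" for X
    using Suc.prems by (intro Suc.IH) simp
  then show ?case using Suc.prems by simp
qed

lemma Ck_family_mono:
  assumes "Ck_family k J F" "l \<le> k"
  shows "Ck_family l J F"
  using assms(2)
proof (induction rule: inc_induct)
  case base
  show ?case by (rule assms(1))
next
  case (step n)
  from step(3) show ?case by (rule Ck_family_Suc_imp)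
qed

lemma Ck_family_subset: "Ck_family k J F \<Longrightarrow> I \<subseteq> J \<Longrightarrow> Ck_family k I F"
proof (induction k arbitrary: F)
  case 0 then show ?case by (auto intro: continuous_on_subset)
next
  case (Suc k)
  then have "continuous_on (J \<times> UNIV) (\<lambda>(t, x). F t x)" by simp
  then have "continuous_on (I \<times> UNIV) (\<lambda>(t, x). F t x)"
    by (rule continuous_on_subset) (use Suc.prems in auto)
  moreover have "Ck_family k I (\<lambda>t. dd X (F t))" for X
    using Suc.IH Suc.prems by simp
  ultimately show ?case using Suc.prems by auto
qed

lemma continuous_on_time:
  "continuous_on J g \<Longrightarrow> continuous_on (J \<times> UNIV) (\<lambda>(t, x). g t)"
  using continuous_on_compose2[of J g "J \<times> UNIV" fst] continuous_on_fst[OF continuous_on_id]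
  by (auto simp: split_def)

lemma continuous_on_static:
  "continuous_on UNIV f \<Longrightarrow> continuous_on (J \<times> UNIV) (\<lambda>(t, x). f x)"
  using continuous_on_compose2[of UNIV f "J \<times> UNIV" snd] continuous_on_snd[OF continuous_on_id]
  by (auto simp: split_def)

lemma Ck_family_time:
  "continuous_on J g \<Longrightarrow> Ck_family k J (\<lambda>t (x::'a::euclidean_space). g t)"
proof (induction k arbitrary: g)
  case 0
  then show ?case by (simp add: continuous_on_time)
next
  case (Suc k)
  have "dd X (\<lambda>x::'a. g t) = (\<lambda>x. 0)" for X t
    by (rule ext, rule dd_eqI[of _ "\<lambda>_. 0"]) (rule has_derivative_const)
  then have "Ck_family k J (\<lambda>t. dd X (\<lambda>x::'a. g t))" for X
    using Suc.IH[of "\<lambda>_. 0"] by simp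
  with Suc.prems show ?case
    by (simp add: continuous_on_time)
qed

lemma Ck_family_const: "Ck_family k J (\<lambda>t x. c)"
  by (rule Ck_family_time) simp

lemma Ck_family_linear:
  assumes "bounded_linear L" shows "Ck_family k J (\<lambda>t. L)"
proof (cases k)
  case 0
  then show ?thesis
    using assms by (simp add: continuous_on_static linear_continuous_on)
next
  case (Suc l)
  have "dd X L = (\<lambda>x. L X)" for X
    by (rule ext, rule dd_eqI) (rule bounded_linear_imp_has_derivative[OF assms])
  then show ?thesis
    using assms Suc by (simp add: continuous_on_static linear_continuous_on
        bounded_linear_imp_differentiable Ck_family_const)
qed

lemma Ck_family_bounded_linear:
  assumes "bounded_linear L"
  shows "Ck_family k J F \<Longrightarrow> Ck_family k J (\<lambda>t x. L (F t x))"
proof (induction k arbitrary: F)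
  case 0
  then show ?case
    using bounded_linear.continuous_on[OF assms] by (auto simp: split_def)
next
  case (Suc k)
  have d: "F t differentiable at x" if "t \<in> J" for t x using Suc.prems that by simp
  have e: "((\<lambda>x. L (F t x)) has_derivative (\<lambda>X. L (dd X (F t) x))) (at x)" if "t \<in> J" for t x
    using bounded_linear.has_derivative[OF assms has_derivative_dd[OF d[OF that]]] .
  have "Ck_family k J (\<lambda>t. dd X (\<lambda>x. L (F t x)))" for X
  proof -
    have "Ck_family k J (\<lambda>t x. L (dd X (F t) x))"
      using Suc.prems by (intro Suc.IH) simp
    moreover have "dd X (\<lambda>x. L (F t x)) = (\<lambda>x. L (dd X (F t) x))" if "t \<in> J" for t
      by (rule ext, rule dd_eqI, rule e[OF that])
    ultimately show ?thesis by (subst Ck_family_cong) auto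
  qed
  moreover have "continuous_on (J \<times> UNIV) (\<lambda>(t, x). L (F t x))"
    using Suc.prems bounded_linear.continuous_on[OF assms] by (auto simp: split_def)
  ultimately show ?case using e by (auto simp: differentiable_def)
qed

lemma Ck_family_add:
  "Ck_family k J F \<Longrightarrow> Ck_family k J G \<Longrightarrow> Ck_family k J (\<lambda>t x. F t x + G t x)"
proof (induction k arbitrary: F G)
  case 0
  then show ?case by (auto simp: split_def intro!: continuous_intros)
next
  case (Suc k)
  have e: "((\<lambda>x. F t x + G t x) has_derivative (\<lambda>X. dd X (F t) x + dd X (G t) x)) (at x)"
    if "t \<in> J" for t x
    using Suc.prems that by (intro has_derivative_add has_derivative_dd) auto
  have "Ck_family k J (\<lambda>t. dd X (\<lambda>x. F t x + G t x))" for X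
  proof -
    have "Ck_family k J (\<lambda>t x. dd X (F t) x + dd X (G t) x)"
      using Suc.prems by (intro Suc.IH) simp_all
    moreover have "dd X (\<lambda>x. F t x + G t x) = (\<lambda>x. dd X (F t) x + dd X (G t) x)" if "t \<in> J" for t
      by (rule ext, rule dd_eqI, rule e[OF that])
    ultimately show ?thesis by (subst Ck_family_cong) auto
  qed
  moreover have "continuous_on (J \<times> UNIV) (\<lambda>(t, x). F t x + G t x)"
    using Suc.prems by (auto simp: split_def intro!: continuous_intros)
  ultimately show ?case using e by (auto simp: differentiable_def)
qed

lemma Ck_family_bilinear:
  assumes "bounded_bilinear P"
  shows "Ck_family k J F \<Longrightarrow> Ck_family k J G \<Longrightarrow> Ck_family k J (\<lambda>t x. P (F t x) (G t x))"
proof (induction k arbitrary: F G)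
  case 0
  then show ?case
    by (auto simp: split_def intro!: bounded_bilinear.continuous_on[OF assms])
next
  case (Suc k)
  have e: "((\<lambda>x. P (F t x) (G t x)) has_derivative
      (\<lambda>X. P (F t x) (dd X (G t) x) + P (dd X (F t) x) (G t x))) (at x)"
    if "t \<in> J" for t x
    using Suc.prems that by (intro bounded_bilinear.FDERIV[OF assms] has_derivative_dd) auto
  have "Ck_family k J (\<lambda>t. dd X (\<lambda>x. P (F t x) (G t x)))" for X
  proof -
    have "Ck_family k J (\<lambda>t x. P (F t x) (dd X (G t) x) + P (dd X (F t) x) (G t x))"
      using Suc.prems Ck_family_Suc_imp[OF Suc.prems(1)] Ck_family_Suc_imp[OF Suc.prems(2)]
      by (intro Ck_family_add Suc.IH) simp_all
    moreover have "dd X (\<lambda>x. P (F t x) (G t x)) =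
        (\<lambda>x. P (F t x) (dd X (G t) x) + P (dd X (F t) x) (G t x))" if "t \<in> J" for t
      by (rule ext, rule dd_eqI, rule e[OF that])
    ultimately show ?thesis by (subst Ck_family_cong) auto
  qed
  moreover have "continuous_on (J \<times> UNIV) (\<lambda>(t, x). P (F t x) (G t x))"
    using Suc.prems by (auto simp: split_def intro!: bounded_bilinear.continuous_on[OF assms])
  ultimately show ?case using e by (auto simp: differentiable_def)
qed

text \<open>Logarithm, reciprocal, square root and the trigonometric functions all enter through
  holomorphic extensions: the derivative of a holomorphic function is holomorphic on the same open
  set, so the induction on \<open>k\<close> closes without a list of higher derivatives.\<close>

lemma Ck_family_holomorphic:
  assumes "open S" "\<And>t x. t \<in> J \<Longrightarrow> F t x \<in> S"
  shows "Ck_family k J F \<Longrightarrow> h holomorphic_on S \<Longrightarrow> Ck_family k J (\<lambda>t x. h (F t x))"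
proof (induction k arbitrary: h)
  case 0
  then have "continuous_on S h" by (simp add: holomorphic_on_imp_continuous_on)
  then have "continuous_on (J \<times> UNIV) (\<lambda>z. h ((\<lambda>(t, x). F t x) z))"
    by (rule continuous_on_compose2) (use 0 assms in auto)
  then show ?case by (simp add: split_def)
next
  case (Suc k)
  have "continuous_on S h" using Suc by (simp add: holomorphic_on_imp_continuous_on)
  then have "continuous_on (J \<times> UNIV) (\<lambda>z. h ((\<lambda>(t, x). F t x) z))"
    by (rule continuous_on_compose2) (use Suc.prems assms in auto)
  then have c: "continuous_on (J \<times> UNIV) (\<lambda>(t, x). h (F t x))" by (simp add: split_def)
  have e: "((\<lambda>x. h (F t x)) has_derivative (\<lambda>X. deriv h (F t x) * dd X (F t) x)) (at x)"
    if "t \<in> J" for t x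
  proof -
    have "(h has_field_derivative deriv h (F t x)) (at (F t x))"
      using Suc.prems assms that by (intro holomorphic_derivI[of _ S]) auto
    then have "(h has_derivative (\<lambda>y. deriv h (F t x) * y)) (at (F t x))"
      by (simp add: has_field_derivative_def)
    moreover have "(F t has_derivative (\<lambda>X. dd X (F t) x)) (at x)"
      using Suc.prems that by (intro has_derivative_dd) auto
    ultimately show ?thesis
      using has_derivative_compose by fastforce
  qed
  have "Ck_family k J (\<lambda>t. dd X (\<lambda>x. h (F t x)))" for X
  proof -
    have "Ck_family k J (\<lambda>t x. deriv h (F t x) * dd X (F t) x)"
    proof (rule Ck_family_bilinear[OF bounded_bilinear_mult])
      show "Ck_family k J (\<lambda>t x. deriv h (F t x))"
        using Suc.IH[OF Ck_family_Suc_imp[OF Suc.prems(1)] holomorphic_deriv[OF Suc.prems(2) assms(1)]] .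
      show "Ck_family k J (\<lambda>t x. dd X (F t) x)" using Suc.prems(1) by simp
    qed
    moreover have "dd X (\<lambda>x. h (F t x)) = (\<lambda>x. deriv h (F t x) * dd X (F t) x)" if "t \<in> J" for t
      by (rule ext, rule dd_eqI, rule e[OF that])
    ultimately show ?thesis by (subst Ck_family_cong) auto
  qed
  with c show ?case using e by (auto simp: differentiable_def)
qed

lemma continuous_on_slice:
  assumes "continuous_on (J \<times> UNIV) (\<lambda>(t, x). F t x)" "t \<in> J"
  shows "continuous_on UNIV (F t)"
proof -
  have "continuous_on UNIV (\<lambda>x. (t, x))" by (intro continuous_on_Pair continuous_on_const continuous_on_id)
  from continuous_on_compose2[OF assms(1) this] assms(2) show ?thesis by force
qed

lemma continuous_on_slice_time:
  assumes "continuous_on (J \<times> UNIV) (\<lambda>(t, x). F t x)" "A \<subseteq> J"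
  shows "continuous_on A (\<lambda>t. F t x)"
proof -
  have "continuous_on A (\<lambda>t. (t, x))" by (intro continuous_on_Pair continuous_on_const continuous_on_id)
  from continuous_on_compose2[OF assms(1) this] assms(2) show ?thesis by force
qed

lemma Ck_family_imp_Ck: "Ck_family k J F \<Longrightarrow> t \<in> J \<Longrightarrow> Ck k (F t)"
proof (induction k arbitrary: F)
  case 0
  then show ?case using continuous_on_slice by fastforce
next
  case (Suc k)
  have "Ck k (dd X (F t))" for X
    using Suc.IH[of "\<lambda>t. dd X (F t)"] Suc.prems by simp
  then show ?case using Suc.prems by simp
qed

lemma Ck_imp_Ck_family: "Ck k f \<Longrightarrow> Ck_family k J (\<lambda>t. f)"
proof (induction k arbitrary: f)
  case 0
  then show ?case by (simp add: continuous_on_static)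
next
  case (Suc k)
  then have "continuous_on UNIV f"
    by (auto intro!: continuous_at_imp_continuous_on differentiable_imp_continuous_within)
  with Suc show ?case
    by (simp add: continuous_on_static)
qed

lemma Ck_iff_family: "Ck k f \<longleftrightarrow> Ck_family k {0} (\<lambda>t. f)"
  using Ck_imp_Ck_family[of k f "{0}"] Ck_family_imp_Ck[of k "{0}" "\<lambda>t. f" 0] by auto

lemma Ck_mono: "Ck k f \<Longrightarrow> l \<le> k \<Longrightarrow> Ck l f"
  unfolding Ck_iff_family by (rule Ck_family_mono)

lemma Ck_continuous: "Ck k f \<Longrightarrow> continuous_on UNIV f"
  using Ck_mono[of k f 0] by simp

lemma C2_familyE:
  assumes "C2_family k J F"
  obtains F' F'' where "Ck_family k J F" "Ck_family k J F'" "Ck_family k J F''"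
    "\<And>t x. t \<in> J \<Longrightarrow> ((\<lambda>\<tau>. F \<tau> x) has_vector_derivative F' t x) (at t)"
    "\<And>t x. t \<in> J \<Longrightarrow> ((\<lambda>\<tau>. F' \<tau> x) has_vector_derivative F'' t x) (at t)"
  using assms unfolding C2_family_def by blast

lemma C2_familyI:
  assumes "Ck_family k J F" "Ck_family k J F'" "Ck_family k J F''"
    "\<And>t x. t \<in> J \<Longrightarrow> ((\<lambda>\<tau>. F \<tau> x) has_vector_derivative F' t x) (at t)"
    "\<And>t x. t \<in> J \<Longrightarrow> ((\<lambda>\<tau>. F' \<tau> x) has_vector_derivative F'' t x) (at t)"
  shows "C2_family k J F"
  using assms unfolding C2_family_def by blast

lemma C2_family_mono: "C2_family k J F \<Longrightarrow> l \<le> k \<Longrightarrow> C2_family l J F"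
  unfolding C2_family_def by (meson Ck_family_mono)

lemma C2_family_subset: "C2_family k J F \<Longrightarrow> I \<subseteq> J \<Longrightarrow> C2_family k I F"
  unfolding C2_family_def by (meson Ck_family_subset subsetD)

lemma C2_family_Ck: "C2_family k J F \<Longrightarrow> Ck_family k J F"
  unfolding C2_family_def by blast

lemma C2_family_static: "Ck k f \<Longrightarrow> C2_family k J (\<lambda>t. f)"
  by (rule C2_familyI[of _ _ _ "\<lambda>_ _. 0" "\<lambda>_ _. 0"]) (auto intro: Ck_family_const Ck_imp_Ck_family)

lemma C2_family_const: "C2_family k J (\<lambda>t x. c)"
  by (rule C2_familyI[of _ _ _ "\<lambda>_ _. 0" "\<lambda>_ _. 0"]) (auto intro: Ck_family_const)

lemma C2_family_time:
  fixes g :: "real \<Rightarrow> 'b::real_normed_vector"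
  assumes "\<And>t. t \<in> J \<Longrightarrow> (g has_vector_derivative g' t) (at t)"
    "\<And>t. t \<in> J \<Longrightarrow> (g' has_vector_derivative g'' t) (at t)" "continuous_on J g''"
  shows "C2_family k J (\<lambda>t (x::'a::euclidean_space). g t)"
proof -
  have "continuous_on J g" "continuous_on J g'"
    using assms(1,2) by (auto intro!: continuous_at_imp_continuous_on has_vector_derivative_continuous)
  with assms show ?thesis
    by (intro C2_familyI[of _ _ _ "\<lambda>t x. g' t" "\<lambda>t x. g'' t"] Ck_family_time) auto
qed

lemma C2_family_ident: "C2_family k J (\<lambda>t (x::'a::euclidean_space). t)"
  by (rule C2_family_time[of _ _ "\<lambda>_. 1" "\<lambda>_. 0"]) (auto intro: has_vector_derivative_id has_vector_derivative_const)

lemma C2_family_bounded_linear: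
  assumes "bounded_linear L" "C2_family k J F"
  shows "C2_family k J (\<lambda>t x. L (F t x))"
  using assms(2)
proof (rule C2_familyE)
  fix F' F'' assume "Ck_family k J F" "Ck_family k J F'" "Ck_family k J F''"
    "\<And>t x. t \<in> J \<Longrightarrow> ((\<lambda>\<tau>. F \<tau> x) has_vector_derivative F' t x) (at t)"
    "\<And>t x. t \<in> J \<Longrightarrow> ((\<lambda>\<tau>. F' \<tau> x) has_vector_derivative F'' t x) (at t)"
  then show ?thesis
    by (intro C2_familyI[of _ _ _ "\<lambda>t x. L (F' t x)" "\<lambda>t x. L (F'' t x)"]
        Ck_family_bounded_linear[OF assms(1)] bounded_linear.has_vector_derivative[OF assms(1)]) auto
qed

lemma C2_family_add:
  assumes "C2_family k J F" "C2_family k J G"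
  shows "C2_family k J (\<lambda>t x. F t x + G t x)"
  using assms(1)
proof (rule C2_familyE)
  fix F' F'' assume F: "Ck_family k J F" "Ck_family k J F'" "Ck_family k J F''"
    "\<And>t x. t \<in> J \<Longrightarrow> ((\<lambda>\<tau>. F \<tau> x) has_vector_derivative F' t x) (at t)"
    "\<And>t x. t \<in> J \<Longrightarrow> ((\<lambda>\<tau>. F' \<tau> x) has_vector_derivative F'' t x) (at t)"
  show ?thesis using assms(2)
  proof (rule C2_familyE)
    fix G' G'' assume G: "Ck_family k J G" "Ck_family k J G'" "Ck_family k J G''"
      "\<And>t x. t \<in> J \<Longrightarrow> ((\<lambda>\<tau>. G \<tau> x) has_vector_derivative G' t x) (at t)"
      "\<And>t x. t \<in> J \<Longrightarrow> ((\<lambda>\<tau>. G' \<tau> x) has_vector_derivative G'' t x) (at t)"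
    show ?thesis
      by (rule C2_familyI[of _ _ _ "\<lambda>t x. F' t x + G' t x" "\<lambda>t x. F'' t x + G'' t x"])
        (use F G in \<open>auto intro!: Ck_family_add has_vector_derivative_add\<close>)
  qed
qed

lemma C2_family_bilinear:
  assumes P: "bounded_bilinear P" and "C2_family k J F" "C2_family k J G"
  shows "C2_family k J (\<lambda>t x. P (F t x) (G t x))"
  using assms(2)
proof (rule C2_familyE)
  fix F' F'' assume F: "Ck_family k J F" "Ck_family k J F'" "Ck_family k J F''"
    "\<And>t x. t \<in> J \<Longrightarrow> ((\<lambda>\<tau>. F \<tau> x) has_vector_derivative F' t x) (at t)"
    "\<And>t x. t \<in> J \<Longrightarrow> ((\<lambda>\<tau>. F' \<tau> x) has_vector_derivative F'' t x) (at t)"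
  show ?thesis using assms(3)
  proof (rule C2_familyE)
    fix G' G'' assume G: "Ck_family k J G" "Ck_family k J G'" "Ck_family k J G''"
      "\<And>t x. t \<in> J \<Longrightarrow> ((\<lambda>\<tau>. G \<tau> x) has_vector_derivative G' t x) (at t)"
      "\<And>t x. t \<in> J \<Longrightarrow> ((\<lambda>\<tau>. G' \<tau> x) has_vector_derivative G'' t x) (at t)"
    show ?thesis
    proof (rule C2_familyI[of _ _ _ "\<lambda>t x. P (F t x) (G' t x) + P (F' t x) (G t x)"
          "\<lambda>t x. (P (F t x) (G'' t x) + P (F' t x) (G' t x)) + (P (F' t x) (G' t x) + P (F'' t x) (G t x))"])
    qed (use F G in \<open>auto intro!: Ck_family_add Ck_family_bilinear[OF P] has_vector_derivative_add
        bounded_bilinear.has_vector_derivative[OF P]\<close>)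
  qed
qed

lemma C2_family_holomorphic:
  assumes "C2_family k J F" "open S" "h holomorphic_on S" "\<And>t x. t \<in> J \<Longrightarrow> F t x \<in> S"
  shows "C2_family k J (\<lambda>t x. h (F t x))"
  using assms(1)
proof (rule C2_familyE)
  fix F' F'' assume F: "Ck_family k J F" "Ck_family k J F'" "Ck_family k J F''"
    "\<And>t x. t \<in> J \<Longrightarrow> ((\<lambda>\<tau>. F \<tau> x) has_vector_derivative F' t x) (at t)"
    "\<And>t x. t \<in> J \<Longrightarrow> ((\<lambda>\<tau>. F' \<tau> x) has_vector_derivative F'' t x) (at t)"
  have h1: "deriv h holomorphic_on S" using assms by (intro holomorphic_deriv)
  have h2: "deriv (deriv h) holomorphic_on S" using assms h1 by (intro holomorphic_deriv)
  have chain: "((\<lambda>\<tau>. g (F \<tau> x)) has_vector_derivative F' t x * deriv g (F t x)) (at t)"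
    if "g holomorphic_on S" "t \<in> J" for g t x
  proof -
    have "(g has_field_derivative deriv g (F t x)) (at (F t x))"
      using assms that by (intro holomorphic_derivI[of _ S]) auto
    then show ?thesis
      using field_vector_diff_chain_at[OF F(4)[OF that(2)]] by (simp add: o_def)
  qed
  note c = Ck_family_holomorphic[OF assms(2,4) F(1) h1] Ck_family_holomorphic[OF assms(2,4) F(1) h2]
    Ck_family_holomorphic[OF assms(2,4) F(1) assms(3)]
  show ?thesis
  proof (rule C2_familyI[of _ _ _ "\<lambda>t x. F' t x * deriv h (F t x)"
        "\<lambda>t x. F' t x * (F' t x * deriv (deriv h) (F t x)) + F'' t x * deriv h (F t x)"])
    show "((\<lambda>\<tau>. F' \<tau> x * deriv h (F \<tau> x)) has_vector_derivative
        F' t x * (F' t x * deriv (deriv h) (F t x)) + F'' t x * deriv h (F t x)) (at t)"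
      if "t \<in> J" for t x
      using has_vector_derivative_mult[OF F(5)[OF that] chain[OF h1 that]] .
  qed (use F assms chain[OF assms(3)] in \<open>auto intro!: Ck_family_add Ck_family_bilinear[OF bounded_bilinear_mult] c\<close>)
qed

text \<open>By the fundamental theorem of calculus \<open>F \<tau> - F a\<close> is the time
  integral of \<open>G\<close>. Differentiating this integral in the direction \<open>X\<close>
  under the integral sign, and then in time, exchanges the two derivatives.\<close>

lemma has_vector_derivative_dd:
  fixes F G :: "real \<Rightarrow> 'a::euclidean_space \<Rightarrow> 'b::euclidean_space"
  assumes F: "Ck_family (Suc k) J F" and G: "Ck_family (Suc k) J G" and "open J"
    and d: "\<And>t x. t \<in> J \<Longrightarrow> ((\<lambda>\<tau>. F \<tau> x) has_vector_derivative G t x) (at t)" and t: "t \<in> J"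
  shows "((\<lambda>\<tau>. dd X (F \<tau>) x) has_vector_derivative dd X (G t) x) (at t)"
proof -
  from \<open>open J\<close> t obtain e where e: "e > 0" "cball t e \<subseteq> J"
    by (meson open_contains_cball)
  define a b where "a = t - e" and "b = t + e"
  have ab: "{a..b} \<subseteq> J" "a < t" "t < b"
    using e by (auto simp: a_def b_def cball_eq_atLeastAtMost)
  have cG: "continuous_on (J \<times> UNIV) (\<lambda>(t, x). G t x)"
    using G by simp
  have cdG: "continuous_on (J \<times> UNIV) (\<lambda>(t, x). dd X (G t) x)"
    by (rule Ck_family_continuous[of k]) (use G in simp)
  note cGc = continuous_on_slice_time[OF cG] and cdGc = continuous_on_slice_time[OF cdG]
  have line: "((\<lambda>\<epsilon>. H (x + \<epsilon> *\<^sub>R X)) has_vector_derivative dd X H (x + \<epsilon> *\<^sub>R X)) (at \<epsilon>)"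
    if "\<And>y. H differentiable at y" for H :: "'a \<Rightarrow> 'b" and \<epsilon>
  proof -
    have 1: "((\<lambda>\<epsilon>. x + \<epsilon> *\<^sub>R X) has_derivative (\<lambda>h. h *\<^sub>R X)) (at \<epsilon>)"
      by (auto intro!: derivative_eq_intros)
    have "((\<lambda>\<epsilon>. H (x + \<epsilon> *\<^sub>R X)) has_derivative (\<lambda>h. dd (h *\<^sub>R X) H (x + \<epsilon> *\<^sub>R X))) (at \<epsilon>)"
      using has_derivative_compose[OF 1 has_derivative_dd[OF that]] .
    moreover have "dd (h *\<^sub>R X) H y = h *\<^sub>R dd X H y" for h y
      using has_derivative_linear[OF has_derivative_dd[OF that]] by (rule linear_scale)
    ultimately show ?thesis by (simp add: has_vector_derivative_def)
  qed
  have int: "dd X (F \<tau>) x - dd X (F a) x = integral {a..\<tau>} (\<lambda>\<sigma>. dd X (G \<sigma>) x)" if \<tau>: "\<tau> \<in> {a..b}" for \<tau>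
  proof -
    have sub: "{a..\<tau>} \<subseteq> J" using \<tau> ab by auto
    have J: "\<tau> \<in> J" "a \<in> J" using \<tau> ab by auto
    have ftc: "F \<tau> y - F a y = integral {a..\<tau>} (\<lambda>\<sigma>. G \<sigma> y)" for y
    proof -
      have "((\<lambda>\<sigma>. F \<sigma> y) has_vector_derivative G \<sigma> y) (at \<sigma> within {a..\<tau>})" if "\<sigma> \<in> {a..\<tau>}" for \<sigma>
        using d[of \<sigma> y] sub that by (blast intro: has_vector_derivative_at_within)
      moreover have "a \<le> \<tau>" using \<tau> by simp
      ultimately have "((\<lambda>\<sigma>. G \<sigma> y) has_integral (F \<tau> y - F a y)) {a..\<tau>}"
        using fundamental_theorem_of_calculus[of a \<tau> "\<lambda>\<sigma>. F \<sigma> y" "\<lambda>\<sigma>. G \<sigma> y"] by simp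
      then show ?thesis by (simp add: integral_unique)
    qed
    have "((\<lambda>\<epsilon>. integral (cbox a \<tau>) (\<lambda>\<sigma>. G \<sigma> (x + \<epsilon> *\<^sub>R X))) has_vector_derivative
        integral (cbox a \<tau>) (\<lambda>\<sigma>. dd X (G \<sigma>) (x + 0 *\<^sub>R X))) (at 0 within UNIV)"
    proof (rule leibniz_rule_vector_derivative)
      show "((\<lambda>\<epsilon>. G \<sigma> (x + \<epsilon> *\<^sub>R X)) has_vector_derivative dd X (G \<sigma>) (x + \<epsilon> *\<^sub>R X)) (at \<epsilon> within UNIV)"
        if "\<sigma> \<in> cbox a \<tau>" for \<epsilon> \<sigma>
      proof -
        have "\<sigma> \<in> J" using that sub by auto
        then have "G \<sigma> differentiable at y" for y using G by simp
        from line[OF this] show ?thesis by simp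
      qed
      show "(\<lambda>\<sigma>. G \<sigma> (x + \<epsilon> *\<^sub>R X)) integrable_on cbox a \<tau>" for \<epsilon>
        using cGc[OF sub] by (simp add: integrable_continuous_interval)
      have "continuous_on (UNIV \<times> cbox a \<tau>) (\<lambda>z. (\<lambda>(t, x). dd X (G t) x) (snd z, x + fst z *\<^sub>R X))"
        by (rule continuous_on_compose2[OF cdG]) (use sub in \<open>auto intro!: continuous_intros\<close>)
      then show "continuous_on (UNIV \<times> cbox a \<tau>) (\<lambda>(\<epsilon>, \<sigma>). dd X (G \<sigma>) (x + \<epsilon> *\<^sub>R X))"
        by (simp add: split_def)
    qed auto
    then have "((\<lambda>\<epsilon>. F \<tau> (x + \<epsilon> *\<^sub>R X) - F a (x + \<epsilon> *\<^sub>R X)) has_vector_derivative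
        integral {a..\<tau>} (\<lambda>\<sigma>. dd X (G \<sigma>) x)) (at 0)"
      by (simp add: ftc)
    moreover have "((\<lambda>\<epsilon>. F \<tau> (x + \<epsilon> *\<^sub>R X) - F a (x + \<epsilon> *\<^sub>R X)) has_vector_derivative
        (dd X (F \<tau>) (x + 0 *\<^sub>R X) - dd X (F a) (x + 0 *\<^sub>R X))) (at 0)"
      by (intro has_vector_derivative_diff line) (use F J in auto)
    ultimately show ?thesis
      using vector_derivative_unique_at by fastforce
  qed
  have "((\<lambda>\<tau>. integral {a..\<tau>} (\<lambda>\<sigma>. dd X (G \<sigma>) x)) has_vector_derivative dd X (G t) x) (at t within {a..b})"
    by (rule integral_has_vector_derivative) (use cdGc[OF ab(1)] ab in auto)
  then have "((\<lambda>\<tau>. integral {a..\<tau>} (\<lambda>\<sigma>. dd X (G \<sigma>) x)) has_vector_derivative dd X (G t) x) (at t)"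
    using ab by (metis at_within_Icc_at)
  then have "((\<lambda>\<tau>. integral {a..\<tau>} (\<lambda>\<sigma>. dd X (G \<sigma>) x) + dd X (F a) x) has_vector_derivative dd X (G t) x) (at t)"
    by (auto intro!: derivative_eq_intros)
  then show ?thesis
  proof (rule has_vector_derivative_transform_within_open[where S="{a<..<b}"])
    fix \<tau> assume "\<tau> \<in> {a<..<b}"
    then have "\<tau> \<in> {a..b}" by simp
    from int[OF this] show "integral {a..\<tau>} (\<lambda>\<sigma>. dd X (G \<sigma>) x) + dd X (F a) x = dd X (F \<tau>) x"
      by (simp add: algebra_simps)
  qed (use ab in auto)
qed

lemma C2_family_dd:
  fixes F :: "real \<Rightarrow> 'a::euclidean_space \<Rightarrow> 'b::euclidean_space"
  assumes "C2_family (Suc k) J F" "open J"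
  shows "C2_family k J (\<lambda>t. dd X (F t))"
proof -
  show ?thesis using assms(1)
  proof (rule C2_familyE)
    fix F' F'' assume F: "Ck_family (Suc k) J F" "Ck_family (Suc k) J F'" "Ck_family (Suc k) J F''"
      "\<And>t x. t \<in> J \<Longrightarrow> ((\<lambda>\<tau>. F \<tau> x) has_vector_derivative F' t x) (at t)"
      "\<And>t x. t \<in> J \<Longrightarrow> ((\<lambda>\<tau>. F' \<tau> x) has_vector_derivative F'' t x) (at t)"
    show ?thesis
    proof (rule C2_familyI[of _ _ _ "\<lambda>t. dd X (F' t)" "\<lambda>t. dd X (F'' t)"])
      fix t x assume t: "t \<in> J"
      show "((\<lambda>\<tau>. dd X (F \<tau>) x) has_vector_derivative dd X (F' t) x) (at t)"
        by (rule has_vector_derivative_dd[OF F(1,2) assms(2) F(4) t])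
      show "((\<lambda>\<tau>. dd X (F' \<tau>) x) has_vector_derivative dd X (F'' t) x) (at t)"
        by (rule has_vector_derivative_dd[OF F(2,3) assms(2) F(5) t])
    qed (use F in auto)
  qed
qed

section \<open>Periodic integrals, difference quotients, and the null Lagrangian on the
  torus\<close>

section \<open>Integration over the torus\<close>

lemma antiderivative_exists:
  fixes g :: "real \<Rightarrow> 'a::banach"
  assumes "continuous_on UNIV g"
  obtains \<Phi> where "\<And>x. (\<Phi> has_vector_derivative g x) (at x)"
proof
  fix x :: real
  \<comment> \<open>The integral over a reversed, hence empty, interval is zero, so exactly one
    summand is active for each sign of \<open>x\<close>.\<close>
  let ?\<Phi> = "\<lambda>x. integral {0..x} g - integral {x..0} g"
  define b where "b = \<bar>x\<bar> + 1"
  have b: "-b < x" "x < b" "-b < 0" "0 < b" unfolding b_def by linarith+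
  have int: "g integrable_on {c..d}" for c d
    using assms by (intro integrable_continuous_interval) (rule continuous_on_subset, auto)
  have "((\<lambda>y. integral {-b..y} g) has_vector_derivative g x) (at x within {-b..b})"
    using b by (intro integral_has_vector_derivative continuous_on_subset[OF assms]) auto
  then have "((\<lambda>y. integral {-b..y} g) has_vector_derivative g x) (at x)"
    using b by (metis at_within_Icc_at)
  then have "((\<lambda>y. integral {-b..y} g - integral {-b..0} g) has_vector_derivative g x - 0) (at x)"
    by (intro has_vector_derivative_diff has_vector_derivative_const)
  then have "((\<lambda>y. integral {-b..y} g - integral {-b..0} g) has_vector_derivative g x) (at x)" by simp
  then show "(?\<Phi> has_vector_derivative g x) (at x)"
  proof (rule has_vector_derivative_transform_within_open[where S="{-b<..<b}"])
    fix y assume y: "y \<in> {-b<..<b}"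
    show "integral {-b..y} g - integral {-b..0} g = ?\<Phi> y"
    proof (cases "0 \<le> y")
      case True
      have "integral {-b..0} g + integral {0..y} g = integral {-b..y} g"
        by (rule Henstock_Kurzweil_Integration.integral_combine[OF _ True int]) (use b in simp)
      moreover have "integral {y..0} g = 0" using True by (cases "y = 0") auto
      ultimately show ?thesis by (simp add: algebra_simps)
    next
      case False
      have "integral {-b..y} g + integral {y..0} g = integral {-b..0} g"
        by (rule Henstock_Kurzweil_Integration.integral_combine[OF _ _ int]) (use y False in auto)
      moreover have "integral {0..y} g = 0" using False by auto
      ultimately show ?thesis by (simp add: algebra_simps)
    qed
  qed (use b in auto)
qed

text \<open>For an antiderivative \<Phi> the increment of \<Phi> over one period has derivative
  zero, hence is the same from every starting point.\<close>

lemma integral_shift_periodic: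
  fixes g :: "real \<Rightarrow> 'a::banach"
  assumes "continuous_on UNIV g" "\<And>x. g (x + P) = g x" "0 \<le> P"
  shows "integral {0..P} (\<lambda>x. g (x + h)) = integral {0..P} g"
proof -
  obtain \<Phi> where \<Phi>: "\<And>x. (\<Phi> has_vector_derivative g x) (at x)"
    using antiderivative_exists[OF assms(1)] by blast
  have sh: "((\<lambda>x. \<Phi> (x + c)) has_vector_derivative g (x + c)) (at x within S)" for x c S
  proof -
    have "((\<lambda>x. x + c) has_vector_derivative 1) (at x)"
      by (auto intro!: derivative_eq_intros)
    then have "((\<Phi> \<circ> (\<lambda>x. x + c)) has_vector_derivative 1 *\<^sub>R g (x + c)) (at x)"
      by (rule vector_diff_chain_at[OF _ \<Phi>])
    then show ?thesis by (simp add: o_def has_vector_derivative_at_within)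
  qed
  have "((\<lambda>x. \<Phi> (x + P) - \<Phi> x) has_vector_derivative 0) (at x within UNIV)" for x
    using has_vector_derivative_diff[OF sh[of P x] \<Phi>[of x]] assms(2) by simp
  then obtain c where c: "\<And>x. \<Phi> (x + P) - \<Phi> x = c"
    using has_vector_derivative_zero_constant[of UNIV "\<lambda>x. \<Phi> (x + P) - \<Phi> x"] by auto
  have "((\<lambda>x. g (x + h)) has_integral (\<Phi> (P + h) - \<Phi> (0 + h))) {0..P}" for h
    by (rule fundamental_theorem_of_calculus[OF assms(3)]) (rule sh)
  then have "integral {0..P} (\<lambda>x. g (x + h)) = \<Phi> (P + h) - \<Phi> (0 + h)" for h
    by (rule integral_unique)
  then have "integral {0..P} (\<lambda>x. g (x + h)) = c" for h
    using c[of h] by (simp add: add.commute[of P h])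
  from this[of h] this[of 0] show ?thesis by simp
qed

text \<open>The value at time 0 is the supplied derivative. Expansions in t can thus be written as
  exact identities with continuous coefficients instead of Taylor estimates.\<close>

definition diff_quot ::
  "(real \<Rightarrow> 'a \<Rightarrow> 'b::real_normed_vector) \<Rightarrow> (real \<Rightarrow> 'a \<Rightarrow> 'b) \<Rightarrow> real \<Rightarrow> 'a \<Rightarrow> 'b" where
  "diff_quot f f' t x = (if t = 0 then f' 0 x else (1 / t) *\<^sub>R (f t x - f 0 x))"

text \<open>Hadamard's formula: the quotient is the mean of \<open>f'\<close> along the segment from
  0 to t. The time set is therefore asked to be star-shaped about 0.\<close>

lemma continuous_on_diff_quot:
  fixes f f' :: "real \<Rightarrow> 'a::topological_space \<Rightarrow> 'b::banach"
  assumes d: "\<And>t x. t \<in> J \<Longrightarrow> ((\<lambda>\<tau>. f \<tau> x) has_vector_derivative f' t x) (at t)"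
    and c: "continuous_on (J \<times> UNIV) (\<lambda>(t, x). f' t x)"
    and J: "\<And>t \<sigma>. t \<in> J \<Longrightarrow> \<sigma> \<in> {0..1} \<Longrightarrow> \<sigma> * t \<in> J"
  shows "continuous_on (J \<times> UNIV) (\<lambda>(t, x). diff_quot f f' t x)"
proof -
  have eq: "diff_quot f f' t x = integral (cbox 0 1) (\<lambda>\<sigma>. f' (\<sigma> * t) x)" if t: "t \<in> J" for t x
  proof (cases "t = 0")
    case True
    then show ?thesis by (simp add: diff_quot_def)
  next
    case False
    have der: "((\<lambda>\<sigma>. (1 / t) *\<^sub>R f (\<sigma> * t) x) has_vector_derivative f' (\<sigma> * t) x) (at \<sigma> within {0..1})"
      if "\<sigma> \<in> {0..1}" for \<sigma>
    proof -
      have "((\<lambda>\<sigma>. \<sigma> * t) has_vector_derivative t) (at \<sigma>)"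
        by (auto intro!: derivative_eq_intros)
      then have "(((\<lambda>\<tau>. f \<tau> x) \<circ> (\<lambda>\<sigma>. \<sigma> * t)) has_vector_derivative t *\<^sub>R f' (\<sigma> * t) x) (at \<sigma>)"
        using vector_diff_chain_at[of "\<lambda>\<sigma>. \<sigma> * t" t \<sigma> "\<lambda>\<tau>. f \<tau> x" "f' (\<sigma> * t) x"] d[OF J[OF t that]] by simp
      then have "((\<lambda>\<sigma>. (1 / t) *\<^sub>R f (\<sigma> * t) x) has_vector_derivative (1 / t) *\<^sub>R t *\<^sub>R f' (\<sigma> * t) x) (at \<sigma>)"
        by (intro bounded_linear.has_vector_derivative[OF bounded_linear_scaleR_right]) (simp add: o_def)
      with False show ?thesis by (simp add: has_vector_derivative_at_within)
    qed
    have "((\<lambda>\<sigma>. f' (\<sigma> * t) x) has_integral ((1 / t) *\<^sub>R f (1 * t) x - (1 / t) *\<^sub>R f (0 * t) x)) {0..1}"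
      by (rule fundamental_theorem_of_calculus[OF _ der]) simp_all
    then show ?thesis using False
      by (simp add: diff_quot_def integral_unique scaleR_diff_right)
  qed
  have "continuous_on ((J \<times> UNIV) \<times> cbox 0 1) (\<lambda>z. (\<lambda>(t, x). f' t x) (snd z * fst (fst z), snd (fst z)))"
    by (rule continuous_on_compose2[OF c]) (use J in \<open>auto intro!: continuous_intros\<close>)
  then have "continuous_on (J \<times> UNIV) (\<lambda>z. integral (cbox 0 1) (\<lambda>\<sigma>. f' (\<sigma> * fst z) (snd z)))"
    by (intro integral_continuous_on_param) (simp add: split_def)
  then show ?thesis
    by (rule continuous_on_eq) (use eq in auto)
qed

lemma periodic_iff:
  "periodic r s f \<longleftrightarrow> (\<forall>x. f (x + (2 * pi * r, 0)) = f x \<and> f (x + (0, 2 * pi * s)) = f x)"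
proof
  assume f: "periodic r s f"
  have "(2 * pi * r * of_int 1, 2 * pi * s * of_int 0) \<in> lattice r s"
    "(2 * pi * r * of_int 0, 2 * pi * s * of_int 1) \<in> lattice r s"
    unfolding lattice_def by blast+
  with f show "\<forall>x. f (x + (2 * pi * r, 0)) = f x \<and> f (x + (0, 2 * pi * s)) = f x"
    unfolding periodic_def by fastforce
next
  assume a: "\<forall>x. f (x + (2 * pi * r, 0)) = f x \<and> f (x + (0, 2 * pi * s)) = f x"
  have gen: "f (x + of_int m *\<^sub>R p) = f x" if "\<And>x. f (x + p) = f x" for m x p
  proof (induction m arbitrary: x rule: int_induct[of _ 0])
    case base then show ?case by simp
  next
    case (step1 i)
    have "f (x + of_int (i + 1) *\<^sub>R p) = f ((x + p) + of_int i *\<^sub>R p)" by (simp add: algebra_simps)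
    then show ?case using step1(2)[of "x + p"] that by simp
  next
    case (step2 i)
    have "f (x + of_int (i - 1) *\<^sub>R p) = f ((x - p) + of_int i *\<^sub>R p)" by (simp add: algebra_simps)
    then show ?case using step2(2)[of "x - p"] that[of "x - p"] by simp
  qed
  show "periodic r s f" unfolding periodic_def lattice_def
  proof safe
    fix x1 x2 :: real and m n :: int
    have "(x1, x2) + (2 * pi * r * of_int m, 2 * pi * s * of_int n)
       = ((x1, x2) + of_int m *\<^sub>R (2 * pi * r, 0)) + of_int n *\<^sub>R (0, 2 * pi * s)"
      by simp
    moreover have "f (((x1, x2) + of_int m *\<^sub>R (2 * pi * r, 0)) + of_int n *\<^sub>R (0, 2 * pi * s)) = f ((x1, x2) + of_int m *\<^sub>R (2 * pi * r, 0))"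
      by (rule gen) (use a in blast)
    moreover have "f ((x1, x2) + of_int m *\<^sub>R (2 * pi * r, 0)) = f (x1, x2)"
      by (rule gen) (use a in blast)
    ultimately show "f ((x1, x2) + (2 * pi * r * of_int m, 2 * pi * s * of_int n)) = f (x1, x2)"
      by metis
  qed
qed

lemma has_derivative_shift:
  "(f has_derivative D) (at (x + l)) \<Longrightarrow> ((\<lambda>y. f (y + l)) has_derivative D) (at x)"
  using has_derivative_compose[of "\<lambda>y. y + l" "\<lambda>y. y" x UNIV f D]
    has_derivative_add[OF has_derivative_ident[of "at x"] has_derivative_const[of l "at x"]] by simp

lemma periodic_dd:
  fixes f :: "real \<times> real \<Rightarrow> 'b::real_normed_vector"
  assumes "periodic r s f" "\<And>x. f differentiable at x"
  shows "periodic r s (dd X f)"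
  unfolding periodic_def
proof safe
  fix x l :: "real \<times> real" assume l: "l \<in> lattice r s"
  have "(\<lambda>y. f (y + l)) = f" using assms(1) l unfolding periodic_def by auto
  with has_derivative_shift[OF has_derivative_dd[OF assms(2)[of "x + l"]]]
  show "dd X f (x + l) = dd X f x"
    using dd_eqI[of f "\<lambda>X. dd X f (x + l)" x X] by simp
qed

abbreviation cell :: "real \<Rightarrow> real \<Rightarrow> (real \<times> real) set" where
  "cell r s \<equiv> cbox (0, 0) (2 * pi * r, 2 * pi * s)"

lemma integral_cell_const:
  "0 \<le> r \<Longrightarrow> 0 \<le> s \<Longrightarrow> integral (cell r s) (\<lambda>x. c :: real) = 4 * pi\<^sup>2 * r * s * c"
  by (simp add: content_Pair power2_eq_square)

lemma integrable_cell:
  fixes f :: "real \<times> real \<Rightarrow> 'b::banach"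
  shows "continuous_on UNIV f \<Longrightarrow> f integrable_on cell r s"
  by (meson integrable_continuous continuous_on_subset subset_UNIV)

lemma partial_u:
  fixes f :: "real \<times> real \<Rightarrow> 'b::real_normed_vector"
  assumes "f differentiable at (u, v)"
  shows "((\<lambda>u. f (u, v)) has_vector_derivative dd (1, 0) f (u, v)) (at u within S)"
proof -
  have "((\<lambda>u. (u, v)) has_derivative (\<lambda>h. (h, 0))) (at u within S)"
    by (auto intro!: derivative_eq_intros)
  note D = has_derivative_compose[OF this has_derivative_dd[OF assms]]
  have "dd (h, 0) f (u, v) = h *\<^sub>R dd (1, 0) f (u, v)" for h
    using dd_coords[OF assms, of "(h, 0)"] by simp
  then have "(\<lambda>h. dd (h, 0) f (u, v)) = (\<lambda>h. h *\<^sub>R dd (1, 0) f (u, v))" by (intro ext)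
  from has_derivative_eq_rhs[OF D this] show ?thesis
    unfolding has_vector_derivative_def .
qed

lemma partial_v:
  fixes f :: "real \<times> real \<Rightarrow> 'b::real_normed_vector"
  assumes "f differentiable at (u, v)"
  shows "((\<lambda>v. f (u, v)) has_vector_derivative dd (0, 1) f (u, v)) (at v within S)"
proof -
  have "((\<lambda>v. (u, v)) has_derivative (\<lambda>h. (0, h))) (at v within S)"
    by (auto intro!: derivative_eq_intros)
  note D = has_derivative_compose[OF this has_derivative_dd[OF assms]]
  have "dd (0, h) f (u, v) = h *\<^sub>R dd (0, 1) f (u, v)" for h
    using dd_coords[OF assms, of "(0, h)"] by simp
  then have "(\<lambda>h. dd (0, h) f (u, v)) = (\<lambda>h. h *\<^sub>R dd (0, 1) f (u, v))" by (intro ext)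
  from has_derivative_eq_rhs[OF D this] show ?thesis
    unfolding has_vector_derivative_def .
qed

lemma Ck_Suc_differentiable: "Ck (Suc k) f \<Longrightarrow> f differentiable at x"
  unfolding Ck.simps by blast

lemma Ck_Suc_dd: "Ck (Suc k) f \<Longrightarrow> Ck k (dd X f)"
  unfolding Ck.simps by blast

lemma Ck1_differentiable: "Ck 1 f \<Longrightarrow> f differentiable at x"
  unfolding One_nat_def by (rule Ck_Suc_differentiable)

lemma Ck_Suc_dd_continuous: "Ck (Suc k) f \<Longrightarrow> continuous_on UNIV (dd X f)"
  using Ck_Suc_dd Ck_continuous by blast

lemma Ck1_dd_continuous: "Ck 1 f \<Longrightarrow> continuous_on UNIV (dd X f)"
  unfolding One_nat_def by (rule Ck_Suc_dd_continuous)

lemma Ck1_I: "(\<And>x. f differentiable at x) \<Longrightarrow> (\<And>X. continuous_on UNIV (dd X f)) \<Longrightarrow> Ck 1 f"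
  unfolding One_nat_def Ck.simps by blast

lemma integral_cell_swap:
  fixes f :: "real \<times> real \<Rightarrow> 'b::banach"
  assumes "continuous_on UNIV f"
  shows "integral (cell r s) f =
    integral (cbox 0 (2 * pi * s)) (\<lambda>v. integral (cbox 0 (2 * pi * r)) (\<lambda>u. f (u, v)))"
proof -
  have c: "continuous_on (cell r s) f" by (rule continuous_on_subset[OF assms]) simp
  have "integral (cell r s) f =
    integral (cbox 0 (2 * pi * r)) (\<lambda>u. integral (cbox 0 (2 * pi * s)) (\<lambda>v. f (u, v)))"
    by (rule integral_prod_continuous[OF c])
  also have "\<dots> = integral (cbox 0 (2 * pi * s)) (\<lambda>v. integral (cbox 0 (2 * pi * r)) (\<lambda>u. f (u, v)))"
    by (rule integral_swap_continuous[of 0 0 _ _ "\<lambda>u v. f (u, v)"]) (use c in simp)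
  finally show ?thesis .
qed

lemma integral_dd_periodic:
  fixes f :: "real \<times> real \<Rightarrow> 'b::banach"
  assumes f: "Ck (Suc k) f" and p: "periodic r s f" and rs: "0 < r" "0 < s"
  shows "integral (cell r s) (dd X f) = 0"
proof -
  note d = Ck_Suc_differentiable[OF f] and c = Ck_Suc_dd_continuous[OF f]
  have P: "f (u + 2 * pi * r, v) = f (u, v)" "f (u, v + 2 * pi * s) = f (u, v)" for u v
    using p[unfolded periodic_iff, rule_format, of "(u, v)"] by simp_all
  have u: "integral (cell r s) (dd (1, 0) f) = 0"
  proof -
    have "((\<lambda>u. dd (1, 0) f (u, v)) has_integral (f (2 * pi * r, v) - f (0, v))) {0..2 * pi * r}" for v
      using rs by (intro fundamental_theorem_of_calculus partial_u d) simp
    from integral_unique[OF this]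
    have "integral {0..2 * pi * r} (\<lambda>u. dd (1, 0) f (u, v)) = 0" for v
      using P(1)[of 0 v] by simp
    then show ?thesis by (simp add: integral_cell_swap[OF c])
  qed
  have v: "integral (cell r s) (dd (0, 1) f) = 0"
  proof -
    have "((\<lambda>v. dd (0, 1) f (u, v)) has_integral (f (u, 2 * pi * s) - f (u, 0))) {0..2 * pi * s}" for u
      using rs by (intro fundamental_theorem_of_calculus partial_v d) simp
    from integral_unique[OF this]
    have "integral {0..2 * pi * s} (\<lambda>v. dd (0, 1) f (u, v)) = 0" for u
      using P(2)[of u 0] by simp
    moreover have "continuous_on (cell r s) (dd (0, 1) f)" by (rule continuous_on_subset[OF c]) simp
    ultimately show ?thesis by (simp add: integral_prod_continuous)
  qed
  have "integral (cell r s) (dd X f) = integral (cell r s) (\<lambda>x. fst X *\<^sub>R dd (1, 0) f x + snd X *\<^sub>R dd (0, 1) f x)"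
    by (intro integral_cong dd_coords d)
  also have "\<dots> = fst X *\<^sub>R integral (cell r s) (dd (1, 0) f) + snd X *\<^sub>R integral (cell r s) (dd (0, 1) f)"
    by (subst integral_add) (auto intro!: integrable_cell continuous_intros c)
  finally show ?thesis using u v by simp
qed

lemma integral_cell_shift_u:
  fixes f :: "real \<times> real \<Rightarrow> 'b::banach"
  assumes c: "continuous_on UNIV f" and p: "periodic r s f" and rs: "0 < r" "0 < s"
  shows "integral (cell r s) (\<lambda>x. f (x + (h, 0))) = integral (cell r s) f"
proof -
  have P: "f (u + 2 * pi * r, v) = f (u, v)" for u v
    using p[unfolded periodic_iff, rule_format, of "(u, v)"] by simp_all
  have cu: "continuous_on UNIV (\<lambda>u. f (u, v))" for v
    by (rule continuous_on_compose2[OF c]) (auto intro!: continuous_intros)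
  have "integral {0..2 * pi * r} (\<lambda>u. f (u + h, v)) = integral {0..2 * pi * r} (\<lambda>u. f (u, v))" for v
    using integral_shift_periodic[OF cu, of "2 * pi * r" v h] P rs by simp
  moreover have "continuous_on UNIV (\<lambda>x. f (x + (h, 0)))"
    by (rule continuous_on_compose2[OF c]) (auto intro!: continuous_intros)
  ultimately show ?thesis
    by (simp add: integral_cell_swap[OF c] integral_cell_swap[of "\<lambda>x. f (x + (h, 0))"])
qed

text \<open>The coefficient of the two-form df \<and> dg.\<close>

definition wedge :: "(real \<times> real \<Rightarrow> real) \<Rightarrow> (real \<times> real \<Rightarrow> real) \<Rightarrow> real \<times> real \<Rightarrow> real" where
  "wedge f g x = dd (1, 0) f x * dd (0, 1) g x - dd (0, 1) f x * dd (1, 0) g x"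

lemma dd_mult:
  fixes f g :: "real \<times> real \<Rightarrow> real"
  assumes "f differentiable at x" "g differentiable at x"
  shows "dd X (\<lambda>x. f x * g x) x = f x * dd X g x + dd X f x * g x"
  using has_derivative_mult[OF has_derivative_dd[OF assms(1)] has_derivative_dd[OF assms(2)]]
  by (rule dd_eqI)

text \<open>For functions of class \<open>C\<^sup>2\<close> this is integration by parts; as only one derivative is at
  our disposal, the derivative in the first direction is replaced by a difference quotient.\<close>

lemma integral_wedge_periodic:
  assumes a: "Ck 1 a" "periodic r s a" and b: "Ck 1 b" "periodic r s b" and rs: "0 < r" "0 < s"
  shows "integral (cell r s) (wedge a b) = 0"
proof -
  define e :: "real \<times> real" where "e = (1, 0)"
  note da = Ck1_differentiable[OF a(1)] and db = Ck1_differentiable[OF b(1)]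
  note cda = Ck1_dd_continuous[OF a(1)] and cdb = Ck1_dd_continuous[OF b(1)]
  have ca: "continuous_on UNIV a" and cb: "continuous_on UNIV b"
    using a b Ck_continuous by blast+
  define q where "q c h x = diff_quot (\<lambda>h x. c (x + (h, 0))) (\<lambda>h x. dd (1, 0) c (x + (h, 0))) h x"
    for c :: "real \<times> real \<Rightarrow> real" and h x
  have cq: "continuous_on (UNIV \<times> UNIV) (\<lambda>(h, x). q c h x)" if "Ck 1 c" for c
    unfolding q_def
  proof (rule continuous_on_diff_quot)
    fix t and x :: "real \<times> real"
    have "((\<lambda>u. c (u, snd x)) has_vector_derivative dd (1, 0) c (fst x + t, snd x)) (at (fst x + t))"
      by (intro partial_u Ck1_differentiable that)
    moreover have "((\<lambda>t. fst x + t) has_vector_derivative 1) (at t)"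
      by (auto intro!: derivative_eq_intros)
    ultimately have "((\<lambda>u. c (u, snd x)) \<circ> (\<lambda>t. fst x + t) has_vector_derivative 1 *\<^sub>R dd (1, 0) c (fst x + t, snd x)) (at t)"
      by (intro vector_diff_chain_at)
    moreover have "x + (t, 0) = (fst x + t, snd x)" for t by (cases x) simp
    ultimately show "((\<lambda>t. c (x + (t, 0))) has_vector_derivative dd (1, 0) c (x + (t, 0))) (at t)"
      by (simp add: o_def)
  next
    have "continuous_on UNIV (dd (1, 0) c)" by (rule Ck1_dd_continuous[OF that])
    then have "continuous_on (UNIV \<times> UNIV) (\<lambda>z. dd (1, 0) c (snd z + (fst z, 0)))"
      by (rule continuous_on_compose2) (auto intro!: continuous_intros)
    then show "continuous_on (UNIV \<times> UNIV) (\<lambda>(h, x). dd (1, 0) c (x + (h, 0)))"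
      by (simp add: split_def)
  qed simp
  \<comment> \<open>The quotient of \<open>b\<close> is taken with \<open>- h\<close>: carrying the
    shift by \<open>h\<close> from \<open>a\<close> over to \<open>b\<close> under the integral
    reverses it. With this choice the integral vanishes for every nonzero \<open>h\<close>, and
    continuity gives the value at 0.\<close>
  define \<Phi> where "\<Phi> h = integral (cell r s) (\<lambda>x. q a h x * dd (0, 1) b x - dd (0, 1) a x * q b (- h) x)" for h
  have "continuous_on UNIV \<Phi>"
    unfolding \<Phi>_def
  proof (rule integral_continuous_on_param)
    have 1: "continuous_on (UNIV \<times> cell r s) (\<lambda>z. q a (fst z) (snd z))"
      by (rule continuous_on_subset[of "UNIV \<times> UNIV"]) (use cq[OF a(1)] in \<open>auto simp: split_def\<close>)
    have 2: "continuous_on (UNIV \<times> cell r s) (\<lambda>z. (\<lambda>(h, x). q b h x) (- fst z, snd z))"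
      by (rule continuous_on_compose2[OF cq[OF b(1)]]) (auto intro!: continuous_intros)
    show "continuous_on (UNIV \<times> cell r s)
        (\<lambda>(h, x). q a h x * dd (0, 1) b x - dd (0, 1) a x * q b (- h) x)"
      unfolding split_def
      by (intro continuous_intros 1 2[unfolded split_def, simplified]
          continuous_on_compose2[OF cda[of "(0,1)"]] continuous_on_compose2[OF cdb[of "(0,1)"]]) auto
  qed
  moreover have "\<Phi> h = 0" if "h \<noteq> 0" for h
  proof -
    have csh: "continuous_on UNIV (\<lambda>x. f (x + (k, 0)))" if "continuous_on UNIV f" for f :: "real \<times> real \<Rightarrow> real" and k
      by (rule continuous_on_compose2[OF that]) (auto intro!: continuous_intros)
    have ibp: "integral (cell r s) (\<lambda>x. a (x + (k, 0)) * dd (0, 1) b x) = - integral (cell r s) (\<lambda>x. dd (0, 1) a (x + (k, 0)) * b x)" for k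
    proof -
      define c where "c x = a (x + (k, 0))" for x
      have hc: "(c has_derivative (\<lambda>X. dd X a (x + (k, 0)))) (at x)" for x
        unfolding c_def by (rule has_derivative_shift[OF has_derivative_dd[OF da]])
      have dc: "c differentiable at x" for x
        using hc unfolding differentiable_def by blast
      have ddc: "dd X c = (\<lambda>x. dd X a (x + (k, 0)))" for X
        by (rule ext) (rule dd_eqI[OF hc])
      have "Ck 1 c"
        by (intro Ck1_I dc) (simp add: ddc csh[OF cda])
      then have "Ck 1 (\<lambda>x. c x * b x)"
        using b(1) unfolding Ck_iff_family by (rule Ck_family_bilinear[OF bounded_bilinear_mult])
      moreover have "periodic r s (\<lambda>x. c x * b x)"
        using a(2) b(2) unfolding periodic_def c_def by (simp add: add.commute add.left_commute)
      ultimately have "integral (cell r s) (dd (0, 1) (\<lambda>x. c x * b x)) = 0"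
        using integral_dd_periodic[of 0 "\<lambda>x. c x * b x"] rs unfolding One_nat_def by blast
      moreover have "dd (0, 1) (\<lambda>x. c x * b x) = (\<lambda>x. a (x + (k, 0)) * dd (0, 1) b x + dd (0, 1) a (x + (k, 0)) * b x)"
        by (rule ext, subst dd_mult[OF dc db]) (simp add: ddc, simp add: c_def)
      moreover have "integral (cell r s) (\<lambda>x. a (x + (k, 0)) * dd (0, 1) b x + dd (0, 1) a (x + (k, 0)) * b x)
        = integral (cell r s) (\<lambda>x. a (x + (k, 0)) * dd (0, 1) b x) + integral (cell r s) (\<lambda>x. dd (0, 1) a (x + (k, 0)) * b x)"
        by (intro integral_add integrable_cell continuous_on_mult csh ca cb cda cdb)
      ultimately show ?thesis by simp
    qed
    have shift: "integral (cell r s) (\<lambda>x. dd (0, 1) a (x + (h, 0)) * b x) = integral (cell r s) (\<lambda>x. dd (0, 1) a x * b (x + (- h, 0)))"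
    proof -
      define f where "f x = dd (0, 1) a x * b (x + (- h, 0))" for x
      have "continuous_on UNIV f" unfolding f_def by (intro continuous_on_mult csh cb cda)
      moreover have "periodic r s f"
        using periodic_dd[OF a(2) da] b(2) unfolding periodic_def f_def by (simp add: add.commute add.left_commute)
      ultimately have "integral (cell r s) (\<lambda>x. f (x + (h, 0))) = integral (cell r s) f"
        by (rule integral_cell_shift_u[OF _ _ rs])
      moreover have "x + (h, 0) + (-h, 0) = x" for x :: "real \<times> real" by (cases x) simp
      ultimately show ?thesis by (simp add: f_def[abs_def])
    qed
    have z: "x + (0, 0) = x" for x :: "real \<times> real" by (cases x) simp
    have "h * \<Phi> h = integral (cell r s) (\<lambda>x. h * (q a h x * dd (0, 1) b x - dd (0, 1) a x * q b (- h) x))"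
      by (simp add: \<Phi>_def)
    also have "(\<lambda>x. h * (q a h x * dd (0, 1) b x - dd (0, 1) a x * q b (- h) x)) =
      (\<lambda>x. (a (x + (h, 0)) * dd (0, 1) b x - a (x + (0, 0)) * dd (0, 1) b x)
         + (dd (0, 1) a x * b (x + (- h, 0)) - dd (0, 1) a (x + (0, 0)) * b x))"
      using that unfolding q_def diff_quot_def z by (auto simp: field_simps z)
    also have "integral (cell r s) \<dots> =
       (integral (cell r s) (\<lambda>x. a (x + (h, 0)) * dd (0, 1) b x) - integral (cell r s) (\<lambda>x. a (x + (0, 0)) * dd (0, 1) b x))
       + (integral (cell r s) (\<lambda>x. dd (0, 1) a x * b (x + (- h, 0))) - integral (cell r s) (\<lambda>x. dd (0, 1) a (x + (0, 0)) * b x))"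
      by (simp only: integral_add integral_diff integrable_cell continuous_on_diff continuous_on_mult
          csh[OF ca] csh[OF cb] csh[OF cda] ca cb cda cdb)
    also have "\<dots> = 0" unfolding ibp shift by simp
    finally show ?thesis using that by simp
  qed
  ultimately have "\<Phi> 0 = 0"
  proof -
    assume c: "continuous_on UNIV \<Phi>" and n: "\<And>h. h \<noteq> 0 \<Longrightarrow> \<Phi> h = 0"
    have "(\<Phi> \<longlongrightarrow> \<Phi> 0) (at 0)" using c by (simp add: continuous_on_def)
    moreover have "(\<Phi> \<longlongrightarrow> 0) (at 0)"
      by (rule tendsto_eventually) (auto simp: eventually_at_filter n)
    ultimately show ?thesis using tendsto_unique[of "at 0"] by force
  qed
  moreover have "x + (0, 0) = x" for x :: "real \<times> real" by (cases x) simp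
  ultimately show ?thesis
    by (simp add: \<Phi>_def q_def diff_quot_def wedge_def[abs_def])
qed

lemma dd_affine_part:
  fixes U :: "real \<times> real \<Rightarrow> real"
  assumes "U differentiable at x"
  shows "dd X (\<lambda>x. U x - (\<alpha> * fst x + \<beta> * snd x)) x = dd X U x - (\<alpha> * fst X + \<beta> * snd X)"
  by (rule dd_eqI) (rule has_derivative_diff[OF has_derivative_dd[OF assms]], auto intro!: derivative_eq_intros)

text \<open>Splitting off the affine parts leaves a wedge of periodic functions and total
  derivatives, all of integral zero. The result depends on the periods alone, which is what makes
  this integrand a null Lagrangian.\<close>

lemma integral_wedge:
  assumes U: "Ck 1 U" "periodic r s (\<lambda>x. U x - (\<alpha> * fst x + \<beta> * snd x))"
    and V: "Ck 1 V" "periodic r s (\<lambda>x. V x - (\<gamma> * fst x + \<delta> * snd x))" and rs: "0 < r" "0 < s"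
  shows "integral (cell r s) (wedge U V) = 4 * pi\<^sup>2 * r * s * (\<alpha> * \<delta> - \<beta> * \<gamma>)"
proof -
  define a b where "a x = U x - (\<alpha> * fst x + \<beta> * snd x)" and "b x = V x - (\<gamma> * fst x + \<delta> * snd x)" for x
  note dU = Ck1_differentiable[OF U(1)] and dV = Ck1_differentiable[OF V(1)]
  have dda: "dd X a = (\<lambda>x. dd X U x - (\<alpha> * fst X + \<beta> * snd X))"
    and ddb: "dd X b = (\<lambda>x. dd X V x - (\<gamma> * fst X + \<delta> * snd X))" for X
    unfolding a_def b_def by (intro ext dd_affine_part dU dV)+
  have diff: "(\<lambda>x. f x - (p * fst x + q * snd x)) differentiable at x"
    if "f differentiable at x" for f :: "real \<times> real \<Rightarrow> real" and p q x
    using that by (intro derivative_intros differentiable_diff) (auto simp: differentiable_def intro!: derivative_eq_intros exI)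
  have a: "Ck 1 a" "periodic r s a" and b: "Ck 1 b" "periodic r s b"
  proof -
    show "Ck 1 a"
      by (rule Ck1_I) (simp_all only: dda, simp_all add: a_def[abs_def] diff dU continuous_on_diff Ck1_dd_continuous[OF U(1)])
    show "Ck 1 b"
      by (rule Ck1_I) (simp_all only: ddb, simp_all add: b_def[abs_def] diff dV continuous_on_diff Ck1_dd_continuous[OF V(1)])
  qed (use U(2) V(2) in \<open>simp_all only: a_def[abs_def] b_def[abs_def]\<close>)
  note ca = Ck1_dd_continuous[OF a(1)] and cb = Ck1_dd_continuous[OF b(1)]
  have "wedge U V = (\<lambda>x. wedge a b x + ((\<alpha> * dd (0, 1) b x - \<beta> * dd (1, 0) b x)
      + (\<delta> * dd (1, 0) a x - \<gamma> * dd (0, 1) a x) + (\<alpha> * \<delta> - \<beta> * \<gamma>)))"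
    by (auto simp: wedge_def dda ddb algebra_simps)
  then have "integral (cell r s) (wedge U V) = integral (cell r s) (wedge a b) +
     ((\<alpha> * integral (cell r s) (dd (0, 1) b) - \<beta> * integral (cell r s) (dd (1, 0) b))
      + (\<delta> * integral (cell r s) (dd (1, 0) a) - \<gamma> * integral (cell r s) (dd (0, 1) a))
      + integral (cell r s) (\<lambda>x. \<alpha> * \<delta> - \<beta> * \<gamma>))"
    by (simp only: integral_add integral_diff integral_mult_right integrable_cell continuous_on_add
        continuous_on_diff continuous_on_mult continuous_on_const ca cb wedge_def[abs_def])
  then show ?thesis
    using integral_wedge_periodic[OF a b rs] integral_dd_periodic[of 0, OF _ a(2) rs]
      integral_dd_periodic[of 0, OF _ b(2) rs] a(1)[unfolded One_nat_def] b(1)[unfolded One_nat_def]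
      integral_cell_const[of r s "\<alpha> * \<delta> - \<beta> * \<gamma>"] rs
    by (simp del: Ck.simps)
qed

section \<open>Isothermal coordinates, the lower bound for the conformal energy, uniqueness of the
  coordinates of the flat torus\<close>

section \<open>Conformal energy and Teichmueller coordinates\<close>

text \<open>The squared gradient norm of \<open>U\<close> times the area element of
  \<open>g\<close>; a conformal factor of \<open>g\<close> cancels.\<close>

definition conf_energy :: "metric \<Rightarrow> (real \<times> real \<Rightarrow> real) \<Rightarrow> real \<times> real \<Rightarrow> real" where
  "conf_energy g U x =
     (g x (0, 1) (0, 1) * (dd (1, 0) U x)\<^sup>2 - 2 * g x (1, 0) (0, 1) * (dd (1, 0) U x * dd (0, 1) U x)
      + g x (1, 0) (1, 0) * (dd (0, 1) U x)\<^sup>2) / sqrt (gram_det g x)"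

lemma lattice_step:
  assumes "0 < r" "0 < s" "a \<in> lattice r s" "a \<noteq> b" "b \<in> lattice r s"
  shows "min (2 * pi * r) (2 * pi * s) \<le> \<bar>fst a - fst b\<bar> + \<bar>snd a - snd b\<bar>"
proof -
  obtain m n m' n' where a: "a = (2 * pi * r * of_int m, 2 * pi * s * of_int n)"
    and b: "b = (2 * pi * r * of_int m', 2 * pi * s * of_int n')"
    using assms unfolding lattice_def by blast
  have 1: "\<bar>fst a - fst b\<bar> = 2 * pi * r * \<bar>of_int (m - m')\<bar>" "\<bar>snd a - snd b\<bar> = 2 * pi * s * \<bar>of_int (n - n')\<bar>"
    using assms(1,2) by (simp_all add: a b abs_mult flip: right_diff_distrib)
  show ?thesis
  proof (cases "m = m'")
    case False
    then have "1 \<le> \<bar>m - m'\<bar>" by simp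
    then have "(1::real) \<le> \<bar>of_int (m - m')\<bar>" by linarith
    then have "2 * pi * r * 1 \<le> \<bar>fst a - fst b\<bar>"
      unfolding 1 using assms(1) by (intro mult_left_mono) auto
    then show ?thesis by linarith
  next
    case True
    then have "1 \<le> \<bar>n - n'\<bar>" using assms(4) a b by auto
    then have "(1::real) \<le> \<bar>of_int (n - n')\<bar>" by linarith
    then have "2 * pi * s * 1 \<le> \<bar>snd a - snd b\<bar>"
      unfolding 1 using assms(2) by (intro mult_left_mono) auto
    then show ?thesis by linarith
  qed
qed

text \<open>Along the isotopy, \<open>H \<tau> (x + l) - H \<tau> x\<close> is a lattice point
  depending continuously on \<tau>, so it keeps its initial value \<open>l\<close>. This
  equivariance is all that the isotopy contributes: it fixes the periods of the lift.\<close>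

lemma isotopic_to_id_shift:
  assumes iso: "isotopic_to_id r s \<phi>" and rs: "0 < r" "0 < s" and l: "l \<in> lattice r s"
  shows "\<phi> (x + l) = \<phi> x + l"
proof -
  obtain H where H: "Ck_family 1 {0..1} H" "\<And>\<tau>. \<tau> \<in> {0..1} \<Longrightarrow> torus_diffeo r s (H \<tau>)"
    "H 0 = id" "H 1 = \<phi>"
    using iso unfolding isotopic_to_id_def by blast
  define h where "h \<tau> = H \<tau> (x + l) - H \<tau> x" for \<tau>
  have lat: "h \<tau> \<in> lattice r s" if "\<tau> \<in> {0..1}" for \<tau>
  proof -
    have "(x + l) - x \<in> lattice r s" using l by simp
    then show ?thesis using H(2)[OF that] unfolding torus_diffeo_def h_def by blast
  qed
  note slice = continuous_on_slice_time[OF Ck_family_continuous[OF H(1)] order_refl]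
  have ch: "continuous_on {0..1} h"
    unfolding h_def by (intro continuous_on_diff slice)
  define d where "d = min (2 * pi * r) (2 * pi * s) / 2"
  have "0 < d" using rs by (simp add: d_def)
  have "(\<lambda>\<tau>. h \<tau>) constant_on {0..1}"
  proof -
    have f: "(\<lambda>\<tau>. fst (h \<tau>)) constant_on {0..1} \<and> (\<lambda>\<tau>. snd (h \<tau>)) constant_on {0..1}"
    proof -
      have step: "\<exists>e>0. \<forall>\<sigma>. \<sigma> \<in> {0..1} \<and> k \<sigma> \<noteq> k \<tau> \<longrightarrow> e \<le> norm (k \<sigma> - k \<tau>)"
        if k: "k = (\<lambda>\<tau>. fst (h \<tau>)) \<or> k = (\<lambda>\<tau>. snd (h \<tau>))" and \<tau>: "\<tau> \<in> {0..1}" for k :: "real \<Rightarrow> real" and \<tau>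
      proof (intro exI conjI allI impI)
        show "0 < min (2 * pi * r) (2 * pi * s)" using rs by simp
        fix \<sigma> :: real assume \<sigma>': "\<sigma> \<in> {0..1} \<and> k \<sigma> \<noteq> k \<tau>"
        note \<sigma> = conjunct1[OF \<sigma>'] conjunct2[OF \<sigma>']
        obtain m n where \<sigma>': "h \<sigma> = (2 * pi * r * of_int m, 2 * pi * s * of_int n)"
          using lat[OF \<sigma>(1)] unfolding lattice_def by blast
        obtain m' n' where \<tau>': "h \<tau> = (2 * pi * r * of_int m', 2 * pi * s * of_int n')"
          using lat[OF \<tau>] unfolding lattice_def by blast
        have R: "(2 * pi * r * of_int m, 0) \<in> lattice r s" for m
          unfolding lattice_def by (auto intro!: exI[of _ m] exI[of _ 0])
        have S: "(0, 2 * pi * s * of_int m) \<in> lattice r s" for m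
          unfolding lattice_def by (auto intro!: exI[of _ m] exI[of _ 0])
        from k show "min (2 * pi * r) (2 * pi * s) \<le> norm (k \<sigma> - k \<tau>)"
        proof
          assume k: "k = (\<lambda>\<tau>. fst (h \<tau>))"
          show ?thesis
            using lattice_step[OF rs R(1)[of m] _ R(1)[of m']] \<sigma>(2) unfolding k \<sigma>' \<tau>' by simp
        next
          assume k: "k = (\<lambda>\<tau>. snd (h \<tau>))"
          show ?thesis
            using lattice_step[OF rs S[of n] _ S[of n']] \<sigma>(2) unfolding k \<sigma>' \<tau>' by simp
        qed
      qed
      show ?thesis
        using continuous_discrete_range_constant[OF connected_Icc continuous_on_fst[OF ch] step[OF disjI1[OF refl]]]
          continuous_discrete_range_constant[OF connected_Icc continuous_on_snd[OF ch] step[OF disjI2[OF refl]]]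
        by blast
    qed
    then show ?thesis unfolding constant_on_def by (metis prod_eqI)
  qed
  then have "h 1 = h 0" unfolding constant_on_def by force
  then show ?thesis by (simp add: h_def H(3,4) algebra_simps)
qed

text \<open>The model metric is the squared modulus of du + (a + i b) (r/s) dv. Its real and
  imaginary parts, pulled back by the lift, integrate to functions \<open>p\<close> and
  \<open>q\<close> that are isothermal for \<open>g\<close> and carry (a, b) in their
  periods.\<close>

lemma teichmueller_coordinates:
  assumes T: "has_teichmueller r s g (a, b)" and rs: "0 < r" "0 < s"
  obtains E p q where "\<And>x. 0 < E x" "Ck 1 p" "Ck 1 q"
    "periodic r s (\<lambda>x. p x - (1 * fst x + a * (r / s) * snd x))"
    "periodic r s (\<lambda>x. q x - (0 * fst x + b * (r / s) * snd x))"
    "\<And>x X Y. g x X Y = E x * (dd X p x * dd Y p x + dd X q x * dd Y q x)"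
proof -
  obtain w \<phi> where \<phi>: "torus_diffeo r s \<phi>" "isotopic_to_id r s \<phi>"
    and g: "\<And>x X Y. g x X Y = exp (2 * w x) * pullback \<phi> (model_metric r s (a, b)) x X Y"
    using T unfolding has_teichmueller_def by auto
  have C: "Ck 1 \<phi>" using \<phi>(1) unfolding torus_diffeo_def by blast
  note sh = isotopic_to_id_shift[OF \<phi>(2) rs]
  define p where "p x = fst (\<phi> x) + a * (r / s) * snd (\<phi> x)" for x
  define q where "q x = b * (r / s) * snd (\<phi> x)" for x
  have Cf: "Ck 1 (\<lambda>x. fst (\<phi> x))" and Cs: "Ck 1 (\<lambda>x. snd (\<phi> x))"
    using C unfolding Ck_iff_family
    by (rule Ck_family_bounded_linear[OF bounded_linear_fst], rule Ck_family_bounded_linear[OF bounded_linear_snd])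
  have Cc: "Ck 1 (\<lambda>x. c * snd (\<phi> x))" for c
    using Cs unfolding Ck_iff_family by (rule Ck_family_bounded_linear[OF bounded_linear_mult_right])
  have Cp: "Ck 1 p" and Cq: "Ck 1 q"
    using Cf Cc unfolding p_def[abs_def] q_def[abs_def] Ck_iff_family by (rule Ck_family_add, blast+)
  have D: "(\<phi> has_derivative (\<lambda>X. dd X \<phi> x)) (at x)" for x
    by (rule has_derivative_dd[OF Ck1_differentiable[OF C]])
  have ddp: "dd X p x = fst (dd X \<phi> x) + a * (r / s) * snd (dd X \<phi> x)" for X x
    unfolding p_def[abs_def] by (rule dd_eqI) (use rs in \<open>auto intro!: derivative_eq_intros D\<close>)
  have ddq: "dd X q x = b * (r / s) * snd (dd X \<phi> x)" for X x
    unfolding q_def[abs_def] by (rule dd_eqI) (use rs in \<open>auto intro!: derivative_eq_intros D\<close>)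
  show ?thesis
  proof (rule that[of "\<lambda>x. exp (2 * w x)" p q])
    show "g x X Y = exp (2 * w x) * (dd X p x * dd Y p x + dd X q x * dd Y q x)" for x X Y
      unfolding g pullback_def model_metric_def ddp ddq
      by (simp add: algebra_simps power2_eq_square power_divide add_divide_distrib)
    show "periodic r s (\<lambda>x. p x - (1 * fst x + a * (r / s) * snd x))"
      "periodic r s (\<lambda>x. q x - (0 * fst x + b * (r / s) * snd x))"
      unfolding periodic_def p_def q_def by (simp_all add: sh algebra_simps add_divide_distrib)
  qed (use Cp Cq in auto)
qed

lemma continuous_wedge: "Ck 1 f \<Longrightarrow> Ck 1 g \<Longrightarrow> continuous_on UNIV (wedge f g)"
  unfolding wedge_def[abs_def] by (intro continuous_intros Ck1_dd_continuous)

lemma gram_det_sum_squares: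
  assumes "\<And>x X Y. g x X Y = E x * (dd X p x * dd Y p x + dd X q x * dd Y q x)"
  shows "gram_det g x = (E x * wedge p q x)\<^sup>2"
  unfolding gram_det_def assms wedge_def by (simp add: power2_eq_square algebra_simps)

text \<open>A continuous function without zeros on the connected plane has a constant sign, and the
  integral decides which. This shows that the uniformising map preserves orientation.\<close>

lemma wedge_positive:
  assumes c: "continuous_on UNIV J" and nz: "\<And>x. J x \<noteq> (0::real)" and pos: "0 < integral (cell r s) J"
  shows "0 < J x"
proof (rule ccontr)
  assume "\<not> 0 < J x"
  then have x: "J x < 0" using nz[of x] by linarith
  have "J y \<le> 0" for y
  proof (rule ccontr)
    assume y: "\<not> J y \<le> 0"
    have "connected (range J)"
      using connected_continuous_image[OF c connected_UNIV] .
    then have "0 \<in> range J"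
      by (rule connectedD_interval[of _ "J x" "J y"]) (use x y in auto)
    then show False using nz by auto
  qed
  then have "0 \<le> integral (cell r s) (\<lambda>x. - J x)"
    by (intro integral_nonneg integrable_cell continuous_intros c) auto
  then show False using pos by simp
qed

text \<open>In the isothermal coordinates the density is ((dU \<and> dp)^2 + (dU \<and> dq)^2) / (dp
  \<and> dq), read as a relation of coefficients. Completing the square bounds it below by 2 dU
  \<and> dq - dp \<and> dq, and both of these integrals are known from the periods. Equality holds
  for dU = dp.\<close>

lemma conf_energy_lower_bound:
  assumes T: "has_teichmueller r s g (0, s / r)" and rs: "0 < r" "0 < s"
    and pos: "\<And>x. 0 < gram_det g x" and U: "Ck 1 U" "periodic r s (\<lambda>x. U x - fst x)"
    and c: "continuous_on UNIV (conf_energy g U)"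
  shows "4 * pi\<^sup>2 * r * s \<le> integral (cell r s) (conf_energy g U)"
proof -
  obtain E p q where E: "\<And>x. 0 < E x" and C: "Ck 1 p" "Ck 1 q"
    and P: "periodic r s (\<lambda>x. p x - (1 * fst x + 0 * (r / s) * snd x))"
    "periodic r s (\<lambda>x. q x - (0 * fst x + s / r * (r / s) * snd x))"
    and g: "\<And>x X Y. g x X Y = E x * (dd X p x * dd Y p x + dd X q x * dd Y q x)"
    by (rule teichmueller_coordinates[OF T rs]) (rule that)
  note det = gram_det_sum_squares[of g, OF g]
  have J: "integral (cell r s) (wedge p q) = 4 * pi\<^sup>2 * r * s"
    using integral_wedge[OF C(1) P(1) C(2) P(2) rs] rs by simp
  have nz: "wedge p q x \<noteq> 0" for x using pos[of x] unfolding det by auto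
  have Jpos: "0 < wedge p q x" for x
    by (rule wedge_positive[OF continuous_wedge[OF C] nz, of r s]) (use J rs in simp)
  have Uq: "integral (cell r s) (wedge U q) = 4 * pi\<^sup>2 * r * s"
    using integral_wedge[OF U(1) _ C(2) P(2) rs, of 1 0] U(2) rs by simp
  have "2 * wedge U q x - wedge p q x \<le> conf_energy g U x" for x
  proof -
    have sq: "sqrt (gram_det g x) = E x * wedge p q x"
      unfolding det using E[of x] Jpos[of x] by simp
    have "conf_energy g U x = ((wedge U p x)\<^sup>2 + (wedge U q x)\<^sup>2) / wedge p q x"
      unfolding conf_energy_def sq unfolding g wedge_def using E[of x]
      by (simp add: divide_simps) (simp add: power2_eq_square algebra_simps)
    moreover have "(2 * wedge U q x - wedge p q x) * wedge p q x \<le> (wedge U p x)\<^sup>2 + (wedge U q x)\<^sup>2"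
      using zero_le_square[of "wedge U q x - wedge p q x"] zero_le_square[of "wedge U p x"]
      unfolding power2_eq_square left_diff_distrib right_diff_distrib mult.commute[of "wedge p q x" "wedge U q x"]
      by linarith
    ultimately show ?thesis using Jpos[of x] by (simp add: pos_le_divide_eq)
  qed
  then have "integral (cell r s) (\<lambda>x. 2 * wedge U q x - wedge p q x) \<le> integral (cell r s) (conf_energy g U)"
    by (intro integral_le integrable_cell continuous_intros continuous_wedge U C c) auto
  also have "integral (cell r s) (\<lambda>x. 2 * wedge U q x - wedge p q x)
      = 2 * integral (cell r s) (wedge U q) - integral (cell r s) (wedge p q)"
    by (subst integral_diff) (auto intro!: integrable_cell continuous_intros continuous_wedge U C)
  finally show ?thesis unfolding Uq J by linarith
qed

lemma torus_param_has_derivative: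
  "(torus_param r s has_derivative
     (\<lambda>X. (of_real r * ((fst X / r) *\<^sub>R (\<i> * cis (fst x / r))), of_real s * ((snd X / s) *\<^sub>R (\<i> * cis (snd x / s)))))) (at x)"
  unfolding torus_param_def split_def divide_inverse
  by (auto intro!: derivative_eq_intros)

lemma dd_torus_param:
  assumes "r \<noteq> 0" "s \<noteq> 0"
  shows "dd X (torus_param r s) x = (fst X *\<^sub>R (\<i> * cis (fst x / r)), snd X *\<^sub>R (\<i> * cis (snd x / s)))"
  using assms by (subst dd_eqI[OF torus_param_has_derivative]) (simp add: scaleR_conv_of_real)

lemma inner_scale_cis: "(a *\<^sub>R (\<i> * cis t)) \<bullet> (b *\<^sub>R (\<i> * cis t)) = a * b"
proof -
  have "cos t * cos t + sin t * sin t = 1"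
    using sin_cos_squared_add[of t] by (simp add: power2_eq_square)
  then show ?thesis
    by (simp add: inner_complex_def cis.ctr algebra_simps flip: distrib_left)
qed

lemma induced_metric_torus_param:
  assumes "r \<noteq> 0" "s \<noteq> 0"
  shows "induced_metric (torus_param r s) x X Y = fst X * fst Y + snd X * snd Y"
  unfolding induced_metric_def dd_torus_param[OF assms] inner_prod_def
  by (simp only: fst_conv snd_conv inner_scale_cis)

lemma torus_diffeo_id: "torus_diffeo r s id"
proof -
  have "Ck 1 (id :: real \<times> real \<Rightarrow> real \<times> real)"
    unfolding Ck_iff_family by (rule Ck_family_linear) (rule bounded_linear_ident[folded id_def])
  then show ?thesis unfolding torus_diffeo_def by (auto simp: inv_id)
qed

lemma isotopic_to_id_id: "isotopic_to_id r s id"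
proof -
  have "Ck_family 1 {0..1} (\<lambda>t. id :: real \<times> real \<Rightarrow> real \<times> real)"
    by (rule Ck_family_linear) (rule bounded_linear_ident[folded id_def])
  then show ?thesis unfolding isotopic_to_id_def using torus_diffeo_id by blast
qed

lemma model_metric_flat:
  assumes "r \<noteq> 0" "s \<noteq> 0"
  shows "model_metric r s (0, s / r) x X Y = fst X * fst Y + snd X * snd Y"
  unfolding model_metric_def using assms by (simp add: field_simps power2_eq_square)

text \<open>For uniqueness, conformality to the flat metric makes |dP|^2 and |dQ|^2 both equal to
  the Jacobian, whose mean is \<open>D\<close>. The mean gradients of \<open>P\<close> and
  \<open>Q\<close> are (1, a') and (0, D) by periodicity, and the mean of a square dominates the
  square of the mean: 1 + a'^2 \<le> D and D^2 \<le> D. Hence a' = 0 and D = 1.\<close>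

lemma Teich_torus_param:
  assumes rs: "0 < r" "0 < s"
  shows "Teich r s (torus_param r s) = (0, s / r)"
proof -
  define g where "g = induced_metric (torus_param r s)"
  have g: "g x X Y = fst X * fst Y + snd X * snd Y" for x X Y
    unfolding g_def using induced_metric_torus_param rs by simp
  have ddid: "dd X id x = X" for X x :: "real \<times> real"
    by (rule dd_eqI) (auto intro!: derivative_eq_intros simp: id_def)
  have ex: "has_teichmueller r s g (0, s / r)"
    unfolding has_teichmueller_def
  proof (intro conjI exI[of _ "\<lambda>_::real \<times> real. 0::real"] exI[of _ id] allI)
    show "g x X Y = exp (2 * 0) * pullback id (model_metric r s (0, s / r)) x X Y" for x X Y
      using rs by (simp add: g pullback_def ddid model_metric_flat)
  qed (use rs torus_diffeo_id isotopic_to_id_id in \<open>auto simp: periodic_def\<close>)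
  have uniq: "p = (0, s / r)" if T: "has_teichmueller r s g p" for p
  proof -
    obtain a b where p: "p = (a, b)" by (cases p)
    have "0 < b" using T unfolding has_teichmueller_def p by simp
    define a' D where "a' = a * (r / s)" and "D = b * (r / s)"
    have "0 < D" using \<open>0 < b\<close> rs by (simp add: D_def)
    obtain E P Q where E: "\<And>x. 0 < E x" and C: "Ck 1 P" "Ck 1 Q"
      and per': "periodic r s (\<lambda>x. P x - (1 * fst x + a * (r / s) * snd x))"
      "periodic r s (\<lambda>x. Q x - (0 * fst x + b * (r / s) * snd x))"
      and gE: "\<And>x X Y. g x X Y = E x * (dd X P x * dd Y P x + dd X Q x * dd Y Q x)"
      by (rule teichmueller_coordinates[OF T[unfolded p] rs]) (rule that)
    note per = per'[folded a'_def D_def]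
    define A where "A = 4 * pi\<^sup>2 * r * s"
    have "0 < A" using rs by (simp add: A_def)
    have J: "integral (cell r s) (wedge P Q) = A * D"
      using integral_wedge[OF C(1) per(1) C(2) per(2) rs] by (simp add: A_def)
    have conf: "1 = E x * ((dd (1, 0) P x)\<^sup>2 + (dd (1, 0) Q x)\<^sup>2)"
      "1 = E x * ((dd (0, 1) P x)\<^sup>2 + (dd (0, 1) Q x)\<^sup>2)"
      "0 = E x * (dd (1, 0) P x * dd (0, 1) P x + dd (1, 0) Q x * dd (0, 1) Q x)" for x
      using gE[of x "(1, 0)" "(1, 0)"] gE[of x "(0, 1)" "(0, 1)"] gE[of x "(1, 0)" "(0, 1)"]
      unfolding g by (simp_all add: power2_eq_square)
    have det: "(E x * wedge P Q x)\<^sup>2 = 1" for x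
      using gram_det_sum_squares[of g E P Q x, OF gE] by (simp add: gram_det_def g)
    have Jpos: "0 < wedge P Q x" for x
    proof (rule wedge_positive[OF continuous_wedge[OF C], of r s])
      show "wedge P Q x \<noteq> 0" for x using det[of x] by auto
      show "0 < integral (cell r s) (wedge P Q)" using J \<open>0 < A\<close> \<open>0 < D\<close> by simp
    qed
    have EJ: "E x * wedge P Q x = 1" for x
      using det[of x] mult_pos_pos[OF E[of x] Jpos[of x]] by (simp add: power2_eq_1_iff)
    \<comment> \<open>Conformality controls the columns of the differential. Together with the
      positive Jacobian it gives the Cauchy-Riemann equations, which turn the column norms into the
      row norms |dP|^2 and |dQ|^2.\<close>
    have row: "(dd (1, 0) P x)\<^sup>2 + (dd (0, 1) P x)\<^sup>2 = wedge P Q x"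
      "(dd (1, 0) Q x)\<^sup>2 + (dd (0, 1) Q x)\<^sup>2 = wedge P Q x" for x
    proof -
      let ?a = "dd (1, 0) P x" and ?b = "dd (0, 1) P x" and ?c = "dd (1, 0) Q x" and ?d = "dd (0, 1) Q x"
      define J where "J = wedge P Q x"
      have Jd: "J = ?a * ?d - ?b * ?c" by (simp add: J_def wedge_def)
      have "E x \<noteq> 0" using E[of x] by simp
      have i: "?a\<^sup>2 + ?c\<^sup>2 = J" "?b\<^sup>2 + ?d\<^sup>2 = J"
        using conf(1,2)[of x] EJ[of x] \<open>E x \<noteq> 0\<close> unfolding J_def by (metis mult_cancel_left)+
      have ii: "?a * ?b + ?c * ?d = 0" using conf(3)[of x] \<open>E x \<noteq> 0\<close> by simp
      have "J \<noteq> 0" using Jpos[of x] by (simp add: J_def)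
      have "J * ?a = ?d * J"
      proof -
        have "?d * J - J * ?a = ?d * (?a\<^sup>2 + ?c\<^sup>2) - ?a * (?a * ?d - ?b * ?c)" using i Jd by simp
        also have "\<dots> = ?c * (?a * ?b + ?c * ?d)" by (simp add: power2_eq_square algebra_simps)
        finally show ?thesis using ii by auto
      qed
      then have ad: "?a = ?d" using \<open>J \<noteq> 0\<close> by auto
      have "J * ?b = - ?c * J"
      proof -
        have "- ?c * J - J * ?b = - ?c * (?b\<^sup>2 + ?d\<^sup>2) - ?b * (?a * ?d - ?b * ?c)" using i Jd by simp
        also have "\<dots> = - ?d * (?a * ?b + ?c * ?d)" by (simp add: power2_eq_square algebra_simps)
        finally show ?thesis using ii by simp
      qed
      then have bc: "?b = - ?c" using \<open>J \<noteq> 0\<close> by (metis mult.commute mult_cancel_left)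
      show "?a\<^sup>2 + ?b\<^sup>2 = wedge P Q x" "?c\<^sup>2 + ?d\<^sup>2 = wedge P Q x"
        using i ad bc by (simp_all add: J_def power2_eq_square)
    qed
    have low: "A * (\<alpha>\<^sup>2 + \<beta>\<^sup>2) \<le> A * D"
      if F: "Ck 1 F" "periodic r s (\<lambda>x. F x - (\<alpha> * fst x + \<beta> * snd x))"
        and row: "\<And>x. (dd (1, 0) F x)\<^sup>2 + (dd (0, 1) F x)\<^sup>2 = wedge P Q x" for F \<alpha> \<beta>
    proof -
      have CL: "Ck 1 (fst :: real \<times> real \<Rightarrow> real)" "Ck 1 (snd :: real \<times> real \<Rightarrow> real)"
        unfolding Ck_iff_family by (rule Ck_family_linear, rule bounded_linear_fst bounded_linear_snd)+
      have LL: "dd X fst x = fst X" "dd X snd x = snd X" for X x :: "real \<times> real"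
        by (rule dd_eqI, rule bounded_linear_imp_has_derivative, rule bounded_linear_fst bounded_linear_snd)+
      have u: "integral (cell r s) (dd (1, 0) F) = A * \<alpha>"
        using integral_wedge[OF F CL(2) _ rs, of 0 1]
        by (simp add: wedge_def[abs_def] LL periodic_def A_def)
      have v: "integral (cell r s) (dd (0, 1) F) = A * \<beta>"
        using integral_wedge[OF CL(1) _ F rs, of 1 0]
        by (simp add: wedge_def[abs_def] LL periodic_def A_def)
      note cF = Ck1_dd_continuous[OF F(1)]
      have "2 * \<alpha> * dd (1, 0) F x + 2 * \<beta> * dd (0, 1) F x - (\<alpha>\<^sup>2 + \<beta>\<^sup>2) \<le> wedge P Q x" for x
        using zero_le_power2[of "dd (1, 0) F x - \<alpha>"] zero_le_power2[of "dd (0, 1) F x - \<beta>"] row[of x]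
        by (simp add: power2_eq_square algebra_simps)
      then have "integral (cell r s) (\<lambda>x. 2 * \<alpha> * dd (1, 0) F x + 2 * \<beta> * dd (0, 1) F x - (\<alpha>\<^sup>2 + \<beta>\<^sup>2)) \<le> A * D"
        unfolding J[symmetric] by (intro integral_le integrable_cell continuous_intros continuous_wedge C cF) auto
      also have "integral (cell r s) (\<lambda>x. 2 * \<alpha> * dd (1, 0) F x + 2 * \<beta> * dd (0, 1) F x - (\<alpha>\<^sup>2 + \<beta>\<^sup>2))
          = 2 * \<alpha> * (A * \<alpha>) + 2 * \<beta> * (A * \<beta>) - A * (\<alpha>\<^sup>2 + \<beta>\<^sup>2)"
        using rs integral_cell_const[of r s "\<alpha>\<^sup>2 + \<beta>\<^sup>2"]
        by (simp only: integral_add integral_diff integral_mult_right integrable_cell continuous_on_add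
            continuous_on_mult continuous_on_const cF u v A_def less_imp_le)
      finally show ?thesis by (simp add: power2_eq_square algebra_simps)
    qed
    have "1 + a'\<^sup>2 \<le> D" using low[OF C(1) per(1) row(1)] \<open>0 < A\<close> by simp
    moreover have "D\<^sup>2 \<le> D" using low[OF C(2) per(2) row(2)] \<open>0 < A\<close> by simp
    then have "D \<le> 1" using \<open>0 < D\<close> by (simp add: power2_eq_square)
    moreover have "0 \<le> a'\<^sup>2" by simp
    ultimately have "a'\<^sup>2 = 0" "D = 1" by linarith+
    then have "a = 0" "b = s / r" using rs by (auto simp: a'_def D_def field_simps)
    then show ?thesis by (simp add: p)
  qed
  show ?thesis
    unfolding Teich_def teichmueller_def g_def[symmetric] using ex uniq by (rule the_equality)
qed

section \<open>Symmetry of second derivatives, normal projection and mean curvature in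
  coordinates\<close>

section \<open>Immersed surfaces in the sphere\<close>

lemma C2_family_real_holomorphic:
  fixes F :: "real \<Rightarrow> 'a::euclidean_space \<Rightarrow> real"
  assumes "C2_family k J F" "open S" "h holomorphic_on S" "\<And>t x. t \<in> J \<Longrightarrow> of_real (F t x) \<in> S"
  shows "C2_family k J (\<lambda>t x. Re (h (of_real (F t x))))"
  by (rule C2_family_bounded_linear[OF bounded_linear_Re], rule C2_family_holomorphic[OF _ assms(2,3)],
      rule C2_family_bounded_linear[OF bounded_linear_of_real assms(1)]) (rule assms(4))

lemma C2_family_cong:
  assumes "C2_family k J F" "open J" "\<And>t x. t \<in> J \<Longrightarrow> F t x = G t x"
  shows "C2_family k J G"
  using assms(1)
proof (rule C2_familyE)
  fix F' F'' assume F: "Ck_family k J F" "Ck_family k J F'" "Ck_family k J F''"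
    "\<And>t x. t \<in> J \<Longrightarrow> ((\<lambda>\<tau>. F \<tau> x) has_vector_derivative F' t x) (at t)"
    "\<And>t x. t \<in> J \<Longrightarrow> ((\<lambda>\<tau>. F' \<tau> x) has_vector_derivative F'' t x) (at t)"
  have "Ck_family k J G" using F(1) Ck_family_cong[of J F G] assms(3) by (metis ext)
  moreover have "((\<lambda>\<tau>. G \<tau> x) has_vector_derivative F' t x) (at t)" if "t \<in> J" for t x
    using F(4)[OF that, of x] assms(2) that
    by (rule has_vector_derivative_transform_within_open) (rule assms(3))
  ultimately show ?thesis using F(2,3,5) by (intro C2_familyI[of k J G F' F''])
qed

lemma C2_family_inverse:
  fixes F :: "real \<Rightarrow> 'a::euclidean_space \<Rightarrow> real"
  assumes "C2_family k J F" "open J" "\<And>t x. t \<in> J \<Longrightarrow> F t x \<noteq> 0"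
  shows "C2_family k J (\<lambda>t x. inverse (F t x))"
proof (rule C2_family_cong[OF _ assms(2)])
  show "C2_family k J (\<lambda>t x. Re (inverse (of_real (F t x))))"
    by (rule C2_family_real_holomorphic[OF assms(1), of "- {0}"])
      (use assms(3) in \<open>auto intro!: holomorphic_intros\<close>)
  show "Re (inverse (of_real (F t x))) = inverse (F t x)" for t x
    by (simp flip: of_real_inverse)
qed

lemma C2_family_sqrt:
  fixes F :: "real \<Rightarrow> 'a::euclidean_space \<Rightarrow> real"
  assumes "C2_family k J F" "open J" "\<And>t x. t \<in> J \<Longrightarrow> 0 < F t x"
  shows "C2_family k J (\<lambda>t x. sqrt (F t x))"
proof (rule C2_family_cong[OF _ assms(2)])
  show "C2_family k J (\<lambda>t x. Re (csqrt (of_real (F t x))))"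
    by (rule C2_family_real_holomorphic[OF assms(1), of "- \<real>\<^sub>\<le>\<^sub>0"])
      (use assms(3) in \<open>auto intro!: holomorphic_on_csqrt simp: complex_nonpos_Reals_iff not_le\<close>)
  show "Re (csqrt (of_real (F t x))) = sqrt (F t x)" if "t \<in> J" for t x
    using assms(3)[OF that, of x] by (simp add: less_imp_le)
qed

lemmas C2_family_mult = C2_family_bilinear[OF bounded_bilinear_mult]
lemmas C2_family_scaleR = C2_family_bilinear[OF bounded_bilinear_scaleR]
lemmas C2_family_inner = C2_family_bilinear[OF bounded_bilinear_inner]
lemmas C2_family_minus = C2_family_bounded_linear[OF bounded_linear_minus[OF bounded_linear_ident]]

lemma C2_family_diff:
  assumes "C2_family k J F" "C2_family k J G"
  shows "C2_family k J (\<lambda>t x. F t x - G t x)"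
  using C2_family_add[OF assms(1) C2_family_minus[OF assms(2)]] by simp

lemma C2_family_divide:
  fixes F :: "real \<Rightarrow> 'a::euclidean_space \<Rightarrow> real"
  assumes "C2_family k J F" "C2_family k J G" "open J" "\<And>t x. t \<in> J \<Longrightarrow> G t x \<noteq> 0"
  shows "C2_family k J (\<lambda>t x. F t x / G t x)"
  unfolding divide_inverse by (intro C2_family_mult assms C2_family_inverse)

lemma C2_family_power2:
  fixes F :: "real \<Rightarrow> 'a::euclidean_space \<Rightarrow> real"
  assumes "C2_family k J F"
  shows "C2_family k J (\<lambda>t x. (F t x)\<^sup>2)"
  unfolding power2_eq_square by (intro C2_family_mult assms)

lemma integral_has_derivative_time:
  fixes G :: "real \<Rightarrow> real \<times> real \<Rightarrow> real"
  assumes "open J" "convex J" and c: "continuous_on (J \<times> UNIV) (\<lambda>(t, x). G t x)"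
    "continuous_on (J \<times> UNIV) (\<lambda>(t, x). G' t x)"
    and d: "\<And>t x. t \<in> J \<Longrightarrow> ((\<lambda>\<tau>. G \<tau> x) has_vector_derivative G' t x) (at t)" and t: "t \<in> J"
  shows "((\<lambda>t. integral (cell r s) (G t)) has_real_derivative integral (cell r s) (G' t)) (at t)"
proof -
  have "((\<lambda>t. integral (cell r s) (G t)) has_vector_derivative integral (cell r s) (G' t)) (at t within J)"
  proof (rule leibniz_rule_vector_derivative[OF _ _ _ t assms(2)])
    show "((\<lambda>\<tau>. G \<tau> x) has_vector_derivative G' t x) (at t within J)" if "t \<in> J" for t x
      using d[OF that] by (rule has_vector_derivative_at_within)
    show "G t integrable_on cell r s" if "t \<in> J" for t
      using continuous_on_slice[OF c(1) that] by (rule integrable_cell)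
    show "continuous_on (J \<times> cell r s) (\<lambda>(t, x). G' t x)"
      using c(2) by (rule continuous_on_subset) auto
  qed
  then show ?thesis
    unfolding has_real_derivative_iff_has_vector_derivative at_within_open[OF t assms(1)] .
qed

lemma integral_C2_family:
  fixes G :: "real \<Rightarrow> real \<times> real \<Rightarrow> real"
  assumes "C2_family k J G" "open J" "convex J"
  obtains W' W'' where "\<And>t. t \<in> J \<Longrightarrow> ((\<lambda>t. integral (cell r s) (G t)) has_real_derivative W' t) (at t)"
    "\<And>t. t \<in> J \<Longrightarrow> (W' has_real_derivative W'' t) (at t)"
  using assms(1)
proof (rule C2_familyE)
  fix F' F'' assume F: "Ck_family k J G" "Ck_family k J F'" "Ck_family k J F''"
    "\<And>t x. t \<in> J \<Longrightarrow> ((\<lambda>\<tau>. G \<tau> x) has_vector_derivative F' t x) (at t)"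
    "\<And>t x. t \<in> J \<Longrightarrow> ((\<lambda>\<tau>. F' \<tau> x) has_vector_derivative F'' t x) (at t)"
  note c = F(1-3)[THEN Ck_family_continuous]
  show thesis
  proof (rule that)
    fix t assume t: "t \<in> J"
    show "((\<lambda>t. integral (cell r s) (G t)) has_real_derivative integral (cell r s) (F' t)) (at t)"
      by (rule integral_has_derivative_time[OF assms(2,3) c(1,2) F(4) t])
    show "((\<lambda>t. integral (cell r s) (F' t)) has_real_derivative integral (cell r s) (F'' t)) (at t)"
      by (rule integral_has_derivative_time[OF assms(2,3) c(2,3) F(5) t])
  qed
qed

text \<open>This is the exchange of time and space derivatives for the translates of
  \<open>f\<close> along \<open>Y\<close>, whose time derivative is \<open>dd Y f\<close>.\<close>

lemma dd_dd_commute: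
  fixes f :: "'a::euclidean_space \<Rightarrow> 'b::euclidean_space"
  assumes "Ck 2 f"
  shows "dd X (dd Y f) x = dd Y (dd X f) x"
proof -
  have f: "Ck (Suc (Suc 0)) f" using assms by (simp add: numeral_2_eq_2 del: Ck.simps)
  have f1: "Ck (Suc 0) (dd Z f)" for Z using f by (rule Ck_Suc_dd)
  have shift: "Ck_family k UNIV (\<lambda>t x. h (x + t *\<^sub>R Y))" if "Ck k h" for h :: "'a \<Rightarrow> 'b" and k
    using that
  proof (induction k arbitrary: h)
    case 0
    have "continuous_on (UNIV \<times> UNIV) (\<lambda>z. h (snd z + fst z *\<^sub>R Y))"
      by (rule continuous_on_compose2[of UNIV h]) (use 0 in \<open>auto intro!: continuous_intros\<close>)
    then show ?case by (simp add: split_def)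
  next
    case (Suc k)
    have D: "((\<lambda>x. h (x + t *\<^sub>R Y)) has_derivative (\<lambda>X. dd X h (x + t *\<^sub>R Y))) (at x)" for t x
    proof -
      have "((\<lambda>x. x + t *\<^sub>R Y) has_derivative (\<lambda>x. x)) (at x)" by (auto intro!: derivative_eq_intros)
      from has_derivative_compose[OF this has_derivative_dd[OF Ck_Suc_differentiable[OF Suc.prems]]]
      show ?thesis .
    qed
    have e: "dd X (\<lambda>x. h (x + t *\<^sub>R Y)) = (\<lambda>x. dd X h (x + t *\<^sub>R Y))" for X t
      by (rule ext) (rule dd_eqI[OF D])
    have "continuous_on (UNIV \<times> UNIV) (\<lambda>z. h (snd z + fst z *\<^sub>R Y))"
      by (rule continuous_on_compose2[OF Ck_continuous[OF Suc.prems]]) (auto intro!: continuous_intros)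
    then have c: "continuous_on (UNIV \<times> UNIV) (\<lambda>(t, x). h (x + t *\<^sub>R Y))" by (simp add: split_def)
    show ?case
      unfolding Ck_family.simps e
      using c D Suc.IH[OF Ck_Suc_dd[OF Suc.prems]] by (auto simp: differentiable_def)
  qed
  have line: "((\<lambda>t. h (x + t *\<^sub>R Y)) has_vector_derivative dd Y h (x + t *\<^sub>R Y)) (at t)"
    if "\<And>x. h differentiable at x" for h :: "'a \<Rightarrow> 'b" and x t
  proof -
    have "((\<lambda>t. x + t *\<^sub>R Y) has_derivative (\<lambda>k. k *\<^sub>R Y)) (at t)" by (auto intro!: derivative_eq_intros)
    note D = has_derivative_compose[OF this has_derivative_dd[OF that]]
    have "dd (k *\<^sub>R Y) h y = k *\<^sub>R dd Y h y" for k y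
      using has_derivative_linear[OF has_derivative_dd[OF that]] by (rule linear_scale)
    then have "(\<lambda>k. dd (k *\<^sub>R Y) h (x + t *\<^sub>R Y)) = (\<lambda>k. k *\<^sub>R dd Y h (x + t *\<^sub>R Y))" by (rule ext)
    from has_derivative_eq_rhs[OF D this] show ?thesis unfolding has_vector_derivative_def .
  qed
  have D: "((\<lambda>x. f (x + t *\<^sub>R Y)) has_derivative (\<lambda>X. dd X f (x + t *\<^sub>R Y))) (at x)" for t x
    using has_derivative_shift[OF has_derivative_dd[OF Ck_Suc_differentiable[OF f]]] .
  have "((\<lambda>t. dd X (\<lambda>x. f (x + t *\<^sub>R Y)) x) has_vector_derivative dd X (\<lambda>x. dd Y f (x + 0 *\<^sub>R Y)) x) (at 0)"
  proof (rule has_vector_derivative_dd[where J=UNIV and k=0])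
    show "Ck_family (Suc 0) UNIV (\<lambda>t x. f (x + t *\<^sub>R Y))" by (rule shift[OF Ck_mono[OF f]]) simp
    show "Ck_family (Suc 0) UNIV (\<lambda>t x. dd Y f (x + t *\<^sub>R Y))" by (rule shift[OF f1])
    show "((\<lambda>t. f (x + t *\<^sub>R Y)) has_vector_derivative dd Y f (x + t *\<^sub>R Y)) (at t)" for x t
      by (rule line[OF Ck_Suc_differentiable[OF f]])
  qed simp_all
  moreover have "dd X (\<lambda>x. f (x + t *\<^sub>R Y)) x = dd X f (x + t *\<^sub>R Y)" for t
    by (rule dd_eqI[OF D])
  ultimately have "((\<lambda>t. dd X f (x + t *\<^sub>R Y)) has_vector_derivative dd X (dd Y f) x) (at 0)" by simp
  moreover have "((\<lambda>t. dd X f (x + t *\<^sub>R Y)) has_vector_derivative dd Y (dd X f) (x + 0 *\<^sub>R Y)) (at 0)"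
    by (rule line[OF Ck_Suc_differentiable[OF f1]])
  ultimately show ?thesis using vector_derivative_unique_at by fastforce
qed

text \<open>Two candidates differ by a vector that lies in the span and is orthogonal to it, hence
  to itself. The definite description thereby becomes computable.\<close>

lemma orth_part_eq:
  assumes "p \<in> S\<^sup>\<bottom>" "w - p \<in> span S"
  shows "orth_part S w = p"
  unfolding orth_part_def
proof (rule the_equality)
  fix p' assume p': "p' \<in> S\<^sup>\<bottom> \<and> w - p' \<in> span S"
  have "(w - p) - (w - p') \<in> span S" by (rule span_diff[OF assms(2) conjunct2[OF p']])
  then have d: "p' - p \<in> span S" by simp
  have "p' - p \<in> S\<^sup>\<bottom>" using assms p' subspace_diff[OF subspace_orthogonal_comp] by blast
  then have "orthogonal y (p' - p)" if "y \<in> S" for y using that unfolding orthogonal_comp_def by blast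
  then have "orthogonal (p' - p) y" if "y \<in> S" for y using that orthogonal_commute by blast
  then have "orthogonal (p' - p) (p' - p)" using d orthogonal_to_span by blast
  then show "p' = p" by (simp add: orthogonal_def)
qed (simp add: assms)

lemma dd_inner:
  fixes f g :: "real \<times> real \<Rightarrow> 'b::real_inner"
  assumes "f differentiable at x" "g differentiable at x"
  shows "dd X (\<lambda>x. f x \<bullet> g x) x = f x \<bullet> dd X g x + dd X f x \<bullet> g x"
  by (rule dd_eqI) (rule has_derivative_inner[OF has_derivative_dd[OF assms(1)] has_derivative_dd[OF assms(2)]])

text \<open>With \<open>tan2\<close>, the coefficients of the tangential part of \<open>w\<close> in
  the basis f_u, f_v, obtained from the Gram matrix by Cramer's rule.\<close>

definition tan1 where
  "tan1 f w x = (let g = induced_metric f in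
     (g x (0, 1) (0, 1) * (w \<bullet> dd (1, 0) f x) - g x (1, 0) (0, 1) * (w \<bullet> dd (0, 1) f x)) / gram_det g x)"

definition tan2 where
  "tan2 f w x = (let g = induced_metric f in
     (g x (1, 0) (1, 0) * (w \<bullet> dd (0, 1) f x) - g x (1, 0) (0, 1) * (w \<bullet> dd (1, 0) f x)) / gram_det g x)"

text \<open>An explicit form of the projection used in \<open>second_ff\<close>; being rational in
  \<open>f\<close>, its first derivatives and \<open>w\<close>, it fits into the calculus of
  families.\<close>

definition nor :: "(real \<times> real \<Rightarrow> complex \<times> complex) \<Rightarrow> complex \<times> complex \<Rightarrow> real \<times> real \<Rightarrow> complex \<times> complex" where
  "nor f w x = w - (w \<bullet> f x) *\<^sub>R f x - tan1 f w x *\<^sub>R dd (1, 0) f x - tan2 f w x *\<^sub>R dd (0, 1) f x"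

lemma nor_linear: "nor f (a *\<^sub>R v + b *\<^sub>R w) x = a *\<^sub>R nor f v x + b *\<^sub>R nor f w x"
  unfolding nor_def tan1_def tan2_def Let_def
  by (simp add: inner_add_left scaleR_add_left scaleR_add_right scaleR_diff_right algebra_simps
      add_divide_distrib diff_divide_distrib)

text \<open>Gram-Schmidt: the determinant is |f_u|^2 times the squared distance of f_v from the line
  spanned by f_u.\<close>

lemma gram_det_pos:
  assumes "f differentiable at x" "inj (frechet_derivative f (at x))"
  shows "0 < gram_det (induced_metric f) x"
proof -
  let ?a = "dd (1, 0) f x" and ?b = "dd (0, 1) f x"
  have inj: "X = Y" if "dd X f x = dd Y f x" for X Y
    using injD[OF assms(2)] that unfolding dd_def by blast
  have a0: "?a \<noteq> 0"
  proof
    assume "?a = 0"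
    then have "dd (1, 0) f x = dd 0 f x" using dd_coords[OF assms(1), of 0] by simp
    then show False using inj[of "(1, 0)" 0] by (simp add: zero_prod_def)
  qed
  define c where "c = (?a \<bullet> ?b) / (?a \<bullet> ?a)"
  have aa: "0 < ?a \<bullet> ?a" using a0 by simp
  have "?b \<noteq> c *\<^sub>R ?a"
  proof
    assume "?b = c *\<^sub>R ?a"
    then have "dd (0, 1) f x = dd (c, 0) f x" using dd_coords[OF assms(1), of "(c, 0)"] by simp
    then show False using inj[of "(0, 1)" "(c, 0)"] by simp
  qed
  then have "0 < (?b - c *\<^sub>R ?a) \<bullet> (?b - c *\<^sub>R ?a)" by simp
  also have "\<dots> = ?b \<bullet> ?b - 2 * c * (?a \<bullet> ?b) + c * c * (?a \<bullet> ?a)"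
    by (simp add: inner_diff_left inner_diff_right inner_commute algebra_simps)
  also have "\<dots> = ?b \<bullet> ?b - (?a \<bullet> ?b)\<^sup>2 / (?a \<bullet> ?a)"
    using a0 unfolding c_def by (simp add: field_simps power2_eq_square)
  finally have "0 < (?b \<bullet> ?b - (?a \<bullet> ?b)\<^sup>2 / (?a \<bullet> ?a)) * (?a \<bullet> ?a)" using aa by simp
  also have "\<dots> = gram_det (induced_metric f) x"
    using a0 unfolding gram_det_def induced_metric_def by (simp add: field_simps)
  finally show ?thesis .
qed

locale surface =
  fixes f :: "real \<times> real \<Rightarrow> complex \<times> complex"
  assumes smooth: "Ck 2 f" and sphere: "\<And>x. f x \<bullet> f x = 1"
    and gpos: "\<And>x. 0 < gram_det (induced_metric f) x"
begin

abbreviation "fu \<equiv> dd (1, 0) f"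
abbreviation "fv \<equiv> dd (0, 1) f"
abbreviation "EE x \<equiv> fu x \<bullet> fu x"
abbreviation "FF x \<equiv> fu x \<bullet> fv x"
abbreviation "GG x \<equiv> fv x \<bullet> fv x"

lemma smooth1: "Ck 1 f" and smooth1': "Ck 1 (dd X f)"
proof -
  have "Ck (Suc (Suc 0)) f" using smooth by (simp add: numeral_2_eq_2 del: Ck.simps)
  then show "Ck 1 (dd X f)" unfolding One_nat_def by (rule Ck_Suc_dd)
  show "Ck 1 f" by (rule Ck_mono[OF smooth]) simp
qed

lemma diff: "f differentiable at x" and diff': "dd X f differentiable at x"
  using Ck1_differentiable smooth1 smooth1' by blast+

lemma metric: "induced_metric f x (1, 0) (1, 0) = EE x" "induced_metric f x (1, 0) (0, 1) = FF x"
  "induced_metric f x (0, 1) (0, 1) = GG x" "gram_det (induced_metric f) x = EE x * GG x - (FF x)\<^sup>2"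
  by (simp_all add: induced_metric_def gram_det_def)

lemma det_pos: "0 < EE x * GG x - (FF x)\<^sup>2"
  using gpos[of x] unfolding metric .

lemma tangent_orthogonal: "dd X f x \<bullet> f x = 0"
proof -
  have "(\<lambda>x. f x \<bullet> f x) = (\<lambda>x. 1)" using sphere by auto
  then have "dd X (\<lambda>x. f x \<bullet> f x) x = dd X (\<lambda>x. 1::real) x" by simp
  also have "\<dots> = 0" by (rule dd_eqI[of _ "\<lambda>_. 0"]) (rule has_derivative_const)
  finally show ?thesis using dd_inner[OF diff[of x] diff[of x], of X] by (simp add: inner_commute)
qed

lemma tangent_orthogonal': "f x \<bullet> dd X f x = 0"
  using tangent_orthogonal[of X x] by (simp add: inner_commute)

lemma tan_metric:
  "tan1 f w x = (GG x * (w \<bullet> fu x) - FF x * (w \<bullet> fv x)) / (EE x * GG x - (FF x)\<^sup>2)"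
  "tan2 f w x = (EE x * (w \<bullet> fv x) - FF x * (w \<bullet> fu x)) / (EE x * GG x - (FF x)\<^sup>2)"
  unfolding tan1_def tan2_def Let_def metric by simp_all

lemma tan_solve:
  "tan1 f w x * EE x + tan2 f w x * FF x = w \<bullet> fu x"
  "tan1 f w x * FF x + tan2 f w x * GG x = w \<bullet> fv x"
proof -
  define D p q where "D = EE x * GG x - (FF x)\<^sup>2" and "p = w \<bullet> fu x" and "q = w \<bullet> fv x"
  have D: "D \<noteq> 0" using det_pos[of x] by (simp add: D_def)
  have "(GG x * p - FF x * q) * EE x + (EE x * q - FF x * p) * FF x = p * D"
    "(GG x * p - FF x * q) * FF x + (EE x * q - FF x * p) * GG x = q * D"
    by (simp_all add: D_def power2_eq_square algebra_simps)
  then show "tan1 f w x * EE x + tan2 f w x * FF x = w \<bullet> fu x"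
    "tan1 f w x * FF x + tan2 f w x * GG x = w \<bullet> fv x"
    unfolding tan_metric D_def[symmetric] p_def[symmetric] q_def[symmetric]
    using D by (simp_all add: eq_divide_eq flip: add_divide_distrib)
qed

lemma nor_orthogonal: "nor f w x \<bullet> f x = 0" "nor f w x \<bullet> fu x = 0" "nor f w x \<bullet> fv x = 0"
proof -
  note t = tangent_orthogonal tangent_orthogonal'
  show "nor f w x \<bullet> f x = 0"
    unfolding nor_def by (simp add: inner_diff_left t sphere)
  show "nor f w x \<bullet> fu x = 0"
    using tan_solve(1)[of w x] unfolding nor_def
    by (simp add: inner_diff_left t inner_commute[of "fv x"])
  show "nor f w x \<bullet> fv x = 0"
    using tan_solve(2)[of w x] unfolding nor_def
    by (simp add: inner_diff_left t)
qed

lemma orth_part_nor: "orth_part (insert (f x) (range (\<lambda>Z. dd Z f x))) w = nor f w x"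
proof (rule orth_part_eq)
  let ?S = "insert (f x) (range (\<lambda>Z. dd Z f x))"
  have "nor f w x \<bullet> dd Z f x = 0" for Z
    unfolding dd_coords[OF diff, of Z] by (simp add: inner_add_right nor_orthogonal)
  then show "nor f w x \<in> ?S\<^sup>\<bottom>"
    using nor_orthogonal(1)[of w x] unfolding orthogonal_comp_def orthogonal_def
    by (auto simp: inner_commute)
  have "w - nor f w x = (w \<bullet> f x) *\<^sub>R f x + tan1 f w x *\<^sub>R fu x + tan2 f w x *\<^sub>R fv x"
    unfolding nor_def by simp
  also have "\<dots> \<in> span ?S"
    by (intro span_add span_scale span_base) auto
  finally show "w - nor f w x \<in> span ?S" .
qed

text \<open>The metric trace of the coordinate Hessian. The Christoffel terms that separate it from
  the Laplacian are tangential and disappear under \<open>nor\<close>.\<close>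

definition "Lam x = (1 / (EE x * GG x - (FF x)\<^sup>2)) *\<^sub>R
   (GG x *\<^sub>R dd (1, 0) fu x - (2 * FF x) *\<^sub>R dd (1, 0) fv x + EE x *\<^sub>R dd (0, 1) fv x)"

lemma mean_curvature_nor: "mean_curvature f x = nor f (Lam x) x"
proof -
  have lin: "nor f (c *\<^sub>R (a *\<^sub>R u - b *\<^sub>R v + d *\<^sub>R w)) x =
      c *\<^sub>R (a *\<^sub>R nor f u x - b *\<^sub>R nor f v x + d *\<^sub>R nor f w x)" for a b c d u v w
  proof -
    have "c *\<^sub>R (a *\<^sub>R u - b *\<^sub>R v + d *\<^sub>R w) = 1 *\<^sub>R ((c * a) *\<^sub>R u + (- (c * b)) *\<^sub>R v) + (c * d) *\<^sub>R w"
      by (simp add: algebra_simps)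
    then have "nor f (c *\<^sub>R (a *\<^sub>R u - b *\<^sub>R v + d *\<^sub>R w)) x =
       1 *\<^sub>R ((c * a) *\<^sub>R nor f u x + (- (c * b)) *\<^sub>R nor f v x) + (c * d) *\<^sub>R nor f w x"
      by (simp only: nor_linear)
    then show ?thesis by (simp add: algebra_simps)
  qed
  show ?thesis
    unfolding mean_curvature_def Let_def second_ff_def orth_part_nor metric Lam_def lin by simp
qed

end

section \<open>Smooth dependence of the energy on time, and the lower bound by a test field\<close>

section \<open>The Willmore functional and a lower bound\<close>

definition willmore_density :: "(real \<times> real \<Rightarrow> complex \<times> complex) \<Rightarrow> real \<times> real \<Rightarrow> real" where
  "willmore_density f x =
     ((norm (mean_curvature f x))\<^sup>2 / 4 + 1) * sqrt (gram_det (induced_metric f) x)"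

lemma willmore_density_integral: "willmore r s f = integral (cell r s) (willmore_density f)"
  unfolding willmore_def willmore_density_def ..

lemma (in surface) willmore_density_nor:
  "willmore_density f x = ((nor f (Lam x) x \<bullet> nor f (Lam x) x) / 4 + 1) * sqrt (EE x * GG x - (FF x)\<^sup>2)"
  unfolding willmore_density_def mean_curvature_nor metric power2_norm_eq_inner ..

text \<open>The explicit projection makes the density a rational expression in \<open>f\<close> and
  its first two derivatives, apart from the square root of the positive Gram determinant; two
  spatial derivatives are consumed.\<close>

lemma C2_family_willmore_density:
  assumes F: "C2_family 2 J F" and J: "open J" and S: "\<And>t. t \<in> J \<Longrightarrow> surface (F t)"
  shows "C2_family 0 J (\<lambda>t. willmore_density (F t))"
proof -
  have F2: "C2_family (Suc (Suc 0)) J F" using F by (simp add: numeral_2_eq_2)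
  have F1: "C2_family (Suc 0) J (\<lambda>t. dd X (F t))" for X by (rule C2_family_dd[OF F2 J])
  have b0: "C2_family 0 J (\<lambda>t x. F t x)" by (rule C2_family_mono[OF F2]) simp
  have b1: "C2_family 0 J (\<lambda>t x. dd X (F t) x)" for X by (rule C2_family_mono[OF F1]) simp
  have b2: "C2_family 0 J (\<lambda>t x. dd X (dd Y (F t)) x)" for X Y by (rule C2_family_dd[OF F1 J])
  define DD where "DD t x = (dd (1, 0) (F t) x \<bullet> dd (1, 0) (F t) x) * (dd (0, 1) (F t) x \<bullet> dd (0, 1) (F t) x)
       - (dd (1, 0) (F t) x \<bullet> dd (0, 1) (F t) x)\<^sup>2" for t x
  have det: "C2_family 0 J (\<lambda>t x. DD t x)"
    unfolding DD_def by (intro C2_family_diff C2_family_mult C2_family_power2 C2_family_inner b1)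
  have pos: "0 < DD t x" if "t \<in> J" for t x
    using surface.det_pos[OF S[OF that]] unfolding DD_def .
  have nz: "DD t x \<noteq> 0" if "t \<in> J" for t x
    using pos[OF that, of x] by simp
  define L where "L t x = (1 / DD t x) *\<^sub>R
     ((dd (0, 1) (F t) x \<bullet> dd (0, 1) (F t) x) *\<^sub>R dd (1, 0) (dd (1, 0) (F t)) x
      - (2 * (dd (1, 0) (F t) x \<bullet> dd (0, 1) (F t) x)) *\<^sub>R dd (1, 0) (dd (0, 1) (F t)) x
      + (dd (1, 0) (F t) x \<bullet> dd (1, 0) (F t) x) *\<^sub>R dd (0, 1) (dd (0, 1) (F t)) x)" for t x
  have L: "C2_family 0 J (\<lambda>t x. L t x)"
    unfolding L_def
    by (intro C2_family_scaleR C2_family_add C2_family_diff C2_family_divide C2_family_const C2_family_mult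
        C2_family_inner b1 b2 det J nz)
  define n where "n t x = L t x - (L t x \<bullet> F t x) *\<^sub>R F t x
     - (((dd (0, 1) (F t) x \<bullet> dd (0, 1) (F t) x) * (L t x \<bullet> dd (1, 0) (F t) x)
         - (dd (1, 0) (F t) x \<bullet> dd (0, 1) (F t) x) * (L t x \<bullet> dd (0, 1) (F t) x))
        / DD t x) *\<^sub>R dd (1, 0) (F t) x
     - (((dd (1, 0) (F t) x \<bullet> dd (1, 0) (F t) x) * (L t x \<bullet> dd (0, 1) (F t) x)
         - (dd (1, 0) (F t) x \<bullet> dd (0, 1) (F t) x) * (L t x \<bullet> dd (1, 0) (F t) x))
        / DD t x) *\<^sub>R dd (0, 1) (F t) x" for t x
  have n: "C2_family 0 J (\<lambda>t x. n t x)"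
    unfolding n_def
    by (intro C2_family_scaleR C2_family_diff C2_family_divide C2_family_mult
        C2_family_inner b0 b1 L det J nz)
  show ?thesis
  proof (rule C2_family_cong[OF _ J])
    show "C2_family 0 J (\<lambda>t x. ((n t x \<bullet> n t x) * (1 / 4) + 1) *
       sqrt (DD t x))"
      by (intro C2_family_mult C2_family_add C2_family_inner C2_family_const n C2_family_sqrt det J pos)
    fix t x assume t: "t \<in> J"
    interpret surface "F t" by (rule S[OF t])
    have "L t x = Lam x" unfolding L_def Lam_def DD_def ..
    then have "n t x = nor (F t) (Lam x) x" unfolding n_def nor_def tan_metric DD_def by simp
    then show "((n t x \<bullet> n t x) * (1 / 4) + 1) * sqrt (DD t x) = willmore_density (F t) x"
      unfolding willmore_density_nor DD_def by simp
  qed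
qed

lemma immersion_surface:
  assumes "immersion k r s f" "2 \<le> k"
  shows "surface f"
proof
  show C: "Ck 2 f" using assms Ck_mono unfolding immersion_def by blast
  show "f x \<bullet> f x = 1" for x
  proof -
    have "f x \<in> sphere 0 1" using assms unfolding immersion_def by blast
    then show ?thesis using norm_eq_1[of "f x"] by simp
  qed
  have "Ck 1 f" by (rule Ck_mono[OF C]) simp
  then show "0 < gram_det (induced_metric f) x" for x
    using assms unfolding immersion_def by (blast intro: gram_det_pos Ck1_differentiable)
qed

text \<open>This gives meaning to the iterated \<open>deriv\<close> in the definition of stability,
  which for a function that is not differentiable would say nothing.\<close>

lemma willmore_twice_differentiable:
  assumes V: "variation k r s f \<delta> F" and "2 \<le> k"
  obtains W' W'' where
    "\<And>t. t \<in> {-\<delta><..<\<delta>} \<Longrightarrow> ((\<lambda>t. willmore r s (F t)) has_real_derivative W' t) (at t)"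
    "\<And>t. t \<in> {-\<delta><..<\<delta>} \<Longrightarrow> (W' has_real_derivative W'' t) (at t)"
proof -
  have "C2_family 0 {-\<delta><..<\<delta>} (\<lambda>t. willmore_density (F t))"
  proof (rule C2_family_willmore_density)
    show "C2_family 2 {-\<delta><..<\<delta>} F" using V assms(2) C2_family_mono unfolding variation_def by blast
    show "surface (F t)" if "t \<in> {-\<delta><..<\<delta>}" for t
      using V assms(2) that immersion_surface unfolding variation_def by blast
  qed simp
  then show thesis
  proof (rule integral_C2_family[where r=r and s=s])
    fix W' W''
    assume a: "\<And>t. t \<in> {-\<delta><..<\<delta>} \<Longrightarrow>
        ((\<lambda>t. integral (cell r s) (willmore_density (F t))) has_real_derivative W' t) (at t)"
      "\<And>t. t \<in> {-\<delta><..<\<delta>} \<Longrightarrow> (W' has_real_derivative W'' t) (at t)"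
    show thesis by (rule that[unfolded willmore_density_integral, OF a])
  qed simp_all
qed

text \<open>Reading of the letters: \<open>E\<close>, \<open>F\<close>, \<open>G\<close> are the
  Gram entries; \<open>e1\<close>, \<open>k1\<close>, \<open>h1\<close> are the products of f_uu,
  f_uv, f_vv with f_u, and index 2 means products with f_v; \<open>n11\<close>, \<open>n12\<close>,
  \<open>n22\<close> are their products with N; \<open>a\<close>, \<open>b\<close> are those of f_u,
  f_v with N; \<open>c12\<close> is f_u . N_v, and so on.\<close>

lemma divergence_algebra:
  fixes E F G m :: real
  assumes m: "0 < m" "m * m = E * G - F * F"
  shows "((2 * k2 * a + G * (n11 + c11) - ((e2 + k1) * b + F * (n12 + c21))) / m
      - (G * a - F * b) * (2 * e1 * G + E * (2 * k2) - 2 * F * (e2 + k1)) / (2 * (m * m * m)))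
    + ((2 * k1 * b + E * (n22 + c22) - ((k2 + h1) * a + F * (n12 + c12))) / m
      - (E * b - F * a) * (2 * k1 * G + E * (2 * h2) - 2 * F * (k2 + h1)) / (2 * (m * m * m)))
    = m * ((G * n11 - 2 * F * n12 + E * n22) / (m * m)
        - (G * ((G * e1 - 2 * F * k1 + E * h1) / (m * m)) - F * ((G * e2 - 2 * F * k2 + E * h2) / (m * m))) / (m * m) * a
        - (E * ((G * e2 - 2 * F * k2 + E * h2) / (m * m)) - F * ((G * e1 - 2 * F * k1 + E * h1) / (m * m))) / (m * m) * b)
      + (G * c11 - F * (c12 + c21) + E * c22) / m" (is "?L = ?R")
proof -
  define D where "D = E * G - F * F"
  have d: "m \<noteq> 0" using m by simp
  have D: "m * m = D" "D \<noteq> 0" using m by (auto simp: D_def)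
  define P Q P' Q' where "P = 2 * k2 * a + G * (n11 + c11) - ((e2 + k1) * b + F * (n12 + c21))"
    and "Q = 2 * k1 * b + E * (n22 + c22) - ((k2 + h1) * a + F * (n12 + c12))"
    and "P' = (G * a - F * b) * (e1 * G + E * k2 - F * (e2 + k1))"
    and "Q' = (E * b - F * a) * (k1 * G + E * h2 - F * (k2 + h1))"
  define l1 l2 n S where "l1 = G * e1 - 2 * F * k1 + E * h1" and "l2 = G * e2 - 2 * F * k2 + E * h2"
    and "n = G * n11 - 2 * F * n12 + E * n22" and "S = G * c11 - F * (c12 + c21) + E * c22"
  have "?L = P / m - 2 * P' / (2 * (D * m)) + (Q / m - 2 * Q' / (2 * (D * m)))"
    unfolding P_def Q_def P'_def Q'_def D(1) by (simp add: algebra_simps)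
  also have "\<dots> = (P * D - P' + (Q * D - Q')) / (D * m)"
    using d D(2) by (simp add: field_simps)
  also have "P * D - P' + (Q * D - Q') = (n + S) * D - ((G * l1 - F * l2) * a + (E * l2 - F * l1) * b)"
    unfolding P_def Q_def P'_def Q'_def D_def l1_def l2_def n_def S_def by algebra
  also have "\<dots> / (D * m) = m * (n / D - (G * (l1 / D) - F * (l2 / D)) / D * a - (E * (l2 / D) - F * (l1 / D)) / D * b) + S / m"
  proof -
    have "m * (n / D - (G * (l1 / D) - F * (l2 / D)) / D * a - (E * (l2 / D) - F * (l1 / D)) / D * b) + S / m
       = m * (n * D - ((G * l1 - F * l2) * a + (E * l2 - F * l1) * b)) / (D * D) + S / m"
      using D(2) by (simp add: field_simps)
    also have "\<dots> = (m * m) * (n * D - ((G * l1 - F * l2) * a + (E * l2 - F * l1) * b)) / (D * D * m) + S / m"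
      using d by simp
    also have "\<dots> = ((n + S) * D - ((G * l1 - F * l2) * a + (E * l2 - F * l1) * b)) / (D * m)"
      unfolding D(1) using d D(2) by (simp add: field_simps)
    finally show ?thesis by simp
  qed
  also have "\<dots> = ?R" unfolding D(1) l1_def l2_def n_def S_def by simp
  finally show ?thesis .
qed

lemma has_derivative_div_sqrt:
  fixes P D :: "real \<times> real \<Rightarrow> real"
  assumes P: "(P has_derivative P') (at x)" and D: "(D has_derivative D') (at x)" and pos: "0 < D x"
  shows "((\<lambda>x. P x / sqrt (D x)) has_derivative
    (\<lambda>X. P' X / sqrt (D x) - P x * D' X / (2 * (sqrt (D x) * sqrt (D x) * sqrt (D x))))) (at x)"
proof -
  have "((\<lambda>x. P x / sqrt (D x)) has_derivative
    (\<lambda>X. (P' X * sqrt (D x) - P x * (D' X * (inverse (sqrt (D x)) / 2))) / (sqrt (D x) * sqrt (D x)))) (at x)"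
  proof (rule has_derivative_divide'[OF P])
    have "(sqrt has_derivative (*) (inverse (sqrt (D x)) / 2)) (at (D x))"
      using DERIV_real_sqrt[OF pos] by (simp add: has_field_derivative_def)
    from has_derivative_compose[OF D this]
    show "((\<lambda>x. sqrt (D x)) has_derivative (\<lambda>X. D' X * (inverse (sqrt (D x)) / 2))) (at x)"
      by (rule has_derivative_eq_rhs) (simp add: mult.commute)
  qed (use pos in simp)
  then show ?thesis
    by (rule has_derivative_eq_rhs) (use pos in \<open>auto simp: field_simps\<close>)
qed

text \<open>With P the normal part of N, the letters \<open>h\<close>, \<open>p\<close>,
  \<open>q\<close>, \<open>n\<close> stand for H . N, |P|^2, |H|^2, |N|^2; \<open>Q\<close> is the
  tangential correction, and \<open>m * h + S\<close> is a divergence.\<close>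

lemma completed_square:
  fixes m h p q n Q S W :: real
  assumes "m * (2 * h - p) \<le> m * q" "m * p = m * n - Q" "W = m * q / 4 + m"
  shows "- S / 2 + (1 - n / 4) * m + Q / 4 + (m * h + S) / 2 \<le> W"
proof -
  define x1 x2 x3 x4 where x: "x1 = m * h" "x2 = m * p" "x3 = m * q" "x4 = m * n"
  have "2 * x1 - x2 \<le> x3" using assms(1) by (simp add: x algebra_simps)
  moreover have "x2 = x4 - Q" "W = x3 / 4 + m" using assms(2,3) by (simp_all add: x)
  ultimately have "- S / 2 + (m - x4 / 4) + Q / 4 + (x1 + S) / 2 \<le> W" by argo
  moreover have "(1 - n / 4) * m = m - x4 / 4" by (simp add: x algebra_simps)
  ultimately show ?thesis by (simp only: x)
qed

context surface
begin

definition "mm x = sqrt (EE x * GG x - (FF x)\<^sup>2)"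

lemma mm_pos: "0 < mm x" "mm x * mm x = EE x * GG x - FF x * FF x"
  using det_pos[of x] by (simp_all add: mm_def power2_eq_square)

text \<open>What remains of the density when |H|^2 is replaced by 2 H . N - |P|^2, with P the normal
  part of N, and the integral of H . N by minus that of the contraction of df with dN. Only first
  derivatives of \<open>f\<close> and \<open>N\<close> survive.\<close>

definition lower_density :: "(real \<times> real \<Rightarrow> complex \<times> complex) \<Rightarrow> real \<times> real \<Rightarrow> real" where
  "lower_density N x =
     - ((GG x * (fu x \<bullet> dd (1, 0) N x) - FF x * (fu x \<bullet> dd (0, 1) N x + fv x \<bullet> dd (1, 0) N x)
         + EE x * (fv x \<bullet> dd (0, 1) N x)) / mm x) / 2
     + (1 - (N x \<bullet> N x) / 4) * mm x
     + ((GG x * (N x \<bullet> fu x)\<^sup>2 - 2 * FF x * (N x \<bullet> fu x) * (N x \<bullet> fv x) + EE x * (N x \<bullet> fv x)\<^sup>2) / mm x) / 4"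

text \<open>With \<open>flux2\<close>, the area element times the vector field dual to the one-form
  df . N.\<close>

definition "flux1 N x = (GG x * (fu x \<bullet> N x) - FF x * (fv x \<bullet> N x)) / sqrt (EE x * GG x - (FF x)\<^sup>2)"
definition "flux2 N x = (EE x * (fv x \<bullet> N x) - FF x * (fu x \<bullet> N x)) / sqrt (EE x * GG x - (FF x)\<^sup>2)"

lemma flux_smooth: assumes N: "Ck 1 N" shows "Ck 1 (flux1 N)" "Ck 1 (flux2 N)"
proof -
  have N': "C2_family 1 UNIV (\<lambda>t x. N x)" using C2_family_static[OF N] .
  have b: "C2_family 1 UNIV (\<lambda>t x. dd X f x)" for X using C2_family_static[OF smooth1'] .
  have nz: "sqrt (EE x * GG x - (FF x)\<^sup>2) \<noteq> 0" for x using det_pos[of x] by simp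
  have "C2_family 1 UNIV (\<lambda>t. flux1 N)" "C2_family 1 UNIV (\<lambda>t. flux2 N)"
    unfolding flux1_def flux2_def
    by (intro C2_family_divide C2_family_diff C2_family_mult C2_family_inner C2_family_sqrt C2_family_power2
        N' b open_UNIV det_pos nz)+
  then show "Ck 1 (flux1 N)" "Ck 1 (flux2 N)"
    using Ck_family_imp_Ck[OF C2_family_Ck] by blast+
qed

text \<open>By the product rule the divergence is the Laplacian of f paired with N, plus the
  contraction of df with dN. In the sphere the Laplacian of f is H - 2 f, and the second term is
  invisible to N.\<close>

lemma divergence:
  assumes N: "Ck 1 N" and Nf: "\<And>x. N x \<bullet> f x = 0"
  shows "dd (1, 0) (flux1 N) x + dd (0, 1) (flux2 N) x = mm x * (mean_curvature f x \<bullet> N x)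
     + (GG x * (fu x \<bullet> dd (1, 0) N x) - FF x * (fu x \<bullet> dd (0, 1) N x + fv x \<bullet> dd (1, 0) N x)
         + EE x * (fv x \<bullet> dd (0, 1) N x)) / mm x"
proof -
  have hN: "(N has_derivative (\<lambda>X. dd X N x)) (at x)" by (rule has_derivative_dd[OF Ck1_differentiable[OF N]])
  have hu: "(fu has_derivative (\<lambda>X. dd X fu x)) (at x)" and hv: "(fv has_derivative (\<lambda>X. dd X fv x)) (at x)"
    by (rule has_derivative_dd[OF diff'])+
  have E: "(EE has_derivative (\<lambda>X. 2 * (dd X fu x \<bullet> fu x))) (at x)"
    by (rule has_derivative_eq_rhs[OF has_derivative_inner[OF hu hu]]) (simp add: inner_commute)
  have G: "(GG has_derivative (\<lambda>X. 2 * (dd X fv x \<bullet> fv x))) (at x)"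
    by (rule has_derivative_eq_rhs[OF has_derivative_inner[OF hv hv]]) (simp add: inner_commute)
  have F: "(FF has_derivative (\<lambda>X. dd X fu x \<bullet> fv x + dd X fv x \<bullet> fu x)) (at x)"
    by (rule has_derivative_eq_rhs[OF has_derivative_inner[OF hu hv]]) (simp add: inner_commute add.commute)
  have a: "((\<lambda>x. fu x \<bullet> N x) has_derivative (\<lambda>X. dd X fu x \<bullet> N x + fu x \<bullet> dd X N x)) (at x)"
    by (rule has_derivative_eq_rhs[OF has_derivative_inner[OF hu hN]]) (simp add: add.commute)
  have b: "((\<lambda>x. fv x \<bullet> N x) has_derivative (\<lambda>X. dd X fv x \<bullet> N x + fv x \<bullet> dd X N x)) (at x)"
    by (rule has_derivative_eq_rhs[OF has_derivative_inner[OF hv hN]]) (simp add: add.commute)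
  have D: "((\<lambda>x. EE x * GG x - (FF x)\<^sup>2) has_derivative
     (\<lambda>X. 2 * (dd X fu x \<bullet> fu x) * GG x + EE x * (2 * (dd X fv x \<bullet> fv x))
        - 2 * FF x * (dd X fu x \<bullet> fv x + dd X fv x \<bullet> fu x))) (at x)"
    unfolding power2_eq_square
    by (rule has_derivative_eq_rhs[OF has_derivative_diff[OF has_derivative_mult[OF E G] has_derivative_mult[OF F F]]])
      (simp add: algebra_simps)
  have P: "((\<lambda>x. GG x * (fu x \<bullet> N x) - FF x * (fv x \<bullet> N x)) has_derivative
     (\<lambda>X. 2 * (dd X fv x \<bullet> fv x) * (fu x \<bullet> N x) + GG x * (dd X fu x \<bullet> N x + fu x \<bullet> dd X N x)
       - ((dd X fu x \<bullet> fv x + dd X fv x \<bullet> fu x) * (fv x \<bullet> N x) + FF x * (dd X fv x \<bullet> N x + fv x \<bullet> dd X N x)))) (at x)"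
    by (rule has_derivative_eq_rhs[OF has_derivative_diff[OF has_derivative_mult[OF G a] has_derivative_mult[OF F b]]])
      (simp add: algebra_simps)
  have Q: "((\<lambda>x. EE x * (fv x \<bullet> N x) - FF x * (fu x \<bullet> N x)) has_derivative
     (\<lambda>X. 2 * (dd X fu x \<bullet> fu x) * (fv x \<bullet> N x) + EE x * (dd X fv x \<bullet> N x + fv x \<bullet> dd X N x)
       - ((dd X fu x \<bullet> fv x + dd X fv x \<bullet> fu x) * (fu x \<bullet> N x) + FF x * (dd X fu x \<bullet> N x + fu x \<bullet> dd X N x)))) (at x)"
    by (rule has_derivative_eq_rhs[OF has_derivative_diff[OF has_derivative_mult[OF E b] has_derivative_mult[OF F a]]])
      (simp add: algebra_simps)
  have f: "flux1 N = (\<lambda>x. (GG x * (fu x \<bullet> N x) - FF x * (fv x \<bullet> N x)) / sqrt (EE x * GG x - (FF x)\<^sup>2))"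
    "flux2 N = (\<lambda>x. (EE x * (fv x \<bullet> N x) - FF x * (fu x \<bullet> N x)) / sqrt (EE x * GG x - (FF x)\<^sup>2))"
    by (simp_all add: fun_eq_iff flux1_def flux2_def)
  note d1 = dd_eqI[OF has_derivative_div_sqrt[OF P D det_pos], of "(1, 0)", folded f, folded mm_def]
  note d2 = dd_eqI[OF has_derivative_div_sqrt[OF Q D det_pos], of "(0, 1)", folded f, folded mm_def]
  have sym: "dd (0, 1) fu x = dd (1, 0) fv x" by (rule dd_dd_commute[OF smooth])
  have det: "EE x * GG x - (FF x)\<^sup>2 = mm x * mm x" using mm_pos(2)[of x] by (simp add: power2_eq_square)
  have L: "Lam x \<bullet> w = (GG x * (dd (1, 0) fu x \<bullet> w) - 2 * FF x * (dd (1, 0) fv x \<bullet> w)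
      + EE x * (dd (0, 1) fv x \<bullet> w)) / (mm x * mm x)" for w
    unfolding Lam_def det by (simp add: inner_add_left inner_diff_left)
  have H: "mean_curvature f x \<bullet> N x = Lam x \<bullet> N x
      - (GG x * (Lam x \<bullet> fu x) - FF x * (Lam x \<bullet> fv x)) / (mm x * mm x) * (fu x \<bullet> N x)
      - (EE x * (Lam x \<bullet> fv x) - FF x * (Lam x \<bullet> fu x)) / (mm x * mm x) * (fv x \<bullet> N x)"
    unfolding mean_curvature_nor nor_def tan_metric det
    using Nf[of x] by (simp add: inner_diff_left inner_commute[of "f x"])
  show ?thesis
    unfolding d1 d2 H L sym by (rule divergence_algebra[OF mm_pos])
qed

lemma willmore_density_lower_bound:
  assumes N: "Ck 1 N" and Nf: "\<And>x. N x \<bullet> f x = 0"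
  shows "lower_density N x + (dd (1, 0) (flux1 N) x + dd (0, 1) (flux2 N) x) / 2 \<le> willmore_density f x"
proof -
  define H where "H = mean_curvature f x"
  define P where "P = nor f (N x) x"
  define a b where "a = N x \<bullet> fu x" and "b = N x \<bullet> fv x"
  have det: "EE x * GG x - (FF x)\<^sup>2 = mm x * mm x" using mm_pos(2)[of x] by (simp add: power2_eq_square)
  have o: "H \<bullet> f x = 0" "H \<bullet> fu x = 0" "H \<bullet> fv x = 0"
    unfolding H_def mean_curvature_nor by (rule nor_orthogonal)+
  have P': "P = N x - tan1 f (N x) x *\<^sub>R fu x - tan2 f (N x) x *\<^sub>R fv x"
    unfolding P_def nor_def using Nf by simp
  have HP: "H \<bullet> P = H \<bullet> N x" unfolding P' by (simp add: inner_diff_right o)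
  have "P \<bullet> P = P \<bullet> N x"
    using nor_orthogonal(2,3)[of "N x" x, folded P_def]
    by (subst (2) P') (simp add: inner_diff_right)
  also have "\<dots> = N x \<bullet> N x - (tan1 f (N x) x * a + tan2 f (N x) x * b)"
    unfolding P' a_def b_def
    by (simp add: inner_diff_left inner_commute[of "fu x" "N x"] inner_commute[of "fv x" "N x"])
  also have "tan1 f (N x) x * a + tan2 f (N x) x * b
     = (GG x * a\<^sup>2 - 2 * FF x * a * b + EE x * b\<^sup>2) / (mm x * mm x)"
    unfolding tan_metric det a_def b_def
    by (simp add: power2_eq_square algebra_simps add_divide_distrib diff_divide_distrib)
  finally have PP: "P \<bullet> P = N x \<bullet> N x - (GG x * a\<^sup>2 - 2 * FF x * a * b + EE x * b\<^sup>2) / (mm x * mm x)" .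
  \<comment> \<open>Equality holds exactly when the normal part of N is the mean curvature vector; a
    sharp bound needs test fields close to it.\<close>
  have "0 \<le> (H - P) \<bullet> (H - P)" by simp
  then have "2 * (H \<bullet> N x) - P \<bullet> P \<le> H \<bullet> H"
    unfolding HP[symmetric] by (simp add: inner_diff_left inner_diff_right inner_commute)
  then have "mm x * (2 * (H \<bullet> N x) - P \<bullet> P) \<le> mm x * (H \<bullet> H)"
    using mm_pos(1)[of x] by (intro mult_left_mono) auto
  moreover have "mm x * (P \<bullet> P) = mm x * (N x \<bullet> N x) - (GG x * a\<^sup>2 - 2 * FF x * a * b + EE x * b\<^sup>2) / mm x"
    unfolding PP using mm_pos(1)[of x] by (simp add: right_diff_distrib)
  moreover have "willmore_density f x = mm x * (H \<bullet> H) / 4 + mm x"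
    unfolding willmore_density_nor mm_def[symmetric] H_def mean_curvature_nor by (simp add: algebra_simps)
  ultimately show ?thesis
    unfolding divergence[OF N Nf] lower_density_def H_def[symmetric] a_def[symmetric] b_def[symmetric]
    by (intro completed_square) (simp_all only:)
qed

lemma continuous_mm: "continuous_on UNIV mm"
  unfolding mm_def[abs_def] by (intro continuous_intros Ck1_dd_continuous smooth1)

lemma continuous_lower_density:
  assumes "Ck 1 N"
  shows "continuous_on UNIV (lower_density N)"
proof -
  have nz: "\<forall>x\<in>UNIV. mm x \<noteq> 0" using mm_pos(1) less_irrefl by metis
  show ?thesis
    unfolding lower_density_def[abs_def]
    by (intro continuous_intros continuous_mm Ck1_dd_continuous[OF smooth1] Ck1_dd_continuous[OF assms]
        Ck_continuous[OF assms] nz) simp_all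
qed

lemma continuous_willmore_density: "continuous_on UNIV (willmore_density f)"
proof -
  have "C2_family 0 UNIV (\<lambda>t::real. willmore_density f)"
    by (rule C2_family_willmore_density[OF C2_family_static[OF smooth] open_UNIV surface_axioms])
  then have "Ck 0 (willmore_density f)" by (rule Ck_family_imp_Ck[OF C2_family_Ck, of _ _ _ 0]) simp
  then show ?thesis by simp
qed

lemma willmore_lower_bound:
  assumes N: "Ck 1 N" and Nf: "\<And>x. N x \<bullet> f x = 0" and per: "periodic r s f" "periodic r s N" and rs: "0 < r" "0 < s"
  shows "integral (cell r s) (lower_density N) \<le> willmore r s f"
proof -
  note c = Ck1_dd_continuous[OF flux_smooth(1)[OF N]] Ck1_dd_continuous[OF flux_smooth(2)[OF N]]
  have p: "periodic r s (dd X f)" for X by (rule periodic_dd[OF per(1) diff])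
  have e: "fu (x + l) = fu x" "fv (x + l) = fv x" "N (x + l) = N x" if "l \<in> lattice r s" for x l
    using p[of "(1, 0)"] p[of "(0, 1)"] per(2) that unfolding periodic_def by blast+
  have pf: "periodic r s (flux1 N)" "periodic r s (flux2 N)"
    unfolding flux1_def[abs_def] flux2_def[abs_def] periodic_def
    by (intro allI ballI, simp only: e)+
  have z: "integral (cell r s) (dd X (flux1 N)) = 0" "integral (cell r s) (dd X (flux2 N)) = 0" for X
    using integral_dd_periodic[of 0 "flux1 N" r s X, folded One_nat_def, OF flux_smooth(1)[OF N] pf(1) rs]
      integral_dd_periodic[of 0 "flux2 N" r s X, folded One_nat_def, OF flux_smooth(2)[OF N] pf(2) rs] .
  have "integral (cell r s) (\<lambda>x. lower_density N x + (dd (1, 0) (flux1 N) x + dd (0, 1) (flux2 N) x) / 2)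
     \<le> integral (cell r s) (willmore_density f)"
    by (intro integral_le integrable_cell continuous_on_add continuous_on_divide continuous_on_const c
        continuous_lower_density N continuous_willmore_density willmore_density_lower_bound Nf) auto
  also have "((\<lambda>x. lower_density N x + (dd (1, 0) (flux1 N) x + dd (0, 1) (flux2 N) x) / 2) has_integral
     (integral (cell r s) (lower_density N)
       + (integral (cell r s) (dd (1, 0) (flux1 N)) + integral (cell r s) (dd (0, 1) (flux2 N))) / 2)) (cell r s)"
    by (intro has_integral_add has_integral_divide integrable_integral integrable_cell c continuous_lower_density N)
  from integral_unique[OF this]
  have "integral (cell r s) (\<lambda>x. lower_density N x + (dd (1, 0) (flux1 N) x + dd (0, 1) (flux2 N) x) / 2)
     = integral (cell r s) (lower_density N)"
    by (simp only: z) simp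
  finally show ?thesis unfolding willmore_density_integral .
qed

end

section \<open>Bessel's inequality, approximate Parseval identity and the spectral gap\<close>

section \<open>Fourier coefficients on the torus\<close>

locale torus =
  fixes r s :: real
  assumes rs: "0 < r" "0 < s"
begin

definition area where "area = 4 * pi\<^sup>2 * r * s"

lemma area_pos: "0 < area" using rs by (simp add: area_def)

definition mode :: "int \<times> int \<Rightarrow> real \<times> real \<Rightarrow> complex" where
  "mode p x = cis (of_int (fst p) * (fst x / r) + of_int (snd p) * (snd x / s))"

lemma mode_add: "mode (p + q) x = mode p x * mode q x"
  by (simp add: mode_def cis_mult algebra_simps add_divide_distrib)

lemma mode_0 [simp]: "mode 0 x = 1" "mode (0, 0) x = 1"
  by (simp_all add: mode_def)

lemma mode_minus: "mode (- p) x = cnj (mode p x)"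
  by (simp add: mode_def cis_cnj)

lemma mode_cnj: "mode p x * cnj (mode q x) = mode (p - q) x"
  by (simp add: mode_add[symmetric] flip: mode_minus)

lemma mode_has_derivative:
  "(mode p has_derivative (\<lambda>X. (of_int (fst p) * (fst X / r) + of_int (snd p) * (snd X / s)) *\<^sub>R (\<i> * mode p x))) (at x)"
  unfolding mode_def[abs_def] divide_inverse
  by (rule has_derivative_cis) (auto intro!: derivative_eq_intros)

lemma mode_dd: "dd X (mode p) x = (of_int (fst p) * (fst X / r) + of_int (snd p) * (snd X / s)) *\<^sub>R (\<i> * mode p x)"
  by (rule dd_eqI[OF mode_has_derivative])

lemma continuous_mode: "continuous_on UNIV (mode p)"
  unfolding mode_def[abs_def] by (intro continuous_intros) (use rs in auto)

lemma mode_Ck1: "Ck 1 (mode p)"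
proof (rule Ck1_I)
  show "mode p differentiable at x" for x
    unfolding differentiable_def using mode_has_derivative by blast
  show "continuous_on UNIV (dd X (mode p))" for X
    unfolding mode_dd[abs_def] by (intro continuous_intros continuous_mode)
qed

lemma mode_periodic: "periodic r s (mode p)"
proof -
  have "cis (of_int m * (2 * pi) + t) = cis t" for m t
    using cis_mult[of "of_int m * (2 * pi)" t] cis_multiple_2pi[of "of_int m"] by (simp add: mult.commute)
  note c = this
  show ?thesis
    unfolding periodic_iff
  proof (intro allI conjI)
    fix x
    have "of_int (fst p) * (fst (x + (2 * pi * r, 0)) / r) + of_int (snd p) * (snd (x + (2 * pi * r, 0)) / s)
      = of_int (fst p) * (2 * pi) + (of_int (fst p) * (fst x / r) + of_int (snd p) * (snd x / s))"
      using rs by (simp add: field_simps)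
    then show "mode p (x + (2 * pi * r, 0)) = mode p x" unfolding mode_def by (simp only: c)
    have "of_int (fst p) * (fst (x + (0, 2 * pi * s)) / r) + of_int (snd p) * (snd (x + (0, 2 * pi * s)) / s)
      = of_int (snd p) * (2 * pi) + (of_int (fst p) * (fst x / r) + of_int (snd p) * (snd x / s))"
      using rs by (simp add: field_simps)
    then show "mode p (x + (0, 2 * pi * s)) = mode p x" unfolding mode_def by (simp only: c)
  qed
qed

lemma integral_mode: "integral (cell r s) (mode p) = (if p = 0 then of_real area else 0)"
proof (cases "p = 0")
  case True
  then have "mode p = (\<lambda>x. 1)" by auto
  with True rs show ?thesis
    by (simp add: content_Pair area_def power2_eq_square scaleR_conv_of_real)
next
  case False
  have z: "integral (cell r s) (dd X (mode p)) = 0" for X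
    by (rule integral_dd_periodic[of 0, folded One_nat_def]) (use mode_Ck1 mode_periodic rs in auto)
  have "c *\<^sub>R (\<i> * integral (cell r s) (mode p)) = 0"
    if "\<And>x. dd X (mode p) x = c *\<^sub>R (\<i> * mode p x)" for X c
  proof -
    have "integral (cell r s) (dd X (mode p)) = integral (cell r s) (\<lambda>x. c *\<^sub>R (\<i> * mode p x))"
      using that by (intro integral_cong) auto
    then show ?thesis using z[of X] by simp
  qed
  note z' = this
  have "of_int (fst p) * (1 / r) \<noteq> 0 \<or> of_int (snd p) * (1 / s) \<noteq> 0"
    using False rs by (cases p) (auto simp: zero_prod_def)
  then have "integral (cell r s) (mode p) = 0"
    using z'[of "(1, 0)" "of_int (fst p) * (1 / r)"] z'[of "(0, 1)" "of_int (snd p) * (1 / s)"]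
    unfolding mode_dd by auto
  then show ?thesis using False by simp
qed

definition avg :: "(real \<times> real \<Rightarrow> real) \<Rightarrow> real" where
  "avg f = integral (cell r s) f / area"

definition coeff :: "(real \<times> real \<Rightarrow> real) \<Rightarrow> int \<times> int \<Rightarrow> complex" where
  "coeff f p = integral (cell r s) (\<lambda>x. of_real (f x) * cnj (mode p x)) / of_real area"

definition trig :: "(int \<times> int) set \<Rightarrow> (int \<times> int \<Rightarrow> complex) \<Rightarrow> real \<times> real \<Rightarrow> complex" where
  "trig S d x = (\<Sum>p\<in>S. d p * mode p x)"

lemma continuous_trig: "continuous_on UNIV (trig S d)"
  unfolding trig_def[abs_def] by (intro continuous_intros continuous_mode)

text \<open>The modes are orthonormal for the average. Taking \<open>d = coeff f\<close> yields
  Bessel's inequality, and dropping the nonnegative last sum for a good approximation yields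
  Parseval's up to an error.\<close>

lemma avg_trig_distance:
  assumes S: "finite S" and f: "continuous_on UNIV f"
  shows "integral (cell r s) (\<lambda>x. (cmod (of_real (f x) - trig S d x))\<^sup>2) / area
     = avg (\<lambda>x. (f x)\<^sup>2) - (\<Sum>p\<in>S. (cmod (coeff f p))\<^sup>2) + (\<Sum>p\<in>S. (cmod (coeff f p - d p))\<^sup>2)"
proof -
  note c = continuous_mode f
  have cf: "integral (cell r s) (\<lambda>x. of_real (f x) * cnj (mode p x)) = of_real area * coeff f p" for p
    using area_pos by (simp add: coeff_def)
  have cf': "integral (cell r s) (\<lambda>x. of_real (f x) * mode p x) = of_real area * cnj (coeff f p)" for p
  proof -
    have "((\<lambda>x. of_real (f x) * cnj (mode p x)) has_integral (of_real area * coeff f p)) (cell r s)"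
      unfolding cf[symmetric] by (intro integrable_integral integrable_cell continuous_intros c)
    from has_integral_linear[OF this bounded_linear_cnj]
    show ?thesis by (intro integral_unique) (simp add: o_def)
  qed
  have e: "of_real ((cmod (of_real (f x) - trig S d x))\<^sup>2) = of_real ((f x)\<^sup>2)
     - (\<Sum>p\<in>S. cnj (d p) * (of_real (f x) * cnj (mode p x)))
     - (\<Sum>p\<in>S. d p * (of_real (f x) * mode p x))
     + (\<Sum>p\<in>S. \<Sum>q\<in>S. d p * cnj (d q) * mode (p - q) x)" for x
    unfolding complex_norm_square trig_def
    by (simp add: algebra_simps sum_distrib_left sum_distrib_right sum_product cnj_sum power2_eq_square
        flip: mode_cnj) (subst sum.swap, simp add: mult_ac)
  have c1: "of_real (integral (cell r s) (\<lambda>x. (cmod (of_real (f x) - trig S d x))\<^sup>2))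
     = integral (cell r s) (\<lambda>x. complex_of_real ((cmod (of_real (f x) - trig S d x))\<^sup>2))"
  proof -
    have "((\<lambda>x. (cmod (of_real (f x) - trig S d x))\<^sup>2) has_integral
        integral (cell r s) (\<lambda>x. (cmod (of_real (f x) - trig S d x))\<^sup>2)) (cell r s)"
      by (intro integrable_integral integrable_cell continuous_intros f continuous_trig)
    from has_integral_linear[OF this, of "of_real :: real \<Rightarrow> complex"] bounded_linear_of_real
    have "((\<lambda>x. complex_of_real ((cmod (of_real (f x) - trig S d x))\<^sup>2)) has_integral
        of_real (integral (cell r s) (\<lambda>x. (cmod (of_real (f x) - trig S d x))\<^sup>2))) (cell r s)"
      by (simp add: o_def)
    from integral_unique[OF this] show ?thesis by (rule sym)
  qed
  have "((\<lambda>x. complex_of_real ((cmod (of_real (f x) - trig S d x))\<^sup>2)) has_integral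
     (of_real (area * avg (\<lambda>x. (f x)\<^sup>2)) - (\<Sum>p\<in>S. cnj (d p) * (of_real area * coeff f p))
       - (\<Sum>p\<in>S. d p * (of_real area * cnj (coeff f p)))
       + (\<Sum>p\<in>S. \<Sum>q\<in>S. d p * cnj (d q) * (if p - q = 0 then of_real area else 0)))) (cell r s)"
    unfolding e
  proof (intro has_integral_add has_integral_diff has_integral_sum S has_integral_mult_right)
    have "((\<lambda>x. (f x)\<^sup>2) has_integral (area * avg (\<lambda>x. (f x)\<^sup>2))) (cell r s)"
    proof -
      have "area * avg (\<lambda>x. (f x)\<^sup>2) = integral (cell r s) (\<lambda>x. (f x)\<^sup>2)"
        using area_pos by (simp add: avg_def)
      then show ?thesis by (auto intro!: integrable_integral integrable_cell continuous_intros c)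
    qed
    from has_integral_linear[OF this bounded_linear_of_real]
    show "((\<lambda>x. complex_of_real ((f x)\<^sup>2)) has_integral complex_of_real (area * avg (\<lambda>x. (f x)\<^sup>2))) (cell r s)"
      by (simp add: o_def)
    fix p
    show "((\<lambda>x. of_real (f x) * cnj (mode p x)) has_integral (of_real area * coeff f p)) (cell r s)"
      unfolding cf[symmetric] by (intro integrable_integral integrable_cell continuous_intros c)
    show "((\<lambda>x. of_real (f x) * mode p x) has_integral (of_real area * cnj (coeff f p))) (cell r s)"
      unfolding cf'[symmetric] by (intro integrable_integral integrable_cell continuous_intros c)
    fix q
    show "(mode (p - q) has_integral (if p - q = 0 then of_real area else 0)) (cell r s)"
      unfolding integral_mode[symmetric] by (intro integrable_integral integrable_cell c)
  qed
  note I = integral_unique[OF this]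
  have "(\<Sum>p\<in>S. \<Sum>q\<in>S. d p * cnj (d q) * (if p - q = 0 then of_real area else 0))
      = (\<Sum>p\<in>S. of_real area * (d p * cnj (d p)))"
  proof (rule sum.cong)
    fix p assume p: "p \<in> S"
    have "(\<Sum>q\<in>S. d p * cnj (d q) * (if p - q = 0 then of_real area else 0))
       = (\<Sum>q\<in>S. if p = q then of_real area * (d p * cnj (d q)) else 0)"
      by (rule sum.cong) auto
    then show "(\<Sum>q\<in>S. d p * cnj (d q) * (if p - q = 0 then of_real area else 0)) = of_real area * (d p * cnj (d p))"
      using p S by (simp add: sum.delta)
  qed simp
  then have c2: "(of_real (area * avg (\<lambda>x. (f x)\<^sup>2)) - (\<Sum>p\<in>S. cnj (d p) * (of_real area * coeff f p))
       - (\<Sum>p\<in>S. d p * (of_real area * cnj (coeff f p)))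
       + (\<Sum>p\<in>S. \<Sum>q\<in>S. d p * cnj (d q) * (if p - q = 0 then of_real area else 0)))
     = of_real area * (of_real (avg (\<lambda>x. (f x)\<^sup>2)) - (\<Sum>p\<in>S. coeff f p * cnj (coeff f p))
        + (\<Sum>p\<in>S. (coeff f p - d p) * cnj (coeff f p - d p)))"
    by (simp add: algebra_simps sum.distrib sum_subtractf sum_distrib_left)
  have c3: "of_real area * (of_real (avg (\<lambda>x. (f x)\<^sup>2)) - (\<Sum>p\<in>S. coeff f p * cnj (coeff f p))
        + (\<Sum>p\<in>S. (coeff f p - d p) * cnj (coeff f p - d p)))
     = of_real (area * (avg (\<lambda>x. (f x)\<^sup>2) - (\<Sum>p\<in>S. (cmod (coeff f p))\<^sup>2)
       + (\<Sum>p\<in>S. (cmod (coeff f p - d p))\<^sup>2)))"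
    by (simp only: of_real_mult of_real_add of_real_diff of_real_sum complex_norm_square)
  have "integral (cell r s) (\<lambda>x. (cmod (of_real (f x) - trig S d x))\<^sup>2)
      = area * (avg (\<lambda>x. (f x)\<^sup>2) - (\<Sum>p\<in>S. (cmod (coeff f p))\<^sup>2) + (\<Sum>p\<in>S. (cmod (coeff f p - d p))\<^sup>2))"
    using trans[OF c1 trans[OF I trans[OF c2 c3]]] unfolding of_real_eq_iff .
  then show ?thesis using area_pos by simp
qed

lemma Bessel:
  assumes "finite S" "continuous_on UNIV f"
  shows "(\<Sum>p\<in>S. (cmod (coeff f p))\<^sup>2) \<le> avg (\<lambda>x. (f x)\<^sup>2)"
proof -
  have "0 \<le> integral (cell r s) (\<lambda>x. (cmod (of_real (f x) - trig S (coeff f) x))\<^sup>2)"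
    by (intro integral_nonneg integrable_cell continuous_intros assms continuous_trig) auto
  then have "0 \<le> integral (cell r s) (\<lambda>x. (cmod (of_real (f x) - trig S (coeff f) x))\<^sup>2) / area"
    using area_pos by simp
  then show ?thesis unfolding avg_trig_distance[OF assms] by simp
qed

definition is_trig :: "(real \<times> real \<Rightarrow> complex) \<Rightarrow> bool" where
  "is_trig g \<longleftrightarrow> (\<exists>S d. finite S \<and> g = trig S d)"

lemma is_trig_mode: "is_trig (\<lambda>x. c * mode p x)"
  unfolding is_trig_def trig_def[abs_def]
  by (rule exI[of _ "{p}"], rule exI[of _ "\<lambda>_. c"]) simp

lemma is_trig_const: "is_trig (\<lambda>x. c)"
  using is_trig_mode[of c 0] by simp

lemma is_trig_add:
  assumes "is_trig g" "is_trig h" shows "is_trig (\<lambda>x. g x + h x)"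
proof -
  obtain S d T e where g: "finite S" "g = trig S d" and h: "finite T" "h = trig T e"
    using assms unfolding is_trig_def by blast
  define d' e' where "d' p = (if p \<in> S then d p else 0)" and "e' p = (if p \<in> T then e p else 0)" for p
  have "g = trig (S \<union> T) d'" "h = trig (S \<union> T) e'"
    using g h unfolding trig_def[abs_def] d'_def e'_def
    by (auto simp: fun_eq_iff intro!: sum.mono_neutral_cong_left)
  then have "(\<lambda>x. g x + h x) = trig (S \<union> T) (\<lambda>p. d' p + e' p)"
    by (simp add: trig_def[abs_def] distrib_right sum.distrib)
  then show ?thesis using g h unfolding is_trig_def by blast
qed

lemma is_trig_sum: "finite I \<Longrightarrow> (\<And>i. i \<in> I \<Longrightarrow> is_trig (g i)) \<Longrightarrow> is_trig (\<lambda>x. \<Sum>i\<in>I. g i x)"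
  by (induction I rule: finite_induct) (auto intro: is_trig_const is_trig_add)

lemma is_trig_mult:
  assumes "is_trig g" "is_trig h" shows "is_trig (\<lambda>x. g x * h x)"
proof -
  obtain S d T e where g: "finite S" "g = trig S d" and h: "finite T" "h = trig T e"
    using assms unfolding is_trig_def by blast
  have "(\<lambda>x. g x * h x) = (\<lambda>x. \<Sum>p\<in>S. \<Sum>q\<in>T. (d p * e q) * mode (p + q) x)"
    unfolding g h trig_def by (simp add: sum_product mode_add mult_ac)
  then show ?thesis using g h by (auto intro!: is_trig_sum is_trig_mode)
qed

definition circ :: "real \<times> real \<Rightarrow> complex \<times> complex" where
  "circ x = (cis (fst x / r), cis (snd x / s))"

text \<open>The real coordinates of the two circle factors are combinations of the modes with
  indices (\<plusminus>1, 0) and (0, \<plusminus>1), and products of modes are modes.\<close>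

lemma is_trig_poly:
  assumes "real_polynomial_function g"
  shows "is_trig (\<lambda>x. of_real (g (circ x)))"
  using assms
proof (induction rule: real_polynomial_function.induct)
  case (linear h)
  have lin: "linear h" using linear by (rule bounded_linear.linear)
  define a b c d where "a = h (1, 0)" and "b = h (\<i>, 0)" and "c = h (0, 1)" and "d = h (0, \<i>)"
  have h: "h (z, w) = Re z * a + Im z * b + Re w * c + Im w * d" for z w
  proof -
    have "(z, w) = Re z *\<^sub>R (1, 0) + Im z *\<^sub>R (\<i>, 0) + Re w *\<^sub>R (0, 1) + Im w *\<^sub>R (0, \<i>)"
      by (simp add: complex_eq_iff)
    then have "h (z, w) = h (Re z *\<^sub>R (1, 0) + Im z *\<^sub>R (\<i>, 0) + Re w *\<^sub>R (0, 1) + Im w *\<^sub>R (0, \<i>))"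
      by (rule arg_cong)
    then show ?thesis by (simp only: linear_add[OF lin] linear_scale[OF lin] a_def b_def c_def d_def real_scaleR_def)
  qed
  have "(\<lambda>x. complex_of_real (h (circ x))) = (\<lambda>x.
      (Complex (a / 2) (- b / 2) * mode (1, 0) x + Complex (a / 2) (b / 2) * mode (- (1, 0)) x)
      + (Complex (c / 2) (- d / 2) * mode (0, 1) x + Complex (c / 2) (d / 2) * mode (- (0, 1)) x))"
    unfolding circ_def h mode_minus
    by (rule ext) (simp add: mode_def complex_eq_iff algebra_simps)
  then show ?case by (auto intro!: is_trig_add is_trig_mode)
next
  case (const c)
  then show ?case by (simp add: is_trig_const)
next
  case (add f g)
  then show ?case by (simp add: is_trig_add)
next
  case (mult f g)
  then show ?case by (simp add: is_trig_mult)
qed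

lemma circ_eq_imp_lattice:
  assumes "circ x = circ y" shows "x - y \<in> lattice r s"
proof -
  have "\<exists>n::int. a = b + 2 * pi * n" if "cis a = cis b" for a b
    using that sin_cos_eq_iff[of a b] by (auto simp: complex_eq_iff)
  then obtain m n :: int where "fst x / r = fst y / r + 2 * pi * m" "snd x / s = snd y / s + 2 * pi * n"
    using assms unfolding circ_def by (metis prod.inject)
  then have "x - y = (2 * pi * r * m, 2 * pi * s * n)"
    using rs by (cases x; cases y) (auto simp: field_simps)
  then show ?thesis unfolding lattice_def by blast
qed

lemma circ_surj:
  assumes "z \<in> sphere 0 1 \<times> sphere 0 1" obtains x where "x \<in> cell r s" "circ x = z"
proof
  let ?x = "(r * Arg2pi (fst z), s * Arg2pi (snd z))"
  have b: "0 \<le> Arg2pi w \<and> Arg2pi w \<le> 2 * pi" for w using Arg2pi[of w] by auto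
  have "r * Arg2pi w \<le> 2 * pi * r" "s * Arg2pi w \<le> 2 * pi * s" "0 \<le> r * Arg2pi w" "0 \<le> s * Arg2pi w" for w
    using b[of w] rs by (simp_all add: mult.commute)
  then show "?x \<in> cell r s" by simp
  have "cis (Arg2pi w) = w" if "norm w = 1" for w
    using Arg2pi_eq[of w] that by (simp add: cis_conv_exp)
  then show "circ ?x = z" using assms rs by (cases z) (auto simp: circ_def)
qed

text \<open>Stone-Weierstrass on the product of two circles, to which the periodic function is first
  pushed down.\<close>

lemma trig_approx:
  assumes f: "continuous_on UNIV f" and per: "periodic r s f" and e: "0 < e"
  obtains S d where "finite S" "\<And>x. cmod (of_real (f x) - trig S d x) \<le> e"
proof -
  let ?T = "sphere 0 1 \<times> sphere 0 1 :: (complex \<times> complex) set"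
  define g where "g z = f (SOME x. circ x = z)" for z
  have g: "g (circ x) = f x" for x
  proof -
    have "circ (SOME y. circ y = circ x) = circ x" by (rule someI) (rule refl)
    from circ_eq_imp_lattice[OF this] have "f (x + ((SOME y. circ y = circ x) - x)) = f x"
      using per unfolding periodic_def by blast
    then show ?thesis by (simp add: g_def)
  qed
  have cc: "continuous_on UNIV circ" unfolding circ_def[abs_def] by (intro continuous_intros) (use rs in auto)
  have img: "circ x \<in> ?T" for x by (simp add: circ_def)
  have T: "compact ?T" by (intro compact_Times compact_sphere)
  \<comment> \<open>Restricted to the compact cell, \<open>circ\<close> is a closed map onto the
    product of circles, so the preimage of a closed set under \<open>g\<close> is the image of a
    compact set.\<close>
  have "continuous_on ?T g"
    unfolding continuous_on_closed_invariant[of ?T g]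
  proof (intro allI impI)
    fix B :: "real set" assume B: "closed B"
    have "compact (cell r s \<inter> f -` B)"
      by (intro compact_Int_closed compact_cbox) (rule continuous_closed_vimage[OF B], use f in \<open>auto simp: continuous_on_eq_continuous_at\<close>)
    then have "compact (circ ` (cell r s \<inter> f -` B))"
      using compact_continuous_image[OF continuous_on_subset[OF cc subset_UNIV]] by blast
    moreover have "circ ` (cell r s \<inter> f -` B) \<inter> ?T = g -` B \<inter> ?T"
    proof (intro equalityI subsetI)
      fix y assume "y \<in> circ ` (cell r s \<inter> f -` B) \<inter> ?T"
      then obtain x where "y = circ x" "f x \<in> B" by blast
      then show "y \<in> g -` B \<inter> ?T" using g[of x] img[of x] by simp
    next
      fix y assume y: "y \<in> g -` B \<inter> ?T"
      then obtain x where x: "x \<in> cell r s" "circ x = y" using circ_surj[of y] by blast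
      then have "x \<in> cell r s \<inter> f -` B" using y g[of x] by simp
      then show "y \<in> circ ` (cell r s \<inter> f -` B) \<inter> ?T" using x(2) y by blast
    qed
    ultimately show "\<exists>A. closed A \<and> A \<inter> ?T = g -` B \<inter> ?T"
      using compact_imp_closed by blast
  qed
  then obtain h where h: "real_polynomial_function h" "\<And>z. z \<in> ?T \<Longrightarrow> \<bar>g z - h z\<bar> < e"
    using Stone_Weierstrass_real_polynomial_function[OF T _ e] by blast
  obtain S d where S: "finite S" "(\<lambda>x. of_real (h (circ x))) = trig S d"
    using is_trig_poly[OF h(1)] unfolding is_trig_def by blast
  have "cmod (of_real (f x) - trig S d x) \<le> e" for x
  proof -
    have "of_real (f x) - trig S d x = of_real (g (circ x) - h (circ x))"
      using fun_cong[OF S(2), of x] by (simp add: g)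
    then show ?thesis using h(2)[OF img[of x]] by (simp only: norm_of_real)
  qed
  then show thesis using that S(1) by blast
qed

text \<open>The prescribed set \<open>T\<close> is forced into \<open>S\<close> so that the low
  modes can be split off from the finite sum.\<close>

lemma Parseval_approx:
  assumes f: "continuous_on UNIV f" and per: "periodic r s f" and e: "0 < e" and T: "finite T"
  obtains S where "finite S" "T \<subseteq> S" "avg (\<lambda>x. (f x)\<^sup>2) \<le> (\<Sum>p\<in>S. (cmod (coeff f p))\<^sup>2) + e"
proof -
  obtain S d where S: "finite S" "\<And>x. cmod (of_real (f x) - trig S d x) \<le> sqrt e"
    using trig_approx[OF f per, of "sqrt e"] e by auto
  have "(cmod (of_real (f x) - trig S d x))\<^sup>2 \<le> e" for x
    using power_mono[OF S(2)[of x], of 2] e by simp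
  then have "integral (cell r s) (\<lambda>x. (cmod (of_real (f x) - trig S d x))\<^sup>2) \<le> integral (cell r s) (\<lambda>x. e)"
    by (intro integral_le integrable_cell continuous_intros f continuous_trig) auto
  also have "\<dots> = area * e" using rs integral_cell_const[of r s e] by (simp add: area_def)
  finally have "integral (cell r s) (\<lambda>x. (cmod (of_real (f x) - trig S d x))\<^sup>2) / area \<le> e"
    using area_pos by (simp add: pos_divide_le_eq mult.commute)
  moreover have "0 \<le> (\<Sum>p\<in>S. (cmod (coeff f p - d p))\<^sup>2)" by (intro sum_nonneg) auto
  ultimately have "avg (\<lambda>x. (f x)\<^sup>2) \<le> (\<Sum>p\<in>S. (cmod (coeff f p))\<^sup>2) + e"
    unfolding avg_trig_distance[OF S(1) f] by linarith
  also have "(\<Sum>p\<in>S. (cmod (coeff f p))\<^sup>2) \<le> (\<Sum>p\<in>S \<union> T. (cmod (coeff f p))\<^sup>2)"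
    using S(1) T by (intro sum_mono2) auto
  finally show thesis using that[of "S \<union> T"] S(1) T by simp
qed

definition du :: "(real \<times> real \<Rightarrow> real) \<Rightarrow> real \<times> real \<Rightarrow> real" where "du f x = r * dd (1, 0) f x"
definition dv :: "(real \<times> real \<Rightarrow> real) \<Rightarrow> real \<times> real \<Rightarrow> real" where "dv f x = s * dd (0, 1) f x"

lemma coeff_derivative:
  assumes f: "Ck 1 f" "periodic r s f"
  shows "coeff (du f) p = \<i> * of_int (fst p) * coeff f p"
    and "coeff (dv f) p = \<i> * of_int (snd p) * coeff f p"
proof -
  define h where "h x = of_real (f x) * cnj (mode p x)" for x
  note hf = has_derivative_dd[OF Ck1_differentiable[OF f(1)]]
    and hm = has_derivative_dd[OF Ck1_differentiable[OF mode_Ck1]]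
  have D: "(h has_derivative (\<lambda>X. of_real (f x) * cnj (dd X (mode p) x) + of_real (dd X f x) * cnj (mode p x))) (at x)" for x
    unfolding h_def[abs_def]
    by (rule has_derivative_mult[OF has_derivative_of_real[OF hf] bounded_linear.has_derivative[OF bounded_linear_cnj hm]])
  have ddh: "dd X h = (\<lambda>x. of_real (f x) * cnj (dd X (mode p) x) + of_real (dd X f x) * cnj (mode p x))" for X
    by (rule ext) (rule dd_eqI[OF D])
  have c: "continuous_on UNIV f" "continuous_on UNIV (dd X f)" for X
    by (rule Ck_continuous[OF f(1)], rule Ck1_dd_continuous[OF f(1)])
  have cm: "continuous_on UNIV (dd X (mode p))" for X by (rule Ck1_dd_continuous[OF mode_Ck1])
  have "Ck 1 h"
  proof (rule Ck1_I)
    show "h differentiable at x" for x unfolding differentiable_def using D by blast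
    show "continuous_on UNIV (dd X h)" for X
      unfolding ddh by (intro continuous_intros c cm continuous_mode)
  qed
  moreover have "periodic r s h" using f(2) mode_periodic[of p] unfolding periodic_def h_def by simp
  ultimately have z: "integral (cell r s) (dd X h) = 0" for X
    using integral_dd_periodic[of 0 h r s X, folded One_nat_def] rs by blast
  have e: "integral (cell r s) (\<lambda>x. of_real (dd X f x) * cnj (mode p x))
      = - integral (cell r s) (\<lambda>x. of_real (f x) * cnj (dd X (mode p) x))" for X
  proof -
    have "integral (cell r s) (dd X h) = integral (cell r s) (\<lambda>x. of_real (f x) * cnj (dd X (mode p) x))
       + integral (cell r s) (\<lambda>x. of_real (dd X f x) * cnj (mode p x))"
      unfolding ddh by (intro integral_add integrable_cell continuous_intros c cm continuous_mode)
    then show ?thesis using z[of X] by (simp add: eq_neg_iff_add_eq_0 add.commute)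
  qed
  have "integral (cell r s) (\<lambda>x. of_real (du f x) * cnj (mode p x))
     = of_real r * integral (cell r s) (\<lambda>x. of_real (dd (1, 0) f x) * cnj (mode p x))"
    unfolding du_def by (simp add: mult.assoc)
  also have "\<dots> = \<i> * of_int (fst p) * integral (cell r s) (\<lambda>x. of_real (f x) * cnj (mode p x))"
    unfolding e mode_dd using rs
    by (simp add: scaleR_conv_of_real mult.left_commute[of "of_real (f _)"] mult.assoc)
  finally show "coeff (du f) p = \<i> * of_int (fst p) * coeff f p"
    unfolding coeff_def by simp
  have "integral (cell r s) (\<lambda>x. of_real (dv f x) * cnj (mode p x))
     = of_real s * integral (cell r s) (\<lambda>x. of_real (dd (0, 1) f x) * cnj (mode p x))"
    unfolding dv_def by (simp add: mult.assoc)
  also have "\<dots> = \<i> * of_int (snd p) * integral (cell r s) (\<lambda>x. of_real (f x) * cnj (mode p x))"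
    unfolding e mode_dd using rs
    by (simp add: scaleR_conv_of_real mult.left_commute[of "of_real (f _)"] mult.assoc)
  finally show "coeff (dv f) p = \<i> * of_int (snd p) * coeff f p"
    unfolding coeff_def by simp
qed

lemma avg_add: "continuous_on UNIV f \<Longrightarrow> continuous_on UNIV g \<Longrightarrow> avg (\<lambda>x. f x + g x) = avg f + avg g"
  unfolding avg_def by (simp add: integral_add integrable_cell add_divide_distrib)

lemma avg_mult: "avg (\<lambda>x. c * f x) = c * avg f"
  unfolding avg_def by simp

text \<open>Every mode outside the nine lowest ones has \<open>k\<^sup>2 + l\<^sup>2 \<ge> 4\<close>.\<close>

lemma spectral_gap:
  assumes f: "Ck 1 f" "periodic r s f" and P: "P \<le> 4"
  shows "(\<Sum>p\<in>{-1..1} \<times> {-1..1}. ((of_int (fst p))\<^sup>2 + (of_int (snd p))\<^sup>2 - P) * (cmod (coeff f p))\<^sup>2)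
     \<le> avg (\<lambda>x. (du f x)\<^sup>2) + avg (\<lambda>x. (dv f x)\<^sup>2) - P * avg (\<lambda>x. (f x)\<^sup>2)"
\<comment> \<open>The derivative averages are bounded below by Bessel and the average of the square
  of \<open>f\<close> above by approximate Parseval, so derivatives never have to be approximated.
  This gives the case P = 4; smaller \<open>P\<close> follows from Bessel for \<open>f\<close> on
  the low modes.\<close>
proof (rule field_le_epsilon)
  fix e :: real assume e: "0 < e"
  let ?T = "{-1..1} \<times> {-1..1} :: (int \<times> int) set"
  have cf: "continuous_on UNIV f" by (rule Ck_continuous[OF f(1)])
  have cd: "continuous_on UNIV (du f)" "continuous_on UNIV (dv f)"
    unfolding du_def[abs_def] dv_def[abs_def] by (intro continuous_intros Ck1_dd_continuous f)+
  obtain S where S: "finite S" "?T \<subseteq> S" "avg (\<lambda>x. (f x)\<^sup>2) \<le> (\<Sum>p\<in>S. (cmod (coeff f p))\<^sup>2) + e / 4"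
    using Parseval_approx[OF cf f(2), of "e / 4" ?T] e by auto
  have B: "(\<Sum>p\<in>S. (of_int (fst p))\<^sup>2 * (cmod (coeff f p))\<^sup>2) \<le> avg (\<lambda>x. (du f x)\<^sup>2)"
    "(\<Sum>p\<in>S. (of_int (snd p))\<^sup>2 * (cmod (coeff f p))\<^sup>2) \<le> avg (\<lambda>x. (dv f x)\<^sup>2)"
    using Bessel[OF S(1) cd(1)] Bessel[OF S(1) cd(2)]
    unfolding coeff_derivative[OF f] by (simp_all add: norm_mult power_mult_distrib)
  have B0: "(\<Sum>p\<in>?T. (cmod (coeff f p))\<^sup>2) \<le> avg (\<lambda>x. (f x)\<^sup>2)"
    by (rule Bessel[OF _ cf]) simp
  have "(\<Sum>p\<in>?T. ((of_int (fst p))\<^sup>2 + (of_int (snd p))\<^sup>2 - 4) * (cmod (coeff f p))\<^sup>2)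
     \<le> (\<Sum>p\<in>S. ((of_int (fst p))\<^sup>2 + (of_int (snd p))\<^sup>2 - 4) * (cmod (coeff f p))\<^sup>2)"
  proof (rule sum_mono2[OF S(1,2)])
    fix p assume "p \<in> S - ?T"
    then obtain k l where p: "p = (k, l)" "2 \<le> \<bar>k\<bar> \<or> 2 \<le> \<bar>l\<bar>" by (cases p) fastforce
    have sq: "4 \<le> m\<^sup>2" if "2 \<le> \<bar>m\<bar>" for m :: int using power_mono[OF that, of 2] by simp
    have "4 \<le> k\<^sup>2 + l\<^sup>2" using p(2) sq[of k] sq[of l] zero_le_power2[of k] zero_le_power2[of l] by linarith
    then have "(4::real) \<le> of_int (k\<^sup>2 + l\<^sup>2)" by linarith
    then have "0 \<le> (of_int k)\<^sup>2 + (of_int l)\<^sup>2 - (4::real)" by simp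
    then show "0 \<le> ((of_int (fst p))\<^sup>2 + (of_int (snd p))\<^sup>2 - 4) * (cmod (coeff f p))\<^sup>2"
      by (simp add: p(1))
  qed
  also have "\<dots> = (\<Sum>p\<in>S. (of_int (fst p))\<^sup>2 * (cmod (coeff f p))\<^sup>2) + (\<Sum>p\<in>S. (of_int (snd p))\<^sup>2 * (cmod (coeff f p))\<^sup>2)
     - 4 * (\<Sum>p\<in>S. (cmod (coeff f p))\<^sup>2)"
    by (simp add: algebra_simps sum.distrib sum_subtractf sum_distrib_left)
  finally have 1: "(\<Sum>p\<in>?T. ((of_int (fst p))\<^sup>2 + (of_int (snd p))\<^sup>2 - 4) * (cmod (coeff f p))\<^sup>2)
     \<le> avg (\<lambda>x. (du f x)\<^sup>2) + avg (\<lambda>x. (dv f x)\<^sup>2) - 4 * avg (\<lambda>x. (f x)\<^sup>2) + e"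
    using B S(3) by linarith
  have "(\<Sum>p\<in>?T. ((of_int (fst p))\<^sup>2 + (of_int (snd p))\<^sup>2 - P) * (cmod (coeff f p))\<^sup>2)
     = (\<Sum>p\<in>?T. ((of_int (fst p))\<^sup>2 + (of_int (snd p))\<^sup>2 - 4) * (cmod (coeff f p))\<^sup>2) + (4 - P) * (\<Sum>p\<in>?T. (cmod (coeff f p))\<^sup>2)"
    by (simp only: sum_distrib_left sum.distrib[symmetric]) (simp add: algebra_simps)
  also have "(4 - P) * (\<Sum>p\<in>?T. (cmod (coeff f p))\<^sup>2) \<le> (4 - P) * avg (\<lambda>x. (f x)\<^sup>2)"
    using P B0 by (intro mult_left_mono) auto
  finally show "(\<Sum>p\<in>?T. ((of_int (fst p))\<^sup>2 + (of_int (snd p))\<^sup>2 - P) * (cmod (coeff f p))\<^sup>2)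
     \<le> avg (\<lambda>x. (du f x)\<^sup>2) + avg (\<lambda>x. (dv f x)\<^sup>2) - P * avg (\<lambda>x. (f x)\<^sup>2) + e"
    using 1 by (simp add: left_diff_distrib)
qed

end

section \<open>Angle coordinates for surfaces near the torus\<close>

section \<open>Variations in polar form\<close>

lemma cell_representative:
  assumes "0 < r" "0 < s"
  obtains y where "y \<in> cell r s" "x - y \<in> lattice r s"
proof
  let ?m = "\<lfloor>fst x / (2 * pi * r)\<rfloor>" and ?n = "\<lfloor>snd x / (2 * pi * s)\<rfloor>"
  let ?y = "x - (2 * pi * r * of_int ?m, 2 * pi * s * of_int ?n)"
  have fl: "0 \<le> z - p * of_int \<lfloor>z / p\<rfloor> \<and> z - p * of_int \<lfloor>z / p\<rfloor> \<le> p" if "0 < p" for z p :: real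
    using floor_divide_lower[OF that, of z] floor_divide_upper[OF that, of z] by (simp add: algebra_simps)
  show "?y \<in> cell r s"
    using fl[of "2 * pi * r" "fst x"] fl[of "2 * pi * s" "snd x"] assms by (cases x) simp
  show "x - ?y \<in> lattice r s" unfolding lattice_def by auto
qed

text \<open>Uniform continuity on a time interval times the compact cell keeps the minimum positive
  for small times, and periodicity extends this to the plane.\<close>

lemma periodic_family_positive:
  fixes g :: "real \<Rightarrow> real \<times> real \<Rightarrow> real"
  assumes c: "continuous_on ({-\<delta><..<\<delta>} \<times> UNIV) (\<lambda>(t, x). g t x)" and \<delta>: "0 < \<delta>"
    and per: "\<And>t. t \<in> {-\<delta><..<\<delta>} \<Longrightarrow> periodic r s (g t)" and rs: "0 < r" "0 < s"
    and pos: "\<And>x. 0 < g 0 x"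
  obtains \<delta>' where "0 < \<delta>'" "\<delta>' \<le> \<delta>" "\<And>t x. t \<in> {-\<delta>'<..<\<delta>'} \<Longrightarrow> 0 < g t x"
proof -
  define K where "K = {-\<delta>/2..\<delta>/2} \<times> cell r s"
  have sub: "K \<subseteq> {-\<delta><..<\<delta>} \<times> UNIV" using \<delta> by (auto simp: K_def)
  have "compact K" unfolding K_def by (intro compact_Times compact_Icc compact_cbox)
  then have uc: "uniformly_continuous_on K (\<lambda>(t, x). g t x)"
    using compact_uniformly_continuous continuous_on_subset[OF c sub] by blast
  have c0: "continuous_on (cell r s) (g 0)"
    using continuous_on_slice[OF c, of 0] \<delta> continuous_on_subset by auto
  have "(0, 0) \<in> cell r s" using rs by simp
  then have ne: "cell r s \<noteq> {}" by blast
  obtain x0 where x0: "x0 \<in> cell r s" "\<And>x. x \<in> cell r s \<Longrightarrow> g 0 x0 \<le> g 0 x"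
    using continuous_attains_inf[OF compact_cbox ne c0] by blast
  obtain d where d: "0 < d" "\<And>p q. p \<in> K \<Longrightarrow> q \<in> K \<Longrightarrow> dist q p < d \<Longrightarrow>
      dist ((\<lambda>(t, x). g t x) q) ((\<lambda>(t, x). g t x) p) < g 0 x0"
    using uc pos[of x0] unfolding uniformly_continuous_on_def by metis
  define \<delta>' where "\<delta>' = min d (\<delta> / 2)"
  have cell: "0 < g t x" if t: "t \<in> {-\<delta>'<..<\<delta>'}" and x: "x \<in> cell r s" for t x
  proof -
    have K: "(t, x) \<in> K" "(0, x) \<in> K" using t x \<delta> by (auto simp: K_def \<delta>'_def)
    have "dist (t, x) (0, x) < d" using t by (auto simp: dist_Pair_Pair \<delta>'_def)
    then have "dist (g t x) (g 0 x) < g 0 x0" using d(2)[OF K(2,1)] by simp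
    then show ?thesis using x0(2)[OF x] by (simp add: dist_real_def)
  qed
  show thesis
  proof
    show "0 < \<delta>'" "\<delta>' \<le> \<delta>" using d \<delta> by (auto simp: \<delta>'_def)
    fix t x assume t: "t \<in> {-\<delta>'<..<\<delta>'}"
    obtain y where y: "y \<in> cell r s" "x - y \<in> lattice r s" using cell_representative[OF rs] .
    have "t \<in> {-\<delta><..<\<delta>}" using t \<open>\<delta>' \<le> \<delta>\<close> by simp
    then have "g t (y + (x - y)) = g t y" using per y(2) unfolding periodic_def by blast
    then show "0 < g t x" using cell[OF t y(1)] by simp
  qed
qed

lemma Ck_family_wedge:
  assumes "Ck_family 1 J F" "Ck_family 1 J G"
  shows "continuous_on (J \<times> UNIV) (\<lambda>(t, x). wedge (F t) (G t) x)"
proof -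
  have c: "continuous_on (J \<times> UNIV) (\<lambda>z. dd X (H (fst z)) (snd z))" if "Ck_family 1 J H" for H :: "real \<Rightarrow> real \<times> real \<Rightarrow> real" and X
    using that unfolding One_nat_def Ck_family.simps(2) Ck_family.simps(1) split_def by blast
  show ?thesis
    unfolding wedge_def split_def by (intro continuous_intros c assms)
qed

lemma norm_cis_polar: "z \<noteq> 0 \<Longrightarrow> z = of_real (cmod z) * cis (Im (Ln z))"
  using exp_Ln[of z] by (metis exp_eq_polar Re_Ln exp_ln norm_exp_eq_Re zero_less_norm_iff)

text \<open>The angles and their time derivatives carry one spatial derivative, which is what the
  first order lower bound consumes. Two spatial derivatives are kept only for each fixed time, in
  \<open>surface (F t)\<close>, where the mean curvature is needed.\<close>

locale polar_family =
  fixes r s \<delta> :: real and F :: "real \<Rightarrow> real \<times> real \<Rightarrow> complex \<times> complex"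
    and \<omega> \<omega>' \<Theta>1 \<Theta>1' \<Theta>2 \<Theta>2' :: "real \<Rightarrow> real \<times> real \<Rightarrow> real"
  assumes rs: "0 < r" "0 < s" "r\<^sup>2 + s\<^sup>2 = 1" and \<delta>: "0 < \<delta>"
    and fam: "Ck_family 1 {-\<delta><..<\<delta>} \<omega>" "Ck_family 1 {-\<delta><..<\<delta>} \<omega>'"
      "Ck_family 1 {-\<delta><..<\<delta>} \<Theta>1" "Ck_family 1 {-\<delta><..<\<delta>} \<Theta>1'"
      "Ck_family 1 {-\<delta><..<\<delta>} \<Theta>2" "Ck_family 1 {-\<delta><..<\<delta>} \<Theta>2'"
    and der: "\<And>t x. t \<in> {-\<delta><..<\<delta>} \<Longrightarrow> ((\<lambda>\<tau>. \<omega> \<tau> x) has_vector_derivative \<omega>' t x) (at t)"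
      "\<And>t x. t \<in> {-\<delta><..<\<delta>} \<Longrightarrow> ((\<lambda>\<tau>. \<Theta>1 \<tau> x) has_vector_derivative \<Theta>1' t x) (at t)"
      "\<And>t x. t \<in> {-\<delta><..<\<delta>} \<Longrightarrow> ((\<lambda>\<tau>. \<Theta>2 \<tau> x) has_vector_derivative \<Theta>2' t x) (at t)"
    and per: "\<And>t. t \<in> {-\<delta><..<\<delta>} \<Longrightarrow> periodic r s (\<omega> t)"
      "\<And>t. t \<in> {-\<delta><..<\<delta>} \<Longrightarrow> periodic r s (\<lambda>x. \<Theta>1 t x - fst x / r)"
      "\<And>t. t \<in> {-\<delta><..<\<delta>} \<Longrightarrow> periodic r s (\<lambda>x. \<Theta>2 t x - snd x / s)"
    and pos: "\<And>t x. t \<in> {-\<delta><..<\<delta>} \<Longrightarrow> 0 < cos (\<omega> t x)" "\<And>t x. t \<in> {-\<delta><..<\<delta>} \<Longrightarrow> 0 < sin (\<omega> t x)"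
      "\<And>t x. t \<in> {-\<delta><..<\<delta>} \<Longrightarrow> 0 < wedge (\<Theta>1 t) (\<Theta>2 t) x"
    and F: "\<And>t x. t \<in> {-\<delta><..<\<delta>} \<Longrightarrow>
        F t x = (of_real (cos (\<omega> t x)) * cis (\<Theta>1 t x), of_real (sin (\<omega> t x)) * cis (\<Theta>2 t x))"
    and init: "\<And>x. cos (\<omega> 0 x) = r" "\<And>x. sin (\<omega> 0 x) = s" "\<And>x. \<Theta>1 0 x = fst x / r" "\<And>x. \<Theta>2 0 x = snd x / s"
      "\<And>x y. \<omega> 0 x = \<omega> 0 y"
    and F_surface: "\<And>t. t \<in> {-\<delta><..<\<delta>} \<Longrightarrow> surface (F t)"
    and F_periodic: "\<And>t. t \<in> {-\<delta><..<\<delta>} \<Longrightarrow> periodic r s (F t)"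

lemma dd_linear_form: "dd X (\<lambda>x::real \<times> real. fst x / r) x = fst X / r" "dd X (\<lambda>x::real \<times> real. snd x / s) x = snd X / s"
  by (rule dd_eqI, auto intro!: derivative_eq_intros simp: divide_inverse)+

text \<open>Multiplied by the modes (-1, 0) and (0, -1), the two components of F become periodic and
  close to the constants \<open>r\<close> and \<open>s\<close>. They stay in the right half plane
  for small times, so the principal logarithm provides globally defined corrections of the two
  angles.\<close>

lemma polar_family_exists:
  assumes V: "variation k r s (torus_param r s) \<delta>0 F" and k: "2 \<le> k"
    and rs: "0 < r" "0 < s" "r\<^sup>2 + s\<^sup>2 = 1"
  obtains \<delta> \<omega> \<omega>' \<Theta>1 \<Theta>1' \<Theta>2 \<Theta>2' where "\<delta> \<le> \<delta>0" "polar_family r s \<delta> F \<omega> \<omega>' \<Theta>1 \<Theta>1' \<Theta>2 \<Theta>2'"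
proof -
  let ?J = "{-\<delta>0<..<\<delta>0}"
  have \<delta>0: "0 < \<delta>0" and F0: "F 0 = torus_param r s" and C: "C2_family k ?J F"
    and I: "\<And>t. t \<in> ?J \<Longrightarrow> immersion k r s (F t)"
    using V unfolding variation_def by blast+
  have per: "periodic r s (F t)" if "t \<in> ?J" for t using I[OF that] unfolding immersion_def by blast
  have C1: "C2_family 1 ?J F" using C2_family_mono[OF C] k by simp
  interpret torus r s using rs by unfold_locales
  have base: "C2_family 1 ?J (\<lambda>t. mode p)" for p by (rule C2_family_static[OF mode_Ck1])
  define P1 P2 where "P1 t x = fst (F t x) * mode (- 1, 0) x" and "P2 t x = snd (F t x) * mode (0, - 1) x" for t x
  have CP: "C2_family 1 ?J P1" "C2_family 1 ?J P2"
    unfolding P1_def[abs_def] P2_def[abs_def]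
    by (intro C2_family_mult C2_family_bounded_linear[OF bounded_linear_fst]
        C2_family_bounded_linear[OF bounded_linear_snd] C1 base)+
  have perP: "periodic r s (P1 t)" "periodic r s (P2 t)" if "t \<in> ?J" for t
    using per[OF that] mode_periodic unfolding periodic_def P1_def P2_def by auto
  have P0: "P1 0 x = of_real r" "P2 0 x = of_real s" for x
    unfolding P1_def P2_def F0 torus_param_def
    by (simp_all add: split_def mode_def cis_mult mult.assoc)
  have cR: "continuous_on (?J \<times> UNIV) (\<lambda>(t, x). Re (G t x))" if "C2_family 1 ?J G" for G :: "real \<Rightarrow> real \<times> real \<Rightarrow> complex"
    using Ck_family_continuous[OF C2_family_Ck[OF C2_family_bounded_linear[OF bounded_linear_Re that]]] .
  obtain \<delta>1 where \<delta>1: "0 < \<delta>1" "\<delta>1 \<le> \<delta>0" "\<And>t x. t \<in> {-\<delta>1<..<\<delta>1} \<Longrightarrow> 0 < Re (P1 t x)"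
    by (rule periodic_family_positive[OF cR[OF CP(1)] \<delta>0 _ rs(1,2)])
      (use perP(1) rs P0 in \<open>auto simp: periodic_def\<close>)
  obtain \<delta>2 where \<delta>2: "0 < \<delta>2" "\<delta>2 \<le> \<delta>0" "\<And>t x. t \<in> {-\<delta>2<..<\<delta>2} \<Longrightarrow> 0 < Re (P2 t x)"
    by (rule periodic_family_positive[OF cR[OF CP(2)] \<delta>0 _ rs(1,2)])
      (use perP(2) rs P0 in \<open>auto simp: periodic_def\<close>)
  define d where "d = min \<delta>1 \<delta>2"
  let ?D = "{-d<..<d}"
  have d: "0 < d" "d \<le> \<delta>0" "?D \<subseteq> ?J" using \<delta>1 \<delta>2 by (auto simp: d_def)
  have ReP: "0 < Re (P1 t x)" "0 < Re (P2 t x)" if "t \<in> ?D" for t x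
    using that \<delta>1(3)[of t x] \<delta>2(3)[of t x] by (auto simp: d_def)
  have CPd: "C2_family 1 ?D P1" "C2_family 1 ?D P2" using CP d(3) C2_family_subset by blast+
  define S where "S = {z::complex. 0 < Re z}"
  have S: "open S" unfolding S_def by (rule open_halfspace_Re_gt)
  have LnS: "Ln holomorphic_on S"
    by (rule holomorphic_on_Ln) (auto simp: S_def complex_nonpos_Reals_iff)
  have CL: "C2_family 1 ?D (\<lambda>t x. Ln (P1 t x))" "C2_family 1 ?D (\<lambda>t x. Ln (P2 t x))"
    by (rule C2_family_holomorphic[OF CPd(1) S LnS], simp add: S_def ReP,
        rule C2_family_holomorphic[OF CPd(2) S LnS], simp add: S_def ReP)
  define T1 T2 where "T1 t x = fst x / r + Im (Ln (P1 t x))" and "T2 t x = snd x / s + Im (Ln (P2 t x))" for t x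
  have lin: "bounded_linear (\<lambda>x::real \<times> real. fst x / r)" "bounded_linear (\<lambda>x::real \<times> real. snd x / s)"
    unfolding divide_inverse
    by (intro bounded_linear_mult_const bounded_linear_fst bounded_linear_snd)+
  have CT: "C2_family 1 ?D T1" "C2_family 1 ?D T2"
  proof -
    have L: "Ck 1 (\<lambda>x::real \<times> real. fst x / r)" "Ck 1 (\<lambda>x::real \<times> real. snd x / s)"
      unfolding Ck_iff_family by (rule Ck_family_linear[OF lin(1)], rule Ck_family_linear[OF lin(2)])
    show "C2_family 1 ?D T1" "C2_family 1 ?D T2"
      unfolding T1_def[abs_def] T2_def[abs_def]
      by (intro C2_family_add C2_family_bounded_linear[OF bounded_linear_Im] CL C2_family_static L)+
  qed
  define n1 n2 where "n1 t x = cmod (P1 t x)" and "n2 t x = cmod (P2 t x)" for t x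
  have nF: "n1 t x = cmod (fst (F t x))" "n2 t x = cmod (snd (F t x))" for t x
    unfolding n1_def n2_def P1_def P2_def by (simp_all add: norm_mult mode_def)
  have npos: "0 < n1 t x" "0 < n2 t x" if "t \<in> ?D" for t x
    using ReP[OF that, of x] unfolding n1_def n2_def by auto
  have nsq: "(n1 t x)\<^sup>2 + (n2 t x)\<^sup>2 = 1" if "t \<in> ?D" for t x
  proof -
    have "F t x \<in> sphere 0 1" using I d(3) that unfolding immersion_def by blast
    then have "norm (F t x) = 1" by simp
    then have "sqrt ((cmod (fst (F t x)))\<^sup>2 + (cmod (snd (F t x)))\<^sup>2) = 1"
      by (simp only: norm_prod_def)
    then show ?thesis unfolding nF by (simp only: real_sqrt_eq_1_iff)
  qed
  have Cn: "C2_family 1 ?D n1" "C2_family 1 ?D n2"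
  proof -
    have *: "C2_family 1 ?D (\<lambda>t x. sqrt ((Re (P t x))\<^sup>2 + (Im (P t x))\<^sup>2))"
      if "C2_family 1 ?D P" "\<And>t x. t \<in> ?D \<Longrightarrow> 0 < Re (P t x)" for P :: "real \<Rightarrow> real \<times> real \<Rightarrow> complex"
    proof (rule C2_family_sqrt)
      show "C2_family 1 ?D (\<lambda>t x. (Re (P t x))\<^sup>2 + (Im (P t x))\<^sup>2)"
        by (intro C2_family_add C2_family_power2 C2_family_bounded_linear[OF bounded_linear_Re]
            C2_family_bounded_linear[OF bounded_linear_Im] that(1))
      show "0 < (Re (P t x))\<^sup>2 + (Im (P t x))\<^sup>2" if "t \<in> ?D" for t x
        using \<open>\<And>t x. t \<in> ?D \<Longrightarrow> 0 < Re (P t x)\<close>[OF that, of x] by (simp add: add_pos_nonneg)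
    qed simp
    show "C2_family 1 ?D n1" "C2_family 1 ?D n2"
      using *[OF CPd(1) ReP(1)] *[OF CPd(2) ReP(2)] unfolding n1_def[abs_def] n2_def[abs_def] cmod_def by blast+
  qed
  \<comment> \<open>A point of the unit circle in the open first quadrant; its argument \<omega> is
    taken from the logarithm in order to inherit smoothness.\<close>
  define z where "z t x = of_real (n1 t x) + \<i> * of_real (n2 t x)" for t x
  have Cz: "C2_family 1 ?D z"
    unfolding z_def[abs_def]
    by (intro C2_family_add C2_family_mult C2_family_const C2_family_bounded_linear[OF bounded_linear_of_real] Cn)
  define w where "w t x = Im (Ln (z t x))" for t x
  have Cw: "C2_family 1 ?D w"
  proof -
    have "C2_family 1 ?D (\<lambda>t x. Ln (z t x))"
      by (rule C2_family_holomorphic[OF Cz S LnS]) (simp add: S_def z_def npos)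
    then show ?thesis unfolding w_def[abs_def] by (rule C2_family_bounded_linear[OF bounded_linear_Im])
  qed
  have cs: "cos (w t x) = n1 t x" "sin (w t x) = n2 t x" if "t \<in> ?D" for t x
  proof -
    have "cmod (z t x) = 1" using nsq[OF that, of x] by (simp add: z_def cmod_def)
    moreover have "z t x \<noteq> 0" using calculation by auto
    ultimately have "z t x = cis (w t x)" using norm_cis_polar[of "z t x"] by (simp add: w_def)
    then have "Re (z t x) = cos (w t x)" "Im (z t x) = sin (w t x)" by simp_all
    then show "cos (w t x) = n1 t x" "sin (w t x) = n2 t x" by (simp_all add: z_def)
  qed
  have rep: "F t x = (of_real (cos (w t x)) * cis (T1 t x), of_real (sin (w t x)) * cis (T2 t x))" if "t \<in> ?D" for t x
  proof -
    have nz: "P1 t x \<noteq> 0" "P2 t x \<noteq> 0" using ReP[OF that, of x] by auto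
    have "fst (F t x) = P1 t x * cis (fst x / r)" "snd (F t x) = P2 t x * cis (snd x / s)"
      unfolding P1_def P2_def by (simp_all add: mode_def cis_mult mult.assoc)
    moreover have "P1 t x = of_real (n1 t x) * cis (Im (Ln (P1 t x)))" "P2 t x = of_real (n2 t x) * cis (Im (Ln (P2 t x)))"
      unfolding n1_def n2_def using norm_cis_polar nz by blast+
    ultimately have "fst (F t x) = of_real (n1 t x) * cis (Im (Ln (P1 t x)) + fst x / r)"
       "snd (F t x) = of_real (n2 t x) * cis (Im (Ln (P2 t x)) + snd x / s)"
      by (metis cis_mult mult.assoc)+
    then show ?thesis unfolding cs[OF that] T1_def T2_def by (simp add: prod_eq_iff add.commute)
  qed
  have init: "T1 0 x = fst x / r" "T2 0 x = snd x / s" "n1 0 x = r" "n2 0 x = s" for x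
    unfolding T1_def T2_def n1_def n2_def P0 using rs by (simp_all add: Ln_of_real)
  have perD: "periodic r s (w t)" "periodic r s (\<lambda>x. T1 t x - fst x / r)" "periodic r s (\<lambda>x. T2 t x - snd x / s)" if "t \<in> ?D" for t
    using perP[of t] d(3) that
    unfolding periodic_def w_def z_def n1_def n2_def T1_def T2_def by (simp_all add: subset_iff)
  have cB: "continuous_on (?D \<times> UNIV) (\<lambda>(t, x). wedge (T1 t) (T2 t) x)"
    by (rule Ck_family_wedge[OF C2_family_Ck[OF CT(1)] C2_family_Ck[OF CT(2)]])
  obtain \<delta> where \<delta>: "0 < \<delta>" "\<delta> \<le> d" "\<And>t x. t \<in> {-\<delta><..<\<delta>} \<Longrightarrow> 0 < wedge (T1 t) (T2 t) x"
  proof (rule periodic_family_positive[OF cB d(1) _ rs(1,2)])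
    fix t assume t: "t \<in> ?D"
    have D: "T1 t differentiable at x" "T2 t differentiable at x" for x
      using Ck1_differentiable[OF Ck_family_imp_Ck[OF C2_family_Ck[OF CT(1)] t]]
        Ck1_differentiable[OF Ck_family_imp_Ck[OF C2_family_Ck[OF CT(2)] t]] by blast+
    have p: "periodic r s (dd X G)"
      if g: "\<And>x. G differentiable at x" and l: "bounded_linear l" and q: "periodic r s (\<lambda>x. G x - l x)" for X G and l :: "real \<times> real \<Rightarrow> real"
    proof -
      have "(\<lambda>x. G x - l x) differentiable at x" for x
        by (intro differentiable_diff g bounded_linear_imp_differentiable l)
      from periodic_dd[OF q this] have "periodic r s (dd X (\<lambda>x. G x - l x))" .
      moreover have "dd X (\<lambda>x. G x - l x) = (\<lambda>x. dd X G x - l X)"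
        by (rule ext, rule dd_eqI) (intro has_derivative_diff has_derivative_dd g bounded_linear_imp_has_derivative l)
      ultimately show ?thesis unfolding periodic_def by simp
    qed
    show "periodic r s (wedge (T1 t) (T2 t))"
      using p[OF D(1) lin(1) perD(2)[OF t]] p[OF D(2) lin(2) perD(3)[OF t]]
      unfolding periodic_def wedge_def by simp
  next
    have "T1 0 = (\<lambda>x. fst x / r)" "T2 0 = (\<lambda>x. snd x / s)" using init by auto
    then show "0 < wedge (T1 0) (T2 0) x" for x using rs by (simp add: wedge_def dd_linear_form)
  qed (rule that)
  let ?E = "{-\<delta><..<\<delta>}"
  have sub: "?E \<subseteq> ?D" "?E \<subseteq> ?J" using \<delta>(2) d by auto
  obtain w' w'' where w': "Ck_family 1 ?E w" "Ck_family 1 ?E w'" "Ck_family 1 ?E w''"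
    "\<And>t x. t \<in> ?E \<Longrightarrow> ((\<lambda>\<tau>. w \<tau> x) has_vector_derivative w' t x) (at t)"
    "\<And>t x. t \<in> ?E \<Longrightarrow> ((\<lambda>\<tau>. w' \<tau> x) has_vector_derivative w'' t x) (at t)"
    by (rule C2_familyE[OF C2_family_subset[OF Cw sub(1)]]) (rule that)
  obtain T1' T1'' where T1': "Ck_family 1 ?E T1" "Ck_family 1 ?E T1'" "Ck_family 1 ?E T1''"
    "\<And>t x. t \<in> ?E \<Longrightarrow> ((\<lambda>\<tau>. T1 \<tau> x) has_vector_derivative T1' t x) (at t)"
    "\<And>t x. t \<in> ?E \<Longrightarrow> ((\<lambda>\<tau>. T1' \<tau> x) has_vector_derivative T1'' t x) (at t)"
    by (rule C2_familyE[OF C2_family_subset[OF CT(1) sub(1)]]) (rule that)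
  obtain T2' T2'' where T2': "Ck_family 1 ?E T2" "Ck_family 1 ?E T2'" "Ck_family 1 ?E T2''"
    "\<And>t x. t \<in> ?E \<Longrightarrow> ((\<lambda>\<tau>. T2 \<tau> x) has_vector_derivative T2' t x) (at t)"
    "\<And>t x. t \<in> ?E \<Longrightarrow> ((\<lambda>\<tau>. T2' \<tau> x) has_vector_derivative T2'' t x) (at t)"
    by (rule C2_familyE[OF C2_family_subset[OF CT(2) sub(1)]]) (rule that)
  have 0: "0 \<in> ?D" using d by simp
  show thesis
  proof (rule that[of \<delta> w w' T1 T1' T2 T2'])
    show "\<delta> \<le> \<delta>0" using \<delta> d by simp
    show "polar_family r s \<delta> F w w' T1 T1' T2 T2'"
    proof (rule polar_family.intro)
      show "surface (F t)" if "t \<in> ?E" for t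
        using immersion_surface[OF I k] sub(2) that by blast
      show "periodic r s (F t)" if "t \<in> ?E" for t using per sub(2) that by blast
      show "0 < cos (w t x)" "0 < sin (w t x)" if "t \<in> ?E" for t x
        using sub(1) that cs[of t x] npos[of t x] by (metis subsetD)+
      show "cos (w 0 x) = r" "sin (w 0 x) = s" for x using cs[OF 0, of x] init by simp_all
      show "w 0 x = w 0 y" for x y unfolding w_def z_def init ..
    qed (rule assms(3,4,5) \<delta>(1) w'(1,2) T1'(1,2) T2'(1,2) init | (rule w'(4) T1'(4) T2'(4) \<delta>(3), assumption)
        | (rule perD rep, rule subsetD[OF sub(1)], assumption))+
  qed
qed

lemma willmore_torus_param:
  assumes rs: "0 < r" "0 < s" "r\<^sup>2 + s\<^sup>2 = 1" and S: "surface (torus_param r s)"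
  shows "willmore r s (torus_param r s) = pi\<^sup>2 / (r * s)"
proof -
  interpret surface "torus_param r s" by (rule S)
  have nz: "r \<noteq> 0" "s \<noteq> 0" using rs by auto
  have fu: "fu = (\<lambda>x. (\<i> * cis (fst x / r), 0))" and fv: "fv = (\<lambda>x. (0, \<i> * cis (snd x / s)))"
    by (rule ext, simp add: dd_torus_param[OF nz])+
  have cc: "cis t \<bullet> cis t = 1" "(\<i> * cis t) \<bullet> (\<i> * cis t) = 1" "cis t \<bullet> (\<i> * cis t) = 0" "(\<i> * cis t) \<bullet> cis t = 0" for t
    using sin_cos_squared_add[of t] by (simp_all add: inner_complex_def power2_eq_square algebra_simps)
  have ddu: "dd X (\<lambda>x::real \<times> real. (\<i> * cis (fst x / r), 0 :: complex)) x = (- (fst X / r) *\<^sub>R cis (fst x / r), 0)" for X x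
    by (rule dd_eqI) (auto intro!: derivative_eq_intros simp: divide_inverse scaleR_conv_of_real complex_eq_iff algebra_simps)
  have ddv: "dd X (\<lambda>x::real \<times> real. (0 :: complex, \<i> * cis (snd x / s))) x = (0, - (snd X / s) *\<^sub>R cis (snd x / s))" for X x
    by (rule dd_eqI) (auto intro!: derivative_eq_intros simp: divide_inverse scaleR_conv_of_real complex_eq_iff algebra_simps)
  have EFG: "EE x = 1" "FF x = 0" "GG x = 1" for x unfolding fu fv by (simp_all add: inner_prod_def cc)
  have L: "Lam x = (- (1 / r) *\<^sub>R cis (fst x / r), - (1 / s) *\<^sub>R cis (snd x / s))" for x
    unfolding Lam_def EFG unfolding fu fv ddu ddv by simp
  have f: "torus_param r s x = (r *\<^sub>R cis (fst x / r), s *\<^sub>R cis (snd x / s))" for x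
    unfolding torus_param_def by (simp add: split_def scaleR_conv_of_real)
  have Lf: "Lam x \<bullet> torus_param r s x = - 2" for x
    unfolding L f inner_prod_def fst_conv snd_conv inner_scaleR_left inner_scaleR_right cc using nz by simp
  have t: "Lam x \<bullet> fu x = 0" "Lam x \<bullet> fv x = 0" for x
    unfolding L fu fv inner_prod_def fst_conv snd_conv inner_scaleR_left inner_scaleR_right cc by simp_all
  have N: "nor (torus_param r s) (Lam x) x = ((2 * r - 1 / r) *\<^sub>R cis (fst x / r), (2 * s - 1 / s) *\<^sub>R cis (snd x / s))" for x
    unfolding nor_def tan_metric EFG Lf t unfolding L f by (simp add: algebra_simps)
  have rs1: "s\<^sup>2 = 1 - r\<^sup>2" using rs by simp
  have "willmore_density (torus_param r s) x = ((2 * r - 1 / r)\<^sup>2 + (2 * s - 1 / s)\<^sup>2) / 4 + 1" for x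
    unfolding willmore_density_nor EFG N unfolding inner_prod_def fst_conv snd_conv inner_scaleR_left inner_scaleR_right cc
    by (simp add: power2_eq_square)
  also have "((2 * r - 1 / r)\<^sup>2 + (2 * s - 1 / s)\<^sup>2) / 4 + 1 = 1 / (4 * r\<^sup>2 * s\<^sup>2)"
  proof -
    have "((2 * r - 1 / r)\<^sup>2 + (2 * s - 1 / s)\<^sup>2) / 4 + 1 = (r\<^sup>2 + s\<^sup>2) - 1 + (1 / r\<^sup>2 + 1 / s\<^sup>2) / 4"
      using nz by (simp add: power2_eq_square field_simps)
    also have "\<dots> = (r\<^sup>2 + s\<^sup>2) / (4 * r\<^sup>2 * s\<^sup>2)"
      unfolding rs(3) using nz by (simp add: field_simps) (simp add: rs1)
    finally show ?thesis unfolding rs(3) .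
  qed
  finally have "willmore_density (torus_param r s) = (\<lambda>x. 1 / (4 * r\<^sup>2 * s\<^sup>2))" by auto
  then have "willmore r s (torus_param r s) = 4 * pi\<^sup>2 * r * s * (1 / (4 * r\<^sup>2 * s\<^sup>2))"
    unfolding willmore_density_integral using integral_cell_const[of r s "1 / (4 * r\<^sup>2 * s\<^sup>2)"] rs by simp
  then show ?thesis using nz by (simp add: power2_eq_square)
qed

section \<open>Polynomial identities behind the expansion in t\<close>

section \<open>Algebra of the expansion\<close>

text \<open>\<open>c\<close>, \<open>s\<close> are cosine and sine of \<omega>; \<open>wu\<close>,
  \<open>au\<close>, \<open>bu\<close> are the u-derivatives of \<omega>, \<Theta>1, \<Theta>2, and
  similarly for v; \<open>z1\<close>, \<open>z2\<close> are the derivatives of a test function with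
  respect to the two angles. The point is that all metric combinations reduce to the three minors
  \<open>W1\<close>, \<open>W2\<close>, \<open>B\<close>, of which only \<open>B\<close> survives at
  t = 0.\<close>

lemma lower_density_algebra:
  fixes c s m X wu wv au av bu bv z1 z2 :: real
  assumes E: "E = wu * wu + c\<^sup>2 * (au * au) + s\<^sup>2 * (bu * bu)"
    and F: "F = wu * wv + c\<^sup>2 * (au * av) + s\<^sup>2 * (bu * bv)"
    and G: "G = wv * wv + c\<^sup>2 * (av * av) + s\<^sup>2 * (bv * bv)"
    and Wd: "W1 = wu * bv - wv * bu" "W2 = au * wv - av * wu" "B = au * bv - av * bu"
  shows "E * G - F\<^sup>2 = c\<^sup>2 * s\<^sup>2 * B\<^sup>2 + (s\<^sup>2 * W1\<^sup>2 + c\<^sup>2 * W2\<^sup>2)"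
    and "- ((G * (wu * (z1 * au + z2 * bu) - X * (c * s) * (au * au) + X * (c * s) * (bu * bu))
      - F * ((wu * (z1 * av + z2 * bv) - X * (c * s) * (au * av) + X * (c * s) * (bu * bv))
           + (wv * (z1 * au + z2 * bu) - X * (c * s) * (av * au) + X * (c * s) * (bv * bu)))
      + E * (wv * (z1 * av + z2 * bv) - X * (c * s) * (av * av) + X * (c * s) * (bv * bv))) / m) / 2
      + (1 - X\<^sup>2 / 4) * m
      + ((G * (X * wu)\<^sup>2 - 2 * F * (X * wu) * (X * wv) + E * (X * wv)\<^sup>2) / m) / 4
    = - ((z1 * (s\<^sup>2 * W1 * B) + z2 * (c\<^sup>2 * W2 * B)) / m) / 2
      + X * (c * s) * ((s\<^sup>2 * B\<^sup>2 + W2\<^sup>2) / m - (c\<^sup>2 * B\<^sup>2 + W1\<^sup>2) / m) / 2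
      + (1 - X\<^sup>2 / 4) * m + X\<^sup>2 * (s\<^sup>2 * W1\<^sup>2 + c\<^sup>2 * W2\<^sup>2) / m / 4" (is "- (?P / m) / 2 + _ + (?Q / m) / 4 = _")
    and "G * (z1 * au + z2 * bu)\<^sup>2 - 2 * F * ((z1 * au + z2 * bu) * (z1 * av + z2 * bv)) + E * (z1 * av + z2 * bv)\<^sup>2
      = z1\<^sup>2 * (s\<^sup>2 * B\<^sup>2 + W2\<^sup>2) - 2 * z1 * z2 * (W1 * W2) + z2\<^sup>2 * (c\<^sup>2 * B\<^sup>2 + W1\<^sup>2)"
proof -
  show "E * G - F\<^sup>2 = c\<^sup>2 * s\<^sup>2 * B\<^sup>2 + (s\<^sup>2 * W1\<^sup>2 + c\<^sup>2 * W2\<^sup>2)"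
    unfolding E F G Wd by (simp add: power2_eq_square algebra_simps)
  have P: "?P = (z1 * (s\<^sup>2 * W1 * B) + z2 * (c\<^sup>2 * W2 * B)) - X * (c * s) * ((s\<^sup>2 * B\<^sup>2 + W2\<^sup>2) - (c\<^sup>2 * B\<^sup>2 + W1\<^sup>2))"
    unfolding E F G Wd by (simp add: power2_eq_square algebra_simps)
  have Q: "?Q = X\<^sup>2 * (s\<^sup>2 * W1\<^sup>2 + c\<^sup>2 * W2\<^sup>2)"
    unfolding E F G Wd by (simp add: power2_eq_square algebra_simps)
  show "- (?P / m) / 2 + (1 - X\<^sup>2 / 4) * m + (?Q / m) / 4
    = - ((z1 * (s\<^sup>2 * W1 * B) + z2 * (c\<^sup>2 * W2 * B)) / m) / 2
      + X * (c * s) * ((s\<^sup>2 * B\<^sup>2 + W2\<^sup>2) / m - (c\<^sup>2 * B\<^sup>2 + W1\<^sup>2) / m) / 2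
      + (1 - X\<^sup>2 / 4) * m + X\<^sup>2 * (s\<^sup>2 * W1\<^sup>2 + c\<^sup>2 * W2\<^sup>2) / m / 4"
    unfolding P Q by (simp add: diff_divide_distrib right_diff_distrib)
  show "G * (z1 * au + z2 * bu)\<^sup>2 - 2 * F * ((z1 * au + z2 * bu) * (z1 * av + z2 * bv)) + E * (z1 * av + z2 * bv)\<^sup>2
      = z1\<^sup>2 * (s\<^sup>2 * B\<^sup>2 + W2\<^sup>2) - 2 * z1 * z2 * (W1 * W2) + z2\<^sup>2 * (c\<^sup>2 * B\<^sup>2 + W1\<^sup>2)"
    unfolding E F G Wd by (simp add: power2_eq_square algebra_simps)
qed

text \<open>The factor \<open>(\<tau> - a)\<^sup>2\<close> that splits off in the fact \<open>k\<close> below expresses that the Clifford torus is a critical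
  point of the Lagrange functional.\<close>

lemma expansion_algebra:
  fixes a r t c s B m w1 w2 y z z1 z2 e1 e2 :: real
  assumes cs: "0 < c" "0 < s" "c\<^sup>2 + s\<^sup>2 = 1" and a: "0 < a" and r: "r\<^sup>2 * (1 + a\<^sup>2) = 1" and B: "0 < B" and m: "0 < m"
    and ed: "e = s\<^sup>2 * w1\<^sup>2 + c\<^sup>2 * w2\<^sup>2" and m2: "m\<^sup>2 = c\<^sup>2 * s\<^sup>2 * B\<^sup>2 + t\<^sup>2 * e"
    and \<tau>: "\<tau> = s / c" and y: "t * y = \<tau> - a" and H: "H = a - 1 / a"
    and L: "L = (1 - a ^ 4) / (4 * a\<^sup>2)" and X: "X = H + t * z" and mu: "u = e / (m + c * s * B)"
    and R1: "R1 = (w2\<^sup>2 - \<tau> * B * u) / m" and R2: "R2 = (w1\<^sup>2 - B / \<tau> * u) / m"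
  shows "- ((t * z1 * (s\<^sup>2 * (t * w1) * B) + t * z2 * (c\<^sup>2 * (t * w2) * B)) / m) / 2
      + X * (c * s) * ((s\<^sup>2 * B\<^sup>2 + (t * w2)\<^sup>2) / m - (c\<^sup>2 * B\<^sup>2 + (t * w1)\<^sup>2) / m) / 2
      + (1 - X\<^sup>2 / 4) * m + X\<^sup>2 * (s\<^sup>2 * (t * w1)\<^sup>2 + c\<^sup>2 * (t * w2)\<^sup>2) / m / 4
      + L * (((r + t * e1)\<^sup>2 * (s\<^sup>2 * B\<^sup>2 + (t * w2)\<^sup>2) - 2 * (r + t * e1) * (t * e2) * ((t * w1) * (t * w2))
          + (t * e2)\<^sup>2 * (c\<^sup>2 * B\<^sup>2 + (t * w1)\<^sup>2)) / m)
    = B / (2 * a) + 2 * L * r * a * t * (e1 * B)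
      + t\<^sup>2 * (y\<^sup>2 * ((1 - a\<^sup>2) * \<tau> - 2 * a) * c\<^sup>2 / (4 * a\<^sup>2) * B + z * c\<^sup>2 * y * (\<tau> + 1 / a) * B / 2
         - z\<^sup>2 * (c * s) * B / 4 + L * (2 * r * e1 * y + e1\<^sup>2 * \<tau>) * B + X * (c * s) * (R1 - R2) / 2
         - (z1 * s\<^sup>2 * w1 + z2 * c\<^sup>2 * w2) * B / m / 2 + (1 - X\<^sup>2 / 4) * u + X\<^sup>2 * e / m / 4
         + L * ((r + t * e1)\<^sup>2 * R1 - 2 * t * (r + t * e1) * e2 * w1 * w2 / m + e2\<^sup>2 * (B / \<tau> + t\<^sup>2 * R2)))" (is "?lhs = _")
    and "(s\<^sup>2 * B\<^sup>2 + (t * w2)\<^sup>2) / m = a * B + t * (y * B) + t\<^sup>2 * R1"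
proof -
  have csB: "0 < c * s * B" using cs B by simp
  have mp: "m + c * s * B \<noteq> 0" using m csB by linarith
  have nz: "m \<noteq> 0" "c \<noteq> 0" "s \<noteq> 0" "a \<noteq> 0" using m cs a by auto
  \<comment> \<open>Rationalising the difference of \<open>m\<close> and \<open>c * s * B\<close>
    exhibits the factor t^2, so \<open>u\<close> involves no division by t.\<close>
  have mm: "m = c * s * B + t\<^sup>2 * u"
  proof -
    have "(m - c * s * B) * (m + c * s * B) = t\<^sup>2 * e"
      using m2 by (simp add: power2_eq_square algebra_simps)
    then have "m - c * s * B = t\<^sup>2 * e / (m + c * s * B)" using mp by (simp add: eq_divide_eq)
    then show ?thesis unfolding mu by simp
  qed
  have T1: "(s\<^sup>2 * B\<^sup>2 + (t * w2)\<^sup>2) / m = \<tau> * B + t\<^sup>2 * R1"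
  proof -
    have "\<tau> * B * (c * s * B) = s\<^sup>2 * B\<^sup>2" unfolding \<tau> using nz by (simp add: power2_eq_square)
    then have "s\<^sup>2 * B\<^sup>2 + (t * w2)\<^sup>2 = \<tau> * B * m + t\<^sup>2 * (w2\<^sup>2 - \<tau> * B * u)"
      by (subst mm) (simp add: algebra_simps power_mult_distrib)
    then show ?thesis unfolding R1 using nz by (simp add: add_divide_distrib)
  qed
  have T2: "(c\<^sup>2 * B\<^sup>2 + (t * w1)\<^sup>2) / m = B / \<tau> + t\<^sup>2 * R2"
  proof -
    have "B / \<tau> * (c * s * B) = c\<^sup>2 * B\<^sup>2" unfolding \<tau> using nz by (simp add: power2_eq_square)
    then have "c\<^sup>2 * B\<^sup>2 + (t * w1)\<^sup>2 = B / \<tau> * m + t\<^sup>2 * (w1\<^sup>2 - B / \<tau> * u)"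
      by (subst mm) (simp add: algebra_simps power_mult_distrib)
    then show ?thesis unfolding R2 using nz by (simp add: add_divide_distrib)
  qed
  show "(s\<^sup>2 * B\<^sup>2 + (t * w2)\<^sup>2) / m = a * B + t * (y * B) + t\<^sup>2 * R1"
  proof -
    have "\<tau> = a + t * y" using y by simp
    then have "\<tau> * B = a * B + t * (y * B)" by (simp only: distrib_right mult.assoc)
    then show ?thesis unfolding T1 by simp
  qed
  have c2: "c\<^sup>2 = 1 / (1 + \<tau>\<^sup>2)"
  proof -
    have "c\<^sup>2 * (1 + \<tau>\<^sup>2) = 1" unfolding \<tau> using cs nz by (simp add: power_divide distrib_left)
    moreover have "1 + \<tau>\<^sup>2 \<noteq> 0" by (metis add_pos_nonneg zero_le_power2 zero_less_one less_irrefl)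
    ultimately show ?thesis by (simp add: eq_divide_eq)
  qed
  have p\<tau>: "1 + \<tau>\<^sup>2 \<noteq> 0" by (metis add_pos_nonneg zero_le_power2 zero_less_one less_irrefl)
  have \<tau>p: "0 < \<tau>" using cs by (simp add: \<tau>)
  have s\<tau>: "s = \<tau> * c" using nz by (simp add: \<tau>)
  have csc: "c * s = c\<^sup>2 * \<tau>" by (simp add: s\<tau> power2_eq_square)
  have Lr: "L * r\<^sup>2 = (1 - a\<^sup>2) / (4 * a\<^sup>2)"
  proof -
    have "L = (1 - a\<^sup>2) / (4 * a\<^sup>2) * (1 + a\<^sup>2)" unfolding L by (simp add: power4_eq_xxxx power2_eq_square algebra_simps)
    then have "L * r\<^sup>2 = (1 - a\<^sup>2) / (4 * a\<^sup>2) * (r\<^sup>2 * (1 + a\<^sup>2))" by (simp only: mult_ac)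
    then show ?thesis by (simp only: r mult_1_right)
  qed
  have k: "H * c\<^sup>2 * (\<tau>\<^sup>2 - 1) / 2 + (1 - H\<^sup>2 / 4) * (c\<^sup>2 * \<tau>) + L * r\<^sup>2 * \<tau> = 1 / (2 * a) + (\<tau> - a)\<^sup>2 * ((1 - a\<^sup>2) * \<tau> - 2 * a) * c\<^sup>2 / (4 * a\<^sup>2)"
  proof -
    have cP: "c\<^sup>2 * (1 + \<tau>\<^sup>2) = 1" unfolding c2 using p\<tau> by simp
    have Hs: "H = (a\<^sup>2 - 1) / a" "1 - H\<^sup>2 / 4 = (6 * a\<^sup>2 - a ^ 4 - 1) / (4 * a\<^sup>2)"
      unfolding H using nz(4) by (simp_all add: field_simps power4_eq_xxxx power2_eq_square)
    have poly: "2 * a * (a\<^sup>2 - 1) * (\<tau>\<^sup>2 - 1) + (6 * a\<^sup>2 - a ^ 4 - 1) * \<tau> + (1 - a\<^sup>2) * \<tau> * (1 + \<tau>\<^sup>2)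
       = 2 * a * (1 + \<tau>\<^sup>2) + (\<tau> - a)\<^sup>2 * ((1 - a\<^sup>2) * \<tau> - 2 * a)"
      by algebra
    have "H * c\<^sup>2 * (\<tau>\<^sup>2 - 1) / 2 + (1 - H\<^sup>2 / 4) * (c\<^sup>2 * \<tau>) + (1 - a\<^sup>2) / (4 * a\<^sup>2) * \<tau> * (c\<^sup>2 * (1 + \<tau>\<^sup>2))
       = c\<^sup>2 * (2 * a * (a\<^sup>2 - 1) * (\<tau>\<^sup>2 - 1) + (6 * a\<^sup>2 - a ^ 4 - 1) * \<tau> + (1 - a\<^sup>2) * \<tau> * (1 + \<tau>\<^sup>2)) / (4 * a\<^sup>2)"
      unfolding Hs(2) unfolding Hs(1) using nz(4)
      by (simp add: add_divide_distrib distrib_left) (simp add: field_simps power2_eq_square)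
    also have "\<dots> = (c\<^sup>2 * (1 + \<tau>\<^sup>2)) / (2 * a) + (\<tau> - a)\<^sup>2 * ((1 - a\<^sup>2) * \<tau> - 2 * a) * c\<^sup>2 / (4 * a\<^sup>2)"
      unfolding poly using nz(4) by (simp add: distrib_left add_divide_distrib) (simp add: field_simps power2_eq_square)
    finally show ?thesis unfolding cP Lr by simp
  qed
  \<comment> \<open>This is the coefficient of the term linear in \<open>z\<close>. It vanishes at
    \<tau> = a because \<open>H\<close> is the mean curvature of the torus, that is, because the
    unperturbed test field is already optimal there.\<close>
  have h: "c\<^sup>2 * (\<tau>\<^sup>2 - 1) - H * (c\<^sup>2 * \<tau>) = c\<^sup>2 * (t * y) * (\<tau> + 1 / a)"
    unfolding y H using nz(4) by (simp add: field_simps power2_eq_square)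
  have \<tau>\<tau>: "\<tau> * B - B / \<tau> = (\<tau>\<^sup>2 - 1) * B / \<tau>" using \<tau>p by (simp add: field_simps power2_eq_square)
  have g1: "X * (c * s) * ((\<tau> * B + t\<^sup>2 * R1) - (B / \<tau> + t\<^sup>2 * R2)) / 2 = X * (c\<^sup>2 * (\<tau>\<^sup>2 - 1)) * B / 2 + t\<^sup>2 * (X * (c * s) * (R1 - R2) / 2)"
  proof -
    have "(\<tau> * B + t\<^sup>2 * R1) - (B / \<tau> + t\<^sup>2 * R2) = (\<tau> * B - B / \<tau>) + t\<^sup>2 * (R1 - R2)" by (simp add: algebra_simps)
    then show ?thesis unfolding \<tau>\<tau> csc using \<tau>p by (simp add: field_simps power2_eq_square)
  qed
  have g2: "(1 - X\<^sup>2 / 4) * m = (1 - X\<^sup>2 / 4) * (c\<^sup>2 * \<tau>) * B + t\<^sup>2 * ((1 - X\<^sup>2 / 4) * u)"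
    unfolding csc[symmetric] by (subst mm) (simp add: algebra_simps)
  have g3: "X\<^sup>2 * (s\<^sup>2 * (t * w1)\<^sup>2 + c\<^sup>2 * (t * w2)\<^sup>2) / m / 4 = t\<^sup>2 * (X\<^sup>2 * e / m / 4)"
    unfolding ed by (simp add: power_mult_distrib algebra_simps)
  have g4: "- ((t * z1 * (s\<^sup>2 * (t * w1) * B) + t * z2 * (c\<^sup>2 * (t * w2) * B)) / m) / 2 = - (t\<^sup>2 * ((z1 * s\<^sup>2 * w1 + z2 * c\<^sup>2 * w2) * B / m / 2))"
    by (simp add: power2_eq_square algebra_simps)
  have g5: "((r + t * e1)\<^sup>2 * (s\<^sup>2 * B\<^sup>2 + (t * w2)\<^sup>2) - 2 * (r + t * e1) * (t * e2) * ((t * w1) * (t * w2))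
          + (t * e2)\<^sup>2 * (c\<^sup>2 * B\<^sup>2 + (t * w1)\<^sup>2)) / m
     = (r + t * e1)\<^sup>2 * \<tau> * B + t\<^sup>2 * ((r + t * e1)\<^sup>2 * R1 - 2 * t * (r + t * e1) * e2 * w1 * w2 / m + e2\<^sup>2 * (B / \<tau> + t\<^sup>2 * R2))"
  proof -
    have "((r + t * e1)\<^sup>2 * (s\<^sup>2 * B\<^sup>2 + (t * w2)\<^sup>2) - 2 * (r + t * e1) * (t * e2) * ((t * w1) * (t * w2))
          + (t * e2)\<^sup>2 * (c\<^sup>2 * B\<^sup>2 + (t * w1)\<^sup>2)) / m
      = (r + t * e1)\<^sup>2 * ((s\<^sup>2 * B\<^sup>2 + (t * w2)\<^sup>2) / m) - t\<^sup>2 * (2 * t * (r + t * e1) * e2 * w1 * w2 / m)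
        + t\<^sup>2 * e2\<^sup>2 * ((c\<^sup>2 * B\<^sup>2 + (t * w1)\<^sup>2) / m)"
    proof -
      have "(A * p - C + D * q) / m = A * (p / m) - C / m + D * (q / m)" for A p C D q
        by (simp add: add_divide_distrib diff_divide_distrib)
      moreover have "2 * (r + t * e1) * (t * e2) * ((t * w1) * (t * w2)) / m = t\<^sup>2 * (2 * t * (r + t * e1) * e2 * w1 * w2 / m)"
        by (simp add: power2_eq_square)
      ultimately show ?thesis by (simp only: power_mult_distrib)
    qed
    then show ?thesis unfolding T1 T2 by (simp add: algebra_simps)
  qed
  have g6: "X * (c\<^sup>2 * (\<tau>\<^sup>2 - 1)) * B / 2 + (1 - X\<^sup>2 / 4) * (c\<^sup>2 * \<tau>) * B + L * ((r + t * e1)\<^sup>2 * \<tau> * B)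
     = B / (2 * a) + 2 * L * r * a * t * (e1 * B)
      + t\<^sup>2 * (y\<^sup>2 * ((1 - a\<^sup>2) * \<tau> - 2 * a) * c\<^sup>2 / (4 * a\<^sup>2) * B + z * c\<^sup>2 * y * (\<tau> + 1 / a) * B / 2
         - z\<^sup>2 * (c * s) * B / 4 + L * (2 * r * e1 * y + e1\<^sup>2 * \<tau>) * B)"
  proof -
    have "X * (c\<^sup>2 * (\<tau>\<^sup>2 - 1)) * B / 2 + (1 - X\<^sup>2 / 4) * (c\<^sup>2 * \<tau>) * B + L * ((r + t * e1)\<^sup>2 * \<tau> * B)
      = (H * c\<^sup>2 * (\<tau>\<^sup>2 - 1) / 2 + (1 - H\<^sup>2 / 4) * (c\<^sup>2 * \<tau>) + L * r\<^sup>2 * \<tau>) * B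
       + t * z * (c\<^sup>2 * (\<tau>\<^sup>2 - 1) - H * (c\<^sup>2 * \<tau>)) * B / 2 - t\<^sup>2 * z\<^sup>2 * (c\<^sup>2 * \<tau>) * B / 4
       + L * (2 * r * t * e1 * \<tau> + t\<^sup>2 * e1\<^sup>2 * \<tau>) * B"
      unfolding X by (simp add: power2_eq_square field_simps)
    also have "\<dots> = B / (2 * a) + (t * y)\<^sup>2 * ((1 - a\<^sup>2) * \<tau> - 2 * a) * c\<^sup>2 / (4 * a\<^sup>2) * B
       + t * z * (c\<^sup>2 * (t * y) * (\<tau> + 1 / a)) * B / 2 - t\<^sup>2 * z\<^sup>2 * (c * s) * B / 4
       + L * (2 * r * t * e1 * (a + t * y) + t\<^sup>2 * e1\<^sup>2 * \<tau>) * B"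
      unfolding k h csc y by (simp add: distrib_right)
    also have "\<dots> = B / (2 * a) + 2 * L * r * a * t * (e1 * B)
      + t\<^sup>2 * (y\<^sup>2 * ((1 - a\<^sup>2) * \<tau> - 2 * a) * c\<^sup>2 / (4 * a\<^sup>2) * B + z * c\<^sup>2 * y * (\<tau> + 1 / a) * B / 2
         - z\<^sup>2 * (c * s) * B / 4 + L * (2 * r * e1 * y + e1\<^sup>2 * \<tau>) * B)"
      by (simp add: power_mult_distrib) (simp add: power2_eq_square distrib_left distrib_right mult_ac right_diff_distrib)
    finally show ?thesis .
  qed
  have combine1: "- (T * q4) + (k1 + T * q1) + (k2 + T * q2) + T * q3 + L * (k5 * \<tau> * B + T * q5)
    = (k1 + k2 + L * (k5 * \<tau> * B)) + T * (q1 - q4 + q2 + q3 + L * q5)" for T q1 q2 q3 q4 q5 k1 k2 k5 :: real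
    by (simp add: algebra_simps)
  have combine2: "A + T * (qa + qb - qc + qd) + T * (q1 - q4 + q2 + q3 + q5)
    = A + T * (qa + qb - qc + qd + q1 - q4 + q2 + q3 + q5)" for A T qa qb qc qd q1 q2 q3 q4 q5 :: real
    by (simp add: algebra_simps)
  have "?lhs = (X * (c\<^sup>2 * (\<tau>\<^sup>2 - 1)) * B / 2 + (1 - X\<^sup>2 / 4) * (c\<^sup>2 * \<tau>) * B + L * ((r + t * e1)\<^sup>2 * \<tau> * B))
     + t\<^sup>2 * (X * (c * s) * (R1 - R2) / 2 - (z1 * s\<^sup>2 * w1 + z2 * c\<^sup>2 * w2) * B / m / 2 + (1 - X\<^sup>2 / 4) * u + X\<^sup>2 * e / m / 4
         + L * ((r + t * e1)\<^sup>2 * R1 - 2 * t * (r + t * e1) * e2 * w1 * w2 / m + e2\<^sup>2 * (B / \<tau> + t\<^sup>2 * R2)))"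
    unfolding T1 T2 g1 g2 g3 g4 g5 by (rule combine1)
  then show "?lhs = B / (2 * a) + 2 * L * r * a * t * (e1 * B)
      + t\<^sup>2 * (y\<^sup>2 * ((1 - a\<^sup>2) * \<tau> - 2 * a) * c\<^sup>2 / (4 * a\<^sup>2) * B + z * c\<^sup>2 * y * (\<tau> + 1 / a) * B / 2
         - z\<^sup>2 * (c * s) * B / 4 + L * (2 * r * e1 * y + e1\<^sup>2 * \<tau>) * B + X * (c * s) * (R1 - R2) / 2
         - (z1 * s\<^sup>2 * w1 + z2 * c\<^sup>2 * w2) * B / m / 2 + (1 - X\<^sup>2 / 4) * u + X\<^sup>2 * e / m / 4
         + L * ((r + t * e1)\<^sup>2 * R1 - 2 * t * (r + t * e1) * e2 * w1 * w2 / m + e2\<^sup>2 * (B / \<tau> + t\<^sup>2 * R2)))"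
    unfolding g6 by (rule trans[OF _ combine2])
qed

text \<open>The bracket of \<open>expansion_algebra\<close> at t = 0, where cosine, sine and \<tau>
  take the values r, a r and a. The curvature terms collapse to r^2/(4a) (|d\<psi>|^2 -
  \<psi>^2/r^2) with derivatives in the angles, which produces the factor k^2 + l^2 - 1/r^2 on the
  mode (k, l).\<close>

lemma second_variation_algebra:
  fixes a r \<psi> \<psi>1 \<psi>2 z z1 z2 e1 e2 :: real
  assumes a: "0 < a" and r: "0 < r" "r\<^sup>2 * (1 + a\<^sup>2) = 1" and L: "L = (1 - a ^ 4) / (4 * a\<^sup>2)" and H: "H = a - 1 / a"
    and B: "B = 1 / (r * (a * r))" and w: "w1 = \<psi>1 / a" "w2 = \<psi>2 / a"
    and e: "e = (a * r)\<^sup>2 * w1\<^sup>2 + r\<^sup>2 * w2\<^sup>2"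
    and R: "R1 = w2\<^sup>2 - a * B * (e / 2)" "R2 = w1\<^sup>2 - B / a * (e / 2)"
  shows "\<psi>\<^sup>2 * ((1 - a\<^sup>2) * a - 2 * a) * r\<^sup>2 / (4 * a\<^sup>2) * B + z * r\<^sup>2 * \<psi> * (a + 1 / a) * B / 2
         - z\<^sup>2 * (r * (a * r)) * B / 4 + L * (2 * r * e1 * \<psi> + e1\<^sup>2 * a) * B + H * (r * (a * r)) * (R1 - R2) / 2
         - (z1 * (a * r)\<^sup>2 * w1 + z2 * r\<^sup>2 * w2) * B / 2 + (1 - H\<^sup>2 / 4) * (e / 2) + H\<^sup>2 * e / 4
         + L * (r\<^sup>2 * R1 + e2\<^sup>2 * (B / a))
    = B * (r\<^sup>2 / (4 * a) * (\<psi>1\<^sup>2 + \<psi>2\<^sup>2) - \<psi>\<^sup>2 / (4 * a) + z * \<psi> / (2 * a) - z\<^sup>2 * r\<^sup>2 * a / 4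
        - r\<^sup>2 / 2 * (a * z1 * \<psi>1 + z2 * \<psi>2 / a) + L * (2 * r * e1 * \<psi> + a * e1\<^sup>2 + e2\<^sup>2 / a))"
proof -
  define q where "q = r\<^sup>2"
  have Q: "1 + a\<^sup>2 \<noteq> 0" using a by (metis add_pos_nonneg zero_le_power2 zero_less_one less_irrefl)
  have q: "q = 1 / (1 + a\<^sup>2)" using r(2) Q by (simp add: q_def eq_divide_eq)
  have q0: "0 < q" using r by (simp add: q_def)
  have rr: "r * (a * r) = a * q" "(a * r)\<^sup>2 = a\<^sup>2 * q" "r\<^sup>2 = q" by (simp_all add: q_def power2_eq_square)
  have Bq: "B * (a * q) = 1" unfolding B rr using a q0 by simp
  have B1: "B = (1 + a\<^sup>2) / a" unfolding B rr q using Q a by simp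
  have e': "e = q * (\<psi>1\<^sup>2 + \<psi>2\<^sup>2 / a\<^sup>2)" unfolding e w rr using a by (simp add: power_divide field_simps)
  have ab: "a * B = 1 / q" "B / a = 1 / (a\<^sup>2 * q)" unfolding B rr using a by (simp_all add: power2_eq_square)
  have R': "R1 = \<psi>2\<^sup>2 / (2 * a\<^sup>2) - \<psi>1\<^sup>2 / 2" "R2 = \<psi>1\<^sup>2 / (2 * a\<^sup>2) - \<psi>2\<^sup>2 / (2 * a ^ 4)"
    unfolding R ab e' w using a q0 by (simp_all add: power_divide field_simps power4_eq_xxxx power2_eq_square)
  have t1: "\<psi>\<^sup>2 * ((1 - a\<^sup>2) * a - 2 * a) * q / (4 * a\<^sup>2) * B = B * (- (\<psi>\<^sup>2 / (4 * a)))"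
  proof -
    have "((1 - a\<^sup>2) * a - 2 * a) * q = - a" unfolding q using Q by (simp add: field_simps power2_eq_square)
    then have "\<psi>\<^sup>2 * (((1 - a\<^sup>2) * a - 2 * a) * q) / (4 * a\<^sup>2) * B = B * (- (\<psi>\<^sup>2 / (4 * a)))"
      using a by (simp add: power2_eq_square)
    then show ?thesis by (simp only: mult.assoc)
  qed
  have t2: "z * q * \<psi> * (a + 1 / a) * B / 2 = B * (z * \<psi> / (2 * a))"
  proof -
    have "q * (a + 1 / a) = q * (1 + a\<^sup>2) / a" using a by (simp add: field_simps power2_eq_square)
    then have "q * (a + 1 / a) = 1 / a" using r(2) by (simp add: q_def)
    moreover have "z * q * \<psi> * (a + 1 / a) * B / 2 = B * (z * \<psi> * (q * (a + 1 / a)) / 2)" by simp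
    ultimately show ?thesis by simp
  qed
  have t3: "z\<^sup>2 * (a * q) * B / 4 = B * (z\<^sup>2 * q * a / 4)" by simp
  have t4: "(z1 * (a\<^sup>2 * q) * w1 + z2 * q * w2) * B / 2 = B * (q / 2 * (a * z1 * \<psi>1 + z2 * \<psi>2 / a))"
    unfolding w using a by (simp add: field_simps power2_eq_square)
  have t5: "H * (a * q) * (R1 - R2) / 2 + (1 - H\<^sup>2 / 4) * (e / 2) + H\<^sup>2 * e / 4 + L * (q * R1)
     = B * (q / (4 * a) * (\<psi>1\<^sup>2 + \<psi>2\<^sup>2))"
  proof -
    define u v where "u = \<psi>1\<^sup>2" and "v = \<psi>2\<^sup>2 / a\<^sup>2"
    have qP: "q * (1 + a\<^sup>2) = 1" using r(2) by (simp add: q_def)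
    have Rd: "R1 = (v - u) / 2" "R1 - R2 = (1 + a\<^sup>2) / (2 * a\<^sup>2) * (v - u)"
      unfolding R' u_def v_def using a by (simp_all add: field_simps power4_eq_xxxx power2_eq_square)
    have H1: "1 + H\<^sup>2 / 4 = (1 + a\<^sup>2)\<^sup>2 / (4 * a\<^sup>2)" "H * a = a\<^sup>2 - 1"
      unfolding H using a by (simp_all add: field_simps power2_eq_square)
    have "H * (a * q) * (R1 - R2) / 2 = (H * a) * (q * (1 + a\<^sup>2)) / (4 * a\<^sup>2) * (v - u)"
      unfolding Rd(2) by (simp add: algebra_simps)
    then have i: "H * (a * q) * (R1 - R2) / 2 = (a\<^sup>2 - 1) / (4 * a\<^sup>2) * (v - u)"
      unfolding qP H1 by simp
    have "(1 - H\<^sup>2 / 4) * (e / 2) + H\<^sup>2 * e / 4 = (1 + H\<^sup>2 / 4) * e / 2" by (simp add: algebra_simps)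
    also have "\<dots> = (q * (1 + a\<^sup>2)) * (1 + a\<^sup>2) / (8 * a\<^sup>2) * (u + v)"
      unfolding H1 e' u_def v_def by (simp add: power2_eq_square)
    finally have ii: "(1 - H\<^sup>2 / 4) * (e / 2) + H\<^sup>2 * e / 4 = (1 + a\<^sup>2) / (8 * a\<^sup>2) * (u + v)"
      unfolding qP by simp
    have "1 - a ^ 4 = (1 - a\<^sup>2) * (1 + a\<^sup>2)" by (simp add: power4_eq_xxxx power2_eq_square algebra_simps)
    then have "L * (q * R1) = (1 - a\<^sup>2) * (q * (1 + a\<^sup>2)) / (4 * a\<^sup>2) * R1" unfolding L by simp
    then have iii: "L * (q * R1) = (1 - a\<^sup>2) / (8 * a\<^sup>2) * (v - u)" unfolding qP Rd(1) by simp
    have "B * (q / (4 * a) * (\<psi>1\<^sup>2 + \<psi>2\<^sup>2)) = (q * (1 + a\<^sup>2)) / (4 * a\<^sup>2) * (u + a\<^sup>2 * v)"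
      unfolding B1 u_def v_def using a by (simp add: power2_eq_square mult_ac)
    then have iv: "B * (q / (4 * a) * (\<psi>1\<^sup>2 + \<psi>2\<^sup>2)) = (u + a\<^sup>2 * v) / (4 * a\<^sup>2)" unfolding qP by simp
    have "(a\<^sup>2 - 1) / (4 * a\<^sup>2) * (v - u) + (1 + a\<^sup>2) / (8 * a\<^sup>2) * (u + v) + (1 - a\<^sup>2) / (8 * a\<^sup>2) * (v - u)
       = (u + a\<^sup>2 * v) / (4 * a\<^sup>2)"
      using a by (simp add: field_simps)
    then show ?thesis using i ii iii iv by linarith
  qed
  show ?thesis
    unfolding rr t1 t2 t3 t4 distrib_left[of L "q * R1"] using t5 by (simp add: algebra_simps)
qed

section \<open>Quantities along a variation, divided by t and continuous up to t = 0\<close>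

section \<open>Difference quotients along a variation\<close>

lemma wedge_time_derivative:
  assumes F: "Ck_family 1 J F" "Ck_family 1 J F'" and G: "Ck_family 1 J G" "Ck_family 1 J G'" and J: "open J" "t \<in> J"
    and d: "\<And>t x. t \<in> J \<Longrightarrow> ((\<lambda>\<tau>. F \<tau> x) has_vector_derivative F' t x) (at t)"
      "\<And>t x. t \<in> J \<Longrightarrow> ((\<lambda>\<tau>. G \<tau> x) has_vector_derivative G' t x) (at t)"
  shows "((\<lambda>\<tau>. wedge (F \<tau>) (G \<tau>) x) has_vector_derivative (wedge (F' t) (G t) x + wedge (F t) (G' t) x)) (at t)"
proof -
  have f: "((\<lambda>\<tau>. dd X (F \<tau>) x) has_vector_derivative dd X (F' t) x) (at t)" for X
    by (rule has_vector_derivative_dd[of 0, folded One_nat_def, OF F J(1) d(1) J(2)])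
  have g: "((\<lambda>\<tau>. dd X (G \<tau>) x) has_vector_derivative dd X (G' t) x) (at t)" for X
    by (rule has_vector_derivative_dd[of 0, folded One_nat_def, OF G J(1) d(2) J(2)])
  have "((\<lambda>\<tau>. wedge (F \<tau>) (G \<tau>) x) has_vector_derivative
     ((dd (1, 0) (F t) x * dd (0, 1) (G' t) x + dd (1, 0) (F' t) x * dd (0, 1) (G t) x)
      - (dd (0, 1) (F t) x * dd (1, 0) (G' t) x + dd (0, 1) (F' t) x * dd (1, 0) (G t) x))) (at t)"
    unfolding wedge_def by (intro has_vector_derivative_diff has_vector_derivative_mult f g)
  then show ?thesis by (simp add: wedge_def algebra_simps)
qed

context polar_family
begin

abbreviation "J \<equiv> {-\<delta><..<\<delta>}"

definition "a = s / r"
definition "\<tau> t x = sin (\<omega> t x) / cos (\<omega> t x)"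
text \<open>At t = 0 the angle \<omega> is constant and \<tau> equals \<open>a\<close>. Hence \<tau>
  - a and the two minors containing d\<omega> vanish there, and this quotient, \<open>w1\<close> and
  \<open>w2\<close> extend continuously.\<close>

definition "y = diff_quot \<tau> (\<lambda>t x. \<omega>' t x / (cos (\<omega> t x))\<^sup>2)"
definition "w1 = diff_quot (\<lambda>t. wedge (\<omega> t) (\<Theta>2 t)) (\<lambda>t x. wedge (\<omega>' t) (\<Theta>2 t) x + wedge (\<omega> t) (\<Theta>2' t) x)"
definition "w2 = diff_quot (\<lambda>t. wedge (\<Theta>1 t) (\<omega> t)) (\<lambda>t x. wedge (\<Theta>1' t) (\<omega> t) x + wedge (\<Theta>1 t) (\<omega>' t) x)"
definition "B t x = wedge (\<Theta>1 t) (\<Theta>2 t) x"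
definition "e t x = (sin (\<omega> t x))\<^sup>2 * (w1 t x)\<^sup>2 + (cos (\<omega> t x))\<^sup>2 * (w2 t x)\<^sup>2"
text \<open>The area element of \<open>F t\<close>, written in terms of the angles.\<close>

definition "m t x = sqrt ((cos (\<omega> t x))\<^sup>2 * (sin (\<omega> t x))\<^sup>2 * (B t x)\<^sup>2 + t\<^sup>2 * e t x)"
definition "mu t x = e t x / (m t x + cos (\<omega> t x) * sin (\<omega> t x) * B t x)"
text \<open>With \<open>R2\<close>, the remainders of order t^2 in the diagonal coefficients of the
  conformal energy with respect to d\<Theta>1 and d\<Theta>2; the leading parts are \<tau> B and B /
  \<tau>.\<close>

definition "R1 t x = ((w2 t x)\<^sup>2 - \<tau> t x * B t x * mu t x) / m t x"
definition "R2 t x = ((w1 t x)\<^sup>2 - B t x / \<tau> t x * mu t x) / m t x"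
text \<open>The mean curvature of the torus with respect to \<open>nn 0\<close>.\<close>

definition "H0 = a - 1 / a"
text \<open>A product torus of ratio \<tau> has Willmore energy pi^2 (\<tau> + 1/\<tau>), and r
  \<Theta>1 has energy 4 pi^2 r^2 \<tau> on it. This multiplier makes the first plus
  \<open>lam\<close> times the second stationary at \<tau> = a.\<close>

definition "lam = (1 - a ^ 4) / (4 * a\<^sup>2)"
text \<open>The time derivative of \<tau> at 0, since cos \<omega> = r there.\<close>

definition "\<psi> x = \<omega>' 0 x / r\<^sup>2"

lemma zero_J: "0 \<in> J" using \<delta> by simp

lemma a_pos: "0 < a" and ar_eq: "a * r = s" and r_eq: "r\<^sup>2 * (1 + a\<^sup>2) = 1"
  using rs by (simp_all add: a_def power_divide distrib_left)

lemma Ck1: assumes "t \<in> J" shows "Ck 1 (\<omega> t)" "Ck 1 (\<omega>' t)" "Ck 1 (\<Theta>1 t)" "Ck 1 (\<Theta>2 t)"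
  using Ck_family_imp_Ck[OF _ assms] fam by blast+

lemma cont: "continuous_on (J \<times> UNIV) (\<lambda>z. \<omega> (fst z) (snd z))" "continuous_on (J \<times> UNIV) (\<lambda>z. \<omega>' (fst z) (snd z))"
  "continuous_on (J \<times> UNIV) (\<lambda>z. \<Theta>1 (fst z) (snd z))" "continuous_on (J \<times> UNIV) (\<lambda>z. \<Theta>2 (fst z) (snd z))"
  "continuous_on (J \<times> UNIV) (\<lambda>z. B (fst z) (snd z))"
  using fam[THEN Ck_family_continuous] Ck_family_wedge[OF fam(3,5)] unfolding split_def B_def by blast+

lemma scaled_J: "t \<in> J \<Longrightarrow> \<sigma> \<in> {0..1} \<Longrightarrow> \<sigma> * t \<in> J"
proof -
  assume t: "t \<in> J" and \<sigma>: "\<sigma> \<in> {0..1}"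
  have "\<bar>\<sigma> * t\<bar> \<le> 1 * \<bar>t\<bar>" unfolding abs_mult using \<sigma> by (intro mult_right_mono) auto
  then have "\<bar>\<sigma> * t\<bar> < \<delta>" using t by auto
  then show ?thesis by auto
qed

lemma cos_nz: "t \<in> J \<Longrightarrow> cos (\<omega> t x) \<noteq> 0" and sin_nz: "t \<in> J \<Longrightarrow> sin (\<omega> t x) \<noteq> 0"
  using pos(1,2)[of t x] by auto

lemma \<tau>_derivative: "t \<in> J \<Longrightarrow> ((\<lambda>t. \<tau> t x) has_vector_derivative \<omega>' t x / (cos (\<omega> t x))\<^sup>2) (at t)"
proof -
  assume t: "t \<in> J"
  have "((\<lambda>t. \<omega> t x) has_real_derivative \<omega>' t x) (at t)"
    using der(1)[OF t] by (simp add: has_real_derivative_iff_has_vector_derivative)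
  then have "((\<lambda>t. tan (\<omega> t x)) has_real_derivative inverse ((cos (\<omega> t x))\<^sup>2) * \<omega>' t x) (at t)"
    by (intro DERIV_chain2[OF DERIV_tan] cos_nz t)
  moreover have "(\<lambda>t. \<tau> t x) = (\<lambda>t. tan (\<omega> t x))" by (simp add: \<tau>_def tan_def)
  moreover have "inverse ((cos (\<omega> t x))\<^sup>2) * \<omega>' t x = \<omega>' t x / (cos (\<omega> t x))\<^sup>2"
    by (simp add: divide_inverse)
  ultimately show ?thesis by (simp only: has_real_derivative_iff_has_vector_derivative)
qed

lemma cont_quot: "continuous_on (J \<times> UNIV) (\<lambda>z. y (fst z) (snd z))"
  "continuous_on (J \<times> UNIV) (\<lambda>z. w1 (fst z) (snd z))" "continuous_on (J \<times> UNIV) (\<lambda>z. w2 (fst z) (snd z))"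
proof -
  have "continuous_on (J \<times> UNIV) (\<lambda>(t, x). y t x)"
    unfolding y_def
  proof (rule continuous_on_diff_quot[OF \<tau>_derivative _ scaled_J])
    show "continuous_on (J \<times> UNIV) (\<lambda>(t, x). \<omega>' t x / (cos (\<omega> t x))\<^sup>2)"
      unfolding split_def by (intro continuous_intros cont) (auto simp: cos_nz)
  qed
  then show "continuous_on (J \<times> UNIV) (\<lambda>z. y (fst z) (snd z))" by (simp only: split_def)
  have "continuous_on (J \<times> UNIV) (\<lambda>(t, x). w1 t x)"
    unfolding w1_def
  proof (rule continuous_on_diff_quot[OF wedge_time_derivative[OF fam(1,2,5,6) _ _ der(1,3)] _ scaled_J])
    show "continuous_on (J \<times> UNIV) (\<lambda>(t, x). wedge (\<omega>' t) (\<Theta>2 t) x + wedge (\<omega> t) (\<Theta>2' t) x)"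
      using continuous_on_add[OF Ck_family_wedge[OF fam(2,5)] Ck_family_wedge[OF fam(1,6)]]
      by (simp add: split_def)
  qed simp_all
  then show "continuous_on (J \<times> UNIV) (\<lambda>z. w1 (fst z) (snd z))" by (simp only: split_def)
  have "continuous_on (J \<times> UNIV) (\<lambda>(t, x). w2 t x)"
    unfolding w2_def
  proof (rule continuous_on_diff_quot[OF wedge_time_derivative[OF fam(3,4,1,2) _ _ der(2,1)] _ scaled_J])
    show "continuous_on (J \<times> UNIV) (\<lambda>(t, x). wedge (\<Theta>1' t) (\<omega> t) x + wedge (\<Theta>1 t) (\<omega>' t) x)"
      using continuous_on_add[OF Ck_family_wedge[OF fam(4,1)] Ck_family_wedge[OF fam(3,2)]]
      by (simp add: split_def)
  qed simp_all
  then show "continuous_on (J \<times> UNIV) (\<lambda>z. w2 (fst z) (snd z))" by (simp only: split_def)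
qed

lemma t_quot: "t * diff_quot f f' t x = f t x - f 0 x" for f f' :: "real \<Rightarrow> real \<times> real \<Rightarrow> real"
  by (simp add: diff_quot_def)

lemma dd_\<omega>_0: "dd X (\<omega> 0) x = 0"
proof -
  have "\<omega> 0 = (\<lambda>x. \<omega> 0 0)" by (rule ext) (rule init(5))
  then show ?thesis using dd_eqI[of "\<lambda>x. \<omega> 0 0" "\<lambda>_. 0" x X] has_derivative_const by metis
qed

lemma dd_\<Theta>_0: "dd X (\<Theta>1 0) x = fst X / r" "dd X (\<Theta>2 0) x = snd X / s"
proof -
  have "\<Theta>1 0 = (\<lambda>x. fst x / r)" "\<Theta>2 0 = (\<lambda>x. snd x / s)" by (rule ext, rule init(3,4))+
  then show "dd X (\<Theta>1 0) x = fst X / r" "dd X (\<Theta>2 0) x = snd X / s" by (simp_all add: dd_linear_form)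
qed

lemma t_mult: "t * w1 t x = wedge (\<omega> t) (\<Theta>2 t) x" "t * w2 t x = wedge (\<Theta>1 t) (\<omega> t) x" "t * y t x = \<tau> t x - a"
  unfolding w1_def w2_def y_def t_quot by (simp_all add: wedge_def dd_\<omega>_0 \<tau>_def init a_def)

lemma B_pos: "t \<in> J \<Longrightarrow> 0 < B t x" unfolding B_def by (rule pos(3))
lemma e_nonneg: "0 \<le> e t x" unfolding e_def by simp
lemma \<tau>_pos: "t \<in> J \<Longrightarrow> 0 < \<tau> t x" unfolding \<tau>_def using pos by simp

lemma m_pos: "t \<in> J \<Longrightarrow> 0 < m t x"
  unfolding m_def using pos[of t x] B_pos[of t x] e_nonneg[of t x]
  by (intro real_sqrt_gt_zero add_pos_nonneg) auto

lemma m_square: "t \<in> J \<Longrightarrow> (m t x)\<^sup>2 = (cos (\<omega> t x))\<^sup>2 * (sin (\<omega> t x))\<^sup>2 * (B t x)\<^sup>2 + t\<^sup>2 * e t x"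
  unfolding m_def using e_nonneg[of t x] by (simp add: real_sqrt_pow2)

lemma mB_nz: "t \<in> J \<Longrightarrow> m t x + cos (\<omega> t x) * sin (\<omega> t x) * B t x \<noteq> 0"
proof -
  assume t: "t \<in> J"
  have "0 < cos (\<omega> t x) * sin (\<omega> t x) * B t x" using pos[OF t] B_pos[OF t] by simp
  then show ?thesis using m_pos[OF t, of x] by linarith
qed

lemma cont2: "continuous_on (J \<times> UNIV) (\<lambda>z. \<tau> (fst z) (snd z))" "continuous_on (J \<times> UNIV) (\<lambda>z. e (fst z) (snd z))"
  "continuous_on (J \<times> UNIV) (\<lambda>z. m (fst z) (snd z))"
  unfolding \<tau>_def m_def e_def by (intro continuous_intros cont cont_quot; auto simp: cos_nz)+

lemma cont3: "continuous_on (J \<times> UNIV) (\<lambda>z. mu (fst z) (snd z))"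
  unfolding mu_def by (intro continuous_intros cont cont2) (auto simp: mB_nz)

lemma m_nz: "t \<in> J \<Longrightarrow> m t x \<noteq> 0" "t \<in> J \<Longrightarrow> \<tau> t x \<noteq> 0"
  using m_pos[of t x] \<tau>_pos[of t x] by auto

lemma cont4: "continuous_on (J \<times> UNIV) (\<lambda>z. R1 (fst z) (snd z))" "continuous_on (J \<times> UNIV) (\<lambda>z. R2 (fst z) (snd z))"
  unfolding R1_def R2_def by (intro continuous_intros cont cont2 cont3 cont_quot; auto simp: m_nz)+

lemma at_zero: "B 0 x = 1 / (r * (a * r))" "m 0 x = 1" "\<tau> 0 x = a" "y 0 x = \<psi> x"
    "w1 0 x = torus.du r \<psi> x / a" "w2 0 x = torus.dv s \<psi> x / a"
proof -
  have nz: "r \<noteq> 0" "s \<noteq> 0" using rs by auto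
  show B: "B 0 x = 1 / (r * (a * r))"
    unfolding B_def wedge_def dd_\<Theta>_0 using nz by (simp add: ar_eq)
  show "m 0 x = 1" unfolding m_def init B unfolding ar_eq using rs by (simp add: power_divide power_mult_distrib)
  show "\<tau> 0 x = a" unfolding \<tau>_def init a_def ..
  show "y 0 x = \<psi> x" unfolding y_def diff_quot_def \<psi>_def init by simp
  interpret torus r s using rs by unfold_locales
  have d: "dd X \<psi> x = dd X (\<omega>' 0) x / r\<^sup>2" for X
    unfolding \<psi>_def[abs_def] divide_inverse
    by (rule dd_eqI, rule has_derivative_mult_left, rule has_derivative_dd[OF Ck1_differentiable[OF Ck1(2)[OF zero_J]]])
  show "w1 0 x = torus.du r \<psi> x / a"
    unfolding w1_def diff_quot_def wedge_def dd_\<omega>_0 dd_\<Theta>_0 du_def d using nz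
    by (simp add: a_def power2_eq_square)
  show "w2 0 x = torus.dv s \<psi> x / a"
    unfolding w2_def diff_quot_def wedge_def dd_\<omega>_0 dd_\<Theta>_0 dv_def d using nz
    by (simp add: a_def power2_eq_square)
qed

lemma \<psi>_Ck1: "Ck 1 \<psi>" and \<psi>_periodic: "periodic r s \<psi>"
proof -
  show "Ck 1 \<psi>"
    using Ck1(2)[OF zero_J] unfolding \<psi>_def[abs_def] divide_inverse Ck_iff_family
    by (rule Ck_family_bounded_linear[OF bounded_linear_mult_left])
  show "periodic r s \<psi>"
    unfolding periodic_def
  proof (intro allI ballI)
    fix x l assume l: "l \<in> lattice r s"
    have "((\<lambda>t. \<omega> t (x + l)) has_vector_derivative \<omega>' 0 (x + l)) (at 0)" by (rule der(1)[OF zero_J])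
    then have "((\<lambda>t. \<omega> t x) has_vector_derivative \<omega>' 0 (x + l)) (at 0)"
    proof (rule has_vector_derivative_transform_within_open[where S=J])
      show "\<omega> t (x + l) = \<omega> t x" if "t \<in> J" for t
        using per(1)[OF that] l unfolding periodic_def by blast
    qed (use zero_J in auto)
    then have "\<omega>' 0 (x + l) = \<omega>' 0 x"
      using vector_derivative_unique_at der(1)[OF zero_J] by blast
    then show "\<psi> (x + l) = \<psi> x" by (simp add: \<psi>_def)
  qed
qed

lemma integral_B: "t \<in> J \<Longrightarrow> integral (cell r s) (B t) = 4 * pi\<^sup>2"
proof -
  assume t: "t \<in> J"
  have "integral (cell r s) (wedge (\<Theta>1 t) (\<Theta>2 t)) = 4 * pi\<^sup>2 * r * s * ((1 / r) * (1 / s) - 0 * 0)"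
    by (rule integral_wedge[OF Ck1(3)[OF t] _ Ck1(4)[OF t] _ rs(1,2)]) (use per(2,3)[OF t] in simp_all)
  then show ?thesis using rs unfolding B_def[abs_def] by simp
qed

lemma continuous_integral:
  fixes f :: "real \<Rightarrow> real \<times> real \<Rightarrow> real"
  assumes "continuous_on (J \<times> UNIV) (\<lambda>z. f (fst z) (snd z))"
  shows "continuous_on J (\<lambda>t. integral (cell r s) (f t))"
proof -
  have "continuous_on (J \<times> cell r s) (\<lambda>(t, x). f t x)"
    unfolding split_def by (rule continuous_on_subset[OF assms]) auto
  then show ?thesis by (rule integral_continuous_on_param)
qed

lemma continuous_slice:
  assumes "continuous_on (J \<times> UNIV) (\<lambda>z. f (fst z) (snd z))" "t \<in> J"
  shows "continuous_on UNIV (f t)"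
  by (rule continuous_on_slice[of J f, OF _ assms(2)]) (use assms(1) in \<open>simp add: split_def\<close>)

lemma F_derivative:
  assumes t: "t \<in> J"
  shows "dd X (F t) x =
    (of_real (cos (\<omega> t x) * dd X (\<Theta>1 t) x) * (\<i> * cis (\<Theta>1 t x)) - of_real (sin (\<omega> t x) * dd X (\<omega> t) x) * cis (\<Theta>1 t x),
     of_real (sin (\<omega> t x) * dd X (\<Theta>2 t) x) * (\<i> * cis (\<Theta>2 t x)) + of_real (cos (\<omega> t x) * dd X (\<omega> t) x) * cis (\<Theta>2 t x))"
proof -
  have F': "F t = (\<lambda>x. (of_real (cos (\<omega> t x)) * cis (\<Theta>1 t x), of_real (sin (\<omega> t x)) * cis (\<Theta>2 t x)))"
    using F[OF t] by auto
  note h = Ck1(1,3,4)[OF t, THEN Ck1_differentiable, THEN has_derivative_dd]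
  show ?thesis unfolding F'
    by (rule dd_eqI) (auto intro!: derivative_eq_intros h simp: scaleR_conv_of_real algebra_simps)
qed

text \<open>The unit normal of the product torus through the point. It is orthogonal to
  \<open>F t\<close>, but tilted against the normal of \<open>F t\<close> as soon as \<omega>
  varies; the tangential term of \<open>lower_density\<close> accounts for the tilt.\<close>

definition "nn t x = (- of_real (sin (\<omega> t x)) * cis (\<Theta>1 t x), of_real (cos (\<omega> t x)) * cis (\<Theta>2 t x))"

lemma N_derivative:
  assumes t: "t \<in> J" and g: "(g has_derivative g') (at x)"
  shows "((\<lambda>x. g x *\<^sub>R nn t x) has_derivative (\<lambda>X. g' X *\<^sub>R nn t x + g x *\<^sub>R
    (- of_real (sin (\<omega> t x) * dd X (\<Theta>1 t) x) * (\<i> * cis (\<Theta>1 t x)) - of_real (cos (\<omega> t x) * dd X (\<omega> t) x) * cis (\<Theta>1 t x),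
     of_real (cos (\<omega> t x) * dd X (\<Theta>2 t) x) * (\<i> * cis (\<Theta>2 t x)) - of_real (sin (\<omega> t x) * dd X (\<omega> t) x) * cis (\<Theta>2 t x)))) (at x)"
proof -
  note h = Ck1(1,3,4)[OF t, THEN Ck1_differentiable, THEN has_derivative_dd]
  have "(nn t has_derivative (\<lambda>X.
    (- of_real (sin (\<omega> t x) * dd X (\<Theta>1 t) x) * (\<i> * cis (\<Theta>1 t x)) - of_real (cos (\<omega> t x) * dd X (\<omega> t) x) * cis (\<Theta>1 t x),
     of_real (cos (\<omega> t x) * dd X (\<Theta>2 t) x) * (\<i> * cis (\<Theta>2 t x)) - of_real (sin (\<omega> t x) * dd X (\<omega> t) x) * cis (\<Theta>2 t x)))) (at x)"
    unfolding nn_def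
    by (auto intro!: derivative_eq_intros h simp: scaleR_conv_of_real algebra_simps)
  from has_derivative_scaleR[OF g this] show ?thesis
    by (rule has_derivative_eq_rhs) (simp add: add.commute)
qed

end

lemma cis_inner:
  "(of_real p * (\<i> * cis t) + of_real q * cis t) \<bullet> (of_real p' * (\<i> * cis t) + of_real q' * cis t) = p * p' + q * q'"
proof -
  have "(of_real p * (\<i> * cis t) + of_real q * cis t) \<bullet> (of_real p' * (\<i> * cis t) + of_real q' * cis t)
     = (p * p' + q * q') * ((sin t)\<^sup>2 + (cos t)\<^sup>2)"
    by (simp add: inner_complex_def power2_eq_square) algebra
  then show ?thesis by simp
qed

section \<open>The two constraint inequalities expanded to second order\<close>

section \<open>Expansion of the lower bound\<close>

context polar_family
begin

lemma frame_inner: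
  "(of_real p * (\<i> * cis \<alpha>) + of_real q * cis \<alpha>, of_real p2 * (\<i> * cis \<beta>) + of_real q2 * cis \<beta>)
    \<bullet> (of_real p' * (\<i> * cis \<alpha>) + of_real q' * cis \<alpha>, of_real p2' * (\<i> * cis \<beta>) + of_real q2' * cis \<beta>)
   = p * p' + q * q' + (p2 * p2' + q2 * q2')"
  by (simp only: inner_prod_def fst_conv snd_conv cis_inner)

text \<open>Real components in the orthonormal basis that moves with the two angles; inner products
  become polynomial in the components.\<close>

definition frame where
  "frame t x p q p2 q2 = (of_real p * (\<i> * cis (\<Theta>1 t x)) + of_real q * cis (\<Theta>1 t x),
     of_real p2 * (\<i> * cis (\<Theta>2 t x)) + of_real q2 * cis (\<Theta>2 t x))"

lemma frame_dot: "frame t x p q p2 q2 \<bullet> frame t x p' q' p2' q2' = p * p' + q * q' + (p2 * p2' + q2 * q2')"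
  unfolding frame_def by (rule frame_inner)

lemma F_frame: "t \<in> J \<Longrightarrow> F t x = frame t x 0 (cos (\<omega> t x)) 0 (sin (\<omega> t x))"
  using F by (simp add: frame_def)

lemma nn_frame: "g *\<^sub>R nn t x = frame t x 0 (- (g * sin (\<omega> t x))) 0 (g * cos (\<omega> t x))"
  by (simp add: frame_def nn_def scaleR_conv_of_real mult.assoc)

lemma dF_frame: "t \<in> J \<Longrightarrow> dd X (F t) x = frame t x (cos (\<omega> t x) * dd X (\<Theta>1 t) x) (- (sin (\<omega> t x) * dd X (\<omega> t) x))
    (sin (\<omega> t x) * dd X (\<Theta>2 t) x) (cos (\<omega> t x) * dd X (\<omega> t) x)"
  by (simp add: F_derivative frame_def)

lemma dN_frame:
  assumes "t \<in> J" "(g has_derivative g') (at x)"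
  shows "dd X (\<lambda>x. g x *\<^sub>R nn t x) x = frame t x (- (g x * (sin (\<omega> t x) * dd X (\<Theta>1 t) x)))
     (- (g' X * sin (\<omega> t x)) - g x * (cos (\<omega> t x) * dd X (\<omega> t) x))
     (g x * (cos (\<omega> t x) * dd X (\<Theta>2 t) x))
     (g' X * cos (\<omega> t x) - g x * (sin (\<omega> t x) * dd X (\<omega> t) x))"
  unfolding dd_eqI[OF N_derivative[OF assms]]
  by (simp add: frame_def nn_def scaleR_conv_of_real algebra_simps)

lemma sc1: "cos (\<omega> t x) * cos (\<omega> t x) + sin (\<omega> t x) * sin (\<omega> t x) = 1"
  using sin_cos_squared_add3[of "\<omega> t x"] .

lemma frame_algebra:
  fixes c n W W' A A' D D' g g1 :: real
  assumes cn: "c * c + n * n = 1"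
  shows "c * A * (c * A') + - (n * W) * - (n * W') + (n * D * (n * D') + c * W * (c * W')) = W * W' + c\<^sup>2 * (A * A') + n\<^sup>2 * (D * D')"
    and "c * A * - (g * (n * A')) + - (n * W) * (- (g1 * n) - g * (c * W')) + (n * D * (g * (c * D')) + c * W * (g1 * c - g * (n * W')))
      = W * g1 - g * (c * n) * (A * A') + g * (c * n) * (D * D')"
    and "0 * (c * A) + - (g * n) * - (n * W) + (0 * (n * D) + g * c * (c * W)) = g * W"
    and "0 * 0 + - (g * n) * - (g * n) + (0 * 0 + g * c * (g * c)) = g\<^sup>2"
    and "0 * 0 + - (g * n) * c + (0 * 0 + g * c * n) = 0"
  using cn by (algebra, algebra, algebra, algebra, simp add: algebra_simps)

lemma metric_products:
  assumes t: "t \<in> J"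
  shows "dd X (F t) x \<bullet> dd Y (F t) x = dd X (\<omega> t) x * dd Y (\<omega> t) x
    + (cos (\<omega> t x))\<^sup>2 * (dd X (\<Theta>1 t) x * dd Y (\<Theta>1 t) x) + (sin (\<omega> t x))\<^sup>2 * (dd X (\<Theta>2 t) x * dd Y (\<Theta>2 t) x)"
  unfolding dF_frame[OF t] frame_dot by (rule frame_algebra(1)[OF sc1])

lemma normal_products:
  assumes t: "t \<in> J" and g: "(g has_derivative g') (at x)"
  shows "dd X (F t) x \<bullet> dd Y (\<lambda>x. g x *\<^sub>R nn t x) x = dd X (\<omega> t) x * g' Y
      - g x * (cos (\<omega> t x) * sin (\<omega> t x)) * (dd X (\<Theta>1 t) x * dd Y (\<Theta>1 t) x)
      + g x * (cos (\<omega> t x) * sin (\<omega> t x)) * (dd X (\<Theta>2 t) x * dd Y (\<Theta>2 t) x)"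
    and "(g x *\<^sub>R nn t x) \<bullet> dd X (F t) x = g x * dd X (\<omega> t) x"
    and "(g x *\<^sub>R nn t x) \<bullet> (g x *\<^sub>R nn t x) = (g x)\<^sup>2"
    and "(g x *\<^sub>R nn t x) \<bullet> F t x = 0"
proof -
  show "dd X (F t) x \<bullet> dd Y (\<lambda>x. g x *\<^sub>R nn t x) x = dd X (\<omega> t) x * g' Y
      - g x * (cos (\<omega> t x) * sin (\<omega> t x)) * (dd X (\<Theta>1 t) x * dd Y (\<Theta>1 t) x)
      + g x * (cos (\<omega> t x) * sin (\<omega> t x)) * (dd X (\<Theta>2 t) x * dd Y (\<Theta>2 t) x)"
    unfolding dF_frame[OF t] dN_frame[OF t g] frame_dot by (rule frame_algebra(2)[OF sc1])
  show "(g x *\<^sub>R nn t x) \<bullet> dd X (F t) x = g x * dd X (\<omega> t) x"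
    unfolding dF_frame[OF t] nn_frame frame_dot by (rule frame_algebra(3)[OF sc1])
  show "(g x *\<^sub>R nn t x) \<bullet> (g x *\<^sub>R nn t x) = (g x)\<^sup>2"
    unfolding nn_frame frame_dot by (rule frame_algebra(4)[OF sc1])
  show "(g x *\<^sub>R nn t x) \<bullet> F t x = 0"
    unfolding F_frame[OF t] nn_frame frame_dot by (rule frame_algebra(5)[OF sc1])
qed

lemma \<Theta>_lattice:
  assumes t: "t \<in> J" and l: "l \<in> lattice r s"
  obtains p q :: int where "\<Theta>1 t (x + l) = \<Theta>1 t x + 2 * pi * p" "\<Theta>2 t (x + l) = \<Theta>2 t x + 2 * pi * q"
proof -
  obtain p q :: int where l': "l = (2 * pi * r * p, 2 * pi * s * q)" using l unfolding lattice_def by blast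
  have "\<Theta>1 t (x + l) - fst (x + l) / r = \<Theta>1 t x - fst x / r" "\<Theta>2 t (x + l) - snd (x + l) / s = \<Theta>2 t x - snd x / s"
    using per(2,3)[OF t] l unfolding periodic_def by blast+
  then have "\<Theta>1 t (x + l) = \<Theta>1 t x + 2 * pi * p" "\<Theta>2 t (x + l) = \<Theta>2 t x + 2 * pi * q"
    using rs by (auto simp: l' add_divide_distrib)
  then show thesis by (rule that)
qed

end

text \<open>\<open>\<zeta>\<close> perturbs the normal component of the test field, \<open>\<eta>\<close> the test function in the
  constraint; both are functions of the two angles of the torus.\<close>

locale polar_test = polar_family +
  fixes \<eta> \<eta>1 \<eta>2 \<zeta> \<zeta>1 \<zeta>2 :: "real \<times> real \<Rightarrow> real"
  assumes \<eta>: "\<And>p. (\<eta> has_derivative (\<lambda>h. \<eta>1 p * fst h + \<eta>2 p * snd h)) (at p)"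
    and \<zeta>: "\<And>p. (\<zeta> has_derivative (\<lambda>h. \<zeta>1 p * fst h + \<zeta>2 p * snd h)) (at p)"
    and cont_test: "continuous_on UNIV \<eta>1" "continuous_on UNIV \<eta>2" "continuous_on UNIV \<zeta>1" "continuous_on UNIV \<zeta>2"
    and per_test: "\<And>p (k::int) (l::int). \<eta> (p + (2 * pi * k, 2 * pi * l)) = \<eta> p"
      "\<And>p (k::int) (l::int). \<zeta> (p + (2 * pi * k, 2 * pi * l)) = \<zeta> p"
begin

definition "ang t x = (\<Theta>1 t x, \<Theta>2 t x)"
text \<open>The factor of \<open>nn\<close> in the test field. At t = 0 the field is the mean
  curvature vector, so the bound on |H|^2 is attained there.\<close>

definition "X t x = H0 + t * \<zeta> (ang t x)"
definition "NN t x = X t x *\<^sub>R nn t x"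
text \<open>At t = 0 this is the isothermal coordinate u, so the energy bound is attained; the
  \<eta>-term is periodic and leaves the periods unchanged.\<close>

definition "UU t x = r * \<Theta>1 t x + t * \<eta> (ang t x)"

text \<open>The bracket multiplying t^2 in \<open>expansion_algebra\<close>. As it is continuous up
  to t = 0, its value there decides the second variation.\<close>

definition "I t x =
  (y t x)\<^sup>2 * ((1 - a\<^sup>2) * \<tau> t x - 2 * a) * (cos (\<omega> t x))\<^sup>2 / (4 * a\<^sup>2) * B t x
   + \<zeta> (ang t x) * (cos (\<omega> t x))\<^sup>2 * y t x * (\<tau> t x + 1 / a) * B t x / 2
   - (\<zeta> (ang t x))\<^sup>2 * (cos (\<omega> t x) * sin (\<omega> t x)) * B t x / 4
   + lam * (2 * r * \<eta>1 (ang t x) * y t x + (\<eta>1 (ang t x))\<^sup>2 * \<tau> t x) * B t x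
   + X t x * (cos (\<omega> t x) * sin (\<omega> t x)) * (R1 t x - R2 t x) / 2
   - (\<zeta>1 (ang t x) * (sin (\<omega> t x))\<^sup>2 * w1 t x + \<zeta>2 (ang t x) * (cos (\<omega> t x))\<^sup>2 * w2 t x) * B t x / m t x / 2
   + (1 - (X t x)\<^sup>2 / 4) * mu t x + (X t x)\<^sup>2 * e t x / m t x / 4
   + lam * ((r + t * \<eta>1 (ang t x))\<^sup>2 * R1 t x - 2 * t * (r + t * \<eta>1 (ang t x)) * \<eta>2 (ang t x) * w1 t x * w2 t x / m t x
        + (\<eta>2 (ang t x))\<^sup>2 * (B t x / \<tau> t x + t\<^sup>2 * R2 t x))"

lemma cont_base: "continuous_on UNIV \<eta>" "continuous_on UNIV \<zeta>"
  using \<eta> \<zeta> by (auto intro!: continuous_at_imp_continuous_on has_derivative_continuous)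

lemma cont_ang: "continuous_on UNIV f \<Longrightarrow> continuous_on (J \<times> UNIV) (\<lambda>z. f (ang (fst z) (snd z)))" for f :: "real \<times> real \<Rightarrow> real"
  unfolding ang_def by (rule continuous_on_compose2[of UNIV f]) (auto intro!: continuous_intros cont)

lemma cont_X: "continuous_on (J \<times> UNIV) (\<lambda>z. X (fst z) (snd z))"
  unfolding X_def by (intro continuous_intros cont_ang cont_base)

lemma cont_I: "continuous_on (J \<times> UNIV) (\<lambda>z. I (fst z) (snd z))"
proof -
  have nz: "\<forall>z\<in>J \<times> UNIV. m (fst z) (snd z) \<noteq> 0" "\<forall>z\<in>J \<times> UNIV. \<tau> (fst z) (snd z) \<noteq> 0"
    "\<forall>z\<in>J \<times> UNIV. a \<noteq> 0" "\<forall>z\<in>J \<times> UNIV. 4 * a\<^sup>2 \<noteq> 0"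
    using m_nz a_pos by auto
  show ?thesis
    unfolding I_def
    by (intro continuous_on_add continuous_on_diff continuous_on_mult continuous_on_divide continuous_on_power
        continuous_on_const continuous_on_fst continuous_on_id continuous_on_cos continuous_on_sin
        cont cont2 cont3 cont4 cont_quot cont_X cont_ang cont_test cont_base nz) auto
qed

lemma ang_has_derivative:
  assumes t: "t \<in> J"
  shows "(ang t has_derivative (\<lambda>Z. (dd Z (\<Theta>1 t) x, dd Z (\<Theta>2 t) x))) (at x)"
  unfolding ang_def by (intro has_derivative_Pair has_derivative_dd Ck1_differentiable Ck1 t)

lemma test_derivative:
  assumes t: "t \<in> J" and f: "\<And>p. (f has_derivative (\<lambda>h. f1 p * fst h + f2 p * snd h)) (at p)"
  shows "((\<lambda>x. f (ang t x)) has_derivative (\<lambda>Z. f1 (ang t x) * dd Z (\<Theta>1 t) x + f2 (ang t x) * dd Z (\<Theta>2 t) x)) (at x)"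
  using has_derivative_compose[OF ang_has_derivative[OF t] f] by simp

lemma Ck1_test:
  assumes t: "t \<in> J" and f: "\<And>p. (f has_derivative (\<lambda>h. f1 p * fst h + f2 p * snd h)) (at p)"
    and c: "continuous_on UNIV f1" "continuous_on UNIV f2"
  shows "Ck 1 (\<lambda>x. f (ang t x))"
proof (rule Ck1_I)
  note D = test_derivative[OF t f]
  show "(\<lambda>x. f (ang t x)) differentiable at x" for x using D unfolding differentiable_def by blast
  have e: "dd Z (\<lambda>x. f (ang t x)) = (\<lambda>x. f1 (ang t x) * dd Z (\<Theta>1 t) x + f2 (ang t x) * dd Z (\<Theta>2 t) x)" for Z
    by (rule ext) (rule dd_eqI[OF D])
  have ca: "continuous_on UNIV (ang t)" unfolding ang_def[abs_def]
    by (intro continuous_on_Pair Ck_continuous[OF Ck1(3)[OF t]] Ck_continuous[OF Ck1(4)[OF t]])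
  have cc: "continuous_on UNIV (\<lambda>x. h (ang t x))" if "continuous_on UNIV h" for h :: "real \<times> real \<Rightarrow> real"
    by (rule continuous_on_compose2[OF that ca]) simp
  show "continuous_on UNIV (dd Z (\<lambda>x. f (ang t x)))" for Z
    unfolding e by (intro continuous_on_add continuous_on_mult cc c Ck1_dd_continuous Ck1 t)
qed

lemma periodic_test:
  assumes t: "t \<in> J" and f: "\<And>p (k::int) (l::int). f (p + (2 * pi * k, 2 * pi * l)) = f p"
  shows "periodic r s (\<lambda>x. f (ang t x))"
  unfolding periodic_def
proof (intro allI ballI)
  fix x l assume l: "l \<in> lattice r s"
  obtain p q :: int where "\<Theta>1 t (x + l) = \<Theta>1 t x + 2 * pi * p" "\<Theta>2 t (x + l) = \<Theta>2 t x + 2 * pi * q"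
    by (rule \<Theta>_lattice[OF t l])
  then have "ang t (x + l) = ang t x + (2 * pi * p, 2 * pi * q)" unfolding ang_def by simp
  then show "f (ang t (x + l)) = f (ang t x)" by (simp only: f)
qed

lemma X_derivative:
  assumes t: "t \<in> J"
  shows "(X t has_derivative (\<lambda>Z. t * \<zeta>1 (ang t x) * dd Z (\<Theta>1 t) x + t * \<zeta>2 (ang t x) * dd Z (\<Theta>2 t) x)) (at x)"
  unfolding X_def[abs_def]
  by (rule has_derivative_eq_rhs[OF has_derivative_add[OF has_derivative_const has_derivative_mult_right[OF test_derivative[OF t \<zeta>]]]])
    (simp add: algebra_simps)

lemma UU_derivative:
  assumes t: "t \<in> J"
  shows "dd Z (UU t) x = (r + t * \<eta>1 (ang t x)) * dd Z (\<Theta>1 t) x + t * \<eta>2 (ang t x) * dd Z (\<Theta>2 t) x"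
proof -
  have "(UU t has_derivative (\<lambda>Z. r * dd Z (\<Theta>1 t) x + t * (\<eta>1 (ang t x) * dd Z (\<Theta>1 t) x + \<eta>2 (ang t x) * dd Z (\<Theta>2 t) x))) (at x)"
    unfolding UU_def[abs_def]
    by (intro has_derivative_add has_derivative_mult_right test_derivative[OF t \<eta>] has_derivative_dd Ck1_differentiable Ck1 t)
  from dd_eqI[OF this] show ?thesis by (simp add: algebra_simps)
qed

lemma Ck1_UU: assumes t: "t \<in> J" shows "Ck 1 (UU t)"
proof -
  have "Ck_family 1 {0} (\<lambda>_ x. r * \<Theta>1 t x)" "Ck_family 1 {0} (\<lambda>_ x. t * \<eta> (ang t x))"
    by (rule Ck_family_bounded_linear[OF bounded_linear_mult_right Ck1(3)[OF t, unfolded Ck_iff_family]],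
        rule Ck_family_bounded_linear[OF bounded_linear_mult_right Ck1_test[OF t \<eta> cont_test(1,2), unfolded Ck_iff_family]])
  then show ?thesis unfolding UU_def[abs_def] Ck_iff_family by (rule Ck_family_add)
qed

lemma periodic_UU: assumes t: "t \<in> J" shows "periodic r s (\<lambda>x. UU t x - fst x)"
proof -
  have "UU t x - fst x = r * (\<Theta>1 t x - fst x / r) + t * \<eta> (ang t x)" for x
    using rs by (simp add: UU_def right_diff_distrib)
  note e = this
  show ?thesis
    unfolding periodic_def
  proof (intro allI ballI)
    fix x l assume l: "l \<in> lattice r s"
    have "\<Theta>1 t (x + l) - fst (x + l) / r = \<Theta>1 t x - fst x / r" "\<eta> (ang t (x + l)) = \<eta> (ang t x)"
      using per(2)[OF t] periodic_test[OF t per_test(1)] l unfolding periodic_def by blast+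
    then show "UU t (x + l) - fst (x + l) = UU t x - fst x" unfolding e by (simp only:)
  qed
qed

lemma Ck1_NN: assumes t: "t \<in> J" shows "Ck 1 (NN t)"
proof -
  have "Ck 1 (\<lambda>x. X t x)"
    using Ck_family_add[OF Ck_family_const[of 1 "{0}" H0] Ck_family_bounded_linear[OF bounded_linear_mult_right
        Ck1_test[OF t \<zeta> cont_test(3,4), unfolded Ck_iff_family]]] unfolding X_def Ck_iff_family .
  moreover have "Ck 1 (nn t)"
  proof -
    have hol: "sin holomorphic_on UNIV" "cos holomorphic_on UNIV" "exp holomorphic_on UNIV" by (intro holomorphic_intros)+
    have *: "Ck_family 1 {0} (\<lambda>_ x. h (of_real (f x)))" if "Ck 1 f" "h holomorphic_on UNIV" for f :: "real \<times> real \<Rightarrow> real" and h :: "complex \<Rightarrow> complex"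
      by (rule Ck_family_holomorphic[OF open_UNIV UNIV_I _ that(2)])
        (rule Ck_family_bounded_linear[OF bounded_linear_of_real that(1)[unfolded Ck_iff_family]])
    have hol': "(\<lambda>z. exp (\<i> * z)) holomorphic_on UNIV" by (intro holomorphic_intros)
    have "Ck_family 1 {0} (\<lambda>_ x. - sin (of_real (\<omega> t x)) * exp (\<i> * of_real (\<Theta>1 t x)))"
      "Ck_family 1 {0} (\<lambda>_ x. cos (of_real (\<omega> t x)) * exp (\<i> * of_real (\<Theta>2 t x)))"
      using Ck_family_bilinear[OF bounded_bilinear_mult
          Ck_family_bounded_linear[OF bounded_linear_minus[OF bounded_linear_ident] *[OF Ck1(1)[OF t] hol(1)]] *[OF Ck1(3)[OF t] hol']]
        Ck_family_bilinear[OF bounded_bilinear_mult *[OF Ck1(1)[OF t] hol(2)] *[OF Ck1(4)[OF t] hol']] by simp_all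
    note P = Ck_family_add[OF Ck_family_bounded_linear[OF bounded_linear_Pair[OF bounded_linear_ident bounded_linear_zero] this(1)]
        Ck_family_bounded_linear[OF bounded_linear_Pair[OF bounded_linear_zero bounded_linear_ident] this(2)]]
    show ?thesis
      unfolding Ck_iff_family nn_def[abs_def]
      using P by (simp add: cis_conv_exp sin_of_real cos_of_real)
  qed
  ultimately show ?thesis
    unfolding NN_def[abs_def] Ck_iff_family by (rule Ck_family_bilinear[OF bounded_bilinear_scaleR])
qed

lemma periodic_NN: assumes t: "t \<in> J" shows "periodic r s (NN t)"
  unfolding periodic_def
proof (intro allI ballI)
  fix x l assume l: "l \<in> lattice r s"
  have c: "cis (z + 2 * pi * of_int k) = cis z" for z k
    using cis_mult[of z "2 * pi * of_int k"] cis_multiple_2pi[of "of_int k"] by simp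
  obtain p q :: int where "\<Theta>1 t (x + l) = \<Theta>1 t x + 2 * pi * p" "\<Theta>2 t (x + l) = \<Theta>2 t x + 2 * pi * q"
    by (rule \<Theta>_lattice[OF t l])
  moreover have "\<omega> t (x + l) = \<omega> t x" "\<zeta> (ang t (x + l)) = \<zeta> (ang t x)"
    using per(1)[OF t] periodic_test[OF t per_test(2)] l unfolding periodic_def by blast+
  ultimately show "NN t (x + l) = NN t x" unfolding NN_def X_def nn_def by (simp only: c)
qed

text \<open>The first identity combines both bounds with weight \<open>lam\<close>; the second is
  the energy of r \<Theta>1 alone and serves the linearised constraint.\<close>

lemma densities:
  assumes t: "t \<in> J"
  shows "surface.lower_density (F t) (NN t) x + lam * conf_energy (induced_metric (F t)) (UU t) x
    = B t x / (2 * a) + 2 * lam * r * a * t * (\<eta>1 (ang t x) * B t x) + t\<^sup>2 * I t x"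
    and "conf_energy (induced_metric (F t)) (\<lambda>x. r * \<Theta>1 t x) x = r\<^sup>2 * (a * B t x + t * (y t x * B t x) + t\<^sup>2 * R1 t x)"
proof -
  interpret S: surface "F t" by (rule F_surface[OF t])
  let ?c = "cos (\<omega> t x)" and ?s = "sin (\<omega> t x)"
  let ?wu = "dd (1, 0) (\<omega> t) x" and ?wv = "dd (0, 1) (\<omega> t) x"
  let ?au = "dd (1, 0) (\<Theta>1 t) x" and ?av = "dd (0, 1) (\<Theta>1 t) x"
  let ?bu = "dd (1, 0) (\<Theta>2 t) x" and ?bv = "dd (0, 1) (\<Theta>2 t) x"
  have W: "t * w1 t x = ?wu * ?bv - ?wv * ?bu" "t * w2 t x = ?au * ?wv - ?av * ?wu" "B t x = ?au * ?bv - ?av * ?bu"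
    unfolding t_mult B_def wedge_def by (rule refl)+
  note E = metric_products[OF t, of "(1, 0)" x "(1, 0)"] and Fm = metric_products[OF t, of "(1, 0)" x "(0, 1)"]
    and G = metric_products[OF t, of "(0, 1)" x "(0, 1)"]
  note alg = lower_density_algebra[OF E Fm G W]
  note NP = normal_products[OF t X_derivative[OF t], folded NN_def]
  have m2: "S.EE x * S.GG x - (S.FF x)\<^sup>2 = (m t x)\<^sup>2"
    unfolding alg(1) m_square[OF t] e_def by (simp add: power_mult_distrib algebra_simps)
  have m: "S.mm x = m t x" unfolding S.mm_def m2 using m_pos[OF t, of x] by simp
  have N0: "(\<lambda>x. X t x *\<^sub>R nn t x) = NN t" by (rule ext) (simp add: NN_def)
  have low: "S.lower_density (NN t) x =
     - ((t * \<zeta>1 (ang t x) * (?s\<^sup>2 * (t * w1 t x) * B t x) + t * \<zeta>2 (ang t x) * (?c\<^sup>2 * (t * w2 t x) * B t x)) / m t x) / 2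
      + X t x * (?c * ?s) * ((?s\<^sup>2 * (B t x)\<^sup>2 + (t * w2 t x)\<^sup>2) / m t x - (?c\<^sup>2 * (B t x)\<^sup>2 + (t * w1 t x)\<^sup>2) / m t x) / 2
      + (1 - (X t x)\<^sup>2 / 4) * m t x + (X t x)\<^sup>2 * (?s\<^sup>2 * (t * w1 t x)\<^sup>2 + ?c\<^sup>2 * (t * w2 t x)\<^sup>2) / m t x / 4"
    unfolding S.lower_density_def m NP[unfolded N0] by (rule alg(2))
  have en: "conf_energy (induced_metric (F t)) U x = (z1\<^sup>2 * (?s\<^sup>2 * (B t x)\<^sup>2 + (t * w2 t x)\<^sup>2)
       - 2 * z1 * z2 * ((t * w1 t x) * (t * w2 t x)) + z2\<^sup>2 * (?c\<^sup>2 * (B t x)\<^sup>2 + (t * w1 t x)\<^sup>2)) / m t x"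
    if U: "\<And>Z. dd Z U x = z1 * dd Z (\<Theta>1 t) x + z2 * dd Z (\<Theta>2 t) x" for U z1 z2
    unfolding conf_energy_def S.metric S.mm_def[symmetric] m U alg(3)[symmetric] ..
  note exp = expansion_algebra[OF pos(1)[OF t] pos(2)[OF t] sin_cos_squared_add2 a_pos r_eq B_pos[OF t] m_pos[OF t]
      e_def m_square[OF t] \<tau>_def t_mult(3) H0_def lam_def X_def mu_def R1_def R2_def]
  show "S.lower_density (NN t) x + lam * conf_energy (induced_metric (F t)) (UU t) x
    = B t x / (2 * a) + 2 * lam * r * a * t * (\<eta>1 (ang t x) * B t x) + t\<^sup>2 * I t x"
    unfolding low en[OF UU_derivative[OF t]] exp(1) I_def ..
  have "dd Z (\<lambda>x. r * \<Theta>1 t x) x = r * dd Z (\<Theta>1 t) x + 0 * dd Z (\<Theta>2 t) x" for Z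
    by (rule trans[OF dd_eqI[OF has_derivative_mult_right[OF has_derivative_dd[OF Ck1_differentiable[OF Ck1(3)[OF t]]]]]]) simp
  from en[OF this] show "conf_energy (induced_metric (F t)) (\<lambda>x. r * \<Theta>1 t x) x = r\<^sup>2 * (a * B t x + t * (y t x * B t x) + t\<^sup>2 * R1 t x)"
    unfolding exp(2)[symmetric] by simp
qed

lemma continuous_energy:
  assumes t: "t \<in> J" and U: "Ck 1 U"
  shows "continuous_on UNIV (conf_energy (induced_metric (F t)) U)"
proof -
  interpret S: surface "F t" by (rule F_surface[OF t])
  have nz: "\<forall>x\<in>UNIV. sqrt (S.EE x * S.GG x - (S.FF x)\<^sup>2) \<noteq> 0" using S.det_pos by (metis less_irrefl real_sqrt_eq_zero_cancel_iff)
  show ?thesis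
    unfolding conf_energy_def[abs_def] S.metric
    by (intro continuous_intros Ck1_dd_continuous S.smooth1 U nz)
qed

text \<open>For a \<ge> 1 the multiplier is nonpositive, so the lower bound on the conformal energy
  turns into an upper bound on its multiple, which may be moved to the other side. The term linear
  in t drops out because it is the wedge of a periodic function with \<Theta>2.\<close>

lemma willmore_expansion:
  assumes t: "t \<in> J" and T: "has_teichmueller r s (induced_metric (F t)) (0, s / r)" and a1: "1 \<le> a"
  shows "pi\<^sup>2 / (r * s) + t\<^sup>2 * integral (cell r s) (I t) \<le> willmore r s (F t)"
proof -
  interpret S: surface "F t" by (rule F_surface[OF t])
  let ?E = "conf_energy (induced_metric (F t)) (UU t)"
  define A where "A = 4 * pi\<^sup>2 * r * s"
  have lam: "lam \<le> 0" unfolding lam_def using a1 by (auto intro!: divide_nonpos_nonneg simp: one_le_power)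
  have ce: "continuous_on UNIV ?E" by (rule continuous_energy[OF t Ck1_UU[OF t]])
  have "A \<le> integral (cell r s) ?E"
    unfolding A_def by (rule conf_energy_lower_bound[OF T rs(1,2) S.gpos Ck1_UU[OF t] periodic_UU[OF t] ce])
  then have 1: "lam * integral (cell r s) ?E \<le> lam * A" using lam by (rule mult_left_mono_neg)
  have nf: "NN t x \<bullet> F t x = 0" for x
    using normal_products(4)[OF t X_derivative[OF t], of x] by (simp add: NN_def)
  have 2: "integral (cell r s) (S.lower_density (NN t)) \<le> willmore r s (F t)"
    by (rule S.willmore_lower_bound[OF Ck1_NN[OF t] nf F_periodic[OF t] periodic_NN[OF t] rs(1,2)])
  note cl = S.continuous_lower_density[OF Ck1_NN[OF t]]
  have cI: "continuous_on UNIV (I t)" by (rule continuous_slice[OF cont_I t])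
  have cB: "continuous_on UNIV (B t)" by (rule continuous_slice[OF cont(5) t])
  have ceB: "continuous_on UNIV (\<lambda>x. \<eta>1 (ang t x) * B t x)"
    by (rule continuous_slice[of "\<lambda>t x. \<eta>1 (ang t x) * B t x", OF _ t])
      (intro continuous_on_mult cont_ang cont_test cont)
  have "integral (cell r s) (wedge (\<lambda>x. \<eta> (ang t x)) (\<Theta>2 t)) = 4 * pi\<^sup>2 * r * s * (0 * (1 / s) - 0 * 0)"
    by (rule integral_wedge[OF Ck1_test[OF t \<eta> cont_test(1,2)] _ Ck1(4)[OF t] _ rs(1,2)])
      (use periodic_test[OF t per_test(1)] per(3)[OF t] in simp_all)
  moreover have "wedge (\<lambda>x. \<eta> (ang t x)) (\<Theta>2 t) = (\<lambda>x. \<eta>1 (ang t x) * B t x)"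
    unfolding wedge_def[abs_def] B_def dd_eqI[OF test_derivative[OF t \<eta>]] by (simp add: fun_eq_iff wedge_def algebra_simps)
  ultimately have 3: "integral (cell r s) (\<lambda>x. \<eta>1 (ang t x) * B t x) = 0" by simp
  have "integral (cell r s) (S.lower_density (NN t)) + lam * integral (cell r s) ?E
      = integral (cell r s) (\<lambda>x. S.lower_density (NN t) x + lam * ?E x)"
    by (subst integral_add) (auto intro!: integrable_cell continuous_intros cl ce)
  also have "\<dots> = integral (cell r s) (\<lambda>x. (1 / (2 * a)) * B t x + (2 * lam * r * a * t) * (\<eta>1 (ang t x) * B t x) + t\<^sup>2 * I t x)"
    by (intro integral_cong) (simp add: densities(1)[OF t])
  also have "\<dots> = (1 / (2 * a)) * integral (cell r s) (B t) + (2 * lam * r * a * t) * integral (cell r s) (\<lambda>x. \<eta>1 (ang t x) * B t x)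
      + t\<^sup>2 * integral (cell r s) (I t)"
    by (intro integral_unique has_integral_add has_integral_mult_right integrable_integral integrable_cell cB ceB cI)
  also have "\<dots> = 2 * pi\<^sup>2 / a + t\<^sup>2 * integral (cell r s) (I t)" unfolding 3 integral_B[OF t] by simp
  finally have 4: "integral (cell r s) (S.lower_density (NN t)) + lam * integral (cell r s) ?E
     = 2 * pi\<^sup>2 / a + t\<^sup>2 * integral (cell r s) (I t)" .
  have "2 * pi\<^sup>2 / a - lam * A = pi\<^sup>2 / (r * s)"
  proof -
    have A': "A = 4 * pi\<^sup>2 * (a * r\<^sup>2)"
    proof -
      have "4 * pi\<^sup>2 * (a * r\<^sup>2) = 4 * pi\<^sup>2 * r * (a * r)" by (simp only: power2_eq_square ac_simps)
      then show ?thesis unfolding ar_eq A_def by simp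
    qed
    have "lam = (1 - a\<^sup>2) / (4 * a\<^sup>2) * (1 + a\<^sup>2)" unfolding lam_def by (simp add: power4_eq_xxxx power2_eq_square algebra_simps)
    then have "lam * A = pi\<^sup>2 * (1 - a\<^sup>2) / a * (r\<^sup>2 * (1 + a\<^sup>2))"
      unfolding A' using a_pos by (simp add: power2_eq_square)
    then have "2 * pi\<^sup>2 / a - lam * A = pi\<^sup>2 * (1 + a\<^sup>2) / a" unfolding r_eq using a_pos by (simp add: field_simps)
    also have "(1 + a\<^sup>2) = 1 / r\<^sup>2" using r_eq rs(1) by (simp add: eq_divide_eq mult.commute)
    also have "pi\<^sup>2 * (1 / r\<^sup>2) / a = pi\<^sup>2 / (r * (a * r))" by (simp add: power2_eq_square)
    also have "\<dots> = pi\<^sup>2 / (r * s)" unfolding ar_eq ..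
    finally show ?thesis .
  qed
  then show ?thesis using 1 2 4 by linarith
qed

text \<open>The energy of r \<Theta>1 is at least its value at t = 0, and after subtraction a factor
  t splits off. Since t takes both signs, the other factor must vanish at 0; this replaces
  differentiating the Teichmueller projection.\<close>

lemma constraint_expansion:
  assumes t: "t \<in> J" and T: "has_teichmueller r s (induced_metric (F t)) (0, s / r)"
  shows "0 \<le> t * (integral (cell r s) (\<lambda>x. y t x * B t x) + t * integral (cell r s) (R1 t))"
proof -
  interpret S: surface "F t" by (rule F_surface[OF t])
  let ?U = "\<lambda>x. r * \<Theta>1 t x"
  have C: "Ck 1 ?U"
    using Ck1(3)[OF t] unfolding Ck_iff_family by (rule Ck_family_bounded_linear[OF bounded_linear_mult_right])
  have "?U x - fst x = r * (\<Theta>1 t x - fst x / r)" for x using rs by (simp add: right_diff_distrib)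
  note e = this
  have p: "periodic r s (\<lambda>x. ?U x - fst x)"
    unfolding periodic_def
  proof (intro allI ballI)
    fix x l assume l: "l \<in> lattice r s"
    have "\<Theta>1 t (x + l) - fst (x + l) / r = \<Theta>1 t x - fst x / r"
      using per(2)[OF t] l unfolding periodic_def by blast
    then show "?U (x + l) - fst (x + l) = ?U x - fst x" unfolding e by (simp only:)
  qed
  have cB: "continuous_on UNIV (B t)" by (rule continuous_slice[OF cont(5) t])
  have cR: "continuous_on UNIV (R1 t)" by (rule continuous_slice[OF cont4(1) t])
  have cy: "continuous_on UNIV (\<lambda>x. y t x * B t x)"
    by (intro continuous_on_mult continuous_slice[OF cont_quot(1) t] cB)
  have A: "4 * pi\<^sup>2 * r * s = 4 * pi\<^sup>2 * (a * r\<^sup>2)"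
  proof -
    have "4 * pi\<^sup>2 * (a * r\<^sup>2) = 4 * pi\<^sup>2 * r * (a * r)" by (simp only: power2_eq_square ac_simps)
    then show ?thesis unfolding ar_eq by simp
  qed
  have "4 * pi\<^sup>2 * r * s \<le> integral (cell r s) (conf_energy (induced_metric (F t)) ?U)"
    by (rule conf_energy_lower_bound[OF T rs(1,2) S.gpos C p continuous_energy[OF t C]])
  also have "conf_energy (induced_metric (F t)) ?U = (\<lambda>x. r\<^sup>2 * (a * B t x + t * (y t x * B t x) + t\<^sup>2 * R1 t x))"
    by (rule ext) (rule densities(2)[OF t])
  also have "integral (cell r s) \<dots> = r\<^sup>2 * (a * integral (cell r s) (B t) + t * integral (cell r s) (\<lambda>x. y t x * B t x) + t\<^sup>2 * integral (cell r s) (R1 t))"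
    by (intro integral_unique has_integral_add has_integral_mult_right integrable_integral integrable_cell cB cR cy)
  finally have "r\<^sup>2 * 0 \<le> r\<^sup>2 * (t * integral (cell r s) (\<lambda>x. y t x * B t x) + t\<^sup>2 * integral (cell r s) (R1 t))"
    unfolding integral_B[OF t] A by (simp add: algebra_simps)
  then have "0 \<le> t * integral (cell r s) (\<lambda>x. y t x * B t x) + t\<^sup>2 * integral (cell r s) (R1 t)"
    using rs(1) by (subst (asm) mult_le_cancel_left_pos) auto
  then show ?thesis by (simp add: power2_eq_square algebra_simps)
qed

lemma I_zero:
  "I 0 x = (let p = (fst x / r, snd x / s) in
    (1 / (r * (a * r))) * (r\<^sup>2 / (4 * a) * ((torus.du r \<psi> x)\<^sup>2 + (torus.dv s \<psi> x)\<^sup>2) - (\<psi> x)\<^sup>2 / (4 * a) + \<zeta> p * \<psi> x / (2 * a)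
       - (\<zeta> p)\<^sup>2 * r\<^sup>2 * a / 4 - r\<^sup>2 / 2 * (a * \<zeta>1 p * torus.du r \<psi> x + \<zeta>2 p * torus.dv s \<psi> x / a)
       + lam * (2 * r * \<eta>1 p * \<psi> x + a * (\<eta>1 p)\<^sup>2 + (\<eta>2 p)\<^sup>2 / a)))"
proof -
  have ang: "ang 0 x = (fst x / r, snd x / s)" by (simp add: ang_def init)
  have X0: "X 0 x = H0" by (simp add: X_def)
  have m0: "m 0 x + r * (a * r) * (1 / (r * (a * r))) = 2" using a_pos rs by (simp add: at_zero)
  have mu0: "mu 0 x = e 0 x / 2" unfolding mu_def init at_zero(1) using m0 by (simp add: ar_eq)
  have e0: "e 0 x = (a * r)\<^sup>2 * (torus.du r \<psi> x / a)\<^sup>2 + r\<^sup>2 * (torus.dv s \<psi> x / a)\<^sup>2"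
    unfolding e_def init at_zero ar_eq ..
  have R: "R1 0 x = (torus.dv s \<psi> x / a)\<^sup>2 - a * (1 / (r * (a * r))) * (e 0 x / 2)"
    "R2 0 x = (torus.du r \<psi> x / a)\<^sup>2 - (1 / (r * (a * r))) / a * (e 0 x / 2)"
    unfolding R1_def R2_def mu0 at_zero by simp_all
  note sv = second_variation_algebra[OF a_pos rs(1) r_eq lam_def H0_def refl refl refl e0 R, of "\<psi> x" "\<zeta> (fst x / r, snd x / s)"
      "\<eta>1 (fst x / r, snd x / s)" "\<zeta>1 (fst x / r, snd x / s)" "\<zeta>2 (fst x / r, snd x / s)" "\<eta>2 (fst x / r, snd x / s)"]
  have s0: "sin (\<omega> 0 x) = a * r" using init(2) ar_eq by simp
  show ?thesis
    unfolding Let_def sv[symmetric] I_def ang X0 mu0 at_zero s0 init(1)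
    by (simp only: mult_zero_left mult_zero_right add_0_right diff_zero zero_power2 div_by_1 mult_1 power_one mult_1_right)
qed

end

section \<open>Second derivatives from one-sided bounds; averages against trigonometric test
  functions\<close>

section \<open>Second derivatives and trigonometric test functions\<close>

lemma second_derivative_local_min:
  fixes f f' :: "real \<Rightarrow> real"
  assumes d: "0 < \<delta>" "\<And>t. \<bar>t\<bar> < \<delta> \<Longrightarrow> (f has_real_derivative f' t) (at t)" "(f' has_real_derivative l) (at 0)"
    and m: "\<And>t. \<bar>t\<bar> < \<delta> \<Longrightarrow> f 0 \<le> f t"
  shows "f' 0 = 0" "0 \<le> l"
proof -
  show f0: "f' 0 = 0" by (rule DERIV_local_min[OF d(2) d(1)]) (use d(1) m in auto)
  show "0 \<le> l"
  proof (rule ccontr)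
    assume "\<not> 0 \<le> l"
    then obtain e where e: "0 < e" "\<And>h. 0 < h \<Longrightarrow> h < e \<Longrightarrow> f' h < 0"
      using DERIV_neg_dec_right[OF d(3)] f0 by fastforce
    define h where "h = min e \<delta> / 2"
    have h: "0 < h" "h < e" "h < \<delta>" using e(1) d(1) by (auto simp: h_def min_def)
    have "f h < f 0"
    proof (rule DERIV_neg_imp_decreasing_open[OF h(1)])
      show "\<exists>y. (f has_real_derivative y) (at x) \<and> y < 0" if "0 < x" "x < h" for x
        using d(2)[of x] e(2)[of x] that h by auto
      show "continuous_on {0..h} f"
        by (intro continuous_at_imp_continuous_on ballI DERIV_isCont[OF d(2)]) (use h in auto)
    qed
    then show False using m[of h] h by auto
  qed
qed

text \<open>Subtracting (C 0 - e) t^2 from \<open>W\<close> leaves a local minimum at 0, as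
  \<open>C\<close> is continuous there. The first order condition and the second order bound come
  out together, without derivatives of \<open>C\<close>.\<close>

lemma second_derivative_lower_bound:
  fixes W W' C :: "real \<Rightarrow> real"
  assumes d: "0 < \<delta>" "\<And>t. \<bar>t\<bar> < \<delta> \<Longrightarrow> (W has_real_derivative W' t) (at t)" "(W' has_real_derivative l) (at 0)"
    and b: "\<And>t. \<bar>t\<bar> < \<delta> \<Longrightarrow> W 0 + t\<^sup>2 * C t \<le> W t" and C: "isCont C 0"
  shows "W' 0 = 0" "2 * C 0 \<le> l"
proof -
  have *: "W' 0 = 0 \<and> 2 * (C 0 - e) \<le> l" if e: "0 < e" for e
  proof -
    obtain d1 where d1: "0 < d1" "\<And>t. \<bar>t\<bar> < d1 \<Longrightarrow> \<bar>C t - C 0\<bar> < e"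
      using C e unfolding continuous_at_eps_delta by (auto simp: dist_real_def)
    let ?f = "\<lambda>t. W t - (C 0 - e) * t\<^sup>2" and ?f' = "\<lambda>t. W' t - (C 0 - e) * (2 * t)"
    have 1: "0 < min \<delta> d1" using d(1) d1 by simp
    have 2: "(?f has_real_derivative ?f' t) (at t)" if "\<bar>t\<bar> < min \<delta> d1" for t
      using d(2)[of t] that by (auto intro!: derivative_eq_intros)
    have 3: "(?f' has_real_derivative l - (C 0 - e) * 2) (at 0)" using d(3) by (auto intro!: derivative_eq_intros)
    have 4: "?f 0 \<le> ?f t" if t: "\<bar>t\<bar> < min \<delta> d1" for t
    proof -
      have "C 0 - e \<le> C t" using d1(2)[of t] t by auto
      then have "t\<^sup>2 * (C 0 - e) \<le> t\<^sup>2 * C t" by (rule mult_left_mono) simp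
      then show ?thesis using b[of t] t by (simp add: mult.commute)
    qed
    show ?thesis using second_derivative_local_min[OF 1 2 3 4] by simp
  qed
  show "W' 0 = 0" using *[of 1] by simp
  show "2 * C 0 \<le> l"
  proof (rule field_le_epsilon)
    fix e :: real assume "0 < e" then show "2 * C 0 \<le> l + e" using *[of "e / 2"] by (simp add: algebra_simps)
  qed
qed

lemma second_deriv_eq:
  fixes W W' :: "real \<Rightarrow> real"
  assumes "0 < \<delta>" "\<And>t. \<bar>t\<bar> < \<delta> \<Longrightarrow> (W has_real_derivative W' t) (at t)" "(W' has_real_derivative l) (at 0)"
  shows "(deriv ^^ 2) W 0 = l"
proof -
  have "eventually (\<lambda>t. t \<in> ball 0 \<delta>) (nhds (0::real))" using assms(1) by (intro eventually_nhds_in_open) auto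
  then have "eventually (\<lambda>t. deriv W t = W' t) (nhds 0)"
    by (rule eventually_mono) (use assms(2) in \<open>auto intro: DERIV_imp_deriv\<close>)
  then have "deriv (deriv W) 0 = deriv W' 0" by (rule deriv_cong_ev) simp
  then show ?thesis using DERIV_imp_deriv[OF assms(3)] by (simp add: numeral_2_eq_2)
qed

text \<open>The arguments are the two angles themselves, not points of the torus as for
  \<open>mode\<close>, because the test functions are composed with the moving angles of
  \<open>F t\<close>.\<close>

definition wave :: "(int \<times> int) set \<Rightarrow> (int \<times> int \<Rightarrow> complex) \<Rightarrow> real \<times> real \<Rightarrow> real" where
  "wave S d p = (\<Sum>q\<in>S. Re (d q * cis (of_int (fst q) * fst p + of_int (snd q) * snd p)))"

lemma wave_derivative:
  "(wave S d has_derivative (\<lambda>h. wave S (\<lambda>q. \<i> * of_int (fst q) * d q) p * fst h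
      + wave S (\<lambda>q. \<i> * of_int (snd q) * d q) p * snd h)) (at p)"
proof -
  let ?L = "\<lambda>q p. of_int (fst q) * fst p + of_int (snd q) * snd (p :: real \<times> real)"
  have "((\<lambda>p. Re (d q * cis (?L q p))) has_derivative (\<lambda>h. Re (d q * (?L q h *\<^sub>R (\<i> * cis (?L q p)))))) (at p)" for q
    by (rule bounded_linear.has_derivative[OF bounded_linear_Re], rule has_derivative_mult_right,
        rule has_derivative_cis) (auto intro!: derivative_eq_intros)
  then have "(wave S d has_derivative (\<lambda>h. \<Sum>q\<in>S. Re (d q * (?L q h *\<^sub>R (\<i> * cis (?L q p)))))) (at p)"
    unfolding wave_def[abs_def] by (intro has_derivative_sum)
  moreover have "(\<lambda>h. \<Sum>q\<in>S. Re (d q * (?L q h *\<^sub>R (\<i> * cis (?L q p)))))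
    = (\<lambda>h. wave S (\<lambda>q. \<i> * of_int (fst q) * d q) p * fst h + wave S (\<lambda>q. \<i> * of_int (snd q) * d q) p * snd h)"
    by (rule ext) (simp add: wave_def sum_distrib_right flip: sum.distrib, rule sum.cong, simp_all add: algebra_simps)
  ultimately show ?thesis by simp
qed

lemma continuous_wave: "continuous_on UNIV (wave S d)"
  using wave_derivative[of S d] by (auto intro!: continuous_at_imp_continuous_on has_derivative_continuous)

lemma wave_periodic: "wave S d (p + (2 * pi * of_int k, 2 * pi * of_int l)) = wave S d p"
proof -
  have "cis (of_int (fst q) * (fst p + 2 * pi * of_int k) + of_int (snd q) * (snd p + 2 * pi * of_int l))
     = cis (of_int (fst q) * fst p + of_int (snd q) * snd p)" for q :: "int \<times> int"
  proof -
    have "of_int (fst q) * (fst p + 2 * pi * of_int k) + of_int (snd q) * (snd p + 2 * pi * of_int l)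
       = (of_int (fst q) * fst p + of_int (snd q) * snd p) + 2 * pi * of_int (fst q * k + snd q * l)"
      by (simp add: algebra_simps)
    then show ?thesis using cis_multiple_2pi[of "of_int (fst q * k + snd q * l)"] by (simp flip: cis_mult)
  qed
  then show ?thesis unfolding wave_def by simp
qed

context torus
begin

definition has_avg :: "(real \<times> real \<Rightarrow> real) \<Rightarrow> real \<Rightarrow> bool" where
  "has_avg f m \<longleftrightarrow> continuous_on UNIV f \<and> avg f = m"

lemma has_avg_add: "has_avg f m \<Longrightarrow> has_avg g n \<Longrightarrow> has_avg (\<lambda>x. f x + g x) (m + n)"
  unfolding has_avg_def by (auto simp: avg_add intro: continuous_intros)

lemma has_avg_mult: "has_avg f m \<Longrightarrow> has_avg (\<lambda>x. c * f x) (c * m)"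
  unfolding has_avg_def by (auto simp: avg_mult intro: continuous_intros)

lemma has_avg_avg: "continuous_on UNIV f \<Longrightarrow> has_avg f (avg f)"
  unfolding has_avg_def by simp

definition pw where "pw S d x = wave S d (fst x / r, snd x / s)"

lemma pw_mode: "pw S d x = (\<Sum>q\<in>S. Re (d q * mode q x))"
  by (simp add: pw_def wave_def mode_def)

lemma continuous_pw: "continuous_on UNIV (pw S d)"
  unfolding pw_mode[abs_def] by (intro continuous_intros continuous_mode)

lemma coeff_uminus: "coeff f (- p) = cnj (coeff f p)"
proof -
  have "cnj (integral (cell r s) (\<lambda>x. of_real (f x) * cnj (mode p x))) = integral (cell r s) (\<lambda>x. cnj (of_real (f x) * cnj (mode p x)))"
    by (rule integral_cnj)
  then show ?thesis unfolding coeff_def by (simp add: mode_minus)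
qed

lemma has_avg_pw:
  assumes f: "continuous_on UNIV f"
  shows "has_avg (\<lambda>x. f x * pw S d x) (\<Sum>q\<in>S. Re (d q * cnj (coeff f q)))"
proof -
  have 1: "has_avg (\<lambda>x. f x * Re (d q * mode q x)) (Re (d q * cnj (coeff f q)))" for q
    unfolding has_avg_def
  proof
    show "continuous_on UNIV (\<lambda>x. f x * Re (d q * mode q x))" by (intro continuous_intros f continuous_mode)
    have i: "(\<lambda>x. of_real (f x) * mode q x) integrable_on cell r s"
      by (intro integrable_cell continuous_intros f continuous_mode)
    have "integral (cell r s) (\<lambda>x. f x * Re (d q * mode q x)) = integral (cell r s) (\<lambda>x. Re (d q * (of_real (f x) * mode q x)))"
      by (rule integral_cong) (simp add: algebra_simps)
    also have "\<dots> = Re (integral (cell r s) (\<lambda>x. d q * (of_real (f x) * mode q x)))"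
      by (rule integral_linear[OF _ bounded_linear_Re, unfolded o_def]) (intro integrable_cell continuous_intros f continuous_mode)
    also have "\<dots> = Re (d q * integral (cell r s) (\<lambda>x. of_real (f x) * mode q x))" by simp
    also have "(\<lambda>x. of_real (f x) * mode q x) = (\<lambda>x. of_real (f x) * cnj (mode (- q) x))" by (simp add: mode_minus)
    also have "integral (cell r s) \<dots> = of_real area * coeff f (- q)" using area_pos by (simp add: coeff_def)
    finally show "avg (\<lambda>x. f x * Re (d q * mode q x)) = Re (d q * cnj (coeff f q))"
      using area_pos unfolding avg_def coeff_uminus mult.left_commute[of "d q"] by simp
  qed
  show ?thesis
  proof (cases "finite S")
    case True
    then show ?thesis unfolding pw_mode[abs_def]
    proof (induction S rule: finite_induct)
      case empty then show ?case by (simp add: has_avg_def avg_def)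
    next
      case (insert q S)
      then show ?case using has_avg_add[OF 1[of q] insert.IH] by (simp add: distrib_left)
    qed
  next
    case False then show ?thesis unfolding pw_mode[abs_def] by (simp add: has_avg_def avg_def)
  qed
qed

text \<open>A real part contributes half of the mode and half of its conjugate; the condition on
  \<open>p + q\<close> says that no conjugate falls back onto the mode in question.\<close>

lemma coeff_pw:
  assumes S: "finite S" "p \<in> S" "\<And>q. q \<in> S \<Longrightarrow> p + q \<noteq> 0"
  shows "coeff (pw S d) p = d p / 2"
proof -
  have "of_real (pw S d x) * cnj (mode p x) = (\<Sum>q\<in>S. (d q / 2) * mode (q - p) x + (cnj (d q) / 2) * mode (- (p + q)) x)" for x
  proof -
    have "of_real (Re (d q * mode q x)) * cnj (mode p x) = (d q / 2) * mode (q - p) x + (cnj (d q) / 2) * mode (- (p + q)) x" for q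
    proof -
      have "of_real (Re (d q * mode q x)) = (d q * mode q x + cnj (d q * mode q x)) / 2" by (simp add: complex_eq_iff)
      then show ?thesis by (simp add: mode_minus mode_add mode_cnj[symmetric] algebra_simps add_divide_distrib)
    qed
    then show ?thesis unfolding pw_mode of_real_sum sum_distrib_right by simp
  qed
  then have "integral (cell r s) (\<lambda>x. of_real (pw S d x) * cnj (mode p x))
     = (\<Sum>q\<in>S. (d q / 2) * integral (cell r s) (mode (q - p)) + (cnj (d q) / 2) * integral (cell r s) (mode (- (p + q))))"
    by (simp only:) (intro integral_unique has_integral_sum has_integral_add has_integral_mult_right integrable_integral
        integrable_cell continuous_mode S(1))
  also have "\<dots> = (\<Sum>q\<in>S. if q = p then (d p / 2) * of_real area else 0)"
  proof (rule sum.cong)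
    fix q assume "q \<in> S"
    then have "- (p + q) \<noteq> 0" using S(3) by (metis neg_equal_0_iff_equal)
    then show "(d q / 2) * integral (cell r s) (mode (q - p)) + (cnj (d q) / 2) * integral (cell r s) (mode (- (p + q)))
       = (if q = p then (d p / 2) * of_real area else 0)" unfolding integral_mode by auto
  qed simp
  also have "\<dots> = (d p / 2) * of_real area" using S(1,2) by (simp add: sum.delta)
  finally show ?thesis using area_pos unfolding coeff_def by simp
qed

lemma has_avg_pw_square:
  assumes S: "finite S" "\<And>p q. p \<in> S \<Longrightarrow> q \<in> S \<Longrightarrow> p + q \<noteq> 0"
  shows "has_avg (\<lambda>x. (pw S d x)\<^sup>2) (\<Sum>q\<in>S. (cmod (d q))\<^sup>2 / 2)"
proof -
  have "(\<Sum>q\<in>S. Re (d q * cnj (coeff (pw S d) q))) = (\<Sum>q\<in>S. (cmod (d q))\<^sup>2 / 2)"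
  proof (rule sum.cong)
    fix q assume "q \<in> S"
    then have "coeff (pw S d) q = d q / 2" using coeff_pw S by blast
    moreover have "Re (z * cnj (z / 2)) = (cmod z)\<^sup>2 / 2" for z
      by (simp only: cmod_power2) (simp add: power2_eq_square add_divide_distrib)
    ultimately show "Re (d q * cnj (coeff (pw S d) q)) = (cmod (d q))\<^sup>2 / 2" by (simp only:)
  qed simp
  then show ?thesis using has_avg_pw[OF continuous_pw, of S d S d] by (simp add: power2_eq_square)
qed

end

section \<open>Nonnegativity of the second variation and stability for 1/2 \<le> r \<le> s\<close>

section \<open>Stability\<close>

text \<open>The identities treat the modes (1, 0), (0, 1) and (1, \<plusminus>1); the factor 2 in
  front counts a mode and its negative. The values inserted are the stationary points of the
  quadratic polynomials in the free Fourier coefficients, for instance y = -2r/a for 2 r y + a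
  y^2/2. That the totals vanish reflects the Moebius invariance of the energy and of the conformal
  class.\<close>

lemma second_variation_gains:
  fixes a q A A' C :: real
  assumes a: "0 < a" and q: "q * (1 + a\<^sup>2) = 1" and r: "r\<^sup>2 = q" "0 < r"
    and L: "L = (1 - a ^ 4) / (4 * a\<^sup>2)"
  shows "q / (4 * a) * (2 * (1 - (1 + a\<^sup>2))) + (2 / a\<^sup>2) / (2 * a) - q * a / 4 * ((2 / a\<^sup>2)\<^sup>2 / 2) - q / 2 * (a * (2 / a\<^sup>2))
      + L * (2 * r * (- 2 * r / a) + a * ((- 2 * r / a)\<^sup>2 / 2)) = 0" (is ?A)
    and "q / (4 * a) * (2 * (1 - (1 + a\<^sup>2))) + 2 / (2 * a) - q * a / 4 * (2\<^sup>2 / 2) - q / 2 * (2 / a) = 0" (is ?B)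
    and "q / (4 * a) * (2 * (2 - (1 + a\<^sup>2))) + L * (2 * r * (- 2 * r / (a + 1 / a))
      + a * ((- 2 * r / (a + 1 / a))\<^sup>2 / 2) + (- 2 * r / (a + 1 / a))\<^sup>2 / 2 / a) = 0" (is ?C)
proof -
  have Q: "1 + a\<^sup>2 \<noteq> 0" using a by (metis add_pos_nonneg zero_le_power2 zero_less_one less_irrefl)
  have q': "q = 1 / (1 + a\<^sup>2)" using q Q by (simp add: eq_divide_eq)
  have L': "L = (1 - a\<^sup>2) * (1 + a\<^sup>2) / (4 * a\<^sup>2)" unfolding L by (simp add: power4_eq_xxxx power2_eq_square algebra_simps)
  have LQ: "L * q = (1 - a\<^sup>2) / (4 * a\<^sup>2)"
  proof -
    have "L * q = (1 - a\<^sup>2) / (4 * a\<^sup>2) * (q * (1 + a\<^sup>2))" unfolding L' by simp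
    then show ?thesis unfolding q by simp
  qed
  have x10: "2 * r * (- 2 * r / a) + a * ((- 2 * r / a)\<^sup>2 / 2) = q * (- 2 / a)"
    unfolding r(1)[symmetric] using a by (simp add: power2_eq_square field_simps)
  have w: "a + 1 / a = (1 + a\<^sup>2) / a" using a by (simp add: power2_eq_square field_simps)
  have nz: "a + 1 / a \<noteq> 0" unfolding w using a Q by simp
  have "2 * r * (- 2 * r / z) + a * ((- 2 * r / z)\<^sup>2 / 2) + (- 2 * r / z)\<^sup>2 / 2 / a = q * (- 2 / z)"
    if z: "z \<noteq> 0" "z = a + 1 / a" for z
  proof -
    have "a * ((- 2 * r / z)\<^sup>2 / 2) + (- 2 * r / z)\<^sup>2 / 2 / a = (a + 1 / a) * ((- 2 * r / z)\<^sup>2 / 2)" by (simp add: distrib_right)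
    also have "\<dots> = 2 * r\<^sup>2 / z" unfolding z(2)[symmetric] using z(1) by (simp add: power2_eq_square)
    finally have e: "a * ((- 2 * r / z)\<^sup>2 / 2) + (- 2 * r / z)\<^sup>2 / 2 / a = 2 * r\<^sup>2 / z" .
    have e': "2 * r * (- 2 * r / z) = - 4 * r\<^sup>2 / z" by (simp add: power2_eq_square)
    show ?thesis unfolding add.assoc e e' r(1)[symmetric] by (simp add: power2_eq_square)
  qed
  note x11 = this[OF nz refl]
  have eA: "L * (q * (- 2 / a)) = (1 - a\<^sup>2) / (4 * a\<^sup>2) * (- 2 / a)" using LQ by (simp only: mult.assoc[symmetric])
  show ?A unfolding x10 eA unfolding q' using a Q
    by (simp add: divide_simps) (simp add: eval_nat_numeral algebra_simps)
  show ?B unfolding q' using a Q by (simp add: divide_simps) (simp add: eval_nat_numeral algebra_simps)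
  have eC: "L * (q * (- 2 / (a + 1 / a))) = (1 - a\<^sup>2) / (4 * a\<^sup>2) * (- 2 * a / (1 + a\<^sup>2))"
    unfolding w using LQ a by (simp only: mult.assoc[symmetric]) simp
  show ?C unfolding x11 eC unfolding q' using a Q
    by (simp add: divide_simps) (simp add: eval_nat_numeral algebra_simps)
qed

context torus
begin

text \<open>The factor -\<i> cancels the \<i> of differentiation: what enters is the gradient of
  \<eta>, whose Fourier coefficients have to be real multiples of those of \<open>f\<close>.\<close>

definition test_coeff :: "real \<Rightarrow> (real \<times> real \<Rightarrow> real) \<Rightarrow> int \<times> int \<Rightarrow> complex" where
  "test_coeff a f q = - \<i> * of_real (if q = (1, 0) then - 2 * r / a else - 2 * r / (a + 1 / a)) * coeff f q"

definition normal_coeff :: "real \<Rightarrow> (real \<times> real \<Rightarrow> real) \<Rightarrow> int \<times> int \<Rightarrow> complex" where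
  "normal_coeff a f q = of_real (if q = (1, 0) then 2 / a\<^sup>2 else 2) * coeff f q"

abbreviation "test_modes \<equiv> {(1, 0), (1, 1), (1, - 1)} :: (int \<times> int) set"
abbreviation "normal_modes \<equiv> {(1, 0), (0, 1)} :: (int \<times> int) set"

text \<open>Completing squares in the modes \<open>(1, 0)\<close>, \<open>(0, 1)\<close>, \<open>(1, \<plusminus>1)\<close> with the coefficients above exactly
  cancels their contribution to the second variation.\<close>

lemma second_variation_nonneg:
  assumes f: "Ck 1 f" "periodic r s f" and mean: "coeff f (0, 0) = 0"
    and a: "0 < a" and r1: "r\<^sup>2 * (1 + a\<^sup>2) = 1" and a3: "a\<^sup>2 \<le> 3" and L: "L = (1 - a ^ 4) / (4 * a\<^sup>2)"
  shows "0 \<le> avg (\<lambda>x. r\<^sup>2 / (4 * a) * ((du f x)\<^sup>2 + (dv f x)\<^sup>2) - (f x)\<^sup>2 / (4 * a)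
       + pw normal_modes (normal_coeff a f) x * f x / (2 * a)
       - (pw normal_modes (normal_coeff a f) x)\<^sup>2 * r\<^sup>2 * a / 4
       - r\<^sup>2 / 2 * (a * pw normal_modes (\<lambda>q. \<i> * of_int (fst q) * normal_coeff a f q) x * du f x
          + pw normal_modes (\<lambda>q. \<i> * of_int (snd q) * normal_coeff a f q) x * dv f x / a)
       + L * (2 * r * pw test_modes (\<lambda>q. \<i> * of_int (fst q) * test_coeff a f q) x * f x
          + a * (pw test_modes (\<lambda>q. \<i> * of_int (fst q) * test_coeff a f q) x)\<^sup>2
          + (pw test_modes (\<lambda>q. \<i> * of_int (snd q) * test_coeff a f q) x)\<^sup>2 / a))"
proof -
  define q where "q = r\<^sup>2"
  have q0: "0 < q" using rs by (simp add: q_def)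
  define x y z where "x = 2 / a\<^sup>2" and "y = - 2 * r / a" and "z = - 2 * r / (a + 1 / a)"
  define A A' C D where "A = (cmod (coeff f (1, 0)))\<^sup>2" and "A' = (cmod (coeff f (0, 1)))\<^sup>2"
    and "C = (cmod (coeff f (1, 1)))\<^sup>2" and "D = (cmod (coeff f (1, - 1)))\<^sup>2"
  note gains = second_variation_gains[OF a r1[folded q_def] q_def[symmetric] rs(1) L, folded x_def y_def z_def]
  have cf: "continuous_on UNIV f" by (rule Ck_continuous[OF f(1)])
  have cd: "continuous_on UNIV (du f)" "continuous_on UNIV (dv f)"
    unfolding du_def[abs_def] dv_def[abs_def] by (intro continuous_intros Ck1_dd_continuous f)+
  have Re_sq: "Re (of_real c * w * cnj w) = c * (cmod w)\<^sup>2" for c w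
    by (simp only: cmod_power2) (simp add: power2_eq_square algebra_simps)
  have Re_i: "Re (\<i> * m * (of_real c * w) * cnj (\<i> * m * w)) = c * (cmod (m * w))\<^sup>2" for c m w
    by (simp only: cmod_power2) (simp add: power2_eq_square algebra_simps)
  define N N1 N2 T1 T2 where "N = pw normal_modes (normal_coeff a f)"
    and "N1 = pw normal_modes (\<lambda>q. \<i> * of_int (fst q) * normal_coeff a f q)"
    and "N2 = pw normal_modes (\<lambda>q. \<i> * of_int (snd q) * normal_coeff a f q)"
    and "T1 = pw test_modes (\<lambda>q. \<i> * of_int (fst q) * test_coeff a f q)"
    and "T2 = pw test_modes (\<lambda>q. \<i> * of_int (snd q) * test_coeff a f q)"
  have nm: "p + q \<noteq> 0" if "p \<in> normal_modes" "q \<in> normal_modes" for p q :: "int \<times> int"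
    using that by (auto simp: zero_prod_def)
  have tm: "p + q \<noteq> 0" if "p \<in> test_modes" "q \<in> test_modes" for p q :: "int \<times> int"
    using that by (auto simp: zero_prod_def)
  have h1: "has_avg (\<lambda>t. f t * N t) (x * A + 2 * A')"
    using has_avg_pw[OF cf, of normal_modes "normal_coeff a f"]
    unfolding normal_coeff_def Re_sq by (simp add: N_def normal_coeff_def[abs_def] x_def A_def A'_def)
  have h2: "has_avg (\<lambda>t. (N t)\<^sup>2) (x\<^sup>2 / 2 * A + 2\<^sup>2 / 2 * A')"
    using has_avg_pw_square[OF _ nm, where S = normal_modes and d = "normal_coeff a f"]
    by (simp add: N_def normal_coeff_def norm_mult power_mult_distrib norm_divide norm_power x_def A_def A'_def power_divide)
  have h3: "has_avg (\<lambda>t. du f t * N1 t) (x * A)"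
    using has_avg_pw[OF cd(1), of normal_modes "\<lambda>q. \<i> * of_int (fst q) * normal_coeff a f q"]
    unfolding coeff_derivative[OF f] normal_coeff_def Re_i
    by (simp add: N1_def normal_coeff_def[abs_def] x_def A_def)
  have h4: "has_avg (\<lambda>t. dv f t * N2 t) (2 * A')"
    using has_avg_pw[OF cd(2), of normal_modes "\<lambda>q. \<i> * of_int (snd q) * normal_coeff a f q"]
    unfolding coeff_derivative[OF f] normal_coeff_def Re_i
    by (simp add: N2_def normal_coeff_def[abs_def] x_def A'_def)
  have ii: "\<i> * m * (- \<i> * c * w) = m * c * w" for m c w :: complex by (simp add: complex_eq_iff algebra_simps)
  have tc: "\<i> * of_int (fst q) * test_coeff a f q = of_real (of_int (fst q) * (if q = (1, 0) then y else z)) * coeff f q"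
    "\<i> * of_int (snd q) * test_coeff a f q = of_real (of_int (snd q) * (if q = (1, 0) then y else z)) * coeff f q" for q
    unfolding test_coeff_def y_def[symmetric] z_def[symmetric] ii by simp_all
  have h5: "has_avg (\<lambda>t. f t * T1 t) (y * A + z * C + z * D)"
    using has_avg_pw[OF cf, of test_modes "\<lambda>q. \<i> * of_int (fst q) * test_coeff a f q"]
    unfolding tc Re_sq by (simp add: T1_def tc A_def C_def D_def add.assoc)
  have h6: "has_avg (\<lambda>t. (T1 t)\<^sup>2) (y\<^sup>2 / 2 * A + z\<^sup>2 / 2 * C + z\<^sup>2 / 2 * D)"
    using has_avg_pw_square[OF _ tm, where S = test_modes and d = "\<lambda>q. \<i> * of_int (fst q) * test_coeff a f q"]
    unfolding tc norm_mult power_mult_distrib by (simp add: T1_def tc A_def C_def D_def add.assoc)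
  have h7: "has_avg (\<lambda>t. (T2 t)\<^sup>2) (z\<^sup>2 / 2 * C + z\<^sup>2 / 2 * D)"
    using has_avg_pw_square[OF _ tm, where S = test_modes and d = "\<lambda>q. \<i> * of_int (snd q) * test_coeff a f q"]
    unfolding tc norm_mult power_mult_distrib by (simp add: T2_def tc A_def C_def D_def add.assoc)
  define V1 V2 V0 where "V1 = avg (\<lambda>x. (du f x)\<^sup>2)" and "V2 = avg (\<lambda>x. (dv f x)\<^sup>2)" and "V0 = avg (\<lambda>x. (f x)\<^sup>2)"
  have h8: "has_avg (\<lambda>x. (du f x)\<^sup>2) V1" "has_avg (\<lambda>x. (dv f x)\<^sup>2) V2" "has_avg (\<lambda>x. (f x)\<^sup>2) V0"
    unfolding V1_def V2_def V0_def by (intro has_avg_avg continuous_intros cf cd)+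
  have m: "cmod (coeff f (- k, - l)) = cmod (coeff f (k, l))" for k l
    using coeff_uminus[of f "(k, l)"] by simp
  have "(\<Sum>p\<in>{-1..1} \<times> {-1..1}. ((of_int (fst p))\<^sup>2 + (of_int (snd p))\<^sup>2 - (1 + a\<^sup>2)) * (cmod (coeff f p))\<^sup>2)
     = 2 * (1 - (1 + a\<^sup>2)) * A + 2 * (1 - (1 + a\<^sup>2)) * A' + 2 * (2 - (1 + a\<^sup>2)) * C + 2 * (2 - (1 + a\<^sup>2)) * D"
  proof -
    have "{-1..1::int} = {-1, 0, 1}" by auto
    then have e: "{-1..1::int} \<times> {-1..1::int} = {(-1, -1), (-1, 0), (-1, 1), (0, -1), (0, 0), (0, 1), (1, -1), (1, 0), (1, 1)}" by auto
    show ?thesis unfolding e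
      using m[of 1 1] m[of 1 0] m[of 0 1] m[of 1 "- 1"] mean
      by (simp add: A_def A'_def C_def D_def algebra_simps)
  qed
  then have gap: "2 * (1 - (1 + a\<^sup>2)) * A + 2 * (1 - (1 + a\<^sup>2)) * A' + 2 * (2 - (1 + a\<^sup>2)) * C + 2 * (2 - (1 + a\<^sup>2)) * D
     \<le> V1 + V2 - (1 + a\<^sup>2) * V0"
    using spectral_gap[OF f, of "1 + a\<^sup>2"] a3 unfolding V1_def V2_def V0_def by simp
  let ?E = "\<lambda>t. q / (4 * a) * ((du f t)\<^sup>2 + (dv f t)\<^sup>2) + (- 1 / (4 * a)) * (f t)\<^sup>2 + 1 / (2 * a) * (f t * N t)
     + (- (q * a / 4)) * (N t)\<^sup>2 + (- (q / 2)) * (a * (du f t * N1 t) + 1 / a * (dv f t * N2 t))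
     + L * (2 * r * (f t * T1 t) + a * (T1 t)\<^sup>2 + 1 / a * (T2 t)\<^sup>2)"
  let ?M = "q / (4 * a) * (V1 + V2) + (- 1 / (4 * a)) * V0 + 1 / (2 * a) * (x * A + 2 * A')
     + (- (q * a / 4)) * (x\<^sup>2 / 2 * A + 2\<^sup>2 / 2 * A') + (- (q / 2)) * (a * (x * A) + 1 / a * (2 * A'))
     + L * (2 * r * (y * A + z * C + z * D) + a * (y\<^sup>2 / 2 * A + z\<^sup>2 / 2 * C + z\<^sup>2 / 2 * D) + 1 / a * (z\<^sup>2 / 2 * C + z\<^sup>2 / 2 * D))"
  have E: "avg ?E = ?M"
  proof -
    have "has_avg ?E ?M" by (intro has_avg_add has_avg_mult h1 h2 h3 h4 h5 h6 h7 h8)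
    then show ?thesis unfolding has_avg_def by blast
  qed
  \<comment> \<open>Rewriting the zeroth order coefficient through r^2 (1 + a^2) = 1 makes the
    factor k^2 + l^2 - (1 + a^2) of each mode visible.\<close>
  have r2: "- 1 / (4 * a) = - (q / (4 * a) * (1 + a\<^sup>2))" using r1 unfolding q_def by (simp add: mult.commute)
  have "?M = q / (4 * a) * ((V1 + V2 - (1 + a\<^sup>2) * V0) - (2 * (1 - (1 + a\<^sup>2)) * A + 2 * (1 - (1 + a\<^sup>2)) * A' + 2 * (2 - (1 + a\<^sup>2)) * C + 2 * (2 - (1 + a\<^sup>2)) * D))
     + (q / (4 * a) * (2 * (1 - (1 + a\<^sup>2))) + x / (2 * a) - q * a / 4 * (x\<^sup>2 / 2) - q / 2 * (a * x) + L * (2 * r * y + a * (y\<^sup>2 / 2))) * A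
     + (q / (4 * a) * (2 * (1 - (1 + a\<^sup>2))) + 2 / (2 * a) - q * a / 4 * (2\<^sup>2 / 2) - q / 2 * (2 / a)) * A'
     + (q / (4 * a) * (2 * (2 - (1 + a\<^sup>2))) + L * (2 * r * z + a * (z\<^sup>2 / 2) + z\<^sup>2 / 2 / a)) * (C + D)"
    unfolding r2 by (simp add: algebra_simps add_divide_distrib diff_divide_distrib)
  also have "\<dots> = q / (4 * a) * ((V1 + V2 - (1 + a\<^sup>2) * V0) - (2 * (1 - (1 + a\<^sup>2)) * A + 2 * (1 - (1 + a\<^sup>2)) * A' + 2 * (2 - (1 + a\<^sup>2)) * C + 2 * (2 - (1 + a\<^sup>2)) * D))"
    unfolding gains by simp
  also have "0 \<le> \<dots>" using gap q0 a by (intro mult_nonneg_nonneg) auto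
  finally have "0 \<le> avg ?E" unfolding E .
  also have "?E = (\<lambda>x. q / (4 * a) * ((du f x)\<^sup>2 + (dv f x)\<^sup>2) - (f x)\<^sup>2 / (4 * a) + N x * f x / (2 * a)
       - (N x)\<^sup>2 * q * a / 4 - q / 2 * (a * N1 x * du f x + N2 x * dv f x / a)
       + L * (2 * r * T1 x * f x + a * (T1 x)\<^sup>2 + (T2 x)\<^sup>2 / a))"
    by (rule ext) (simp add: algebra_simps)
  finally show ?thesis unfolding q_def N_def N1_def N2_def T1_def T2_def .
qed

end

text \<open>The two bounds on r play separate roles: r \<le> s makes the multiplier nonpositive, and
  r \<ge> 1/2 means 1 + a^2 \<le> 4, the bound required by the spectral gap.\<close>

lemma stable_if_le:
  assumes rs: "0 < r" "0 < s" "r\<^sup>2 + s\<^sup>2 = 1" and le: "r \<le> s" "1 / 2 \<le> r" and k: "2 \<le> k"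
  shows "stable_constrained_willmore k r s (torus_param r s)"
proof -
  have "((\<lambda>t. willmore r s (F t)) has_real_derivative 0) (at 0) \<and> 0 \<le> (deriv ^^ 2) (\<lambda>t. willmore r s (F t)) 0"
    if adm: "admissible k r s (torus_param r s) \<delta>0 F" for \<delta>0 F
  proof -
    have V: "variation k r s (torus_param r s) \<delta>0 F"
      and T: "\<And>t. t \<in> {-\<delta>0<..<\<delta>0} \<Longrightarrow> has_teichmueller r s (induced_metric (F t)) (0, s / r)"
      using adm Teich_torus_param[OF rs(1,2)] unfolding admissible_def by auto
    obtain \<delta> \<omega> \<omega>' \<Theta>1 \<Theta>1' \<Theta>2 \<Theta>2' where \<delta>: "\<delta> \<le> \<delta>0" and P: "polar_family r s \<delta> F \<omega> \<omega>' \<Theta>1 \<Theta>1' \<Theta>2 \<Theta>2'"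
      by (rule polar_family_exists[OF V k rs]) (rule that)
    interpret P: polar_family r s \<delta> F \<omega> \<omega>' \<Theta>1 \<Theta>1' \<Theta>2 \<Theta>2' by (rule P)
    interpret torus r s using rs by unfold_locales
    obtain W' W'' where W: "\<And>t. t \<in> {-\<delta>0<..<\<delta>0} \<Longrightarrow> ((\<lambda>t. willmore r s (F t)) has_real_derivative W' t) (at t)"
      "\<And>t. t \<in> {-\<delta>0<..<\<delta>0} \<Longrightarrow> (W' has_real_derivative W'' t) (at t)"
      by (rule willmore_twice_differentiable[OF V k]) (rule that)
    have T': "has_teichmueller r s (induced_metric (F t)) (0, s / r)" if "t \<in> P.J" for t using T[of t] that \<delta> by auto
    have zJ: "0 \<in> P.J" by (rule P.zero_J)
    have a1: "1 \<le> P.a" using le(1) assms(1) unfolding P.a_def by (simp add: le_divide_eq)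
    have a3: "P.a\<^sup>2 \<le> 3"
    proof -
      have "(1 / 2)\<^sup>2 \<le> r\<^sup>2" using le(2) by (intro power_mono) auto
      then have "s\<^sup>2 \<le> 3 * r\<^sup>2" using assms(3) by (simp add: power2_eq_square)
      then show ?thesis using assms(1) unfolding P.a_def power_divide by (simp add: divide_le_eq)
    qed
    let ?nc = "normal_coeff P.a P.\<psi>" and ?tc = "test_coeff P.a P.\<psi>"
    have "polar_test r s \<delta> F \<omega> \<omega>' \<Theta>1 \<Theta>1' \<Theta>2 \<Theta>2'
      (wave test_modes ?tc) (wave test_modes (\<lambda>q. \<i> * of_int (fst q) * ?tc q)) (wave test_modes (\<lambda>q. \<i> * of_int (snd q) * ?tc q))
      (wave normal_modes ?nc) (wave normal_modes (\<lambda>q. \<i> * of_int (fst q) * ?nc q)) (wave normal_modes (\<lambda>q. \<i> * of_int (snd q) * ?nc q))"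
      by (intro polar_test.intro polar_test_axioms.intro P wave_derivative continuous_wave wave_periodic)
    then interpret X: polar_test r s \<delta> F \<omega> \<omega>' \<Theta>1 \<Theta>1' \<Theta>2 \<Theta>2'
      "wave test_modes ?tc" "wave test_modes (\<lambda>q. \<i> * of_int (fst q) * ?tc q)" "wave test_modes (\<lambda>q. \<i> * of_int (snd q) * ?tc q)"
      "wave normal_modes ?nc" "wave normal_modes (\<lambda>q. \<i> * of_int (fst q) * ?nc q)" "wave normal_modes (\<lambda>q. \<i> * of_int (snd q) * ?nc q)" .
    \<comment> \<open>The constraint says t Y(t) \<ge> 0 on both sides of 0; for continuous
      \<open>Y\<close> this forces Y(0) = 0, so \<psi> has mean zero.\<close>
    have mean: "coeff P.\<psi> (0, 0) = 0"
    proof -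
      define Y where "Y t = integral (cell r s) (\<lambda>x. P.y t x * P.B t x) + t * integral (cell r s) (P.R1 t)" for t
      have cY: "continuous_on P.J Y"
        unfolding Y_def
        by (intro continuous_on_add continuous_on_mult continuous_on_id P.continuous_integral P.cont P.cont4 P.cont_quot)
      have tY: "0 \<le> t * Y t" if "t \<in> P.J" for t
        unfolding Y_def by (rule X.constraint_expansion[OF that T'[OF that]])
      have iY: "isCont Y 0" using cY zJ by (simp add: continuous_on_eq_continuous_at)
      have "Y 0 = 0"
      proof (rule ccontr)
        assume "Y 0 \<noteq> 0"
        then obtain d where d: "0 < d" "\<And>t. \<bar>t\<bar> < d \<Longrightarrow> \<bar>Y t - Y 0\<bar> < \<bar>Y 0\<bar>"
          using iY unfolding continuous_at_eps_delta by (auto simp: dist_real_def dest: spec[of _ "\<bar>Y 0\<bar>"])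
        define t where "t = min d \<delta> / 2"
        have t: "0 < t" "t < d" "t < \<delta>" using d(1) P.\<delta> by (auto simp: t_def min_def)
        have "0 \<le> t * Y t" "0 \<le> - t * Y (- t)" using tY[of t] tY[of "- t"] t by auto
        then have "0 \<le> Y t" "Y (- t) \<le> 0" using t(1) by (simp_all add: zero_le_mult_iff mult_le_0_iff)
        then show False using d(2)[of t] d(2)[of "- t"] t by auto
      qed
      then have "integral (cell r s) P.\<psi> = 0" unfolding Y_def P.at_zero using assms(1) P.a_pos by simp
      then show ?thesis using integral_linear[OF integrable_cell[OF Ck_continuous[OF P.\<psi>_Ck1]] bounded_linear_of_real[where 'a = complex], of r s]
        by (simp add: coeff_def o_def)
    qed
    have I0: "0 \<le> integral (cell r s) (X.I 0)"
    proof -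
      note nn = second_variation_nonneg[OF P.\<psi>_Ck1 P.\<psi>_periodic mean P.a_pos P.r_eq a3 P.lam_def]
      have "integral (cell r s) (X.I 0) = (1 / (r * (P.a * r))) * (area * avg (\<lambda>x. r\<^sup>2 / (4 * P.a) * ((du P.\<psi> x)\<^sup>2 + (dv P.\<psi> x)\<^sup>2) - (P.\<psi> x)\<^sup>2 / (4 * P.a)
       + pw normal_modes ?nc x * P.\<psi> x / (2 * P.a)
       - (pw normal_modes ?nc x)\<^sup>2 * r\<^sup>2 * P.a / 4
       - r\<^sup>2 / 2 * (P.a * pw normal_modes (\<lambda>q. \<i> * of_int (fst q) * ?nc q) x * du P.\<psi> x
          + pw normal_modes (\<lambda>q. \<i> * of_int (snd q) * ?nc q) x * dv P.\<psi> x / P.a)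
       + P.lam * (2 * r * pw test_modes (\<lambda>q. \<i> * of_int (fst q) * ?tc q) x * P.\<psi> x
          + P.a * (pw test_modes (\<lambda>q. \<i> * of_int (fst q) * ?tc q) x)\<^sup>2
          + (pw test_modes (\<lambda>q. \<i> * of_int (snd q) * ?tc q) x)\<^sup>2 / P.a)))"
        using area_pos unfolding X.I_zero[abs_def] Let_def pw_def avg_def by simp
      then show ?thesis using nn area_pos assms(1) P.a_pos by simp
    qed
    have cI: "isCont (\<lambda>t. integral (cell r s) (X.I t)) 0"
      using P.continuous_integral[OF X.cont_I] zJ by (simp add: continuous_on_eq_continuous_at)
    have w0: "willmore r s (F 0) = pi\<^sup>2 / (r * s)"
      using willmore_torus_param[OF assms(1-3)] P.F_surface[OF zJ] V unfolding variation_def by simp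
    have b: "willmore r s (F 0) + t\<^sup>2 * integral (cell r s) (X.I t) \<le> willmore r s (F t)" if "\<bar>t\<bar> < \<delta>" for t
    proof -
      have t: "t \<in> P.J" using that by auto
      show ?thesis unfolding w0 by (rule X.willmore_expansion[OF t T'[OF t] a1])
    qed
    have d: "((\<lambda>t. willmore r s (F t)) has_real_derivative W' t) (at t)" if "\<bar>t\<bar> < \<delta>" for t
      using W(1)[of t] that \<delta> by (auto simp: abs_less_iff)
    have d2: "(W' has_real_derivative W'' 0) (at 0)" using W(2)[of 0] zJ \<delta> by auto
    note R = second_derivative_lower_bound[OF P.\<delta> d d2 b cI]
    have "((\<lambda>t. willmore r s (F t)) has_real_derivative 0) (at 0)" using d[of 0] R(1) P.\<delta> by simp
    moreover have "0 \<le> (deriv ^^ 2) (\<lambda>t. willmore r s (F t)) 0"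
      using second_deriv_eq[OF P.\<delta> d d2] R(2) I0 by simp
    ultimately show ?thesis ..
  qed
  then show ?thesis unfolding stable_constrained_willmore_def constrained_willmore_def by blast
qed

section \<open>Symmetry under exchange of the two factors\<close>

section \<open>Exchanging the two circles\<close>

lemma Ck_family_compose_linear:
  fixes M :: "'a::euclidean_space \<Rightarrow> 'a" and F :: "real \<Rightarrow> 'a \<Rightarrow> 'b::real_normed_vector"
  assumes M: "bounded_linear M"
  shows "Ck_family k J F \<Longrightarrow> Ck_family k J (\<lambda>t x. F t (M x))"
proof (induction k arbitrary: F)
  have c: "continuous_on (J \<times> UNIV) (\<lambda>(t, x). F t (M x))" if "continuous_on (J \<times> UNIV) (\<lambda>(t, x). F t x)" for F :: "real \<Rightarrow> 'a \<Rightarrow> 'b"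
  proof -
    have "continuous_on (J \<times> UNIV) (\<lambda>z. (fst z, M (snd z)))"
      by (intro continuous_on_Pair continuous_on_fst continuous_on_id bounded_linear.continuous_on[OF M] continuous_on_snd)
    from continuous_on_compose2[OF that this] show ?thesis by (force simp: split_def)
  qed
  { case 0 then show ?case unfolding Ck_family.simps by (rule c) }
  case (Suc k)
  have d: "F t differentiable at x" if "t \<in> J" for t x using Suc.prems that by simp
  have D: "((\<lambda>x. F t (M x)) has_derivative (\<lambda>X. dd (M X) (F t) (M x))) (at x)" if "t \<in> J" for t x
    by (rule has_derivative_compose[OF bounded_linear_imp_has_derivative[OF M] has_derivative_dd[OF d[OF that]]])
  have "Ck_family k J (\<lambda>t. dd X (\<lambda>x. F t (M x)))" for X
  proof -
    have "Ck_family k J (\<lambda>t x. dd (M X) (F t) (M x))" using Suc.prems by (intro Suc.IH) simp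
    moreover have "Ck_family k J (\<lambda>t. dd X (\<lambda>x. F t (M x))) \<longleftrightarrow> Ck_family k J (\<lambda>t x. dd (M X) (F t) (M x))"
      by (rule Ck_family_cong) (rule ext, rule dd_eqI[OF D])
    ultimately show ?thesis by (simp only:)
  qed
  moreover have "(\<lambda>x. F t (M x)) differentiable at x" if "t \<in> J" for t x
    using D[OF that] unfolding differentiable_def by blast
  ultimately show ?case using c[OF Ck_family_continuous[OF Suc.prems]] unfolding Ck_family.simps by (intro conjI ballI allI)
qed

abbreviation sw where "sw \<equiv> prod.swap"

definition flip :: "('a \<times> 'a \<Rightarrow> 'b \<times> 'b) \<Rightarrow> 'a \<times> 'a \<Rightarrow> 'b \<times> 'b" where
  "flip f x = sw (f (sw x))"

lemma bounded_linear_swap: "bounded_linear (sw :: 'a::real_normed_vector \<times> 'a \<Rightarrow> 'a \<times> 'a)"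
  using bounded_linear_Pair[OF bounded_linear_snd bounded_linear_fst]
  by (simp add: prod.swap_def[abs_def] split_def)

lemma inner_swap: "sw x \<bullet> sw y = x \<bullet> y" for x y :: "'a::real_inner \<times> 'a"
  by (simp add: inner_prod_def)

lemma swap_linear: "sw (x + y) = sw x + sw y" "sw (x - y) = sw x - sw y" "sw (c *\<^sub>R x) = c *\<^sub>R sw x"
  for x y :: "'a::real_normed_vector \<times> 'a"
  by (cases x; cases y; simp)+

lemma flip_derivative:
  assumes "f differentiable at (sw x)"
  shows "(flip f has_derivative (\<lambda>X. sw (dd (sw X) f (sw x)))) (at x)"
  unfolding flip_def[abs_def]
  by (rule bounded_linear.has_derivative[OF bounded_linear_swap
        has_derivative_compose[OF bounded_linear_imp_has_derivative[OF bounded_linear_swap] has_derivative_dd[OF assms]]])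

lemmas dd_flip = dd_eqI[OF flip_derivative]

lemma Ck_family_flip: "Ck_family k J F \<Longrightarrow> Ck_family k J (\<lambda>t. flip (F t))"
  unfolding flip_def[abs_def]
  by (rule Ck_family_bounded_linear[OF bounded_linear_swap Ck_family_compose_linear[OF bounded_linear_swap]])

lemma Ck_flip: "Ck k f \<Longrightarrow> Ck k (flip f)"
  unfolding Ck_iff_family by (rule Ck_family_flip)

lemma C2_family_flip:
  fixes F :: "real \<Rightarrow> 'a::euclidean_space \<times> 'a \<Rightarrow> 'b::real_normed_vector \<times> 'b"
  assumes "C2_family k J F" shows "C2_family k J (\<lambda>t. flip (F t))"
  using assms
proof (rule C2_familyE)
  fix F' F'' assume F: "Ck_family k J F" "Ck_family k J F'" "Ck_family k J F''"
    "\<And>t x. t \<in> J \<Longrightarrow> ((\<lambda>\<tau>. F \<tau> x) has_vector_derivative F' t x) (at t)"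
    "\<And>t x. t \<in> J \<Longrightarrow> ((\<lambda>\<tau>. F' \<tau> x) has_vector_derivative F'' t x) (at t)"
  show ?thesis
    by (rule C2_familyI[of _ _ _ "\<lambda>t. flip (F' t)" "\<lambda>t. flip (F'' t)"])
      (auto intro!: Ck_family_flip F simp: flip_def intro: bounded_linear.has_vector_derivative[OF bounded_linear_swap F(4)]
        bounded_linear.has_vector_derivative[OF bounded_linear_swap F(5)])
qed

lemma swap_lattice: "sw l \<in> lattice r s \<longleftrightarrow> l \<in> lattice s r"
  unfolding lattice_def by (cases l) auto

lemma periodic_flip:
  assumes "periodic r s f"
  shows "periodic s r (\<lambda>x. f (sw x))"
  unfolding periodic_def
proof (intro allI ballI)
  fix x l assume "l \<in> lattice s r"
  then have "sw l \<in> lattice r s" by (simp only: swap_lattice)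
  then show "f (sw (x + l)) = f (sw x)" using assms unfolding periodic_def swap_linear by blast
qed

lemma induced_metric_flip:
  assumes "\<And>x. f differentiable at x"
  shows "induced_metric (flip f) x X Y = induced_metric f (sw x) (sw X) (sw Y)"
  unfolding induced_metric_def dd_flip[OF assms] inner_swap ..

lemma gram_det_flip:
  assumes "\<And>x. f differentiable at x"
  shows "gram_det (induced_metric (flip f)) x = gram_det (induced_metric f) (sw x)"
  unfolding gram_det_def induced_metric_flip[OF assms] by (simp add: induced_metric_def inner_commute)

lemma torus_param_flip: "flip (torus_param s r) = torus_param r s"
  by (simp add: fun_eq_iff flip_def torus_param_def)

lemma immersion_flip:
  assumes f: "immersion k r s f" and k: "1 \<le> k"
  shows "immersion k s r (flip f)"
  unfolding immersion_def
proof (intro conjI allI)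
  have C: "Ck k f" and p: "periodic r s f" and sp: "\<And>x. f x \<in> sphere 0 1" and inj: "\<And>x. inj (frechet_derivative f (at x))"
    using f unfolding immersion_def by blast+
  have C1: "Ck 1 f" by (rule Ck_mono[OF C k])
  show "periodic s r (flip f)" using periodic_flip[OF p] unfolding flip_def periodic_def by simp
  show "Ck k (flip f)" by (rule Ck_flip[OF C])
  show "flip f x \<in> sphere 0 1" for x using sp[of "sw x"] by (simp add: flip_def norm_Pair prod.swap_def norm_prod_def add.commute)
  have "frechet_derivative (flip f) (at x) = sw \<circ> frechet_derivative f (at (sw x)) \<circ> sw" for x
    using dd_flip[OF Ck1_differentiable[OF C1], of _ x] unfolding dd_def by (simp add: fun_eq_iff)
  then show "inj (frechet_derivative (flip f) (at x))" for x
    by (simp only:) (intro inj_compose inj_swap inj)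
qed

lemma willmore_density_flip:
  assumes f: "surface f"
  shows "willmore_density (flip f) x = willmore_density f (sw x)"
proof -
  interpret f: surface f by (rule f)
  note dF = dd_flip[OF f.diff]
  have dF': "dd X (flip f) = flip (dd (sw X) f)" for X by (rule ext) (simp add: dF flip_def)
  have ddF: "dd X (dd Y (flip f)) x = sw (dd (sw X) (dd (sw Y) f) (sw x))" for X Y
    unfolding dF' by (rule dd_flip[OF f.diff'])
  interpret g: surface "flip f"
  proof
    show "Ck 2 (flip f)" by (rule Ck_flip[OF f.smooth])
    show "flip f x \<bullet> flip f x = 1" for x unfolding flip_def inner_swap by (rule f.sphere)
    show "0 < gram_det (induced_metric (flip f)) x" for x unfolding gram_det_flip[OF f.diff] by (rule f.gpos)
  qed
  have c: "dd (0, 1) f.fu (sw x) = dd (1, 0) f.fv (sw x)" by (rule dd_dd_commute[OF f.smooth])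
  have L: "g.Lam x = sw (f.Lam (sw x))"
    unfolding g.Lam_def f.Lam_def ddF dF swap_linear inner_swap by (simp add: c inner_commute mult.commute add.commute diff_add_eq)
  have "nor (flip f) (sw w) x = sw (nor f w (sw x))" for w
    unfolding nor_def g.tan_metric f.tan_metric dF swap_linear inner_swap flip_def by (simp add: inner_commute mult.commute)
  then show ?thesis
    unfolding f.willmore_density_nor g.willmore_density_nor L dF inner_swap by (simp add: inner_swap inner_commute mult.commute)
qed

lemma willmore_flip:
  assumes f: "surface f"
  shows "willmore s r (flip f) = willmore r s f"
proof -
  have c: "continuous_on UNIV (willmore_density f)" by (rule surface.continuous_willmore_density[OF f])
  have c': "continuous_on UNIV (willmore_density (flip f))"
    unfolding willmore_density_flip[OF f, abs_def] by (rule continuous_on_compose2[OF c bounded_linear.continuous_on[OF bounded_linear_swap]]) auto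
  show ?thesis
    unfolding willmore_density_integral integral_cell_swap[OF c'] willmore_density_flip[OF f]
    using integral_prod_continuous[of 0 0 "2 * pi * r" "2 * pi * s" "willmore_density f"] continuous_on_subset[OF c]
    by simp
qed

lemma torus_diffeo_flip:
  assumes "torus_diffeo r s \<phi>"
  shows "torus_diffeo s r (flip \<phi>)"
proof -
  have b: "bij \<phi>" and C: "Ck 1 \<phi>" "Ck 1 (inv \<phi>)" and l: "\<And>x y. \<phi> x - \<phi> y \<in> lattice r s \<longleftrightarrow> x - y \<in> lattice r s"
    using assms unfolding torus_diffeo_def by blast+
  have "flip \<phi> = sw \<circ> \<phi> \<circ> sw" by (simp add: fun_eq_iff flip_def)
  then have b': "bij (flip \<phi>)" using b by (auto intro!: bij_comp bij_swap)
  have "inv (flip \<phi>) = flip (inv \<phi>)"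
    by (rule inv_equality) (use b in \<open>simp_all add: flip_def bij_is_inj bij_is_surj surj_f_inv_f\<close>)
  then show ?thesis
    unfolding torus_diffeo_def using b' Ck_flip[OF C(1)] Ck_flip[OF C(2)] l
    by (simp only: flip_def swap_linear(2)[symmetric] swap_lattice) (simp add: l swap_lattice[symmetric, of _ r s] swap_linear)
qed

lemma isotopic_to_id_flip:
  assumes "isotopic_to_id r s \<phi>"
  shows "isotopic_to_id s r (flip \<phi>)"
proof -
  obtain H where H: "Ck_family 1 {0..1} H" "\<And>\<tau>. \<tau> \<in> {0..1} \<Longrightarrow> torus_diffeo r s (H \<tau>)" "H 0 = id" "H 1 = \<phi>"
    using assms unfolding isotopic_to_id_def by blast
  have "flip id = id" by (simp add: flip_def fun_eq_iff)
  then show ?thesis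
    unfolding isotopic_to_id_def
    using Ck_family_flip[OF H(1)] torus_diffeo_flip[OF H(2)] H(3,4) by (intro exI[of _ "\<lambda>\<tau>. flip (H \<tau>)"]) simp
qed

text \<open>For these coordinates both model metrics are the Euclidean one, which the exchange
  preserves, so conjugating the diffeomorphism by the exchange is enough.\<close>

lemma has_teichmueller_flip:
  assumes T: "has_teichmueller r s g (0, s / r)" and rs: "0 < r" "0 < s"
    and g': "\<And>x X Y. g' x X Y = g (sw x) (sw X) (sw Y)"
  shows "has_teichmueller s r g' (0, r / s)"
proof -
  obtain w \<phi> where w: "periodic r s w" "torus_diffeo r s \<phi>" "isotopic_to_id r s \<phi>"
    and g: "\<And>x X Y. g x X Y = exp (2 * w x) * pullback \<phi> (model_metric r s (0, s / r)) x X Y"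
    using T unfolding has_teichmueller_def by blast
  have nz: "r \<noteq> 0" "s \<noteq> 0" using rs by auto
  have "Ck 1 \<phi>" using w(2) unfolding torus_diffeo_def by blast
  then have d: "\<phi> differentiable at x" for x by (rule Ck1_differentiable)
  have "g' x X Y = exp (2 * w (sw x)) * pullback (flip \<phi>) (model_metric s r (0, r / s)) x X Y" for x X Y
    unfolding g' g pullback_def model_metric_flat[OF nz] model_metric_flat[OF nz(2,1)] dd_flip[OF d] by simp
  then show ?thesis
    unfolding has_teichmueller_def
    using rs periodic_flip[OF w(1)] torus_diffeo_flip[OF w(2)] isotopic_to_id_flip[OF w(3)]
    by (intro conjI exI[of _ "\<lambda>x. w (sw x)"] exI[of _ "flip \<phi>"] allI) simp_all
qed

lemma admissible_flip:
  assumes A: "admissible k r s (torus_param r s) \<delta> F" and rs: "0 < r" "0 < s" and k: "1 \<le> k"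
  shows "admissible k s r (torus_param s r) \<delta> (\<lambda>t. flip (F t))"
proof -
  have V: "0 < \<delta>" "F 0 = torus_param r s" "C2_family k {-\<delta><..<\<delta>} F"
    and I: "\<And>t. t \<in> {-\<delta><..<\<delta>} \<Longrightarrow> immersion k r s (F t)"
    and T: "\<And>t. t \<in> {-\<delta><..<\<delta>} \<Longrightarrow> has_teichmueller r s (induced_metric (F t)) (0, s / r)"
    using A Teich_torus_param[OF rs] unfolding admissible_def variation_def by auto
  have d: "F t differentiable at x" if "t \<in> {-\<delta><..<\<delta>}" for t x
    using I[OF that] Ck_mono[OF _ k] unfolding immersion_def by (blast intro: Ck1_differentiable)
  have "has_teichmueller s r (induced_metric (flip (F t))) (0, r / s)" if "t \<in> {-\<delta><..<\<delta>}" for t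
    by (rule has_teichmueller_flip[OF T[OF that] rs induced_metric_flip[OF d[OF that]]])
  then show ?thesis
    unfolding admissible_def variation_def Teich_torus_param[OF rs(2,1)]
    using V C2_family_flip[OF V(3)] immersion_flip[OF I k] torus_param_flip by simp
qed

lemma stable_flip:
  assumes st: "stable_constrained_willmore k r s (torus_param r s)" and rs: "0 < r" "0 < s" and k: "2 \<le> k"
  shows "stable_constrained_willmore k s r (torus_param s r)"
proof -
  have "((\<lambda>t. willmore s r (F t)) has_real_derivative 0) (at 0) \<and> 0 \<le> (deriv ^^ 2) (\<lambda>t. willmore s r (F t)) 0"
    if A: "admissible k s r (torus_param s r) \<delta> F" for \<delta> F
  proof -
    have \<delta>: "0 < \<delta>" and I: "\<And>t. t \<in> {-\<delta><..<\<delta>} \<Longrightarrow> immersion k s r (F t)"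
      using A unfolding admissible_def variation_def by blast+
    have "admissible k r s (torus_param r s) \<delta> (\<lambda>t. flip (F t))" by (rule admissible_flip[OF A rs(2,1)]) (use k in simp)
    then have S: "((\<lambda>t. willmore r s (flip (F t))) has_real_derivative 0) (at 0)"
      "0 \<le> (deriv ^^ 2) (\<lambda>t. willmore r s (flip (F t))) 0"
      using st unfolding stable_constrained_willmore_def constrained_willmore_def by blast+
    have e: "willmore r s (flip (F t)) = willmore s r (F t)" if "t \<in> {-\<delta><..<\<delta>}" for t
      by (rule willmore_flip[OF immersion_surface[OF I[OF that] k]])
    \<comment> \<open>The energies are compared only for times inside the interval of the variation;
      both derivatives at 0 depend on nothing more than the germ.\<close>
    have ev: "eventually (\<lambda>t. willmore r s (flip (F t)) = willmore s r (F t)) (nhds 0)"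
      using eventually_nhds_in_open[of "{-\<delta><..<\<delta>}" 0] \<delta> e by (auto elim: eventually_mono)
    have "(deriv ^^ 2) (\<lambda>t. willmore r s (flip (F t))) 0 = (deriv ^^ 2) (\<lambda>t. willmore s r (F t)) 0"
      by (rule higher_deriv_cong_ev[OF ev refl])
    then show ?thesis using S DERIV_cong_ev[OF refl ev refl] by simp
  qed
  then show ?thesis unfolding stable_constrained_willmore_def constrained_willmore_def by blast
qed

section \<open>Mean curvature from a known normal; reparametrisations of one circle factor\<close>

section \<open>Surfaces with explicit normal and circle diffeomorphisms\<close>

text \<open>Four real components in the orthonormal basis of the ambient space that rotates with the
  two angles.\<close>

definition fr :: "real \<Rightarrow> real \<Rightarrow> real \<times> real \<Rightarrow> real \<Rightarrow> real \<Rightarrow> real \<Rightarrow> real \<Rightarrow> complex \<times> complex" where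
  "fr r s x a a' b b' = (Complex a a' * cis (fst x / r), Complex b b' * cis (snd x / s))"

lemma fr_inner: "fr r s x a a' b b' \<bullet> fr r s x c c' d d' = a * c + a' * c' + (b * d + b' * d')"
proof -
  have alg: "(a * p - b * n) * (c * p - d * n) + (a * n + b * p) * (c * n + d * p) = a * c + b * d"
    if "p * p + n * n = 1" for a b c d p n :: real using that by algebra
  have "(Complex a b * cis \<alpha>) \<bullet> (Complex c d * cis \<alpha>) = a * c + b * d" for a b c d \<alpha>
    unfolding inner_complex_def times_complex.sel complex.sel cis.sel
    by (rule alg[OF sin_cos_squared_add3])
  then show ?thesis by (simp add: fr_def inner_prod_def)
qed

lemma fr_scale: "c *\<^sub>R fr r s x a a' b b' = fr r s x (c * a) (c * a') (c * b) (c * b')"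
  by (simp add: fr_def complex_eq_iff algebra_simps)

lemma fr_add: "fr r s x a a' b b' + fr r s x c c' d d' = fr r s x (a + c) (a' + c') (b + d) (b' + d')"
  by (simp add: fr_def complex_eq_iff algebra_simps)

lemma fr_derivative:
  assumes d: "(A has_real_derivative A1) (at (snd x / s))" "(A' has_real_derivative A1') (at (snd x / s))"
    "(B has_real_derivative B1) (at (snd x / s))" "(B' has_real_derivative B1') (at (snd x / s))"
  shows "((\<lambda>x. fr r s x (A (snd x / s)) (A' (snd x / s)) (B (snd x / s)) (B' (snd x / s))) has_derivative
    (\<lambda>X. (fst X / r) *\<^sub>R fr r s x (- A' (snd x / s)) (A (snd x / s)) 0 0
       + (snd X / s) *\<^sub>R fr r s x A1 A1' (B1 - B' (snd x / s)) (B1' + B (snd x / s)))) (at x)"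
proof -
  have lin: "((\<lambda>x. fst x / r) has_derivative (\<lambda>X. fst X / r)) (at x)" "((\<lambda>x. snd x / s) has_derivative (\<lambda>X. snd X / s)) (at x)"
    unfolding divide_inverse by (auto intro!: derivative_eq_intros)
  have C: "((\<lambda>x. Complex (f (snd x / s)) (h (snd x / s))) has_derivative (\<lambda>X. (snd X / s) *\<^sub>R Complex f' h')) (at x)"
    if f: "(f has_real_derivative f') (at (snd x / s))" and h: "(h has_real_derivative h') (at (snd x / s))" for f h f' h'
  proof -
    have "((\<lambda>x. of_real (f (snd x / s)) + \<i> * of_real (h (snd x / s))) has_derivative
        (\<lambda>X. of_real (snd X / s * f') + \<i> * of_real (snd X / s * h'))) (at x)"
      by (intro has_derivative_add has_derivative_mult_right has_derivative_of_real DERIV_compose_FDERIV[OF f lin(2)] DERIV_compose_FDERIV[OF h lin(2)])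
    then show ?thesis unfolding Complex_eq by (simp add: scaleR_conv_of_real algebra_simps)
  qed
  show ?thesis
    unfolding fr_def
    by (rule has_derivative_eq_rhs[OF has_derivative_Pair[OF has_derivative_mult[OF C[OF d(1,2)] has_derivative_cis[OF lin(1)]]
          has_derivative_mult[OF C[OF d(3,4)] has_derivative_cis[OF lin(2)]]]])
      (rule ext, simp add: complex_eq_iff algebra_simps)
qed

context surface
begin

text \<open>Otherwise f, f_u, f_v, N and the difference of the two sides would be five pairwise
  orthogonal nonzero vectors in a real space of dimension four.\<close>

lemma nor_unit_normal:
  assumes N: "N \<bullet> N = 1" "N \<bullet> f x = 0" "N \<bullet> fu x = 0" "N \<bullet> fv x = 0" and F0: "FF x = 0"
  shows "nor f w x = (w \<bullet> N) *\<^sub>R N"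
proof (rule ccontr)
  define d where "d = nor f w x - (w \<bullet> N) *\<^sub>R N"
  assume "nor f w x \<noteq> (w \<bullet> N) *\<^sub>R N"
  then have d0: "d \<bullet> d \<noteq> 0" by (simp add: d_def)
  have N': "f x \<bullet> N = 0" "fu x \<bullet> N = 0" "fv x \<bullet> N = 0" using N by (simp_all add: inner_commute)
  have "nor f w x \<bullet> N = w \<bullet> N" unfolding nor_def by (simp add: inner_diff_left N')
  then have d: "d \<bullet> f x = 0" "d \<bullet> fu x = 0" "d \<bullet> fv x = 0" "d \<bullet> N = 0"
    unfolding d_def by (simp_all add: inner_diff_left nor_orthogonal N)
  have pos: "fu x \<bullet> fu x \<noteq> 0" "fv x \<bullet> fv x \<noteq> 0" using det_pos[of x] F0 by auto
  define S where "S = [f x, fu x, fv x, N, d]"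
  have nz: "v \<bullet> v \<noteq> 0" if "v \<in> set S" for v using that pos d0 N(1) sphere[of x] unfolding S_def by auto
  have o: "pairwise orthogonal (set S)"
    unfolding S_def using d N N' F0 tangent_orthogonal tangent_orthogonal'
    by (auto simp: pairwise_def orthogonal_def inner_commute)
  have "distinct S"
  proof -
    have "a \<noteq> b" if "a \<bullet> b = 0" "a \<bullet> a \<noteq> 0" for a b :: "complex \<times> complex" using that by auto
    then show ?thesis unfolding S_def using d d0 N N' F0 tangent_orthogonal' sphere[of x] pos
      by (simp) (metis inner_commute zero_neq_one)
  qed
  then have "card (set S) = 5" by (simp only: distinct_card) (simp add: S_def)
  moreover have "independent (set S)"
    by (rule pairwise_orthogonal_independent[OF o]) (use nz[of 0] in auto)
  then have "card (set S) \<le> DIM(complex \<times> complex)" using independent_bound by blast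
  ultimately show False by simp
qed

lemma willmore_density_curvatures:
  assumes N: "N \<bullet> N = 1" "N \<bullet> f x = 0" "N \<bullet> fu x = 0" "N \<bullet> fv x = 0" and F0: "FF x = 0"
    and k: "dd (1, 0) fu x \<bullet> N = \<kappa>1 * EE x" "dd (0, 1) fv x \<bullet> N = \<kappa>2 * GG x"
  shows "willmore_density f x = ((\<kappa>1 + \<kappa>2)\<^sup>2 / 4 + 1) * sqrt (EE x * GG x)"
proof -
  have pos: "EE x * GG x \<noteq> 0" using det_pos[of x] F0 by auto
  have "Lam x \<bullet> N = (1 / (EE x * GG x)) * (GG x * (\<kappa>1 * EE x) + EE x * (\<kappa>2 * GG x))"
    unfolding Lam_def F0 using k by (simp add: inner_add_left)
  also have "\<dots> = \<kappa>1 + \<kappa>2" using pos by (simp add: field_simps)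
  finally have "nor f (Lam x) x = (\<kappa>1 + \<kappa>2) *\<^sub>R N" using nor_unit_normal[OF N F0] by simp
  then show ?thesis unfolding willmore_density_nor F0 using N(1) by (simp add: power2_eq_square)
qed

end

definition stretch :: "(real \<Rightarrow> real) \<Rightarrow> real \<times> real \<Rightarrow> real \<times> real" where
  "stretch h x = (fst x, h (snd x))"

lemma lattice_iff: "z \<in> lattice r s \<longleftrightarrow> (\<exists>m::int. fst z = 2 * pi * r * of_int m) \<and> (\<exists>n::int. snd z = 2 * pi * s * of_int n)"
  unfolding lattice_def by (cases z) auto

locale circle_diffeo =
  fixes h h' :: "real \<Rightarrow> real" and s :: real
  assumes s: "0 < s" and deriv: "\<And>v. (h has_real_derivative h' v) (at v)" and cont: "continuous_on UNIV h'"
    and pos: "\<And>v. 0 < h' v" and shift: "\<And>v. h (v + 2 * pi * s) = h v + 2 * pi * s"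
begin

lemma shift_int: "h (v + 2 * pi * s * of_int n) = h v + 2 * pi * s * of_int n"
proof (induction n rule: int_induct[of _ 0])
  case base then show ?case by simp
next
  case (step1 i) then show ?case using shift[of "v + 2 * pi * s * of_int i"] by (simp add: algebra_simps)
next
  case (step2 i) then show ?case using shift[of "v + 2 * pi * s * of_int (i - 1)"] by (simp add: algebra_simps)
qed

lemma strict_mono: "strict_mono h"
proof (rule strict_monoI)
  fix x y :: real assume "x < y" then show "h x < h y"
    by (rule DERIV_pos_imp_increasing) (use deriv pos in blast)
qed

lemma isCont_h: "isCont h v" using deriv DERIV_isCont by blast

lemma surj: "surj h"
proof (rule surjI)
  show "h (SOME v. h v = y) = y" for y
  proof (rule someI_ex[of "\<lambda>v. h v = y"])
    define n where "n = \<lceil>(\<bar>y - h 0\<bar>) / (2 * pi * s)\<rceil>"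
    have L: "0 < 2 * pi * s" using s by simp
    have "\<bar>y - h 0\<bar> \<le> 2 * pi * s * of_int n"
      using le_of_int_ceiling[of "\<bar>y - h 0\<bar> / (2 * pi * s)"] unfolding n_def[symmetric] pos_divide_le_eq[OF L]
      by (simp only: mult.commute)
    then have "h (2 * pi * s * of_int (- n)) \<le> y" "y \<le> h (2 * pi * s * of_int n)" "2 * pi * s * of_int (- n) \<le> 2 * pi * s * of_int n"
      using shift_int[of 0 n] shift_int[of 0 "- n"] by auto
    then show "\<exists>v. h v = y" using IVT[of h "2 * pi * s * of_int (- n)" y "2 * pi * s * of_int n"] isCont_h by blast
  qed
qed

lemma bij: "bij h" using surj strict_mono_imp_inj_on[OF strict_mono] by (simp add: bij_def)

lemma inv_derivative: "(inv h has_real_derivative inverse (h' (inv h y))) (at y)"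
  and inv_cont: "isCont (inv h) y"
proof -
  have f: "h (inv h y) = y" for y using surj by (rule surj_f_inv_f)
  show c: "isCont (inv h) y" for y
  proof -
    have "isCont (inv h) (h (inv h y))"
      by (rule isCont_inverse_function[of 1]) (use strict_mono_imp_inj_on[OF strict_mono] isCont_h in \<open>auto simp: inv_f_f\<close>)
    then show ?thesis unfolding f .
  qed
  show "(inv h has_real_derivative inverse (h' (inv h y))) (at y)"
    by (rule DERIV_inverse_function[where f = h and a = "y - 1" and b = "y + 1"]) (use deriv pos[of "inv h y"] f c in auto)
qed

lemma Ck1_stretch:
  assumes d: "\<And>v. (g has_real_derivative g' v) (at v)" and c: "continuous_on UNIV g'"
  shows "(stretch g has_derivative (\<lambda>X. (fst X, g' (snd x) * snd X))) (at x)" "Ck 1 (stretch g)"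
proof -
  show D: "(stretch g has_derivative (\<lambda>X. (fst X, g' (snd x) * snd X))) (at x)" for x
    unfolding stretch_def[abs_def]
    by (rule has_derivative_eq_rhs[OF has_derivative_Pair[OF has_derivative_fst[OF has_derivative_ident]
          DERIV_compose_FDERIV[OF d has_derivative_snd[OF has_derivative_ident]]]]) (simp add: mult.commute)
  show "Ck 1 (stretch g)"
  proof (rule Ck1_I)
    show "stretch g differentiable at x" for x using D unfolding differentiable_def by blast
    have e: "dd X (stretch g) = (\<lambda>x. (fst X, g' (snd x) * snd X))" for X by (rule ext) (rule dd_eqI[OF D])
    show "continuous_on UNIV (dd X (stretch g))" for X
      unfolding e by (intro continuous_on_Pair continuous_on_const continuous_on_mult continuous_on_compose2[OF c]
          continuous_on_snd continuous_on_id) auto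
  qed
qed

lemma torus_diffeo: "torus_diffeo r s (stretch h)"
  unfolding torus_diffeo_def
proof (intro conjI allI)
  have e: "inv (stretch h) = stretch (inv h)"
    by (rule inv_equality) (simp_all add: stretch_def bij_is_inj[OF bij] surj_f_inv_f[OF surj])
  show "bij (stretch h)"
    by (rule o_bij[of "stretch (inv h)"]) (simp_all add: fun_eq_iff stretch_def bij_is_inj[OF bij] surj_f_inv_f[OF surj])
  show "Ck 1 (stretch h)" by (rule Ck1_stretch(2)[OF deriv cont])
  show "Ck 1 (inv (stretch h))"
    unfolding e
  proof (rule Ck1_stretch(2)[OF inv_derivative])
    have "continuous_on UNIV (inv h)" using inv_cont by (simp add: continuous_at_imp_continuous_on)
    then show "continuous_on UNIV (\<lambda>y. inverse (h' (inv h y)))"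
      using pos by (intro continuous_on_inverse continuous_on_compose2[OF cont]) (auto simp: less_imp_neq[symmetric])
  qed
  fix x y :: "real \<times> real"
  have "(\<exists>n::int. h (snd x) - h (snd y) = 2 * pi * s * of_int n) \<longleftrightarrow> (\<exists>n::int. snd x - snd y = 2 * pi * s * of_int n)"
  proof -
    have "h (snd x) - h (snd y) = 2 * pi * s * of_int n \<longleftrightarrow> snd x - snd y = 2 * pi * s * of_int n" for n
    proof -
      have "h (snd x) - h (snd y) = 2 * pi * s * of_int n \<longleftrightarrow> h (snd x) = h (snd y + 2 * pi * s * of_int n)"
        unfolding shift_int by auto
      also have "\<dots> \<longleftrightarrow> snd x = snd y + 2 * pi * s * of_int n" by (rule inj_eq[OF bij_is_inj[OF bij]])
      finally show ?thesis by auto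
    qed
    then show ?thesis by simp
  qed
  then show "stretch h x - stretch h y \<in> lattice r s \<longleftrightarrow> x - y \<in> lattice r s"
    unfolding lattice_iff by (simp add: stretch_def)
qed

text \<open>Increasing lifts of degree one form a convex set, so the segment from the identity to
  \<open>h\<close> is an isotopy.\<close>

lemma isotopic_to_id: "isotopic_to_id r s (stretch h)"
proof -
  define H where "H \<tau> = stretch (\<lambda>v. (1 - \<tau>) * v + \<tau> * h v)" for \<tau>
  have d: "((\<lambda>v. (1 - \<tau>) * v + \<tau> * h v) has_real_derivative (1 - \<tau>) + \<tau> * h' v) (at v)" for \<tau> v
    by (auto intro!: derivative_eq_intros deriv)
  have "torus_diffeo r s (H \<tau>)" if t: "\<tau> \<in> {0..1}" for \<tau>
  proof -
    interpret \<tau>: circle_diffeo "\<lambda>v. (1 - \<tau>) * v + \<tau> * h v" "\<lambda>v. (1 - \<tau>) + \<tau> * h' v" s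
    proof
      show "0 < (1 - \<tau>) + \<tau> * h' v" for v
        using t pos[of v] by (cases "\<tau> = 0") (auto intro: add_nonneg_pos)
      show "continuous_on UNIV (\<lambda>v. (1 - \<tau>) + \<tau> * h' v)" by (intro continuous_intros cont)
      show "(1 - \<tau>) * (v + 2 * pi * s) + \<tau> * h (v + 2 * pi * s) = (1 - \<tau>) * v + \<tau> * h v + 2 * pi * s" for v
        unfolding shift by (simp add: algebra_simps)
    qed (rule s d)+
    show ?thesis unfolding H_def by (rule \<tau>.torus_diffeo)
  qed
  moreover have "Ck_family 1 {0..1} H"
  proof -
    have Ch: "Ck_family 1 {0..1} (\<lambda>\<tau>. stretch h)" by (rule Ck_imp_Ck_family[OF Ck1_stretch(2)[OF deriv cont]])
    have Ci: "Ck_family 1 {0..1} (\<lambda>\<tau>. \<lambda>x::real \<times> real. x)" by (rule Ck_family_linear[OF bounded_linear_ident])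
    have T: "Ck_family 1 {0..1} (\<lambda>\<tau> x::real \<times> real. \<tau>)" "Ck_family 1 {0..1} (\<lambda>\<tau> x::real \<times> real. 1 - \<tau>)"
      by (intro Ck_family_time continuous_intros)+
    have "Ck_family 1 {0..1} (\<lambda>\<tau> x. (1 - \<tau>) *\<^sub>R x + \<tau> *\<^sub>R stretch h x)"
      by (intro Ck_family_add Ck_family_bilinear[OF bounded_bilinear_scaleR T(2) Ci] Ck_family_bilinear[OF bounded_bilinear_scaleR T(1) Ch])
    moreover have "(\<lambda>\<tau> x. (1 - \<tau>) *\<^sub>R x + \<tau> *\<^sub>R stretch h x) = H"
      unfolding H_def stretch_def by (simp add: fun_eq_iff prod_eq_iff algebra_simps)
    ultimately show ?thesis by simp
  qed
  moreover have "H 0 = id" "H 1 = stretch h" unfolding H_def stretch_def by (simp_all add: fun_eq_iff)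
  ultimately show ?thesis unfolding isotopic_to_id_def by blast
qed

end

section \<open>Geometry of a torus of revolution given by its normal\<close>

section \<open>Tori of revolution\<close>

text \<open>With w = k + i k1 the normal is the inverse stereographic image of w e^(i\<theta>), the
  plane curve with support function k, whose velocity is i (k + k2) e^(i\<theta>). The first six
  identities say that along the meridian surface and normal move in one common unit direction, with
  speeds y/D and 2 (k + k2)/D; the others give unit length and orthogonality.\<close>

lemma rotational_frame:
  fixes k k1 k2 :: real
  assumes D: "D = 1 + k\<^sup>2 + k1\<^sup>2" and y: "y = 1 - k\<^sup>2 + k1\<^sup>2 - 2 * k * k2"
  shows "(2 * k1 * D - 2 * k * (2 * k1 * (k + k2))) / (D * D) = y / D * (2 * k1 / D)"
    and "(2 * k1 * (k2 - k) * D - (1 - k\<^sup>2 + k1\<^sup>2) * (2 * k1 * (k + k2))) / (D * D) - (- (2 * k * k1)) / D = y / D * (- (2 * k * k1) / D)"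
    and "(- (2 * (k1 * k1 + k * k2)) * D - (- (2 * k * k1)) * (2 * k1 * (k + k2))) / (D * D) + (1 - k\<^sup>2 + k1\<^sup>2) / D = y / D * ((1 + k\<^sup>2 - k1\<^sup>2) / D)"
    and "(2 * k1 * (k + k2) * D - (D - 2) * (2 * k1 * (k + k2))) / (D * D) = 2 * (k + k2) / D * (2 * k1 / D)"
    and "(2 * k1 * D - 2 * k * (2 * k1 * (k + k2))) / (D * D) - 2 * k1 / D = 2 * (k + k2) / D * (- (2 * k * k1) / D)"
    and "(2 * k2 * D - 2 * k1 * (2 * k1 * (k + k2))) / (D * D) + 2 * k / D = 2 * (k + k2) / D * ((1 + k\<^sup>2 - k1\<^sup>2) / D)"
    and "2 * k / D * (2 * k / D) + 0 * 0 + ((1 - k\<^sup>2 + k1\<^sup>2) / D * ((1 - k\<^sup>2 + k1\<^sup>2) / D) + - (2 * k * k1) / D * (- (2 * k * k1) / D)) = 1"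
    and "2 * k1 / D * (2 * k1 / D) + 0 * 0 + (- (2 * k * k1) / D * (- (2 * k * k1) / D) + (1 + k\<^sup>2 - k1\<^sup>2) / D * ((1 + k\<^sup>2 - k1\<^sup>2) / D)) = 1"
    and "(D - 2) / D * ((D - 2) / D) + 0 * 0 + (2 * k / D * (2 * k / D) + 2 * k1 / D * (2 * k1 / D)) = 1"
    and "(D - 2) / D * (2 * k / D) + 0 * 0 + (2 * k / D * ((1 - k\<^sup>2 + k1\<^sup>2) / D) + 2 * k1 / D * (- (2 * k * k1) / D)) = 0"
    and "(D - 2) / D * (2 * k1 / D) + 0 * 0 + (2 * k / D * (- (2 * k * k1) / D) + 2 * k1 / D * ((1 + k\<^sup>2 - k1\<^sup>2) / D)) = 0"
proof -
  have "0 < D" unfolding D by (intro add_pos_nonneg) auto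
  \<comment> \<open>With the reciprocal of \<open>D\<close> as a symbol subject to D i = 1, the
    identities become polynomial.\<close>
  define i where "i = inverse D"
  have i: "D * i = 1" using \<open>0 < D\<close> by (simp add: i_def)
  note R = divide_inverse inverse_mult_distrib i_def[symmetric]
  show "(2 * k1 * D - 2 * k * (2 * k1 * (k + k2))) / (D * D) = y / D * (2 * k1 / D)"
    unfolding R using i D y by algebra
  show "(2 * k1 * (k2 - k) * D - (1 - k\<^sup>2 + k1\<^sup>2) * (2 * k1 * (k + k2))) / (D * D) - (- (2 * k * k1)) / D = y / D * (- (2 * k * k1) / D)"
    unfolding R using i D y by algebra
  show "(- (2 * (k1 * k1 + k * k2)) * D - (- (2 * k * k1)) * (2 * k1 * (k + k2))) / (D * D) + (1 - k\<^sup>2 + k1\<^sup>2) / D = y / D * ((1 + k\<^sup>2 - k1\<^sup>2) / D)"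
    unfolding R using i D y by algebra
  show "(2 * k1 * (k + k2) * D - (D - 2) * (2 * k1 * (k + k2))) / (D * D) = 2 * (k + k2) / D * (2 * k1 / D)"
    unfolding R by (simp add: algebra_simps)
  show "(2 * k1 * D - 2 * k * (2 * k1 * (k + k2))) / (D * D) - 2 * k1 / D = 2 * (k + k2) / D * (- (2 * k * k1) / D)"
    unfolding R using i D by algebra
  show "(2 * k2 * D - 2 * k1 * (2 * k1 * (k + k2))) / (D * D) + 2 * k / D = 2 * (k + k2) / D * ((1 + k\<^sup>2 - k1\<^sup>2) / D)"
    unfolding R using i D by algebra
  show "2 * k / D * (2 * k / D) + 0 * 0 + ((1 - k\<^sup>2 + k1\<^sup>2) / D * ((1 - k\<^sup>2 + k1\<^sup>2) / D) + - (2 * k * k1) / D * (- (2 * k * k1) / D)) = 1"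
    unfolding R using i D by algebra
  show "2 * k1 / D * (2 * k1 / D) + 0 * 0 + (- (2 * k * k1) / D * (- (2 * k * k1) / D) + (1 + k\<^sup>2 - k1\<^sup>2) / D * ((1 + k\<^sup>2 - k1\<^sup>2) / D)) = 1"
    unfolding R using i D by algebra
  show "(D - 2) / D * ((D - 2) / D) + 0 * 0 + (2 * k / D * (2 * k / D) + 2 * k1 / D * (2 * k1 / D)) = 1"
    unfolding R using i D by algebra
  show "(D - 2) / D * (2 * k / D) + 0 * 0 + (2 * k / D * ((1 - k\<^sup>2 + k1\<^sup>2) / D) + 2 * k1 / D * (- (2 * k * k1) / D)) = 0"
    unfolding R using i D by algebra
  show "(D - 2) / D * (2 * k1 / D) + 0 * 0 + (2 * k / D * (- (2 * k * k1) / D) + 2 * k1 / D * ((1 + k\<^sup>2 - k1\<^sup>2) / D)) = 0"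
    unfolding R using i D by algebra
qed

text \<open>On the right, the terms without \<open>D\<close> are \<open>(\<kappa>\<^sub>1 - \<kappa>\<^sub>2)\<^sup>2 / 4\<close> times the area element; the last term is
  the Gauss curvature times the area element, the exact derivative of \<open>- 2 k1 / D\<close>.\<close>

lemma rotational_density:
  fixes k k1 k2 :: real
  assumes D: "D = 1 + k\<^sup>2 + k1\<^sup>2" and y: "y = 1 - k\<^sup>2 + k1\<^sup>2 - 2 * k * k2" and pos: "0 < k" "0 < y"
  shows "(((2 - D) / (2 * k) + - (2 * (k + k2) / y))\<^sup>2 / 4 + 1) * (2 * k * y / (D * D))
    = (1 / (k * y) - 1 / k) / 2 + y / k / 8 - (2 * k2 * D - 2 * k1 * (2 * k1 * (k + k2))) / (D * D)"
proof -
  have D0: "0 < D" unfolding D by (intro add_pos_nonneg) auto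
  define x z where "x = (2 - D) / (2 * k)" and "z = - (2 * (k + k2) / y)"
  have xz: "x - z = D * (2 - y) / (2 * k * y)"
  proof -
    have "4 * k * (k + k2) = 2 * D - 2 * y" unfolding D y by (simp add: power2_eq_square algebra_simps)
    then have "(2 - D) * y + 4 * k * (k + k2) = D * (2 - y)" by (simp add: algebra_simps)
    then show ?thesis unfolding x_def z_def using pos by (simp add: field_simps)
  qed
  have xz': "x * z = - ((2 - D) * (k + k2)) / (k * y)"
    unfolding x_def z_def using pos by (simp add: divide_simps)
  have "((x + z)\<^sup>2 / 4 + 1) * (2 * k * y / (D * D)) = ((x - z)\<^sup>2 / 4) * (2 * k * y / (D * D)) + (1 + x * z) * (2 * k * y / (D * D))"
    by (simp add: power2_eq_square algebra_simps add_divide_distrib diff_divide_distrib)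
  also have "((x - z)\<^sup>2 / 4) * (2 * k * y / (D * D)) = (2 - y)\<^sup>2 / (8 * (k * y))"
    unfolding xz using pos D0 by (simp add: power2_eq_square divide_simps)
  also have "\<dots> = (1 / (k * y) - 1 / k) / 2 + y / k / 8"
    using pos by (simp add: power2_eq_square field_simps)
  also have "(1 + x * z) * (2 * k * y / (D * D)) = (2 * k * y - 2 * (2 - D) * (k + k2)) / (D * D)"
    unfolding xz' using pos D0 by (simp add: field_simps)
  also have "2 * k * y - 2 * (2 - D) * (k + k2) = - (2 * k2 * D - 2 * k1 * (2 * k1 * (k + k2)))"
    unfolding D y by (simp add: power2_eq_square algebra_simps)
  finally show ?thesis unfolding x_def z_def by (simp only: minus_divide_left[symmetric] add_uminus_conv_diff)
qed

lemma integral_cell_snd: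
  fixes d :: "real \<Rightarrow> real"
  assumes rs: "0 < r" "0 < s" and d: "continuous_on UNIV d"
  shows "integral (cell r s) (\<lambda>x. d (snd x / s)) = 2 * pi * r * s * integral {0..2 * pi} d"
proof -
  have "continuous_on UNIV (\<lambda>x::real \<times> real. d (snd x / s))"
    by (rule continuous_on_compose2[OF d]) (use rs in \<open>auto intro!: continuous_intros\<close>)
  from integral_cell_swap[OF this, of r s]
  have 1: "integral (cell r s) (\<lambda>x. d (snd x / s)) = integral {0..2 * pi * s} (\<lambda>v. 2 * pi * r * d (v / s))"
    using rs by simp
  have "(d has_integral integral {0..2 * pi} d) {0..2 * pi}"
    by (intro integrable_integral integrable_continuous_interval continuous_on_subset[OF d]) simp
  from has_integral_stretch_real[OF this, of "1 / s"]
  moreover have "(\<lambda>x. x * s) ` {0..2 * pi} = {0..2 * pi * s}"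
    using image_mult_atLeastAtMost[OF rs(2), of 0 "2 * pi"] by (simp add: mult.commute[of _ s])
  ultimately have "((\<lambda>v. d (v / s)) has_integral s * integral {0..2 * pi} d) {0..2 * pi * s}"
    using rs by simp
  from integral_unique[OF has_integral_mult_right[OF this, of "2 * pi * r"]] show ?thesis unfolding 1 by (simp only: ac_simps)
qed

text \<open>With \<open>w = k + i k1\<close> the torus of revolution \<open>F\<close> below is
  \<open>(2 k e\<^bsup>iu/r\<^esup>, (1 - w\<^sup>2) e\<^bsup>i\<theta>\<^esup>) / (1 + \<bar>w\<bar>\<^sup>2)\<close>. The assumption \<open>closing\<close> says that the integral of \<open>y / k\<close>
  over a period is \<open>4 \<pi> s / r\<close>, which fixes the conformal class.\<close>

locale profile =
  fixes r s \<epsilon> \<rho> :: real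
  assumes rs: "0 < r" "0 < s" and \<epsilon>: "0 < \<epsilon>" and \<rho>: "\<bar>\<rho>\<bar> < 1" and b_pos: "0 < 1 - 4 * \<epsilon>\<^sup>2 * (1 - \<rho>\<^sup>2)\<^sup>2"
    and closing: "1 / (\<epsilon> * (1 - \<rho>\<^sup>2)) - \<epsilon> * (1 - 7 * \<rho>\<^sup>2) = 2 * s / r"
begin

text \<open>This is |1 + \<rho> e^(2i\<theta>)|^2. Its reciprocal is a Poisson kernel up to a
  constant, so 1/k has an elementary primitive, while to first order in \<rho> it perturbs by cos
  2\<theta>.\<close>

definition "P \<theta> = 1 + \<rho>\<^sup>2 + 2 * \<rho> * cos (2 * \<theta>)"
definition "k \<theta> = \<epsilon> * P \<theta>"
definition "k1 \<theta> = - 4 * \<epsilon> * \<rho> * sin (2 * \<theta>)"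
definition "k2 \<theta> = - 8 * \<epsilon> * \<rho> * cos (2 * \<theta>)"
definition "D \<theta> = 1 + (k \<theta>)\<^sup>2 + (k1 \<theta>)\<^sup>2"
definition "y \<theta> = 1 - (k \<theta>)\<^sup>2 + (k1 \<theta>)\<^sup>2 - 2 * k \<theta> * k2 \<theta>"
definition "b = 1 - 4 * \<epsilon>\<^sup>2 * (1 - \<rho>\<^sup>2)\<^sup>2"
definition "F x = fr r s x (2 * k (snd x / s) / D (snd x / s)) 0
  ((1 - (k (snd x / s))\<^sup>2 + (k1 (snd x / s))\<^sup>2) / D (snd x / s)) (- (2 * k (snd x / s) * k1 (snd x / s)) / D (snd x / s))"
definition "NF x = fr r s x ((D (snd x / s) - 2) / D (snd x / s)) 0 (2 * k (snd x / s) / D (snd x / s)) (2 * k1 (snd x / s) / D (snd x / s))"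

lemma g_pos: "0 < 1 - \<rho>\<^sup>2"
  using \<rho> abs_square_less_1[of \<rho>] by simp

lemma P_pos: "0 < P \<theta>"
proof -
  have "\<bar>\<rho> * cos (2 * \<theta>)\<bar> \<le> \<bar>\<rho>\<bar> * 1" unfolding abs_mult by (intro mult_left_mono) auto
  then have "1 + \<rho>\<^sup>2 - 2 * \<bar>\<rho>\<bar> \<le> P \<theta>" unfolding P_def by linarith
  moreover have "1 + \<rho>\<^sup>2 - 2 * \<bar>\<rho>\<bar> = (1 - \<bar>\<rho>\<bar>)\<^sup>2" by (simp add: power2_diff)
  moreover have "0 < (1 - \<bar>\<rho>\<bar>)\<^sup>2" using \<rho> by simp
  ultimately show ?thesis by linarith
qed

lemma k_pos: "0 < k \<theta>" unfolding k_def using P_pos \<epsilon> by simp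

lemma D_pos: "0 < D \<theta>" unfolding D_def by (intro add_pos_nonneg) auto

text \<open>For this profile k1^2 - 2 k k2 is 4 k^2 plus a constant. Hence y/k is a combination of k
  and 1/k, k y is a trigonometric polynomial, and positivity of y is immediate from that of
  \<open>b\<close>.\<close>

lemma y_eq: "y \<theta> = b + 3 * (k \<theta>)\<^sup>2"
proof -
  have n: "(sin (2 * \<theta>))\<^sup>2 = 1 - (cos (2 * \<theta>))\<^sup>2" by (rule sin_squared_eq)
  show ?thesis
    unfolding y_def b_def k_def k1_def k2_def P_def power_mult_distrib n
    by (simp add: power2_eq_square algebra_simps)
qed

lemma y_pos: "0 < y \<theta>"
  unfolding y_eq using b_pos unfolding b_def by (intro add_pos_nonneg) auto

lemma k_deriv: "(k has_real_derivative k1 \<theta>) (at \<theta>)" "(k1 has_real_derivative k2 \<theta>) (at \<theta>)"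
  unfolding k_def[abs_def] P_def k1_def[abs_def] k2_def by (auto intro!: derivative_eq_intros)

lemma D_deriv: "(D has_real_derivative 2 * k1 \<theta> * (k \<theta> + k2 \<theta>)) (at \<theta>)"
  unfolding D_def[abs_def] by (auto intro!: derivative_eq_intros k_deriv simp: algebra_simps)

lemma quotient_deriv:
  assumes "(f has_real_derivative f') (at \<theta>)"
  shows "((\<lambda>\<theta>. f \<theta> / D \<theta>) has_real_derivative (f' * D \<theta> - f \<theta> * (2 * k1 \<theta> * (k \<theta> + k2 \<theta>))) / (D \<theta> * D \<theta>)) (at \<theta>)"
  using DERIV_divide[OF assms D_deriv, of ] D_pos[of \<theta>] by simp

lemma num_deriv:
  "((\<lambda>\<theta>. 2 * k \<theta>) has_real_derivative 2 * k1 \<theta>) (at \<theta>)" "((\<lambda>\<theta>. 2 * k1 \<theta>) has_real_derivative 2 * k2 \<theta>) (at \<theta>)"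
  "((\<lambda>\<theta>. 1 - (k \<theta>)\<^sup>2 + (k1 \<theta>)\<^sup>2) has_real_derivative 2 * k1 \<theta> * (k2 \<theta> - k \<theta>)) (at \<theta>)"
  "((\<lambda>\<theta>. - (2 * k \<theta> * k1 \<theta>)) has_real_derivative - (2 * (k1 \<theta> * k1 \<theta> + k \<theta> * k2 \<theta>))) (at \<theta>)"
  "((\<lambda>\<theta>. D \<theta> - 2) has_real_derivative 2 * k1 \<theta> * (k \<theta> + k2 \<theta>)) (at \<theta>)"
  by (auto intro!: derivative_eq_intros k_deriv D_deriv simp: algebra_simps)

lemmas quotient_derivs = num_deriv[THEN quotient_deriv]

lemmas frame = rotational_frame[OF D_def y_def]

lemma F_derivative:
  "dd X F x = (fst X / r) *\<^sub>R fr r s x 0 (2 * k (snd x / s) / D (snd x / s)) 0 0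
    + (snd X / s) *\<^sub>R (y (snd x / s) / D (snd x / s)) *\<^sub>R fr r s x (2 * k1 (snd x / s) / D (snd x / s)) 0
      (- (2 * k (snd x / s) * k1 (snd x / s)) / D (snd x / s)) ((1 + (k (snd x / s))\<^sup>2 - (k1 (snd x / s))\<^sup>2) / D (snd x / s))"
  and F_differentiable: "F differentiable at x"
proof -
  note d = fr_derivative[where r = r and s = s and x = x, OF quotient_derivs(1) DERIV_const[of 0] quotient_derivs(3,4)]
  show "F differentiable at x" unfolding F_def[abs_def] using d unfolding differentiable_def by blast
  show "dd X F x = (fst X / r) *\<^sub>R fr r s x 0 (2 * k (snd x / s) / D (snd x / s)) 0 0
    + (snd X / s) *\<^sub>R (y (snd x / s) / D (snd x / s)) *\<^sub>R fr r s x (2 * k1 (snd x / s) / D (snd x / s)) 0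
      (- (2 * k (snd x / s) * k1 (snd x / s)) / D (snd x / s)) ((1 + (k (snd x / s))\<^sup>2 - (k1 (snd x / s))\<^sup>2) / D (snd x / s))"
    unfolding F_def[abs_def] dd_eqI[OF d] frame(1-3)
    by (simp only: fr_scale mult_zero_right add_0_left minus_zero diff_zero add_0_right)
qed

lemma NF_derivative:
  "dd (0, 1) NF x = (1 / s) *\<^sub>R (2 * (k (snd x / s) + k2 (snd x / s)) / D (snd x / s)) *\<^sub>R fr r s x (2 * k1 (snd x / s) / D (snd x / s)) 0
      (- (2 * k (snd x / s) * k1 (snd x / s)) / D (snd x / s)) ((1 + (k (snd x / s))\<^sup>2 - (k1 (snd x / s))\<^sup>2) / D (snd x / s))"
  and NF_differentiable: "NF differentiable at x"
proof -
  note d = fr_derivative[where r = r and s = s and x = x, OF quotient_derivs(5) DERIV_const[of 0] quotient_derivs(1,2)]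
  show "NF differentiable at x" unfolding NF_def[abs_def] using d unfolding differentiable_def by blast
  show "dd (0, 1) NF x = (1 / s) *\<^sub>R (2 * (k (snd x / s) + k2 (snd x / s)) / D (snd x / s)) *\<^sub>R fr r s x (2 * k1 (snd x / s) / D (snd x / s)) 0
      (- (2 * k (snd x / s) * k1 (snd x / s)) / D (snd x / s)) ((1 + (k (snd x / s))\<^sup>2 - (k1 (snd x / s))\<^sup>2) / D (snd x / s))"
    unfolding NF_def[abs_def] dd_eqI[OF d] frame(4-6)
    by (simp only: fr_scale fr_add fst_conv snd_conv mult_zero_right mult_zero_left div_0 scaleR_zero_left add_0_left add_0_right minus_zero)
qed

lemma F_metric:
  "dd X F x \<bullet> dd Y F x = (2 * k (snd x / s) / (r * D (snd x / s)))\<^sup>2 * (fst X * fst Y)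
     + (y (snd x / s) / (s * D (snd x / s)))\<^sup>2 * (snd X * snd Y)"
proof -
  note t = frame(8)[of "snd x / s"]
  show ?thesis
    unfolding F_derivative inner_add_left inner_add_right inner_scaleR_left inner_scaleR_right fr_inner t
    by (simp add: power2_eq_square ac_simps)
qed

lemma F_sphere: "F x \<bullet> F x = 1"
  unfolding F_def fr_inner by (rule frame(7))

lemma surface: assumes "Ck 2 F" shows "surface F"
proof
  show "Ck 2 F" by fact
  show "F x \<bullet> F x = 1" for x by (rule F_sphere)
  show "0 < gram_det (induced_metric F) x" for x
    unfolding gram_det_def induced_metric_def F_metric
    using k_pos[of "snd x / s"] y_pos[of "snd x / s"] D_pos[of "snd x / s"] rs by simp
qed

lemma density:
  assumes "Ck 2 F"
  shows "willmore_density F x = (1 / (r * s)) * ((1 / (k (snd x / s) * y (snd x / s)) - 1 / k (snd x / s)) / 2 + y (snd x / s) / k (snd x / s) / 8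
    - (2 * k2 (snd x / s) * D (snd x / s) - 2 * k1 (snd x / s) * (2 * k1 (snd x / s) * (k (snd x / s) + k2 (snd x / s)))) / (D (snd x / s) * D (snd x / s)))"
proof -
  interpret S: surface F by (rule surface[OF assms])
  let ?\<theta> = "snd x / s"
  note pos = k_pos[of ?\<theta>] y_pos[of ?\<theta>] D_pos[of ?\<theta>]
  have N1: "NF x \<bullet> NF x = 1" "NF x \<bullet> F x = 0" for x unfolding NF_def F_def fr_inner by (rule frame(9), rule frame(10))
  have N2: "NF x \<bullet> S.fu x = 0" "NF x \<bullet> S.fv x = 0" for x
  proof -
    note t = frame(11)[of "snd x / s"]
    show "NF x \<bullet> S.fu x = 0" unfolding F_derivative by (simp add: NF_def fr_inner inner_add_right)
    show "NF x \<bullet> S.fv x = 0" unfolding F_derivative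
      by (simp only: fst_conv snd_conv div_0 scaleR_zero_left add_0_left inner_scaleR_right NF_def fr_inner t)
  qed
  have F0: "S.FF x = 0" unfolding F_metric by simp
  have E: "S.EE x = (2 * k ?\<theta> / (r * D ?\<theta>))\<^sup>2" and G: "S.GG x = (y ?\<theta> / (s * D ?\<theta>))\<^sup>2" unfolding F_metric by simp_all
  have fuu: "dd (1, 0) S.fu x = fr r s x (- (2 * k ?\<theta> / D ?\<theta> / (r * r))) 0 0 0"
  proof -
    have e: "S.fu = (\<lambda>x. fr r s x 0 (2 * k (snd x / s) / D (snd x / s) / r) 0 0)"
      by (rule ext) (simp add: F_derivative fr_scale fr_add mult.commute[of r])
    note d = fr_derivative[where r = r and s = s and x = x, OF DERIV_const[of 0] DERIV_cdivide[OF quotient_derivs(1), of r] DERIV_const[of 0] DERIV_const[of 0]]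
    show ?thesis unfolding e dd_eqI[OF d] by (simp add: fr_scale fr_add ac_simps)
  qed
  have k1: "dd (1, 0) S.fu x \<bullet> NF x = (2 - D ?\<theta>) / (2 * k ?\<theta>) * S.EE x"
    unfolding fuu E NF_def fr_inner using pos rs by (simp add: power2_eq_square field_simps)
  have k2: "dd (0, 1) S.fv x \<bullet> NF x = - (2 * (k ?\<theta> + k2 ?\<theta>) / y ?\<theta>) * S.GG x"
  proof -
    \<comment> \<open>Weingarten's equation: differentiating the orthogonality of f_v and the normal
      trades the second derivative of F for the derivative of the normal, which is parallel to
      f_v.\<close>
    have "dd (0, 1) (\<lambda>x. S.fv x \<bullet> NF x) x = S.fv x \<bullet> dd (0, 1) NF x + dd (0, 1) S.fv x \<bullet> NF x"
      by (rule dd_inner[OF S.diff' NF_differentiable])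
    moreover have "(\<lambda>x. S.fv x \<bullet> NF x) = (\<lambda>x. 0)" using N2(2) by (simp add: inner_commute)
    moreover have "dd (0, 1) (\<lambda>x::real \<times> real. 0::real) x = 0" by (rule dd_eqI[OF has_derivative_const])
    ultimately have "dd (0, 1) S.fv x \<bullet> NF x = - (S.fv x \<bullet> dd (0, 1) NF x)" by simp
    also have "\<dots> = - (2 * (k ?\<theta> + k2 ?\<theta>) / y ?\<theta>) * S.GG x"
    proof -
      have "dd (0, 1) NF x = (2 * (k ?\<theta> + k2 ?\<theta>) / y ?\<theta>) *\<^sub>R S.fv x"
        unfolding NF_derivative F_derivative using pos by simp
      then show ?thesis by simp
    qed
    finally show ?thesis .
  qed
  have "sqrt (S.EE x * S.GG x) = (2 * k ?\<theta> / (r * D ?\<theta>)) * (y ?\<theta> / (s * D ?\<theta>))"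
    unfolding E G real_sqrt_mult using pos rs by simp
  also have "\<dots> = (1 / (r * s)) * (2 * k ?\<theta> * y ?\<theta> / (D ?\<theta> * D ?\<theta>))" by simp
  finally have "willmore_density F x = (((2 - D ?\<theta>) / (2 * k ?\<theta>) + - (2 * (k ?\<theta> + k2 ?\<theta>) / y ?\<theta>))\<^sup>2 / 4 + 1)
      * ((1 / (r * s)) * (2 * k ?\<theta> * y ?\<theta> / (D ?\<theta> * D ?\<theta>)))"
    using S.willmore_density_curvatures[OF N1 N2 F0 k1 k2] by simp
  also have "\<dots> = (1 / (r * s)) * ((((2 - D ?\<theta>) / (2 * k ?\<theta>) + - (2 * (k ?\<theta> + k2 ?\<theta>) / y ?\<theta>))\<^sup>2 / 4 + 1)
      * (2 * k ?\<theta> * y ?\<theta> / (D ?\<theta> * D ?\<theta>)))" by (rule mult.left_commute)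
  finally show ?thesis unfolding rotational_density[OF D_def y_def k_pos y_pos] .
qed

end

section \<open>Elementary primitives, the closed form of the energy, and the uniformising
  map\<close>

section \<open>Conformal class and Willmore energy of the tori of revolution\<close>

lemma arctan_quotient_algebra:
  fixes \<rho> c n :: real
  assumes cn: "c * c + n * n = 1" and w: "1 + \<rho> * c \<noteq> 0" and P: "1 + \<rho>\<^sup>2 + 2 * \<rho> * c \<noteq> 0"
  shows "1 - inverse (1 + (\<rho> * n / (1 + \<rho> * c))\<^sup>2) * ((\<rho> * (2 * c) * (1 + \<rho> * c) - \<rho> * n * (\<rho> * (- 2 * n))) / ((1 + \<rho> * c) * (1 + \<rho> * c)))
    = (1 - \<rho>\<^sup>2) / (1 + \<rho>\<^sup>2 + 2 * \<rho> * c)"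
proof -
  let ?w = "1 + \<rho> * c" and ?P = "1 + \<rho>\<^sup>2 + 2 * \<rho> * c"
  have "?w * ?w + \<rho> * n * (\<rho> * n) = ?P" using cn by algebra
  then have 1: "1 + (\<rho> * n / ?w)\<^sup>2 = ?P / (?w * ?w)"
    using w by (simp add: power2_eq_square divide_simps)
  have 2: "\<rho> * (2 * c) * ?w - \<rho> * n * (\<rho> * (- 2 * n)) = 2 * (\<rho> * c + \<rho>\<^sup>2)" using cn by algebra
  have 3: "inverse (?P / (?w * ?w)) * (2 * (\<rho> * c + \<rho>\<^sup>2) / (?w * ?w)) = 2 * (\<rho> * c + \<rho>\<^sup>2) / ?P" using w by simp
  have "1 - 2 * (\<rho> * c + \<rho>\<^sup>2) / ?P = (?P - 2 * (\<rho> * c + \<rho>\<^sup>2)) / ?P" unfolding diff_divide_distrib using P by simp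
  also have "?P - 2 * (\<rho> * c + \<rho>\<^sup>2) = 1 - \<rho>\<^sup>2" by simp
  finally show ?thesis unfolding 1 2 3 .
qed

context profile
begin

lemma trig_shift: "cos (2 * (\<theta> + 2 * pi * of_int n)) = cos (2 * \<theta>)" "sin (2 * (\<theta> + 2 * pi * of_int n)) = sin (2 * \<theta>)"
proof -
  have e: "2 * (\<theta> + 2 * pi * of_int n) = 2 * \<theta> + 2 * pi * of_int (2 * n)" by simp
  show "cos (2 * (\<theta> + 2 * pi * of_int n)) = cos (2 * \<theta>)" "sin (2 * (\<theta> + 2 * pi * of_int n)) = sin (2 * \<theta>)"
    unfolding e cos_add sin_add cos_int_2pin sin_int_2pin by simp_all
qed

lemma shift: "P (\<theta> + 2 * pi * of_int n) = P \<theta>" "k (\<theta> + 2 * pi * of_int n) = k \<theta>" "k1 (\<theta> + 2 * pi * of_int n) = k1 \<theta>"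
  "D (\<theta> + 2 * pi * of_int n) = D \<theta>"
  unfolding k_def D_def P_def k1_def trig_shift by simp_all

text \<open>\<theta> minus the argument of 1 + \<rho> e^(2i\<theta>); the real part of that number
  is positive for |\<rho>| < 1, so the arctangent is a continuous branch. The derivative is the
  Poisson kernel.\<close>

definition "phase \<theta> = \<theta> - arctan (\<rho> * sin (2 * \<theta>) / (1 + \<rho> * cos (2 * \<theta>)))"
text \<open>A primitive of y/k; up to scaling it is the parameter of the meridian in which the
  metric is conformal to the flat one.\<close>

definition "Y \<theta> = b / (\<epsilon> * (1 - \<rho>\<^sup>2)) * phase \<theta> + 3 * \<epsilon> * ((1 + \<rho>\<^sup>2) * \<theta> + \<rho> * sin (2 * \<theta>))"

lemma phase_deriv: "(phase has_real_derivative (1 - \<rho>\<^sup>2) / P \<theta>) (at \<theta>)"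
proof -
  have "\<bar>\<rho> * cos (2 * \<theta>)\<bar> \<le> \<bar>\<rho>\<bar> * 1" unfolding abs_mult by (intro mult_left_mono) auto
  then have w: "1 + \<rho> * cos (2 * \<theta>) \<noteq> 0" using \<rho> by linarith
  have P: "1 + \<rho>\<^sup>2 + 2 * \<rho> * cos (2 * \<theta>) \<noteq> 0" using P_pos[of \<theta>] unfolding P_def by simp
  have "((\<lambda>\<theta>. \<rho> * sin (2 * \<theta>)) has_real_derivative \<rho> * (2 * cos (2 * \<theta>))) (at \<theta>)"
    "((\<lambda>\<theta>. 1 + \<rho> * cos (2 * \<theta>)) has_real_derivative \<rho> * (- 2 * sin (2 * \<theta>))) (at \<theta>)"
    by (auto intro!: derivative_eq_intros)
  from DERIV_divide[OF this w]
  have "((\<lambda>\<theta>. arctan (\<rho> * sin (2 * \<theta>) / (1 + \<rho> * cos (2 * \<theta>)))) has_real_derivative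
     inverse (1 + (\<rho> * sin (2 * \<theta>) / (1 + \<rho> * cos (2 * \<theta>)))\<^sup>2) *
      ((\<rho> * (2 * cos (2 * \<theta>)) * (1 + \<rho> * cos (2 * \<theta>)) - \<rho> * sin (2 * \<theta>) * (\<rho> * (- 2 * sin (2 * \<theta>)))) / ((1 + \<rho> * cos (2 * \<theta>)) * (1 + \<rho> * cos (2 * \<theta>))))) (at \<theta>)"
    by (rule DERIV_chain2[OF DERIV_arctan])
  from DERIV_diff[OF DERIV_ident this] show ?thesis
    unfolding arctan_quotient_algebra[OF sin_cos_squared_add3 w P] phase_def[abs_def] P_def .
qed

lemma Y_deriv: "(Y has_real_derivative y \<theta> / k \<theta>) (at \<theta>)"
proof -
  have "(Y has_real_derivative b / (\<epsilon> * (1 - \<rho>\<^sup>2)) * ((1 - \<rho>\<^sup>2) / P \<theta>) + 3 * \<epsilon> * P \<theta>) (at \<theta>)"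
    unfolding Y_def[abs_def] P_def
    by (rule DERIV_add[OF DERIV_cmult[OF phase_deriv[unfolded P_def]] DERIV_cmult]) (auto intro!: derivative_eq_intros)
  moreover have "b / (\<epsilon> * (1 - \<rho>\<^sup>2)) * ((1 - \<rho>\<^sup>2) / P \<theta>) + 3 * \<epsilon> * P \<theta> = y \<theta> / k \<theta>"
    unfolding y_eq k_def using P_pos[of \<theta>] \<epsilon> g_pos by (simp add: power2_eq_square add_divide_distrib)
  ultimately show ?thesis by simp
qed

lemma phase_shift: "phase (\<theta> + 2 * pi) = phase \<theta> + 2 * pi"
  using trig_shift[of \<theta> 1] by (simp add: phase_def)

text \<open>Here \<open>closing\<close> enters: it equates the conformal length of the meridian with
  that of the unperturbed torus.\<close>

lemma Y_shift: "Y (\<theta> + 2 * pi) = Y \<theta> + 4 * pi * s / r"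
proof -
  have nz: "\<epsilon> * (1 - \<rho>\<^sup>2) \<noteq> 0" using \<epsilon> g_pos by simp
  have "b / (\<epsilon> * (1 - \<rho>\<^sup>2)) = 1 / (\<epsilon> * (1 - \<rho>\<^sup>2)) - 4 * \<epsilon> * (1 - \<rho>\<^sup>2)"
    unfolding b_def diff_divide_distrib using nz by (simp add: power2_eq_square)
  then have c: "b / (\<epsilon> * (1 - \<rho>\<^sup>2)) + 3 * \<epsilon> * (1 + \<rho>\<^sup>2) = 2 * s / r"
    unfolding closing[symmetric] by (simp add: algebra_simps)
  have "Y (\<theta> + 2 * pi) = Y \<theta> + 2 * pi * (b / (\<epsilon> * (1 - \<rho>\<^sup>2)) + 3 * \<epsilon> * (1 + \<rho>\<^sup>2))"
    unfolding Y_def phase_shift using trig_shift[of \<theta> 1] by (simp add: algebra_simps add_divide_distrib)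
  then show ?thesis unfolding c by simp
qed

lemma integral_full:
  assumes "\<And>\<theta>. (f has_real_derivative f' \<theta>) (at \<theta>)" "f (2 * pi) = f 0 + c"
  shows "(f' has_integral c) {0..2 * pi}"
proof -
  have "(f' has_integral (f (2 * pi) - f 0)) {0..2 * pi}"
    by (rule fundamental_theorem_of_calculus)
      (auto intro: has_vector_derivative_at_within assms(1)[unfolded has_real_derivative_iff_has_vector_derivative])
  then show ?thesis using assms(2) by simp
qed

lemma integral_y_k: "((\<lambda>\<theta>. y \<theta> / k \<theta>) has_integral 4 * pi * s / r) {0..2 * pi}"
  by (rule integral_full[OF Y_deriv]) (use Y_shift[of 0] in simp)

lemma integral_inverse_k: "((\<lambda>\<theta>. 1 / k \<theta>) has_integral 2 * pi / (\<epsilon> * (1 - \<rho>\<^sup>2))) {0..2 * pi}"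
proof -
  have "((\<lambda>\<theta>. (1 / (\<epsilon> * (1 - \<rho>\<^sup>2))) * ((1 - \<rho>\<^sup>2) / P \<theta>)) has_integral 1 / (\<epsilon> * (1 - \<rho>\<^sup>2)) * (2 * pi)) {0..2 * pi}"
    by (intro has_integral_mult_right integral_full[OF phase_deriv]) (use phase_shift[of 0] in simp)
  moreover have "(1 / (\<epsilon> * (1 - \<rho>\<^sup>2))) * ((1 - \<rho>\<^sup>2) / P \<theta>) = 1 / k \<theta>" for \<theta>
    unfolding k_def using g_pos \<epsilon> by simp
  ultimately show ?thesis by simp
qed

lemma integral_curvature:
  "((\<lambda>\<theta>. (2 * k2 \<theta> * D \<theta> - 2 * k1 \<theta> * (2 * k1 \<theta> * (k \<theta> + k2 \<theta>))) / (D \<theta> * D \<theta>)) has_integral 0) {0..2 * pi}"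
  by (rule integral_full[OF quotient_derivs(2)]) (use shift[of 0 1] in simp)

text \<open>The mean value of k y, whose oscillating part is \<rho> V.\<close>

definition "q = b * \<epsilon> * (1 + \<rho>\<^sup>2) + 3 * \<epsilon> ^ 3 * ((1 + \<rho>\<^sup>2) ^ 3 + 6 * (1 + \<rho>\<^sup>2) * \<rho>\<^sup>2)"
definition "V \<theta> = 2 * b * \<epsilon> * cos (2 * \<theta>) + 3 * \<epsilon> ^ 3 * (6 * (1 + \<rho>\<^sup>2)\<^sup>2 * cos (2 * \<theta>)
   + 12 * (1 + \<rho>\<^sup>2) * \<rho> * (cos (2 * \<theta>))\<^sup>2 - 6 * (1 + \<rho>\<^sup>2) * \<rho> + 8 * \<rho>\<^sup>2 * (cos (2 * \<theta>)) ^ 3)"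

lemma ky_eq: "k \<theta> * y \<theta> = q + \<rho> * V \<theta>"
  unfolding y_eq k_def P_def q_def V_def by (simp add: eval_nat_numeral algebra_simps)

lemma q_pos: "0 < q"
  unfolding q_def using b_pos \<epsilon> unfolding b_def[symmetric] by (intro add_pos_nonneg) (auto intro!: mult_pos_pos add_pos_nonneg)

lemma integral_V: "(V has_integral 0) {0..2 * pi}"
proof (rule integral_full)
  let ?f = "\<lambda>\<theta>::real. b * \<epsilon> * sin (2 * \<theta>) + 3 * \<epsilon> ^ 3 * (3 * (1 + \<rho>\<^sup>2)\<^sup>2 * sin (2 * \<theta>)
      + 3 * (1 + \<rho>\<^sup>2) * \<rho> * (sin (2 * \<theta>) * cos (2 * \<theta>)) + 4 * \<rho>\<^sup>2 * (sin (2 * \<theta>) - (sin (2 * \<theta>)) ^ 3 / 3))"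
  show "?f (2 * pi) = ?f 0 + 0" using trig_shift[of 0 1] by simp
  fix \<theta> :: real
  have n: "sin (2 * \<theta>) * sin (2 * \<theta>) = 1 - cos (2 * \<theta>) * cos (2 * \<theta>)" using sin_cos_squared_add3[of "2 * \<theta>"] by linarith
  have "(?f has_real_derivative b * \<epsilon> * (2 * cos (2 * \<theta>)) + 3 * \<epsilon> ^ 3 * (3 * (1 + \<rho>\<^sup>2)\<^sup>2 * (2 * cos (2 * \<theta>))
      + 3 * (1 + \<rho>\<^sup>2) * \<rho> * (2 * (cos (2 * \<theta>) * cos (2 * \<theta>)) - 2 * (sin (2 * \<theta>) * sin (2 * \<theta>)))
      + 4 * \<rho>\<^sup>2 * (2 * cos (2 * \<theta>) - 2 * (sin (2 * \<theta>) * sin (2 * \<theta>)) * cos (2 * \<theta>)))) (at \<theta>)"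
    by (auto intro!: derivative_eq_intros simp: power2_eq_square algebra_simps)
  then show "(?f has_real_derivative V \<theta>) (at \<theta>)"
    unfolding n V_def by (rule DERIV_cong) (simp add: eval_nat_numeral algebra_simps)
qed

lemma continuous_profile: "continuous_on S k" "continuous_on S y" "continuous_on S V" "continuous_on S k1" "continuous_on S k2" "continuous_on S D"
  unfolding y_eq[abs_def] V_def[abs_def] D_def[abs_def] k_def[abs_def] k1_def[abs_def] k2_def[abs_def] P_def by (intro continuous_intros)+

text \<open>1/(k y) is expanded around the mean \<open>q\<close> exactly to second order in \<rho>:
  the linear term integrates to zero and the remainder is kept as an integral. The other terms of
  the density have elementary integrals, and the curvature term has none left by
  Gauss-Bonnet.\<close>

lemma willmore_profile:
  assumes C: "Ck 2 F"
  shows "willmore r s F = pi * (2 * pi / q + \<rho>\<^sup>2 / q\<^sup>2 * integral {0..2 * pi} (\<lambda>\<theta>. (V \<theta>)\<^sup>2 / (k \<theta> * y \<theta>)) - 2 * pi / (\<epsilon> * (1 - \<rho>\<^sup>2)))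
    + pi\<^sup>2 * s / r"
proof -
  have nz: "k \<theta> \<noteq> 0" "y \<theta> \<noteq> 0" "D \<theta> \<noteq> 0" for \<theta> using k_pos[of \<theta>] y_pos[of \<theta>] D_pos[of \<theta>] by auto
  let ?J = "integral {0..2 * pi} (\<lambda>\<theta>. (V \<theta>)\<^sup>2 / (k \<theta> * y \<theta>))"
  have J: "((\<lambda>\<theta>. (V \<theta>)\<^sup>2 / (k \<theta> * y \<theta>)) has_integral ?J) {0..2 * pi}"
    by (intro integrable_integral integrable_continuous_interval continuous_intros continuous_profile) (simp add: nz)
  have "((\<lambda>\<theta>. 1 / q - (\<rho> / q\<^sup>2) * V \<theta> + (\<rho>\<^sup>2 / q\<^sup>2) * ((V \<theta>)\<^sup>2 / (k \<theta> * y \<theta>))) has_integral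
     (2 * pi) * (1 / q) - (\<rho> / q\<^sup>2) * 0 + (\<rho>\<^sup>2 / q\<^sup>2) * ?J) {0..2 * pi}"
    using has_integral_const_real[of "1 / q" 0 "2 * pi"]
    by (intro has_integral_add has_integral_diff has_integral_mult_right integral_V J) simp
  moreover have "1 / q - (\<rho> / q\<^sup>2) * V \<theta> + (\<rho>\<^sup>2 / q\<^sup>2) * ((V \<theta>)\<^sup>2 / (k \<theta> * y \<theta>)) = 1 / (k \<theta> * y \<theta>)" for \<theta>
  proof -
    have Q: "k \<theta> * y \<theta> \<noteq> 0" using nz by simp
    have "1 / q - (\<rho> / q\<^sup>2) * v + (\<rho>\<^sup>2 / q\<^sup>2) * (v\<^sup>2 / Q) = 1 / Q" if "Q = q + \<rho> * v" "Q \<noteq> 0" for v Q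
    proof -
      have v: "\<rho> * v = Q - q" using that by simp
      have "1 / q - (\<rho> / q\<^sup>2) * v + (\<rho>\<^sup>2 / q\<^sup>2) * (v\<^sup>2 / Q) = 1 / q - (\<rho> * v) / q\<^sup>2 + (\<rho> * v)\<^sup>2 / (q\<^sup>2 * Q)"
        by (simp add: power_mult_distrib)
      also have "\<dots> = 1 / Q" unfolding v using that(2) q_pos by (simp add: power2_eq_square divide_simps) (simp add: algebra_simps)
      finally show ?thesis .
    qed
    from this[OF ky_eq Q] show ?thesis .
  qed
  ultimately have I1: "((\<lambda>\<theta>. 1 / (k \<theta> * y \<theta>)) has_integral 2 * pi / q + \<rho>\<^sup>2 / q\<^sup>2 * ?J) {0..2 * pi}" by simp
  define d where "d \<theta> = (1 / (r * s)) * ((1 / (k \<theta> * y \<theta>) - 1 / k \<theta>) / 2 + y \<theta> / k \<theta> / 8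
    - (2 * k2 \<theta> * D \<theta> - 2 * k1 \<theta> * (2 * k1 \<theta> * (k \<theta> + k2 \<theta>))) / (D \<theta> * D \<theta>))" for \<theta>
  have "(d has_integral (1 / (r * s)) * ((2 * pi / q + \<rho>\<^sup>2 / q\<^sup>2 * ?J - 2 * pi / (\<epsilon> * (1 - \<rho>\<^sup>2))) / 2 + 4 * pi * s / r / 8 - 0)) {0..2 * pi}"
    unfolding d_def
    by (intro has_integral_mult_right has_integral_add has_integral_diff has_integral_divide I1 integral_inverse_k integral_y_k integral_curvature)
  then have I: "integral {0..2 * pi} d = (1 / (r * s)) * ((2 * pi / q + \<rho>\<^sup>2 / q\<^sup>2 * ?J - 2 * pi / (\<epsilon> * (1 - \<rho>\<^sup>2))) / 2 + 4 * pi * s / r / 8)"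
    by (simp add: integral_unique)
  have cd: "continuous_on UNIV d"
    unfolding d_def by (intro continuous_intros continuous_profile) (auto simp: nz rs)
  have "willmore r s F = integral (cell r s) (\<lambda>x. d (snd x / s))"
    unfolding willmore_density_integral d_def by (rule integral_cong) (rule density[OF C])
  also have "\<dots> = 2 * pi * r * s * integral {0..2 * pi} d" by (rule integral_cell_snd[OF rs cd])
  also have "\<dots> = 2 * pi * ((2 * pi / q + \<rho>\<^sup>2 / q\<^sup>2 * ?J - 2 * pi / (\<epsilon> * (1 - \<rho>\<^sup>2))) / 2 + 4 * pi * s / r / 8)"
    unfolding I using rs by simp
  also have "2 * pi * (A / 2 + 4 * pi * s / r / 8) = pi * A + pi\<^sup>2 * s / r" for A
    by (simp add: distrib_left power2_eq_square)
  finally show ?thesis .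
qed

lemma lattice_coords:
  assumes "l \<in> lattice r s"
  obtains m n :: int where "fst (x + l) / r = fst x / r + 2 * pi * of_int m" "snd (x + l) / s = snd x / s + 2 * pi * of_int n"
  using assms rs unfolding lattice_iff by (force simp: add_divide_distrib intro: that)

lemma periodic_F: "periodic r s F"
  unfolding periodic_def
proof (intro allI ballI)
  fix x l assume "l \<in> lattice r s"
  then obtain m n :: int where "fst (x + l) / r = fst x / r + 2 * pi * of_int m" "snd (x + l) / s = snd x / s + 2 * pi * of_int n"
    by (rule lattice_coords)
  moreover have "cis (z + 2 * pi * of_int j) = cis z" for z j
    using cis_mult[of z "2 * pi * of_int j"] cis_multiple_2pi[of "of_int j"] by simp
  ultimately show "F (x + l) = F x" unfolding F_def fr_def by (simp only: shift)
qed

lemma immersion_F: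
  assumes "Ck n F"
  shows "immersion n r s F"
  unfolding immersion_def
proof (intro conjI allI)
  show "F x \<in> sphere 0 1" for x using F_sphere[of x] by (simp add: norm_eq_1)
  show "inj (frechet_derivative F (at x))" for x
  proof -
    have "linear (frechet_derivative F (at x))" using F_differentiable by (rule linear_frechet_derivative)
    moreover have "X = 0" if "frechet_derivative F (at x) X = 0" for X
    proof -
      have "dd X F x \<bullet> dd X F x = 0" using that by (simp add: dd_def)
      then have e: "(2 * k (snd x / s) / (r * D (snd x / s)))\<^sup>2 * (fst X)\<^sup>2 + (y (snd x / s) / (s * D (snd x / s)))\<^sup>2 * (snd X)\<^sup>2 = 0"
        unfolding F_metric by (simp add: power2_eq_square)
      have "2 * k (snd x / s) / (r * D (snd x / s)) \<noteq> 0" "y (snd x / s) / (s * D (snd x / s)) \<noteq> 0"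
        using k_pos[of "snd x / s"] y_pos[of "snd x / s"] D_pos[of "snd x / s"] rs by auto
      with e have "fst X = 0" "snd X = 0"
        by (auto simp: add_nonneg_eq_0_iff)
      then show ?thesis by (simp add: prod_eq_iff)
    qed
    ultimately show ?thesis by (simp add: linear_injective_0)
  qed
qed (rule periodic_F assms)+

text \<open>The metric is diagonal and depends on the meridian parameter only, so stretching this
  parameter makes it conformally flat. The stretched circle has its original length by
  \<open>Y_shift\<close>.\<close>

lemma has_teichmueller_F: "has_teichmueller r s (induced_metric F) (0, s / r)"
proof -
  define h where "h v = r / 2 * Y (v / s)" for v
  define h' where "h' v = r / 2 * (y (v / s) / k (v / s) * (1 / s))" for v
  have nz: "k \<theta> \<noteq> 0" for \<theta> using k_pos[of \<theta>] by simp
  interpret h: circle_diffeo h h' s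
  proof
    show "0 < s" by (rule rs)
    show "(h has_real_derivative h' v) (at v)" for v
      unfolding h_def[abs_def] h'_def
      by (intro DERIV_cmult DERIV_chain2[OF Y_deriv]) (use rs(2) in \<open>auto intro!: derivative_eq_intros\<close>)
    have "continuous_on UNIV (\<lambda>v. (\<lambda>\<theta>. y \<theta> / k \<theta>) (v / s))"
      by (rule continuous_on_compose2[of UNIV "\<lambda>\<theta>. y \<theta> / k \<theta>"]) (use rs(2) nz in \<open>auto intro!: continuous_on_divide continuous_on_id continuous_on_const continuous_profile\<close>)
    then show "continuous_on UNIV h'" unfolding h'_def[abs_def]
      by (intro continuous_on_mult[OF continuous_on_const] continuous_on_mult[OF _ continuous_on_const])
    show "0 < h' v" for v unfolding h'_def using rs k_pos y_pos by simp
    show "h (v + 2 * pi * s) = h v + 2 * pi * s" for v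
      unfolding h_def using Y_shift[of "v / s"] rs by (simp add: add_divide_distrib distrib_left)
  qed
  define w where "w x = ln (2 * k (snd x / s) / (r * D (snd x / s)))" for x :: "real \<times> real"
  have "periodic r s w"
    unfolding periodic_def
  proof (intro allI ballI)
    fix x l assume "l \<in> lattice r s"
    then obtain m n :: int where "fst (x + l) / r = fst x / r + 2 * pi * of_int m" "snd (x + l) / s = snd x / s + 2 * pi * of_int n"
      by (rule lattice_coords)
    then show "w (x + l) = w x" unfolding w_def by (simp only: shift)
  qed
  moreover have "induced_metric F x X Z = exp (2 * w x) * pullback (stretch h) (model_metric r s (0, s / r)) x X Z" for x X Z
  proof -
    let ?\<theta> = "snd x / s"
    note pos = k_pos[of ?\<theta>] y_pos[of ?\<theta>] D_pos[of ?\<theta>]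
    have "exp (w x) = 2 * k ?\<theta> / (r * D ?\<theta>)" unfolding w_def using pos rs by simp
    then have e: "exp (2 * w x) = (2 * k ?\<theta> / (r * D ?\<theta>))\<^sup>2" using exp_double[of "w x"] by simp
    have m: "model_metric r s (0, s / r) z A B = fst A * fst B + snd A * snd B" for z A B
      by (rule model_metric_flat) (use rs in auto)
    have d: "dd A (stretch h) x = (fst A, h' (snd x) * snd A)" for A
      by (rule dd_eqI[OF h.Ck1_stretch(1)[OF h.deriv h.cont]])
    have "(y ?\<theta> / (s * D ?\<theta>))\<^sup>2 = (2 * k ?\<theta> / (r * D ?\<theta>))\<^sup>2 * (h' (snd x) * h' (snd x))"
      unfolding h'_def using pos rs by (simp add: power2_eq_square divide_simps)
    then show ?thesis
      unfolding induced_metric_def F_metric pullback_def m d e by (simp add: distrib_left)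
  qed
  ultimately show ?thesis
    unfolding has_teichmueller_def using rs h.torus_diffeo h.isotopic_to_id
    by (intro conjI exI[of _ w] exI[of _ "stretch h"] allI) simp_all
qed

end

section \<open>The family of profiles through the thin torus\<close>

section \<open>The destabilising variation\<close>

lemma Ck_cis_linear:
  assumes "bounded_linear L"
  shows "Ck n (\<lambda>x. cis (L x))"
proof -
  have "Ck_family n {0} (\<lambda>_ x. exp (\<i> * of_real (L x)))"
    by (rule Ck_family_holomorphic[OF open_UNIV UNIV_I, where h = exp])
      (rule Ck_family_linear, rule bounded_linear_compose[OF bounded_linear_mult_right bounded_linear_compose[OF bounded_linear_of_real assms]],
        rule holomorphic_on_exp)
  then show ?thesis unfolding Ck_iff_family by (simp only: cis_conv_exp)
qed

lemma bounded_linear_coords: "bounded_linear (\<lambda>x::real \<times> real. c * (fst x / r))" "bounded_linear (\<lambda>x::real \<times> real. c * (snd x / s))"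
  unfolding divide_inverse
  by (rule bounded_linear_compose[OF bounded_linear_mult_right bounded_linear_compose[OF bounded_linear_mult_left bounded_linear_fst]],
      rule bounded_linear_compose[OF bounded_linear_mult_right bounded_linear_compose[OF bounded_linear_mult_left bounded_linear_snd]])

lemma C2_family_fr:
  assumes a: "C2_family n J a" and b: "C2_family n J b" and c: "C2_family n J c"
  shows "C2_family n J (\<lambda>t x. fr r s x (a t x) 0 (b t x) (c t x))"
proof -
  have e: "C2_family n J (\<lambda>t x::real \<times> real. cis (1 * (fst x / r)))" "C2_family n J (\<lambda>t x::real \<times> real. cis (1 * (snd x / s)))"
    by (intro C2_family_static Ck_cis_linear bounded_linear_coords)+
  have "C2_family n J (\<lambda>t x. (of_real (a t x) * cis (1 * (fst x / r)), 0) + (0, (of_real (b t x) + \<i> * of_real (c t x)) * cis (1 * (snd x / s))))"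
    by (intro C2_family_add C2_family_bounded_linear[OF bounded_linear_Pair[OF bounded_linear_ident bounded_linear_zero]]
        C2_family_bounded_linear[OF bounded_linear_Pair[OF bounded_linear_zero bounded_linear_ident]]
        C2_family_mult e C2_family_bounded_linear[OF bounded_linear_mult_right] C2_family_bounded_linear[OF bounded_linear_of_real] a b c)
  moreover have "(of_real (a t x) * cis (1 * (fst x / r)), 0) + (0, (of_real (b t x) + \<i> * of_real (c t x)) * cis (1 * (snd x / s)))
      = fr r s x (a t x) 0 (b t x) (c t x)" for t x
    unfolding fr_def Complex_eq by simp
  ultimately show ?thesis by (simp only:)
qed

text \<open>The left side is half the second derivative of the energy along \<open>FF\<close> at 0.
  The sign of the result rests on 1 - 14 \<epsilon>^2 + \<epsilon>^4 = (1 + \<epsilon>^2)^2 - 16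
  \<epsilon>^2, which is positive exactly when 4 \<epsilon> < 1 + \<epsilon>^2, that is r <
  1/2.\<close>

lemma destabilising_algebra:
  fixes \<epsilon> r :: real
  assumes \<epsilon>: "0 < \<epsilon>" "\<epsilon>\<^sup>2 < 1" and r: "r * (1 + \<epsilon>\<^sup>2) = 2 * \<epsilon>" and d: "\<epsilon>' = \<epsilon> + 3 * r * \<epsilon>\<^sup>2"
  shows "2 * pi\<^sup>2 * (- (\<epsilon>' * (1 - 3 * \<epsilon>\<^sup>2) + \<epsilon> + 31 * \<epsilon> ^ 3) / (\<epsilon> * (1 - \<epsilon>\<^sup>2))\<^sup>2 + 3 * r)
     + pi / (\<epsilon> * (1 - \<epsilon>\<^sup>2))\<^sup>2 * ((2 * \<epsilon> * (1 + 5 * \<epsilon>\<^sup>2))\<^sup>2 / (\<epsilon> * (1 - \<epsilon>\<^sup>2)) * pi)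
    = - (12 * pi\<^sup>2 * \<epsilon> * (1 - 14 * \<epsilon>\<^sup>2 + \<epsilon> ^ 4) / (1 - \<epsilon>\<^sup>2) ^ 3)"
proof -
  define e where "e = \<epsilon>\<^sup>2"
  have e: "0 < e" "e < 1" using \<epsilon> by (simp_all add: e_def)
  have r': "r = 2 * \<epsilon> / (1 + e)" using r e by (simp add: e_def[symmetric] eq_divide_eq)
  have d': "\<epsilon>' = \<epsilon> * (1 + 7 * e) / (1 + e)" unfolding d r' using e
    by (simp add: e_def[symmetric] divide_simps) (simp add: e_def power2_eq_square algebra_simps)
  have p3: "\<epsilon> ^ 3 = \<epsilon> * e" "\<epsilon> ^ 4 = e * e" "(\<epsilon> * (1 - e))\<^sup>2 = e * (1 - e)\<^sup>2" "(2 * \<epsilon> * (1 + 5 * e))\<^sup>2 = 4 * e * (1 + 5 * e)\<^sup>2"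
    unfolding e_def by (simp_all add: eval_nat_numeral)
  have n: "\<epsilon>' * (1 - 3 * e) + \<epsilon> + 31 * (\<epsilon> * e) = \<epsilon> * ((2 + 36 * e + 10 * e\<^sup>2) / (1 + e))"
    unfolding d' using e by (simp add: divide_simps) (simp add: power2_eq_square algebra_simps)
  have ee: "\<epsilon> / e = 1 / \<epsilon>" unfolding e_def using \<epsilon> by (simp add: power2_eq_square)
  have t1: "- (\<epsilon> * ((2 + 36 * e + 10 * e\<^sup>2) / (1 + e))) / (e * (1 - e)\<^sup>2) + 3 * (2 * \<epsilon> / (1 + e))
     = (1 / \<epsilon>) * ((6 * e * (1 - e)\<^sup>2 - (2 + 36 * e + 10 * e\<^sup>2)) / ((1 + e) * (1 - e)\<^sup>2))"
  proof -
    have "- (\<epsilon> * ((2 + 36 * e + 10 * e\<^sup>2) / (1 + e))) / (e * (1 - e)\<^sup>2) = - ((\<epsilon> / e) * ((2 + 36 * e + 10 * e\<^sup>2) / ((1 + e) * (1 - e)\<^sup>2)))"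
      by simp
    moreover have "3 * (2 * \<epsilon> / (1 + e)) = (1 / \<epsilon>) * (6 * e * (1 - e)\<^sup>2 / ((1 + e) * (1 - e)\<^sup>2))"
      using e \<epsilon> by (simp add: e_def power2_eq_square)
    ultimately show ?thesis unfolding ee by (simp add: diff_divide_distrib right_diff_distrib)
  qed
  have t2: "pi / (e * (1 - e)\<^sup>2) * (4 * e * (1 + 5 * e)\<^sup>2 / (\<epsilon> * (1 - e)) * pi) = 2 * pi\<^sup>2 * ((1 / \<epsilon>) * (2 * (1 + 5 * e)\<^sup>2 / (1 - e) ^ 3))"
    using e \<epsilon> by (simp add: eval_nat_numeral ac_simps)
  have "(6 * e * (1 - e)\<^sup>2 - (2 + 36 * e + 10 * e\<^sup>2)) / ((1 + e) * (1 - e)\<^sup>2) + 2 * (1 + 5 * e)\<^sup>2 / (1 - e) ^ 3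
     = - (6 * e * (1 - 14 * e + e * e) / (1 - e) ^ 3)"
    using e by (simp add: divide_simps) (simp add: eval_nat_numeral algebra_simps)
  then have "2 * pi\<^sup>2 * ((1 / \<epsilon>) * ((6 * e * (1 - e)\<^sup>2 - (2 + 36 * e + 10 * e\<^sup>2)) / ((1 + e) * (1 - e)\<^sup>2)))
      + 2 * pi\<^sup>2 * ((1 / \<epsilon>) * (2 * (1 + 5 * e)\<^sup>2 / (1 - e) ^ 3)) = 2 * pi\<^sup>2 * ((1 / \<epsilon>) * (- (6 * e * (1 - 14 * e + e * e) / (1 - e) ^ 3)))"
    by (simp only: distrib_left[symmetric])
  also have "\<dots> = - (12 * pi\<^sup>2 * \<epsilon> * (1 - 14 * e + e * e) / (1 - e) ^ 3)"
    using \<epsilon> by (simp add: e_def power2_eq_square)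
  finally show ?thesis unfolding e_def[symmetric] p3 n r' t1 t2 .
qed

locale thin_torus =
  fixes r s :: real
  assumes rs: "0 < r" "0 < s" "r\<^sup>2 + s\<^sup>2 = 1" and thin: "r < 1 / 2"
begin

text \<open>Evaluated at \<open>\<sigma> = t\<^sup>2\<close>, this is the positive root \<open>1 / \<epsilon>\<close> of the quadratic equation \<open>closing\<close>.\<close>

definition "X \<sigma> = (1 - \<sigma>) * (s / r + sqrt ((s / r)\<^sup>2 + (1 - 7 * \<sigma>) / (1 - \<sigma>)))"
definition "\<epsilon> t = 1 / X (t\<^sup>2)"
definition "FF t = profile.F r s (\<epsilon> t) t"
text \<open>The bound 1/3 makes t^2 smaller than 1/7, so that 1 - 7 t^2 stays positive in the
  equation for \<epsilon>.\<close>

abbreviation "J \<equiv> {-1/3<..<1/3 :: real}"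

lemma S_gt: "1 < s / r" "0 < (s / r)\<^sup>2 + 1" "sqrt ((s / r)\<^sup>2 + 1) = 1 / r"
proof -
  have "r\<^sup>2 < (1 / 2)\<^sup>2" using thin rs by (intro power_strict_mono) auto
  then have "r\<^sup>2 < s\<^sup>2" using rs(3) by (simp add: power2_eq_square)
  then have "r < s" using rs by (simp add: power2_less_imp_less)
  then show "1 < s / r" using rs by (simp add: less_divide_eq)
  show "0 < (s / r)\<^sup>2 + 1" by (intro add_nonneg_pos) auto
  have "(s / r)\<^sup>2 + 1 = (1 / r)\<^sup>2" using rs by (simp add: power_divide add_divide_eq_iff add.commute)
  then show "sqrt ((s / r)\<^sup>2 + 1) = 1 / r" using rs by simp
qed

lemma J_square: "t \<in> J \<Longrightarrow> 0 \<le> t\<^sup>2 \<and> t\<^sup>2 < 1 / 7"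
proof -
  assume "t \<in> J"
  then have "\<bar>t\<bar>\<^sup>2 \<le> (1 / 3)\<^sup>2" by (intro power_mono) auto
  then show ?thesis by (simp add: power2_eq_square)
qed

text \<open>The estimate 2 (1 - \<sigma>) < X \<sigma> is the positivity of \<open>b\<close>
  required of a profile; it rests on s > r. The last item is the closing equation in terms of
  1/\<epsilon>.\<close>

lemma X_bounds:
  assumes "0 \<le> \<sigma>" "\<sigma> < 1 / 7"
  shows "0 < (1 - 7 * \<sigma>) / (1 - \<sigma>)" "0 < (s / r)\<^sup>2 + (1 - 7 * \<sigma>) / (1 - \<sigma>)" "2 * (1 - \<sigma>) < X \<sigma>" "0 < X \<sigma>"
    "X \<sigma> / (1 - \<sigma>) - (1 - 7 * \<sigma>) / X \<sigma> = 2 * s / r"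
proof -
  define S R u where "S = s / r" and "R = sqrt (S\<^sup>2 + (1 - 7 * \<sigma>) / (1 - \<sigma>))" and "u = 1 - \<sigma>"
  have u: "0 < u" using assms by (simp add: u_def)
  show p: "0 < (1 - 7 * \<sigma>) / (1 - \<sigma>)" using assms by simp
  then show p2: "0 < (s / r)\<^sup>2 + (1 - 7 * \<sigma>) / (1 - \<sigma>)" by (intro add_nonneg_pos) auto
  have S: "1 < S" using S_gt(1) by (simp add: S_def)
  have R: "R\<^sup>2 = S\<^sup>2 + (1 - 7 * \<sigma>) / u" unfolding R_def u_def S_def using p2 by simp
  have "S \<le> R" unfolding R_def using p S by (intro real_le_rsqrt) auto
  then have R1: "1 < R" using S by simp
  have X: "X \<sigma> = u * (S + R)" unfolding X_def u_def S_def R_def ..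
  have "u * 2 < u * (S + R)" using S R1 u by (intro mult_strict_left_mono) auto
  then show "2 * (1 - \<sigma>) < X \<sigma>" unfolding X u_def[symmetric] by simp
  moreover have "0 < 2 * (1 - \<sigma>)" using u unfolding u_def by simp
  ultimately show "0 < X \<sigma>" by (rule order.strict_trans[rotated])
  have "(1 - 7 * \<sigma>) = (R\<^sup>2 - S\<^sup>2) * u" using R u by simp
  then have "(1 - 7 * \<sigma>) / X \<sigma> = (R - S) * ((S + R) * u) / (u * (S + R))" unfolding X by (simp add: power2_eq_square algebra_simps)
  also have "\<dots> = R - S" using u S R1 by simp
  finally have "(1 - 7 * \<sigma>) / X \<sigma> = R - S" .
  moreover have "X \<sigma> / (1 - \<sigma>) = S + R" unfolding X u_def[symmetric] using u by simp
  ultimately show "X \<sigma> / (1 - \<sigma>) - (1 - 7 * \<sigma>) / X \<sigma> = 2 * s / r" unfolding S_def by simp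
qed

lemma profile: assumes t: "t \<in> J" shows "profile r s (\<epsilon> t) t"
proof
  note b = X_bounds[OF J_square[OF t, THEN conjunct1] J_square[OF t, THEN conjunct2]]
  show "0 < r" "0 < s" by (rule rs)+
  show "0 < \<epsilon> t" unfolding \<epsilon>_def using b by simp
  show "\<bar>t\<bar> < 1" using t by auto
  have g: "0 < 1 - t\<^sup>2" using J_square[OF t] by simp
  have "2 * (1 - t\<^sup>2) * \<epsilon> t < 1" unfolding \<epsilon>_def using b by simp
  moreover have "0 < 2 * (1 - t\<^sup>2) * \<epsilon> t" unfolding \<epsilon>_def using b g by simp
  ultimately have "(2 * (1 - t\<^sup>2) * \<epsilon> t)\<^sup>2 < 1" by (simp add: power_less_one_iff)
  then show "0 < 1 - 4 * (\<epsilon> t)\<^sup>2 * (1 - t\<^sup>2)\<^sup>2" unfolding power_mult_distrib by (simp add: ac_simps)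
  show "1 / (\<epsilon> t * (1 - t\<^sup>2)) - \<epsilon> t * (1 - 7 * t\<^sup>2) = 2 * s / r" unfolding \<epsilon>_def using b(5) by simp
qed

lemma C2_family_FF: "C2_family n J FF"
proof (rule C2_family_cong)
  have oJ: "open J" by simp
  have C: "C2_family n J (\<lambda>t x::real \<times> real. c)" for c :: real by (rule C2_family_const)
  have T: "C2_family n J (\<lambda>t x::real \<times> real. t)" by (rule C2_family_ident)
  have T2: "C2_family n J (\<lambda>t x::real \<times> real. t\<^sup>2)" by (rule C2_family_power2[OF T])
  have tr: "C2_family n J (\<lambda>t x::real \<times> real. cos (2 * (snd x / s)))" "C2_family n J (\<lambda>t x::real \<times> real. sin (2 * (snd x / s)))"
    using C2_family_bounded_linear[OF bounded_linear_Re C2_family_static[OF Ck_cis_linear[OF bounded_linear_coords(2)[of 2 s]]]]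
      C2_family_bounded_linear[OF bounded_linear_Im C2_family_static[OF Ck_cis_linear[OF bounded_linear_coords(2)[of 2 s]]]] by simp_all
  have b: "0 < (s / r)\<^sup>2 + (1 - 7 * t\<^sup>2) / (1 - t\<^sup>2)" "X (t\<^sup>2) \<noteq> 0" "1 - t\<^sup>2 \<noteq> 0" if "t \<in> J" for t
    using X_bounds[of "t\<^sup>2"] J_square[OF that] by auto
  have E: "C2_family n J (\<lambda>t x::real \<times> real. \<epsilon> t)"
    unfolding \<epsilon>_def
    by (rule C2_family_divide[OF C _ oJ b(2)])
      (unfold X_def, intro C2_family_mult C2_family_add C2_family_diff C2_family_divide C2_family_sqrt C T2 oJ b(1,3))
  define kk where "kk t x = \<epsilon> t * (1 + t\<^sup>2 + 2 * t * cos (2 * (snd x / s)))" for t and x :: "real \<times> real"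
  define kk1 where "kk1 t x = (- 4) * \<epsilon> t * t * sin (2 * (snd x / s))" for t and x :: "real \<times> real"
  define DD where "DD t x = 1 + (kk t x)\<^sup>2 + (kk1 t x)\<^sup>2" for t and x :: "real \<times> real"
  have kk: "C2_family n J kk" "C2_family n J kk1"
    unfolding kk_def[abs_def] kk1_def[abs_def] by (intro C2_family_mult C2_family_add E C T T2 tr)+
  have DD: "C2_family n J DD" unfolding DD_def[abs_def] by (intro C2_family_add C2_family_power2 kk C)
  have DD0: "DD t x \<noteq> 0" for t x
  proof -
    have "0 < DD t x" unfolding DD_def by (intro add_pos_nonneg) auto
    then show ?thesis by simp
  qed
  show "C2_family n J (\<lambda>t x. fr r s x (2 * kk t x / DD t x) 0 ((1 - (kk t x)\<^sup>2 + (kk1 t x)\<^sup>2) / DD t x) ((- 2) * kk t x * kk1 t x / DD t x))"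
    by (intro C2_family_fr C2_family_divide C2_family_mult C2_family_add C2_family_diff C2_family_power2 kk C DD oJ DD0)
  show "open J" by simp
  show "fr r s x (2 * kk t x / DD t x) 0 ((1 - (kk t x)\<^sup>2 + (kk1 t x)\<^sup>2) / DD t x) ((- 2) * kk t x * kk1 t x / DD t x) = FF t x" if "t \<in> J" for t x
  proof -
    interpret profile r s "\<epsilon> t" t by (rule profile[OF that])
    show ?thesis unfolding FF_def F_def D_def k_def k1_def P_def DD_def kk_def kk1_def by simp
  qed
qed

lemma Ck_FF: "t \<in> J \<Longrightarrow> Ck n (FF t)"
  using Ck_family_imp_Ck[OF C2_family_Ck[OF C2_family_FF]] .

text \<open>The number \<epsilon> 0 is the tangent of half the angle with sine r and cosine s,
  whence the two rational identities.\<close>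

lemma \<epsilon>_zero: "\<epsilon> 0 = r / (1 + s)" "r * (1 + (\<epsilon> 0)\<^sup>2) = 2 * \<epsilon> 0" "s * (1 + (\<epsilon> 0)\<^sup>2) = 1 - (\<epsilon> 0)\<^sup>2"
proof -
  have "X 0 = (1 + s) / r" unfolding X_def using S_gt(3) by (simp add: add_divide_distrib)
  then show e: "\<epsilon> 0 = r / (1 + s)" unfolding \<epsilon>_def by simp
  have s: "(1 + s)\<^sup>2 \<noteq> 0" "1 + s \<noteq> 0" using rs by auto
  have r2: "r\<^sup>2 = (1 - s) * (1 + s)" using rs(3) by (simp add: power2_eq_square algebra_simps)
  have e2: "(\<epsilon> 0)\<^sup>2 = (1 - s) / (1 + s)" unfolding e power_divide r2 using s by (simp add: power2_eq_square)
  have 1: "1 + (\<epsilon> 0)\<^sup>2 = 2 / (1 + s)" "1 - (\<epsilon> 0)\<^sup>2 = 2 * s / (1 + s)" unfolding e2 using s by (simp_all add: field_simps)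
  show "r * (1 + (\<epsilon> 0)\<^sup>2) = 2 * \<epsilon> 0" "s * (1 + (\<epsilon> 0)\<^sup>2) = 1 - (\<epsilon> 0)\<^sup>2" unfolding 1 unfolding e by simp_all
qed

lemma FF_zero: "FF 0 = torus_param r s"
proof
  fix x
  interpret profile r s "\<epsilon> 0" 0 by (rule profile) simp
  have nz: "1 + (\<epsilon> 0)\<^sup>2 \<noteq> 0" by (metis add_pos_nonneg zero_le_power2 zero_less_one less_irrefl)
  have "2 * \<epsilon> 0 / (1 + (\<epsilon> 0)\<^sup>2) = r" "(1 - (\<epsilon> 0)\<^sup>2) / (1 + (\<epsilon> 0)\<^sup>2) = s"
    using \<epsilon>_zero(2,3) nz by (simp_all add: divide_eq_eq)
  then show "FF 0 x = torus_param r s x"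
    unfolding FF_def F_def D_def k_def k1_def P_def torus_param_def fr_def by (simp add: split_def Complex_eq)
qed

lemma admissible_FF: assumes "2 \<le> n" shows "admissible n r s (torus_param r s) (1 / 3) FF"
proof -
  have "immersion n r s (FF t)" "has_teichmueller r s (induced_metric (FF t)) (0, s / r)" if t: "t \<in> J" for t
  proof -
    interpret profile r s "\<epsilon> t" t by (rule profile[OF t])
    show "immersion n r s (FF t)" using immersion_F Ck_FF[OF t] unfolding FF_def by blast
    show "has_teichmueller r s (induced_metric (FF t)) (0, s / r)" unfolding FF_def by (rule has_teichmueller_F)
  qed
  then show ?thesis
    unfolding admissible_def variation_def Teich_torus_param[OF rs(1,2)] using FF_zero C2_family_FF by simp
qed

end

section \<open>Second derivative of the energy along the family\<close>

section \<open>Instability\<close>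

context thin_torus
begin

text \<open>The coefficients depend on t through \<sigma> = t^2 alone. As functions of \<sigma> they
  need only a first derivative at 0 to yield their share of the t^2 term.\<close>

definition "es \<sigma> = 1 / X \<sigma>"
definition "bs \<sigma> = 1 - 4 * (es \<sigma>)\<^sup>2 * (1 - \<sigma>)\<^sup>2"
definition "qs \<sigma> = bs \<sigma> * es \<sigma> * (1 + \<sigma>) + 3 * (es \<sigma>) ^ 3 * ((1 + \<sigma>) ^ 3 + 6 * (1 + \<sigma>) * \<sigma>)"
definition "As \<sigma> = 1 / qs \<sigma> - X \<sigma> / (1 - \<sigma>)"
definition "kk t \<theta> = es (t\<^sup>2) * (1 + t\<^sup>2 + 2 * t * cos (2 * \<theta>))"
definition "yy t \<theta> = bs (t\<^sup>2) + 3 * (kk t \<theta>)\<^sup>2"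
definition "VV t \<theta> = 2 * bs (t\<^sup>2) * es (t\<^sup>2) * cos (2 * \<theta>) + 3 * (es (t\<^sup>2)) ^ 3 * (6 * (1 + t\<^sup>2)\<^sup>2 * cos (2 * \<theta>)
   + 12 * (1 + t\<^sup>2) * t * (cos (2 * \<theta>))\<^sup>2 - 6 * (1 + t\<^sup>2) * t + 8 * t\<^sup>2 * (cos (2 * \<theta>)) ^ 3)"
definition "JJ t = integral {0..2 * pi} (\<lambda>\<theta>. (VV t \<theta>)\<^sup>2 / (kk t \<theta> * yy t \<theta>))"

lemma \<epsilon>_es: "\<epsilon> t = es (t\<^sup>2)" by (simp add: \<epsilon>_def es_def)

lemma FF_values:
  assumes t: "t \<in> J"
  shows "willmore r s (FF t) = 2 * pi\<^sup>2 * As (t\<^sup>2) + pi * t\<^sup>2 / (qs (t\<^sup>2))\<^sup>2 * JJ t + pi\<^sup>2 * s / r"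
    and "0 < qs (t\<^sup>2)" "0 < kk t \<theta>" "0 < yy t \<theta>"
proof -
  interpret profile r s "\<epsilon> t" t by (rule profile[OF t])
  have b: "b = bs (t\<^sup>2)" unfolding b_def bs_def \<epsilon>_es[symmetric] ..
  have q: "q = qs (t\<^sup>2)" unfolding q_def qs_def b \<epsilon>_es[symmetric] ..
  have k: "k = kk t" by (rule ext) (simp add: k_def P_def kk_def flip: \<epsilon>_es)
  have y: "y = yy t" by (rule ext) (simp only: y_eq yy_def b k)
  have V: "V = VV t" by (rule ext) (simp only: V_def VV_def b \<epsilon>_es[symmetric])
  have X: "1 / (\<epsilon> t * (1 - t\<^sup>2)) = X (t\<^sup>2) / (1 - t\<^sup>2)" unfolding \<epsilon>_def by simp
  have J: "integral {0..2 * pi} (\<lambda>\<theta>. (V \<theta>)\<^sup>2 / (k \<theta> * y \<theta>)) = JJ t" unfolding V k y JJ_def ..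
  have "2 * pi / (\<epsilon> t * (1 - t\<^sup>2)) = 2 * pi * (X (t\<^sup>2) / (1 - t\<^sup>2))" unfolding X[symmetric] by simp
  then show "willmore r s (FF t) = 2 * pi\<^sup>2 * As (t\<^sup>2) + pi * t\<^sup>2 / (qs (t\<^sup>2))\<^sup>2 * JJ t + pi\<^sup>2 * s / r"
    using willmore_profile[OF Ck_FF[OF t, unfolded FF_def]] unfolding J q FF_def As_def
    by (simp add: power2_eq_square right_diff_distrib distrib_left ac_simps)
  show "0 < qs (t\<^sup>2)" "0 < kk t \<theta>" "0 < yy t \<theta>" using q_pos k_pos y_pos unfolding q k y by blast+
qed

abbreviation "e0 \<equiv> es 0"

lemma e0: "0 < e0" "e0\<^sup>2 < 1" "r * (1 + e0\<^sup>2) = 2 * e0" "0 < 1 - 14 * e0\<^sup>2 + e0 ^ 4"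
proof -
  have E: "e0 = \<epsilon> 0" by (simp add: \<epsilon>_es)
  show p: "0 < e0" unfolding es_def using X_bounds(4)[of 0] by simp
  show r: "r * (1 + e0\<^sup>2) = 2 * e0" unfolding E by (rule \<epsilon>_zero)
  have "0 < s * (1 + e0\<^sup>2)" using rs by (intro mult_pos_pos add_pos_nonneg) auto
  then show "e0\<^sup>2 < 1" unfolding E \<epsilon>_zero(3) by simp
  have "0 < 1 + e0\<^sup>2" by (intro add_pos_nonneg) auto
  then have "r * (1 + e0\<^sup>2) < (1 / 2) * (1 + e0\<^sup>2)" using thin by (intro mult_strict_right_mono)
  then have "4 * e0 < 1 + e0\<^sup>2" unfolding r by simp
  then have "(4 * e0)\<^sup>2 < (1 + e0\<^sup>2)\<^sup>2" using p by (intro power_strict_mono) auto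
  then show "0 < 1 - 14 * e0\<^sup>2 + e0 ^ 4" by (simp add: eval_nat_numeral algebra_simps)
qed

lemma X_deriv: "(X has_real_derivative - X 0 - 3 * r) (at 0)"
proof -
  have u: "((\<lambda>\<sigma>. (s / r)\<^sup>2 + (1 - 7 * \<sigma>) / (1 - \<sigma>)) has_real_derivative - 6) (at 0)"
    by (auto intro!: derivative_eq_intros)
  have "((\<lambda>\<sigma>. sqrt ((s / r)\<^sup>2 + (1 - 7 * \<sigma>) / (1 - \<sigma>))) has_real_derivative inverse (sqrt ((s / r)\<^sup>2 + (1 - 7 * 0) / (1 - 0))) / 2 * (- 6)) (at 0)"
    by (rule DERIV_chain2[OF DERIV_real_sqrt u]) (use S_gt(2) in simp)
  then have sq: "((\<lambda>\<sigma>. sqrt ((s / r)\<^sup>2 + (1 - 7 * \<sigma>) / (1 - \<sigma>))) has_real_derivative - 3 * r) (at 0)"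
    using S_gt(3) by simp
  have "((\<lambda>\<sigma>. (1 - \<sigma>) * (s / r + sqrt ((s / r)\<^sup>2 + (1 - 7 * \<sigma>) / (1 - \<sigma>)))) has_real_derivative
     - 1 * (s / r + sqrt ((s / r)\<^sup>2 + (1 - 7 * 0) / (1 - 0))) + (- 3 * r) * (1 - 0)) (at 0)"
  proof (rule DERIV_mult)
    show "((\<lambda>\<sigma>. 1 - \<sigma>) has_real_derivative - 1) (at 0)" by (auto intro!: derivative_eq_intros)
    show "((\<lambda>\<sigma>. s / r + sqrt ((s / r)\<^sup>2 + (1 - 7 * \<sigma>) / (1 - \<sigma>))) has_real_derivative - 3 * r) (at 0)"
      by (rule DERIV_cong[OF DERIV_add[OF DERIV_const sq]]) simp
  qed
  then show ?thesis unfolding X_def[abs_def] by simp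
qed

lemma es_deriv: "(es has_real_derivative e0 + 3 * r * e0\<^sup>2) (at 0)"
proof -
  have X0: "X 0 \<noteq> 0" using X_bounds(4)[of 0] by simp
  have "((\<lambda>\<sigma>. 1 / X \<sigma>) has_real_derivative (0 * X 0 - 1 * (- X 0 - 3 * r)) / (X 0 * X 0)) (at 0)"
    by (rule DERIV_divide[OF DERIV_const X_deriv X0])
  moreover have "(0 * X 0 - 1 * (- X 0 - 3 * r)) / (X 0 * X 0) = e0 + 3 * r * e0\<^sup>2"
    unfolding es_def using X0 by (simp add: power2_eq_square add_divide_distrib)
  ultimately show ?thesis unfolding es_def[abs_def] by simp
qed

lemma q0: "qs 0 = e0 * (1 - e0\<^sup>2)" "qs 0 \<noteq> 0"
proof -
  show e: "qs 0 = e0 * (1 - e0\<^sup>2)" unfolding qs_def bs_def by (simp add: eval_nat_numeral algebra_simps)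
  show "qs 0 \<noteq> 0" unfolding e using e0 by simp
qed

lemma qs_deriv: "(qs has_real_derivative (e0 + 3 * r * e0\<^sup>2) * (1 - 3 * e0\<^sup>2) + e0 + 31 * e0 ^ 3) (at 0)"
proof -
  define d where "d = e0 + 3 * r * e0\<^sup>2"
  have es: "(es has_real_derivative d) (at 0)" unfolding d_def by (rule es_deriv)
  have "(bs has_real_derivative - 8 * e0 * d + 8 * e0\<^sup>2) (at 0)"
    unfolding bs_def[abs_def] by (auto intro!: derivative_eq_intros es simp: power2_eq_square)
  then have "(qs has_real_derivative ((- 8 * e0 * d + 8 * e0\<^sup>2) * e0 + bs 0 * d) + bs 0 * e0 + (9 * e0\<^sup>2 * d + 27 * e0 ^ 3)) (at 0)"
    unfolding qs_def[abs_def] by (auto intro!: derivative_eq_intros es simp: eval_nat_numeral algebra_simps)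
  then show ?thesis
    unfolding d_def[symmetric] by (rule DERIV_cong) (simp add: bs_def eval_nat_numeral algebra_simps)
qed

definition "slope = - ((e0 + 3 * r * e0\<^sup>2) * (1 - 3 * e0\<^sup>2) + e0 + 31 * e0 ^ 3) / (e0 * (1 - e0\<^sup>2))\<^sup>2 + 3 * r"

lemma As_deriv: "(As has_real_derivative slope) (at 0)"
proof -
  have "((\<lambda>\<sigma>. 1 / qs \<sigma> - X \<sigma> / (1 - \<sigma>)) has_real_derivative
     (0 * qs 0 - 1 * ((e0 + 3 * r * e0\<^sup>2) * (1 - 3 * e0\<^sup>2) + e0 + 31 * e0 ^ 3)) / (qs 0 * qs 0)
      - ((- X 0 - 3 * r) * (1 - 0) - X 0 * (- 1)) / ((1 - 0) * (1 - 0))) (at 0)"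
    by (rule DERIV_diff[OF DERIV_divide[OF DERIV_const qs_deriv q0(2)] DERIV_divide[OF X_deriv]])
      (auto intro!: derivative_eq_intros)
  then show ?thesis
    unfolding As_def[abs_def] slope_def q0(1)[symmetric] by (simp add: power2_eq_square)
qed

lemma continuous_es: "continuous_on J (\<lambda>t. es (t\<^sup>2))" "continuous_on J (\<lambda>t. bs (t\<^sup>2))" "continuous_on J (\<lambda>t. qs (t\<^sup>2))"
proof -
  have b: "1 - t\<^sup>2 \<noteq> 0" "X (t\<^sup>2) \<noteq> 0" if "t \<in> J" for t
    using X_bounds[of "t\<^sup>2"] J_square[OF that] by auto
  have "continuous_on J (\<lambda>t. X (t\<^sup>2))" unfolding X_def by (intro continuous_intros) (use b in auto)
  then show e: "continuous_on J (\<lambda>t. es (t\<^sup>2))" unfolding es_def by (intro continuous_intros) (use b in auto)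
  then show "continuous_on J (\<lambda>t. bs (t\<^sup>2))" unfolding bs_def by (intro continuous_intros)
  with e show "continuous_on J (\<lambda>t. qs (t\<^sup>2))" unfolding qs_def by (intro continuous_intros)
qed

lemma continuous_JJ: "continuous_on J JJ"
proof -
  have c: "continuous_on (J \<times> cbox 0 (2 * pi)) (\<lambda>z. h ((fst z)\<^sup>2))" if "continuous_on J (\<lambda>t. h (t\<^sup>2))" for h :: "real \<Rightarrow> real"
    by (rule continuous_on_compose2[OF that continuous_on_fst[OF continuous_on_id]]) auto
  have k: "continuous_on (J \<times> cbox 0 (2 * pi)) (\<lambda>z. kk (fst z) (snd z))"
    unfolding kk_def by (intro continuous_intros c continuous_es)
  have y: "continuous_on (J \<times> cbox 0 (2 * pi)) (\<lambda>z. yy (fst z) (snd z))"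
    unfolding yy_def by (intro continuous_intros c continuous_es k)
  have V: "continuous_on (J \<times> cbox 0 (2 * pi)) (\<lambda>z. VV (fst z) (snd z))"
    unfolding VV_def by (intro continuous_intros c continuous_es)
  have "continuous_on (J \<times> cbox 0 (2 * pi)) (\<lambda>z. (VV (fst z) (snd z))\<^sup>2 / (kk (fst z) (snd z) * yy (fst z) (snd z)))"
  proof (intro continuous_on_divide continuous_on_power continuous_on_mult k y V ballI)
    fix z assume "z \<in> J \<times> cbox 0 (2 * pi)"
    then have "fst z \<in> J" by auto
    from FF_values(3,4)[OF this, of "snd z"] show "kk (fst z) (snd z) * yy (fst z) (snd z) \<noteq> 0" by simp
  qed
  then have "continuous_on (J \<times> cbox 0 (2 * pi)) (\<lambda>(t, \<theta>). (VV t \<theta>)\<^sup>2 / (kk t \<theta> * yy t \<theta>))" by (simp add: split_def)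
  from integral_continuous_on_param[OF this] show ?thesis unfolding JJ_def[abs_def] by simp
qed

lemma JJ_zero: "JJ 0 = (2 * e0 * (1 + 5 * e0\<^sup>2))\<^sup>2 / (e0 * (1 - e0\<^sup>2)) * pi"
proof -
  interpret profile r s "\<epsilon> 0" 0 by (rule profile) simp
  have "((\<lambda>\<theta>. (cos (2 * \<theta>))\<^sup>2) has_integral pi) {0..2 * pi}"
  proof (rule integral_full)
    show "((\<lambda>\<theta>. \<theta> / 2 + sin (2 * \<theta>) * cos (2 * \<theta>) / 4) has_real_derivative (cos (2 * \<theta>))\<^sup>2) (at \<theta>)" for \<theta> :: real
    proof -
      have "((\<lambda>\<theta>. \<theta> / 2 + sin (2 * \<theta>) * cos (2 * \<theta>) / 4) has_real_derivative
          1 / 2 + (2 * (cos (2 * \<theta>))\<^sup>2 - 2 * (sin (2 * \<theta>))\<^sup>2) / 4) (at \<theta>)"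
        by (auto intro!: derivative_eq_intros simp: power2_eq_square)
      then show ?thesis by (rule DERIV_cong) (simp add: sin_squared_eq field_simps)
    qed
    show "2 * pi / 2 + sin (2 * (2 * pi)) * cos (2 * (2 * pi)) / 4 = 0 / 2 + sin (2 * 0) * cos (2 * 0) / 4 + pi"
      using trig_shift[of 0 1] by simp
  qed
  then have "((\<lambda>\<theta>. (2 * e0 * (1 + 5 * e0\<^sup>2))\<^sup>2 / (e0 * (1 - e0\<^sup>2)) * (cos (2 * \<theta>))\<^sup>2) has_integral
     (2 * e0 * (1 + 5 * e0\<^sup>2))\<^sup>2 / (e0 * (1 - e0\<^sup>2)) * pi) {0..2 * pi}" by (rule has_integral_mult_right)
  moreover have "(VV 0 \<theta>)\<^sup>2 / (kk 0 \<theta> * yy 0 \<theta>) = (2 * e0 * (1 + 5 * e0\<^sup>2))\<^sup>2 / (e0 * (1 - e0\<^sup>2)) * (cos (2 * \<theta>))\<^sup>2" for \<theta>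
  proof -
    have v: "VV 0 \<theta> = 2 * e0 * (1 + 5 * e0\<^sup>2) * cos (2 * \<theta>)"
      unfolding VV_def bs_def by (simp add: eval_nat_numeral algebra_simps)
    have "kk 0 \<theta> * yy 0 \<theta> = e0 * (1 - e0\<^sup>2)"
      unfolding kk_def yy_def bs_def by (simp add: eval_nat_numeral algebra_simps)
    then show ?thesis unfolding v power_mult_distrib[of _ "cos (2 * \<theta>)"] by simp
  qed
  ultimately show ?thesis unfolding JJ_def by (simp only: integral_unique)
qed

text \<open>Caratheodory's form of the derivative of \<open>As\<close> writes the energy exactly as
  its initial value minus t^2 C(t) with \<open>C\<close> continuous at 0. The bound on second
  derivatives, applied to the negative of the energy, then contradicts stability because C(0) >
  0.\<close>

lemma not_stable: assumes n: "2 \<le> n" shows "\<not> stable_constrained_willmore n r s (torus_param r s)"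
proof
  assume st: "stable_constrained_willmore n r s (torus_param r s)"
  have A: "admissible n r s (torus_param r s) (1 / 3) FF" by (rule admissible_FF[OF n])
  obtain W' W'' where W: "\<And>t. t \<in> {-(1/3)<..<1/3} \<Longrightarrow> ((\<lambda>t. willmore r s (FF t)) has_real_derivative W' t) (at t)"
    "\<And>t. t \<in> {-(1/3)<..<1/3} \<Longrightarrow> (W' has_real_derivative W'' t) (at t)"
    using willmore_twice_differentiable[OF _ n] A unfolding admissible_def by metis
  have d: "(0::real) < 1 / 3" by simp
  have d1: "((\<lambda>t. willmore r s (FF t)) has_real_derivative W' t) (at t)" if "\<bar>t\<bar> < 1 / 3" for t
    by (rule W(1)) (use that in \<open>auto simp: abs_if split: if_splits\<close>)
  have d2: "(W' has_real_derivative W'' 0) (at 0)" using W(2)[of 0] by simp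
  have "0 \<le> W'' 0"
    using st A second_deriv_eq[OF d d1 d2] unfolding stable_constrained_willmore_def by metis
  obtain G where G: "\<And>z. As z - As 0 = G z * (z - 0)" "isCont G 0" "G 0 = slope"
    using As_deriv unfolding CARAT_DERIV by blast
  define C where "C t = - (2 * pi\<^sup>2 * G (t\<^sup>2) + pi / (qs (t\<^sup>2))\<^sup>2 * JJ t)" for t
  have zJ: "0 \<in> J" by simp
  have "isCont (\<lambda>t. G (t\<^sup>2)) 0" by (rule isCont_o2[where g = G]) (use G(2) in simp_all)
  moreover have "isCont JJ 0" "isCont (\<lambda>t. qs (t\<^sup>2)) 0"
    using continuous_JJ continuous_es(3) zJ by (simp_all add: continuous_on_eq_continuous_at)
  ultimately have cC: "isCont C 0" unfolding C_def using q0(2) by (intro continuous_intros) auto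
  have b: "- willmore r s (FF 0) + t\<^sup>2 * C t \<le> - willmore r s (FF t)" if "\<bar>t\<bar> < 1 / 3" for t
  proof -
    have t: "t \<in> J" using that by auto
    have "As (t\<^sup>2) = As 0 + G (t\<^sup>2) * t\<^sup>2" using G(1)[of "t\<^sup>2"] by simp
    then show ?thesis unfolding FF_values(1)[OF t] FF_values(1)[OF zJ] C_def by (simp add: algebra_simps)
  qed
  have m1: "((\<lambda>t. - willmore r s (FF t)) has_real_derivative - W' t) (at t)" if "\<bar>t\<bar> < 1 / 3" for t
    by (rule DERIV_minus[OF d1[OF that]])
  have "2 * C 0 \<le> - W'' 0"
    by (rule second_derivative_lower_bound(2)[OF d m1 DERIV_minus[OF d2] b cC])
  moreover have "0 < C 0"
  proof -
    have "C 0 = 12 * pi\<^sup>2 * e0 * (1 - 14 * e0\<^sup>2 + e0 ^ 4) / (1 - e0\<^sup>2) ^ 3"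
      unfolding C_def using destabilising_algebra[OF e0(1,2,3) refl] by (simp add: G(3) slope_def q0(1) JJ_zero)
    then show ?thesis using e0 by simp
  qed
  ultimately show False using \<open>0 \<le> W'' 0\<close> by simp
qed

end

lemma stable_iff_wlog:
  assumes rs: "0 < r" "0 < s" "r\<^sup>2 + s\<^sup>2 = 1" and k: "2 \<le> k" and le: "r \<le> s"
  shows "stable_constrained_willmore k r s (torus_param r s) \<longleftrightarrow> 1 / 2 \<le> r"
proof
  assume st: "stable_constrained_willmore k r s (torus_param r s)"
  show "1 / 2 \<le> r"
  proof (rule ccontr)
    assume "\<not> 1 / 2 \<le> r"
    then interpret thin_torus r s by unfold_locales (use rs in auto)
    show False using not_stable[OF k] st by blast
  qed
qed (rule stable_if_le[OF rs le _ k])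

theorem theorem1:
  fixes r s :: real and k :: nat
  assumes "0 < r" and "0 < s" and "r\<^sup>2 + s\<^sup>2 = 1" and "4 \<le> k"
  shows "Teich r s (torus_param r s) = (0, s / r) \<and>
    (stable_constrained_willmore k r s (torus_param r s) \<longleftrightarrow> r \<in> {1 / 2 .. sqrt 3 / 2}) \<and>
    (stable_constrained_willmore k r s (torus_param r s) \<longleftrightarrow>
       snd (Teich r s (torus_param r s)) \<in> {1 / sqrt 3 .. sqrt 3})"
proof -
  have k: "2 \<le> k" using assms(4) by simp
  have nz: "r \<noteq> 0" using assms(1) by simp
  have sq: "r\<^sup>2 = 1 - s\<^sup>2" using assms(3) by simp
  have half: "1 / 2 \<le> z \<longleftrightarrow> 1 / 4 \<le> z\<^sup>2" if "0 < z" for z :: real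
    using abs_le_square_iff[of "1 / 2" z] that by (simp add: power2_eq_square)
  have upper: "r \<le> sqrt 3 / 2 \<longleftrightarrow> 1 / 4 \<le> s\<^sup>2"
  proof -
    have "r \<le> sqrt 3 / 2 \<longleftrightarrow> r\<^sup>2 \<le> (sqrt 3 / 2)\<^sup>2" using abs_le_square_iff[of r "sqrt 3 / 2"] assms(1) by simp
    then show ?thesis using sq by (simp add: power_divide)
  qed
  \<comment> \<open>The condition is symmetric in r and s. In the ordered case the one on the larger
    radius follows from the one on the smaller, so the criterion for r \<le> s and the exchange of
    factors cover everything.\<close>
  have "stable_constrained_willmore k r s (torus_param r s) \<longleftrightarrow> 1 / 4 \<le> r\<^sup>2 \<and> 1 / 4 \<le> s\<^sup>2"
  proof (cases "r \<le> s")
    case True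
    then have "r\<^sup>2 \<le> s\<^sup>2" using assms(1) by (intro power_mono) auto
    then show ?thesis using stable_iff_wlog[OF assms(1-3) k True] half[OF assms(1)] by auto
  next
    case False
    then have le: "s \<le> r" by simp
    then have "s\<^sup>2 \<le> r\<^sup>2" using assms(2) by (intro power_mono) auto
    moreover have "s\<^sup>2 + r\<^sup>2 = 1" using assms(3) by simp
    moreover have "stable_constrained_willmore k r s (torus_param r s) \<longleftrightarrow> stable_constrained_willmore k s r (torus_param s r)"
      using stable_flip[OF _ assms(1,2) k] stable_flip[OF _ assms(2,1) k] by blast
    ultimately show ?thesis using stable_iff_wlog[OF assms(2,1) _ k le] half[OF assms(2)] by auto
  qed
  then have *: "stable_constrained_willmore k r s (torus_param r s) \<longleftrightarrow> r \<in> {1 / 2 .. sqrt 3 / 2}"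
    using upper half[OF assms(1)] by simp
  have b: "s / r \<le> sqrt 3 \<longleftrightarrow> 1 / 4 \<le> r\<^sup>2" "1 / sqrt 3 \<le> s / r \<longleftrightarrow> 1 / 4 \<le> s\<^sup>2"
  proof -
    have "s / r \<le> sqrt 3 \<longleftrightarrow> (s / r)\<^sup>2 \<le> 3" using abs_le_square_iff[of "s / r" "sqrt 3"] assms(1,2) by simp
    also have "\<dots> \<longleftrightarrow> s\<^sup>2 \<le> 3 * r\<^sup>2" using assms(1) by (simp add: power_divide divide_le_eq)
    finally show "s / r \<le> sqrt 3 \<longleftrightarrow> 1 / 4 \<le> r\<^sup>2" using sq by auto
    have "1 / sqrt 3 \<le> s / r \<longleftrightarrow> (1 / sqrt 3)\<^sup>2 \<le> (s / r)\<^sup>2" using abs_le_square_iff[of "1 / sqrt 3" "s / r"] assms(1,2) by simp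
    also have "\<dots> \<longleftrightarrow> r\<^sup>2 \<le> 3 * s\<^sup>2" using assms(1) by (simp add: power_divide le_divide_eq mult.commute)
    finally show "1 / sqrt 3 \<le> s / r \<longleftrightarrow> 1 / 4 \<le> s\<^sup>2" using sq by auto
  qed
  have "r \<in> {1 / 2 .. sqrt 3 / 2} \<longleftrightarrow> s / r \<in> {1 / sqrt 3 .. sqrt 3}"
    using b upper half[OF assms(1)] by auto
  then show ?thesis using * Teich_torus_param[OF assms(1,2)] by simp
qed


end
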